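(* Let $b$ be a prime, $\alpha>1$ an integer, $1\le q\le\infty$, and let $\boldsymbol{\gamma}=(\gamma_u)_{u\subset\mathbb{N}}$ be a set of weights. For $m\ge\alpha$ let $N=b^m+b^{m-1}+\cdots+b^{m-\alpha+1}$ be the number of function evaluations used in the extrapolated polynomial lattice rule. For every $s\in\mathbb{N}$ and $m\ge\alpha$ there exist polynomial lattice point sets $P_{b^{m-\alpha+1}},\ldots,P_{b^m}\subset[0,1)^s$ such that the worst-case error $$e_{s,m}:=\sup_{\substack{f\in W_{s,\alpha,\boldsymbol{\gamma},q,\infty}\\ \|f\|_{s,\alpha,\boldsymbol{\gamma},q,\infty}\le1}}\left|\sum_{\tau=1}^\alpha a_\tau^{(\alpha)}I(f;P_{b^{m-\tau+1}})-I(f)\right|$$ of the corresponding extrapolated polynomial lattice rules satisfies the following. 1. (General weights) If $\lim_{s\to\infty}J_{s,\lambda,\boldsymbol{\gamma}}<\infty$ and $\lim_{s\to\infty}H_{s,\boldsymbol{\gamma},q,\infty}<\infty$ for some $1/\alpha<\lambda\le1$, then $e_{s,m}$ converges with order $O(N^{-1/\lambda})$ with the constant bounded independently of the dimension, i.e. there is $C>0$ independent of $s$ and $m$ with $e_{s,m}\le CN^{-1/\lambda}$. 2. (General weights) If there is a real $\kappa>0$ such that $\limsup_{s\to\infty}J_{s,\lambda,\boldsymbol{\gamma}}/s^\kappa<\infty$ and $\limsup_{s\to\infty}H_{s,\boldsymbol{\gamma},q,\infty}/s^\kappa<\infty$ for some $1/\alpha<\lambda\le1$, then $e_{s,m}$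 converges with order $O(N^{-1/\lambda})$ with the constant depending polynomially on the dimension, i.e. there are $C,t>0$ independent of $s$ and $m$ with $e_{s,m}\le Cs^tN^{-1/\lambda}$. 3. (Product weights) If $\gamma_u=\prod_{j\in u}\gamma_j$ and $\sum_{j=1}^\infty\gamma_j^\lambda<\infty$ for some $1/\alpha<\lambda\le1$, then there is $C>0$ independent of $s$ and $m$ with $e_{s,m}\le CN^{-1/\lambda}$. 4. (Product weights) If $\gamma_u=\prod_{j\in u}\gamma_j$ and $\limsup_{s\to\infty}\frac{\sum_{j=1}^s\gamma_j^\lambda}{\log(s+1)}<\infty$ for some $1/\alpha<\lambda\le1$, then there are $C,t>0$ independent of $s$ and $m$ with $e_{s,m}\le Cs^tN^{-1/\lambda}$.
   Context: **Integration.** $I(f)=\int_{[0,1)^s}f(\boldsymbol{x})\,d\boldsymbol{x}$, and for a finite point set $P$ with $M$ points (counted with multiplicity), $I(f;P)=\frac1M\sum_{\boldsymbol{x}\in P}f(\boldsymbol{x})$. **Extrapolated rule.** $a_\nu^{(\tau)}=\prod_{j=1}^{\nu-1}\left(\frac{-1}{b^j-1}\right)\prod_{j=1}^{\tau-\nu}\left(\frac{b^j}{b^j-1}\right)$ for $1\le\nu\le\tau$; empty products equal $1$. Given polynomial lattice point sets $P_{b^n}$ with $b^n$ points, $n=m-\alpha+1,\ldots,m$, the extrapolated polynomial lattice rule is $f\mapsto\sum_{\tau=1}^\alpha a_\tau^{(\alpha)}I(f;P_{b^{m-\tau+1}})$. **Polynomial lattices.** $\mathbb{F}_b$ is identified with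 $\{0,\ldots,b-1\}$, and $n=\nu_0+\nu_1b+\cdots\in\mathbb{N}_0$ ($b$-adic expansion) with the polynomial $\nu_0+\nu_1x+\cdots\in\mathbb{F}_b[x]$. $G^*_{b,m}$ is the set of nonzero $q\in\mathbb{F}_b[x]$ with $\deg q<m$. The map $v_m:\mathbb{F}_b((x^{-1}))\to[0,1)$ is $v_m(\sum_{i=w}^\infty a_ix^{-i})=\sum_{i=\max\{1,w\}}^m a_ib^{-i}$. For $p\in\mathbb{F}_b[x]$ with $\deg p=m$ and $\boldsymbol{q}=(q_1,\ldots,q_s)\in(G^*_{b,m})^s$, the polynomial lattice point set with $b^m$ points is $\{\boldsymbol{x}_n:0\le n<b^m\}$, $\boldsymbol{x}_n=(v_m(nq_1/p),\ldots,v_m(nq_s/p))$. **Bernoulli polynomials.** $B_\tau(\cdot)$ is the Bernoulli polynomial of degree $\tau$, $b_\tau(\cdot)=B_\tau(\cdot)/\tau!$, $b_\tau=b_\tau(0)$, $\tilde b_\tau:\mathbb{R}\to\mathbb{R}$ the one-periodic extension of $b_\tau(\cdot):[0,1)\to\mathbb{R}$. **Function space.** The weights $\gamma_u$ are non-negative reals indexed by finite $u\subset\mathbb{N}$ (for product weights, $\gamma_\emptyset=1$). For $f:[0,1)^s\to\mathbb{R}$ having partial mixed derivatives up to order $\alpha$ in each variable, put $$\|f\|_{s,\alpha,\boldsymbol{\gamma},q,\infty}=\max_{u\subseteq\{1,\ldots,s\}}\Bigg(\gamma_u^{-q}\sum_{v\subseteq u}\sum_{\boldsymbol{\tau}_{u\setminus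 v}\in\{1,\ldots,\alpha\}^{|u\setminus v|}}\int_{[0,1)^{|v|}}\left|\int_{[0,1)^{s-|v|}}f^{(\boldsymbol{\tau}_{u\setminus v},\boldsymbol{\alpha}_v,\boldsymbol{0})}(\boldsymbol{x})\,d\boldsymbol{x}_{-v}\right|^q d\boldsymbol{x}_v\Bigg)^{1/q},$$ with the obvious modification if $q=\infty$ (and when $\gamma_u=0$, the inner double sum for that $u$ is required to vanish, the $u$-term then being $0$). Here $f^{(\boldsymbol{\tau}_{u\setminus v},\boldsymbol{\alpha}_v,\boldsymbol{0})}$ is the partial mixed derivative of order $\beta_j$ in $x_j$, with $\beta_j=\tau_j$ for $j\in u\setminus v$, $\beta_j=\alpha$ for $j\in v$, $\beta_j=0$ for $j\notin u$; $\boldsymbol{x}_v=(x_j)_{j\in v}$, $\boldsymbol{x}_{-v}=(x_j)_{j\in\{1,\ldots,s\}\setminus v}$. $W_{s,\alpha,\boldsymbol{\gamma},q,\infty}$ is the Banach–Sobolev space of all such functions with finite norm. It is a known fact about this space (from the literature) that its elements satisfy, at every point $\boldsymbol{y}$, $f(\boldsymbol{y})=\sum_{u\subseteq\{1,\ldots,s\}}f_u(\boldsymbol{y}_u)$ with $$f_u(\boldsymbol{y}_u)=\sum_{v\subseteq u}\sum_{\boldsymbol{\tau}_{u\setminus v}\in\{1,\ldots,\alpha\}^{|u\setminus v|}}\prod_{j\in u\setminus v}b_{\tau_j}(y_j)\,(-1)^{(\alpha+1)|v|}\int_{[0,1)^s}f^{(\boldsymbol{\tau}_{u\setminus v},\boldsymbol{\alpha}_v,\boldsymbol{0})}(\boldsymbol{x})\prod_{j\in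 v}\tilde b_\alpha(x_j-y_j)\,d\boldsymbol{x}.$$ **Constants.** With $q'$ the Hölder conjugate of $q$ and $D_\alpha=\max\{|b_1|,\ldots,|b_{\alpha-1}|,\sup_{x\in[0,1)}|\tilde b_\alpha(x)|\}$, $$H_{s,\boldsymbol{\gamma},q,\infty}=\sum_{u\subseteq\{1,\ldots,s\}}\gamma_u(\alpha+1)^{|u|/q'}D_\alpha^{|u|},\qquad J_{s,\lambda,\boldsymbol{\gamma}}=\left[\sum_{\emptyset\ne u\subseteq\{1,\ldots,s\}}\gamma_u^\lambda C_\alpha^{\lambda|u|}E_{\alpha,\lambda}^{|u|}\right]^{1/\lambda},$$ $$C_\alpha=\max\left(\frac{2}{(2\sin\frac{\pi}{b})^\alpha},\max_{1\le z\le\alpha-1}\frac{1}{(2\sin\frac{\pi}{b})^z}\right)\left(1+\frac1b+\frac1{b(b+1)}\right)^{\alpha-2}\left(3+\frac2b+\frac{2b+1}{b-1}\right),$$ $$E_{\alpha,\lambda}=\sum_{w=1}^{\alpha-1}\prod_{i=1}^w\left(\frac{b-1}{b^{\lambda i}-1}\right)+\left(\frac{b^{\lambda\alpha}-1}{b^{\lambda\alpha}-b}\right)\prod_{i=1}^\alpha\left(\frac{b-1}{b^{\lambda i}-1}\right).$$ *)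

theory Defs
  imports
    "HOL-Probability.Probability"
    "HOL-Computational_Algebra.Formal_Laurent_Series"
    "Berlekamp_Zassenhaus.Finite_Field"
begin

section \<open>Polynomial lattice point sets\<close>

text \<open>
  The field with \<open>b\<close> elements is \<open>'p mod_ring\<close> with \<open>'p :: prime_card\<close> and \<open>b = CARD('p)\<close>; its
  elements are identified with \<open>0, \<dots>, b - 1\<close> via \<^const>\<open>of_nat\<close> and \<^const>\<open>to_int_mod_ring\<close>.
\<close>

definition poly_of_nat :: "nat \<Rightarrow> 'p::prime_card mod_ring poly" where
  "poly_of_nat n = (\<Sum>i\<le>n. Polynomial.monom (of_nat (n div CARD('p) ^ i mod CARD('p))) i)"

text \<open>
  A series in \<open>x\<^sup>-\<^sup>1\<close> is represented by a formal Laurent series whose indeterminate \<^const>\<open>fls_X\<close>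
  plays the role of \<open>x\<^sup>-\<^sup>1\<close>. Thus \<open>x\<close> itself is \<^const>\<open>fls_X_inv\<close>, and the coefficient of
  \<open>x\<^sup>-\<^sup>i\<close> is the one with index \<open>i\<close>.
\<close>

definition laurent_of_poly :: "'a::field poly \<Rightarrow> 'a fls" where
  "laurent_of_poly q = poly (map_poly fls_const q) fls_X_inv"

definition v_map :: "nat \<Rightarrow> 'p::prime_card mod_ring fls \<Rightarrow> real" where
  "v_map m L = (\<Sum>i=1..m. of_int (to_int_mod_ring (fls_nth L (int i))) / real CARD('p) ^ i)"

text \<open>
  Points of \<open>[0,1)\<^sup>s\<close> are functions \<open>nat \<Rightarrow> real\<close> that are extensional on \<open>{1..s}\<close>.
\<close>

definition poly_lattice_point ::
  "nat \<Rightarrow> 'p::prime_card mod_ring poly \<Rightarrow> (nat \<Rightarrow> 'p mod_ring poly) \<Rightarrow> nat \<Rightarrow> nat \<Rightarrow> real" where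
  "poly_lattice_point s p q n =
     (\<lambda>j\<in>{1..s}. v_map (Polynomial.degree p) (laurent_of_poly (poly_of_nat n * q j) / laurent_of_poly p))"

text \<open>All polynomial lattice point sets with \<open>b\<^sup>m\<close> points, as multisets.\<close>

definition poly_lattice_point_sets ::
  "'p::prime_card itself \<Rightarrow> nat \<Rightarrow> nat \<Rightarrow> (nat \<Rightarrow> real) multiset set" where
  "poly_lattice_point_sets _ s m =
     {image_mset (poly_lattice_point s p q) (mset_set {0..<CARD('p) ^ m}) | p q.
        Polynomial.degree (p :: 'p mod_ring poly) = m \<and> (\<forall>j\<in>{1..s}. q j \<noteq> 0 \<and> Polynomial.degree (q j) < m)}"


section \<open>Integration and extrapolated rules\<close>

definition cube :: "nat set \<Rightarrow> (nat \<Rightarrow> real) set" where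
  "cube v = (\<Pi>\<^sub>E j\<in>v. {0..<1})"

definition cube_measure :: "nat set \<Rightarrow> (nat \<Rightarrow> real) measure" where
  "cube_measure v = (\<Pi>\<^sub>M j\<in>v. restrict_space lborel {0..<1})"

definition qmc :: "((nat \<Rightarrow> real) \<Rightarrow> real) \<Rightarrow> (nat \<Rightarrow> real) multiset \<Rightarrow> real" where
  "qmc f P = (\<Sum>x\<in>#P. f x) / real (size P)"

text \<open>\<open>extrap_coeff b \<tau> \<nu>\<close> is \<open>a\<^sub>\<nu>\<close> with superscript \<open>(\<tau>)\<close>.\<close>

definition extrap_coeff :: "nat \<Rightarrow> nat \<Rightarrow> nat \<Rightarrow> real" where
  "extrap_coeff b \<tau> \<nu> =
     (\<Prod>j=1..\<nu> - 1. - 1 / (real b ^ j - 1)) * (\<Prod>j=1..\<tau> - \<nu>. real b ^ j / (real b ^ j - 1))"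

text \<open>The family \<open>P\<close> is indexed by the exponent: \<open>P n\<close> is the point set with \<open>b\<^sup>n\<close> points.\<close>

definition extrap_rule ::
  "nat \<Rightarrow> nat \<Rightarrow> nat \<Rightarrow> (nat \<Rightarrow> (nat \<Rightarrow> real) multiset) \<Rightarrow> ((nat \<Rightarrow> real) \<Rightarrow> real) \<Rightarrow> real" where
  "extrap_rule b \<alpha> m P f = (\<Sum>\<tau>=1..\<alpha>. extrap_coeff b \<alpha> \<tau> * qmc f (P (m - \<tau> + 1)))"


section \<open>The Sobolev space\<close>

text \<open>
  Multi-indices are functions \<open>nat \<Rightarrow> nat\<close> of which only the values on \<open>{1..s}\<close> matter.
  The next predicate says that \<open>\<Phi> 0\<close> is a smooth function on \<open>\<real>\<^sup>s\<close> whose support is a compact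
  subset of \<open>(0,1)\<^sup>s\<close>, and that \<open>\<Phi> \<beta>\<close> is its partial derivative of multi-order \<open>\<beta>\<close>.
\<close>

definition test_function :: "nat \<Rightarrow> ((nat \<Rightarrow> nat) \<Rightarrow> (nat \<Rightarrow> real) \<Rightarrow> real) \<Rightarrow> bool" where
  "test_function s \<Phi> \<longleftrightarrow>
     (\<forall>\<beta>. continuous_on (\<Pi>\<^sub>E j\<in>{1..s}. UNIV) (\<Phi> \<beta>)) \<and>
     (\<forall>\<beta>. \<forall>j\<in>{1..s}. \<forall>x\<in>(\<Pi>\<^sub>E j\<in>{1..s}. UNIV).
        ((\<lambda>t. \<Phi> \<beta> (x(j := t))) has_real_derivative \<Phi> (\<beta>(j := Suc (\<beta> j))) x) (at (x j))) \<and>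
     (\<exists>l r. 0 < l \<and> r < 1 \<and>
        (\<forall>x\<in>(\<Pi>\<^sub>E j\<in>{1..s}. UNIV). (\<exists>j\<in>{1..s}. x j \<notin> {l..r}) \<longrightarrow> \<Phi> (\<lambda>_. 0) x = 0))"

text \<open>
  \<open>g\<close> is a weak partial derivative of \<open>f\<close> of multi-order \<open>\<beta>\<close>. Integrability over the whole cube
  (rather than local integrability) is what makes the integrals in the norm meaningful.
\<close>

definition has_weak_deriv ::
  "nat \<Rightarrow> (nat \<Rightarrow> nat) \<Rightarrow> ((nat \<Rightarrow> real) \<Rightarrow> real) \<Rightarrow> ((nat \<Rightarrow> real) \<Rightarrow> real) \<Rightarrow> bool" where
  "has_weak_deriv s \<beta> f g \<longleftrightarrow>
     integrable (cube_measure {1..s}) f \<and> integrable (cube_measure {1..s}) g \<and>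
     (\<forall>\<Phi>. test_function s \<Phi> \<longrightarrow>
        (\<integral>x. f x * \<Phi> \<beta> x \<partial>cube_measure {1..s}) =
        (-1) ^ (\<Sum>j=1..s. \<beta> j) * (\<integral>x. g x * \<Phi> (\<lambda>_. 0) x \<partial>cube_measure {1..s}))"

definition weak_deriv ::
  "nat \<Rightarrow> (nat \<Rightarrow> nat) \<Rightarrow> ((nat \<Rightarrow> real) \<Rightarrow> real) \<Rightarrow> (nat \<Rightarrow> real) \<Rightarrow> real" where
  "weak_deriv s \<beta> f = (SOME g. has_weak_deriv s \<beta> f g)"

definition mixed_index :: "nat \<Rightarrow> nat set \<Rightarrow> nat set \<Rightarrow> (nat \<Rightarrow> nat) \<Rightarrow> nat \<Rightarrow> nat" where
  "mixed_index \<alpha> u v \<tau> = (\<lambda>j. if j \<in> v then \<alpha> else if j \<in> u then \<tau> j else 0)"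

text \<open>The integral over \<open>x\<close> outside \<open>v\<close> of the mixed derivative, as a function of \<open>x\<close> on \<open>v\<close>.\<close>

definition deriv_mean ::
  "nat \<Rightarrow> nat \<Rightarrow> nat set \<Rightarrow> nat set \<Rightarrow> (nat \<Rightarrow> nat) \<Rightarrow> ((nat \<Rightarrow> real) \<Rightarrow> real) \<Rightarrow> (nat \<Rightarrow> real) \<Rightarrow> real" where
  "deriv_mean s \<alpha> u v \<tau> f x =
     (\<integral>z. weak_deriv s (mixed_index \<alpha> u v \<tau>) f (merge v ({1..s} - v) (x, z))
        \<partial>cube_measure ({1..s} - v))"

definition ennroot :: "real \<Rightarrow> ennreal \<Rightarrow> ennreal" where
  "ennroot r x = (if x = \<infinity> then \<infinity> else ennreal (enn2real x powr (1 / r)))"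

text \<open>
  In \<^typ>\<open>ennreal\<close>, \<open>0 / 0 = 0\<close> and \<open>x / 0 = \<infinity>\<close> for \<open>x \<noteq> 0\<close>. So for \<open>\<gamma> u = 0\<close> the term below is \<open>0\<close>
  if all integrals vanish, and \<open>\<infinity>\<close> otherwise.
\<close>

definition norm_term ::
  "nat \<Rightarrow> nat \<Rightarrow> (nat set \<Rightarrow> real) \<Rightarrow> ereal \<Rightarrow> ((nat \<Rightarrow> real) \<Rightarrow> real) \<Rightarrow> nat set \<Rightarrow> ennreal" where
  "norm_term s \<alpha> \<gamma> q f u =
     (if q = \<infinity> then
        (SUP v\<in>Pow u. SUP \<tau>\<in>(\<Pi>\<^sub>E j\<in>u - v. {1..\<alpha>}).
           esssup (cube_measure v) (\<lambda>x. ennreal \<bar>deriv_mean s \<alpha> u v \<tau> f x\<bar>)) / ennreal (\<gamma> u)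
      else
        ennroot (real_of_ereal q)
          ((\<Sum>v\<in>Pow u. \<Sum>\<tau>\<in>(\<Pi>\<^sub>E j\<in>u - v. {1..\<alpha>}).
              \<integral>\<^sup>+x. ennreal (\<bar>deriv_mean s \<alpha> u v \<tau> f x\<bar> powr real_of_ereal q) \<partial>cube_measure v)
           / ennreal (\<gamma> u powr real_of_ereal q)))"

definition sobolev_norm ::
  "nat \<Rightarrow> nat \<Rightarrow> (nat set \<Rightarrow> real) \<Rightarrow> ereal \<Rightarrow> ((nat \<Rightarrow> real) \<Rightarrow> real) \<Rightarrow> ennreal" where
  "sobolev_norm s \<alpha> \<gamma> q f = (MAX u\<in>Pow {1..s}. norm_term s \<alpha> \<gamma> q f u)"

text \<open>
  Quadrature rules evaluate functions at points, so each element is required to be the continuous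
  representative of its class.
\<close>

definition sobolev_space ::
  "nat \<Rightarrow> nat \<Rightarrow> (nat set \<Rightarrow> real) \<Rightarrow> ereal \<Rightarrow> ((nat \<Rightarrow> real) \<Rightarrow> real) set" where
  "sobolev_space s \<alpha> \<gamma> q =
     {f. continuous_on (cube {1..s}) f \<and>
         (\<forall>\<beta>. (\<forall>j\<in>{1..s}. \<beta> j \<le> \<alpha>) \<and> (\<forall>j. j \<notin> {1..s} \<longrightarrow> \<beta> j = 0) \<longrightarrow> (\<exists>g. has_weak_deriv s \<beta> f g)) \<and>
         sobolev_norm s \<alpha> \<gamma> q f < \<infinity>}"

definition worst_case_error ::
  "nat \<Rightarrow> nat \<Rightarrow> nat \<Rightarrow> (nat set \<Rightarrow> real) \<Rightarrow> ereal \<Rightarrow> nat \<Rightarrow>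
   (nat \<Rightarrow> (nat \<Rightarrow> real) multiset) \<Rightarrow> ennreal" where
  "worst_case_error s b \<alpha> \<gamma> q m P =
     (SUP f\<in>{f \<in> sobolev_space s \<alpha> \<gamma> q. sobolev_norm s \<alpha> \<gamma> q f \<le> 1}.
        ennreal \<bar>extrap_rule b \<alpha> m P f - (\<integral>x. f x \<partial>cube_measure {1..s})\<bar>)"


section \<open>Constants\<close>

fun bernoulli_number :: "nat \<Rightarrow> real" where
  "bernoulli_number 0 = 1"
| "bernoulli_number (Suc n) =
     - (\<Sum>k\<le>n. real (Suc (Suc n) choose k) * bernoulli_number k) / real (Suc (Suc n))"

definition bernoulli_poly :: "nat \<Rightarrow> real \<Rightarrow> real" where
  "bernoulli_poly n x = (\<Sum>k\<le>n. real (n choose k) * bernoulli_number k * x ^ (n - k))"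

definition bern :: "nat \<Rightarrow> real \<Rightarrow> real" where
  "bern \<tau> x = bernoulli_poly \<tau> x / fact \<tau>"

definition bern_periodic :: "nat \<Rightarrow> real \<Rightarrow> real" where
  "bern_periodic \<tau> x = bern \<tau> (frac x)"

definition D_const :: "nat \<Rightarrow> real" where
  "D_const \<alpha> =
     Max (insert (SUP x\<in>{0..<1}. \<bar>bern_periodic \<alpha> x\<bar>) ((\<lambda>\<tau>. \<bar>bern \<tau> 0\<bar>) ` {1..\<alpha> - 1}))"

definition conj_exponent :: "ereal \<Rightarrow> ereal" where
  "conj_exponent q = (if q = 1 then \<infinity> else if q = \<infinity> then 1 else q / (q - 1))"

definition H_const :: "nat \<Rightarrow> nat \<Rightarrow> (nat set \<Rightarrow> real) \<Rightarrow> ereal \<Rightarrow> real" where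
  "H_const s \<alpha> \<gamma> q =
     (\<Sum>u\<in>Pow {1..s}.
        \<gamma> u * (real \<alpha> + 1) powr real_of_ereal (ereal (real (card u)) / conj_exponent q)
            * D_const \<alpha> ^ card u)"

definition C_const :: "nat \<Rightarrow> nat \<Rightarrow> real" where
  "C_const b \<alpha> =
     max (2 / (2 * sin (pi / real b)) ^ \<alpha>) (MAX z\<in>{1..\<alpha> - 1}. 1 / (2 * sin (pi / real b)) ^ z)
     * (1 + 1 / real b + 1 / (real b * (real b + 1))) ^ (\<alpha> - 2)
     * (3 + 2 / real b + (2 * real b + 1) / (real b - 1))"

definition E_const :: "nat \<Rightarrow> nat \<Rightarrow> real \<Rightarrow> real" where
  "E_const b \<alpha> lam =
     (\<Sum>w=1..\<alpha> - 1. (\<Prod>i=1..w. (real b - 1) / (real b powr (lam * real i) - 1)))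
     + (real b powr (lam * real \<alpha>) - 1) / (real b powr (lam * real \<alpha>) - real b)
       * (\<Prod>i=1..\<alpha>. (real b - 1) / (real b powr (lam * real i) - 1))"

definition J_const :: "nat \<Rightarrow> nat \<Rightarrow> nat \<Rightarrow> real \<Rightarrow> (nat set \<Rightarrow> real) \<Rightarrow> real" where
  "J_const s b \<alpha> lam \<gamma> =
     (\<Sum>u\<in>Pow {1..s} - {{}}.
        \<gamma> u powr lam * C_const b \<alpha> powr (lam * real (card u)) * E_const b \<alpha> lam ^ card u) powr (1 / lam)"

definition product_weights :: "(nat set \<Rightarrow> real) \<Rightarrow> (nat \<Rightarrow> real) \<Rightarrow> bool" where
  "product_weights \<gamma> g \<longleftrightarrow> (\<forall>u. finite u \<and> u \<subseteq> {1..} \<longrightarrow> \<gamma> u = (\<Prod>j\<in>u. g j))"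

definition num_evals :: "nat \<Rightarrow> nat \<Rightarrow> nat \<Rightarrow> nat" where
  "num_evals b \<alpha> m = (\<Sum>n=m - \<alpha> + 1..m. b ^ n)"

end

theory Submission
  imports Defs "Berlekamp_Zassenhaus.Distinct_Degree_Factorization"
begin

text \<open>
  Three ingredients make the rate \<open>N\<^bsup>- 1 / lam\<^esup>\<close> possible.

  A function of the space is a sum of integrals of its derivatives against products of periodic
  Bernoulli functions (theorem \<open>representation\<close>), a Taylor expansion around the integral. It is obtained by
  integrating by parts against an approximate point mass. Thus the error is controlled by the error
  for products of one-dimensional kernels, and the derivatives enter only through the means that
  form the norm.

  On the grid of multiples of \<open>b\<^sup>-\<^sup>n\<close>, which contains the lattice points, a kernel is a combination of Walsh
  functions. Averaging over a polynomial lattice removes all frequencies except zero and the dual net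
  (lemma \<open>lattice_product_error\<close>). The coefficients on the dual net decay with the sum of the
  leading digit places of the frequency (lemma \<open>walsh_coeff_bound\<close>), so for a good lattice their sum is of the order
  \<open>b\<^bsup>- n / lam\<^esup>\<close>. Good lattices exist by averaging over all generating vectors modulo
  an irreducible polynomial (lemma \<open>good_lattice_exists\<close>).

  The zero frequency is the error of the regular grid, which has an expansion in powers of \<open>b\<^sup>-\<^sup>n\<close>. It
  would spoil the rate, but the weights of the extrapolated rule cancel all powers below \<open>\<alpha>\<close>
  (lemma \<open>extrap_coeff_moments\<close>), and what remains is of order \<open>b\<^bsup>- \<alpha> n\<^esup>\<close>.

  Both parts together bound the worst-case error by a multiple of \<open>J_const + H_const\<close>
  (lemma \<open>good_rules_exist\<close>), where the multiple depends on neither the dimension nor the point sets. The four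
  items then only concern the growth of these two constants with the dimension.
\<close>

text \<open>
  For the real numbers, division with remainder is the ordinary division. There the following rules split
  and merge fractions in the direction opposite to \<open>field_simps\<close>, so that rewriting would not terminate; as rewrite
  rules they are kept for natural numbers and integers.
\<close>

declare
  div_mult_self1 [simp del]
  div_mult_self2 [simp del]
  div_mult_self3 [simp del]
  div_mult_self4 [simp del]
  div_add_self1 [simp del]
  div_add_self2 [simp del]
  div_add [simp del]
  div_diff [simp del]

lemmas div_simps_nat_int [simp] =
  div_mult_self1[where ?'a = nat] div_mult_self1[where ?'a = int]
  div_mult_self2[where ?'a = nat] div_mult_self2[where ?'a = int]
  div_mult_self3[where ?'a = nat] div_mult_self3[where ?'a = int]
  div_mult_self4[where ?'a = nat] div_mult_self4[where ?'a = int]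
  div_add_self1[where ?'a = nat] div_add_self1[where ?'a = int]
  div_add_self2[where ?'a = nat] div_add_self2[where ?'a = int]
  div_add[where ?'a = nat] div_add[where ?'a = int]
  div_diff[where ?'a = int]


section \<open>Periodic Bernoulli functions\<close>

lemma bern_altdef: "bern n x = (\<Sum>k\<le>n. bernoulli_number k / fact k * (x ^ (n - k) / fact (n - k)))"
  unfolding bern_def bernoulli_poly_def sum_divide_distrib
  by (rule sum.cong) (simp_all add: binomial_fact field_simps)

lemma bern_has_field_derivative:
  "(bern (Suc n) has_field_derivative bern n x) (at x)"
proof -
  have "((\<lambda>x. \<Sum>k\<le>Suc n. bernoulli_number k / fact k * (x ^ (Suc n - k) / fact (Suc n - k)))
      has_field_derivative (\<Sum>k\<le>Suc n. if k \<le> n then bernoulli_number k / fact k * (x ^ (n - k) / fact (n - k)) else 0)) (at x)"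
  proof (rule DERIV_sum)
    fix k assume k: "k \<in> {..Suc n}"
    show "((\<lambda>x. bernoulli_number k / fact k * (x ^ (Suc n - k) / fact (Suc n - k))) has_field_derivative
      (if k \<le> n then bernoulli_number k / fact k * (x ^ (n - k) / fact (n - k)) else 0)) (at x)"
    proof (cases "k \<le> n")
      case True
      then obtain m where m: "n = k + m" by (metis le_Suc_ex)
      have e: "real (Suc m) * x ^ m / fact (Suc m) = x ^ m / fact m"
        by (simp add: fact_Suc del: of_nat_Suc)
      have "((\<lambda>x. x ^ Suc m / fact (Suc m)) has_field_derivative (x ^ m / fact m)) (at x)"
        unfolding e[symmetric] by (rule DERIV_cdivide) (rule DERIV_cong[OF DERIV_pow], simp del: power_Suc of_nat_Suc)
      moreover have "Suc n - k = Suc m" "n - k = m" using m by auto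
      ultimately show ?thesis using True DERIV_cmult by (simp only: if_True)
    qed (use k in \<open>auto simp: le_Suc_eq\<close>)
  qed
  then show ?thesis
    unfolding bern_altdef[abs_def] by (simp add: atMost_Suc)
qed

lemma bern_one_eq_zero:
  assumes "n \<ge> 2"
  shows "bern n 1 = bern n 0"
proof -
  obtain m where n: "n = Suc (Suc m)"
    using assms by (metis add_2_eq_Suc le_Suc_ex)
  have r: "real (Suc (Suc m)) * bernoulli_number (Suc m) = - (\<Sum>k\<le>m. real (Suc (Suc m) choose k) * bernoulli_number k)"
    by simp
  have z: "0 ^ (n - k) = (if k = n then 1 else 0 :: real)" if "k \<le> n" for k
    using that by auto
  have e: "{..n} = insert n (insert (Suc m) {..m})" using n by auto
  have "bernoulli_poly n 1 = bernoulli_number n + real (Suc (Suc m)) * bernoulli_number (Suc m)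
      + (\<Sum>k\<le>m. real (Suc (Suc m) choose k) * bernoulli_number k)"
    unfolding bernoulli_poly_def e by (simp add: n del: bernoulli_number.simps)
  also have "\<dots> = bernoulli_number n" using r by linarith
  also have "\<dots> = bernoulli_poly n 0"
  proof -
    have "bernoulli_poly n 0 = (\<Sum>k\<le>n. if k = n then bernoulli_number n else 0)"
      unfolding bernoulli_poly_def by (rule sum.cong) (auto simp: z)
    then show ?thesis by (simp add: sum.delta)
  qed
  finally show ?thesis by (simp add: bern_def)
qed

text \<open>
  The periodic extension of \<open>bern n\<close>, except that for \<open>n = 1\<close> the value at the integers is taken from the
  left. With this choice \<open>per_bern 1 0 = 1 / 2\<close>, as the difference quotients of the second periodic
  Bernoulli function towards the left demand; they are what produces the kernels below.
\<close>

definition per_bern :: "nat \<Rightarrow> real \<Rightarrow> real" where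
  "per_bern n x = (if n = 1 then x - of_int \<lceil>x\<rceil> + 1 / 2 else bern_periodic n x)"

lemma per_bern_plus_of_int [simp]: "per_bern n (x + of_int k) = per_bern n x"
  by (simp add: per_bern_def bern_periodic_def frac_def)

lemma per_bern_plus_of_nat: "per_bern n (x + of_nat k) = per_bern n x"
  using per_bern_plus_of_int[of n x "int k"] by simp

lemma bern_0 [simp]: "bern 0 x = 1"
  by (simp add: bern_def bernoulli_poly_def)

lemma bern_1: "bern (Suc 0) x = x - 1 / 2"
  by (simp add: bern_def bernoulli_poly_def atMost_Suc)

lemma frac_eq_sub: "of_int k \<le> x \<Longrightarrow> x < of_int k + 1 \<Longrightarrow> frac x = x - of_int k" for x :: real
  by (metis frac_def floor_unique)

lemma per_bern_eq_bern:
  assumes "n \<ge> 2" "x \<in> {of_int k..of_int k + 1}"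
  shows "per_bern n x = bern n (x - of_int k)"
proof (cases "x = of_int k + 1")
  case True
  then have "frac x = 0" by (metis Ints_of_int frac_eq_0_iff of_int_1 of_int_add)
  then show ?thesis using True assms bern_one_eq_zero by (simp add: per_bern_def bern_periodic_def)
next
  case False
  then show ?thesis using assms frac_eq_sub[of k x] by (simp add: per_bern_def bern_periodic_def)
qed

lemma continuous_on_bern: "continuous_on A (bern n)"
  unfolding bern_altdef[abs_def] by (intro continuous_intros) auto

lemma isCont_per_bern:
  assumes "n \<ge> 2"
  shows "isCont (per_bern n) x"
proof -
  have c: "continuous_on {of_int k..of_int k + 1} (per_bern n)" for k
  proof -
    have "continuous_on {of_int k..of_int k + 1} (\<lambda>x. bern n (x - of_int k))"
      by (rule continuous_on_compose2[OF continuous_on_bern[of UNIV]]) (auto intro!: continuous_intros)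
    then show ?thesis
      by (rule continuous_on_eq) (use per_bern_eq_bern[OF assms] in auto)
  qed
  have "continuous_on ({of_int (\<lfloor>x\<rfloor> - 1)..of_int (\<lfloor>x\<rfloor> - 1) + 1} \<union> {of_int \<lfloor>x\<rfloor>..of_int \<lfloor>x\<rfloor> + 1}) (per_bern n)"
    by (rule continuous_on_closed_Un) (use c[of "\<lfloor>x\<rfloor> - 1"] c[of "\<lfloor>x\<rfloor>"] in auto)
  also have "{of_int (\<lfloor>x\<rfloor> - 1)..of_int (\<lfloor>x\<rfloor> - 1) + 1} \<union> {of_int \<lfloor>x\<rfloor>..of_int \<lfloor>x\<rfloor> + 1}
      = {of_int \<lfloor>x\<rfloor> - 1..of_int \<lfloor>x\<rfloor> + 1 :: real}"
    by (auto simp: ivl_disj_un)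
  finally have "continuous_on {of_int \<lfloor>x\<rfloor> - 1..of_int \<lfloor>x\<rfloor> + 1 :: real} (per_bern n)" .
  moreover have "of_int \<lfloor>x\<rfloor> - 1 < x" "x < of_int \<lfloor>x\<rfloor> + 1" by linarith+
  ultimately show ?thesis
    by (intro continuous_on_interior[of "{of_int \<lfloor>x\<rfloor> - 1..of_int \<lfloor>x\<rfloor> + 1}"]) auto
qed

lemma per_bern_has_field_derivative:
  assumes "n \<ge> 1" "x \<notin> \<int>"
  shows "(per_bern (Suc n) has_field_derivative per_bern n x) (at x)"
proof -
  define k where "k = \<lfloor>x\<rfloor>"
  have kx: "of_int k < x" "x < of_int k + 1"
    using assms(2) unfolding k_def by (metis Ints_of_int floor_less_iff linorder_neqE_linordered_idom of_int_floor_le order.asym less_le, linarith)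
  have fr: "frac y = y - of_int k" if "y \<in> {of_int k<..<of_int k + 1}" for y :: real
    using that frac_eq_sub[of k y] by auto
  have "((\<lambda>y. bern (Suc n) (y - of_int k)) has_field_derivative bern n (x - of_int k) * 1) (at x)"
    by (rule DERIV_chain2[OF bern_has_field_derivative]) (auto intro!: derivative_eq_intros)
  moreover have "bern n (x - of_int k) = per_bern n x"
  proof (cases "n = 1")
    case True
    have "\<lceil>x\<rceil> = k + 1" using kx by (intro ceiling_unique) auto
    then show ?thesis using True by (simp add: per_bern_def bern_1)
  next
    case False
    then show ?thesis using kx fr[of x] by (simp add: per_bern_def bern_periodic_def)
  qed
  ultimately have "((\<lambda>y. bern (Suc n) (y - of_int k)) has_field_derivative per_bern n x) (at x)" by simp
  then show ?thesis
    by (rule has_field_derivative_transform_within_open[of _ _ _ "{of_int k<..<of_int k + 1}"])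
      (use kx fr assms in \<open>auto simp: per_bern_def bern_periodic_def\<close>)
qed

text \<open>
  The jumps at the integers do not matter: for \<open>n \<ge> 1\<close> the function \<open>per_bern (Suc n)\<close> is continuous and has
  derivative \<open>per_bern n\<close> off the integers, a countable set.
\<close>

lemma per_bern_has_integral:
  assumes "n \<ge> 1" "a \<le> c"
  shows "(per_bern n has_integral (per_bern (Suc n) c - per_bern (Suc n) a)) {a..c}"
proof (rule fundamental_theorem_of_calculus_interior_strong[of "of_int ` {\<lfloor>a\<rfloor>..\<lceil>c\<rceil>}"])
  show "continuous_on {a..c} (per_bern (Suc n))"
    using assms by (intro continuous_at_imp_continuous_on ballI isCont_per_bern) auto
  fix x :: real assume x: "x \<in> {a<..<c} - of_int ` {\<lfloor>a\<rfloor>..\<lceil>c\<rceil>}"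
  have "x \<notin> \<int>"
  proof
    assume "x \<in> \<int>"
    then obtain k where k: "x = of_int k" by (elim Ints_cases)
    then have "k \<in> {\<lfloor>a\<rfloor>..\<lceil>c\<rceil>}" using x by (auto simp: floor_le_iff le_ceiling_iff)
    then show False using x k by blast
  qed
  then show "(per_bern (Suc n) has_vector_derivative per_bern n x) (at x)"
    using per_bern_has_field_derivative[OF assms(1)] has_real_derivative_iff_has_vector_derivative by blast
qed (use assms in auto)

lemma per_bern_affine_has_integral:
  assumes "n \<ge> 1" "a \<le> c"
  shows "((\<lambda>x. per_bern n (x - y)) has_integral (per_bern (Suc n) (c - y) - per_bern (Suc n) (a - y))) {a..c}"
  using has_integral_affinity[of "per_bern n" _ "a - y" "c - y" 1 "-y"] per_bern_has_integral[OF assms(1), of "a - y" "c - y"] assms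
  by (simp add: algebra_simps)

text \<open>
  A periodic Bernoulli function has mean zero, and its derivative is the one of lower order, so along a
  period it moves by at most \<open>1 / 2\<close> away from any of its values. Averaging over the period keeps this bound.
\<close>

lemma abs_per_bern_le: "n \<ge> 1 \<Longrightarrow> \<bar>per_bern n x\<bar> \<le> 1 / 2"
proof (induction n arbitrary: x rule: nat_induct_at_least)
  case base
  have "x \<le> of_int \<lceil>x\<rceil>" "of_int \<lceil>x\<rceil> < x + 1" by linarith+
  then show ?case unfolding per_bern_def abs_le_iff by simp
next
  case (Suc n)
  let ?f = "per_bern (Suc n)"
  have i0: "(?f has_integral 0) {x..x + 1}"
    using per_bern_has_integral[of "Suc n" x "x + 1"] per_bern_plus_of_int[of "Suc (Suc n)" x 1] by simp
  have "((\<lambda>y. ?f x) has_integral ?f x) {x..x+1}"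
    using has_integral_const_real[of "?f x" x "x + 1"] by simp
  from has_integral_diff[OF this i0] have "((\<lambda>y. ?f x - ?f y) has_integral ?f x) {x..x+1}" by simp
  then have "norm (?f x) \<le> 1/2 * measure lborel {x..x+1}"
  proof (rule has_integral_bound_real[where S = "{}", rotated 2])
    fix y assume "y \<in> {x..x+1} - {}"
    then have y: "y \<in> {x..x+1}" by simp
    have "(per_bern n has_integral (?f y - ?f x)) {x..y}"
      using per_bern_has_integral[OF Suc.hyps] y by auto
    then have "norm (?f y - ?f x) \<le> 1/2 * measure lborel {x..y}"
      by (rule has_integral_bound_real[where S = "{}", rotated 2]) (use Suc.IH in auto)
    also have "\<dots> \<le> 1/2 * 1" using y by (intro mult_left_mono) auto
    finally show "norm (?f x - ?f y) \<le> 1/2" unfolding real_norm_def by linarith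
  qed auto
  then show ?case by simp
qed

lemma per_bern_1_sub:
  assumes "0 \<le> x" "x \<le> 1" "0 \<le> y" "y < 1"
  shows "per_bern 1 (x - y) = 1 / 2 + x - y - of_bool (y < x)"
proof -
  have "\<lceil>x - y\<rceil> = of_bool (y < x)" using assms by (intro ceiling_unique) auto
  then show ?thesis by (simp add: per_bern_def)
qed

lemma per_bern_1_sub_div:
  assumes "0 \<le> x" "x \<le> 1" "0 \<le> y" "y < 1" "d < b"
  shows "per_bern 1 ((x - real d - y) / real b) = 1 / 2 + (x - y - real d) / real b - of_bool (d = 0 \<and> y < x)"
proof -
  have b: "real b > 0" "real d + 1 \<le> real b" using assms by auto
  have "\<lceil>(x - real d - y) / real b\<rceil> = of_bool (d = 0 \<and> y < x)"
  proof (cases "d = 0 \<and> y < x")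
    case True
    then show ?thesis using assms b by (intro ceiling_unique) (auto simp: field_simps)
  next
    case False
    have "x - real d - y \<le> 0" using False assms by (cases d) auto
    then show ?thesis using False assms b by (intro ceiling_unique) (auto simp: field_simps)
  qed
  then show ?thesis by (simp add: per_bern_def algebra_simps)
qed

text \<open>
  Raabe's multiplication theorem. Both sides satisfy the same integral recursion in \<open>n\<close> and have mean zero,
  so everything reduces to the sawtooth function.
\<close>

lemma per_bern_multiplication:
  assumes "b \<ge> 1" "n \<ge> 1"
  shows "(\<Sum>d<b. per_bern n (x - real d / real b)) = real b * (1 / real b) ^ n * per_bern n (real b * x)"
  using assms(2)
proof (induction n arbitrary: x rule: nat_induct_at_least)
  case base
  have b: "real b > 0" using assms by simp
  define D where "D = (\<lambda>x. \<Sum>d<b. per_bern 1 (x - real d / real b))"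
  have per: "D (x + 1 / real b) = D x" for x
  proof -
    obtain c where c: "b = Suc c" using assms by (cases b) auto
    have e: "x + 1 / real (Suc c) - real (Suc d) / real (Suc c) = x - real d / real (Suc c)" for d
      by (simp add: diff_divide_distrib add_divide_distrib)
    have "D (x + 1 / real b) = per_bern 1 (x + 1 / real b) + (\<Sum>d<c. per_bern 1 (x - real d / real b))"
      unfolding D_def unfolding c unfolding sum.lessThan_Suc_shift e by simp
    also have "per_bern 1 (x + 1 / real b) = per_bern 1 (x - real c / real b)"
    proof -
      have "x + 1 / real b = x - real c / real b + of_int 1" using b c by (simp add: field_simps)
      then show ?thesis by (metis per_bern_plus_of_int)
    qed
    finally show ?thesis unfolding D_def unfolding c by simp
  qed
  have per_nat: "D (x + real j / real b) = D x" for j x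
  proof (induction j)
    case (Suc j)
    have "x + real (Suc j) / real b = (x + real j / real b) + 1 / real b" by (simp add: add_divide_distrib)
    then show ?case using per Suc by metis
  qed simp
  have per_int: "D (x + of_int j / real b) = D x" for j x
  proof (cases "j \<ge> 0")
    case True then show ?thesis using per_nat[of x "nat j"] by simp
  next
    case False then show ?thesis using per_nat[of "x + of_int j / real b" "nat (-j)"] by simp
  qed
  define t where "t = frac (real b * x)"
  have t: "0 \<le> t" "t < 1" unfolding t_def by (simp_all add: frac_lt_1)
  have x: "x = t / real b + of_int \<lfloor>real b * x\<rfloor> / real b"
    unfolding t_def frac_def using b by (simp add: field_simps)
  have "D x = D (t / real b)" by (subst x) (rule per_int)
  also have "\<dots> = (\<Sum>d<b. 1/2 + (t - real d) / real b - of_bool (d = 0 \<and> 0 < t))"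
    unfolding D_def
  proof (rule sum.cong)
    fix d assume "d \<in> {..<b}"
    then show "per_bern 1 (t / real b - real d / real b) = 1/2 + (t - real d) / real b - of_bool (d = 0 \<and> 0 < t)"
      using per_bern_1_sub_div[of t 0 d b] t by (simp add: diff_divide_distrib)
  qed simp
  also have "\<dots> = real b / 2 + t - (\<Sum>d<b. real d) / real b - (\<Sum>d<b. of_bool (d = 0 \<and> 0 < t))"
    using b by (simp add: sum.distrib sum_subtractf sum_divide_distrib diff_divide_distrib)
  also have "(\<Sum>d<b. of_bool (d = 0 \<and> 0 < t) :: real) = (\<Sum>d<b. if d = 0 then of_bool (0 < t) else 0)"
    by (rule sum.cong) auto
  also have "\<dots> = of_bool (0 < t)" using assms by (simp add: sum.delta)
  also have "(\<Sum>d<b. real d) = real b * (real b - 1) / 2"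
    by (induction b) (auto simp: field_simps)
  also have "real b * (real b - 1) / 2 / real b = (real b - 1) / 2" using b by simp
  also have "real b / 2 + t - (real b - 1) / 2 - of_bool (0 < t) = 1/2 + t - of_bool (0 < t)"
    by (simp add: field_simps)
  finally have "D x = 1/2 + t - of_bool (0 < t)" .
  also have "\<dots> = per_bern 1 t" using per_bern_1_sub[of t 0] t by simp
  also have "\<dots> = per_bern 1 (t + of_int \<lfloor>real b * x\<rfloor>)" by simp
  also have "t + of_int \<lfloor>real b * x\<rfloor> = real b * x" by (simp add: t_def frac_def)
  finally show ?case using b by (simp add: D_def)
next
  case (Suc n)
  have b: "real b > 0" and b0: "b \<noteq> 0" using assms by simp_all
  define L where "L = (\<lambda>m x. \<Sum>d<b. per_bern m (x - real d / real b))"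
  define R where "R = (\<lambda>m x. real b * (1 / real b) ^ m * per_bern m (real b * x))"
  have iL: "(L m has_integral (L (Suc m) z - L (Suc m) y)) {y..z}" if "m \<ge> 1" "y \<le> z" for m y z
    unfolding L_def sum_subtractf[symmetric]
    by (intro has_integral_sum per_bern_affine_has_integral that finite_lessThan)
  have iR: "(R m has_integral (R (Suc m) z - R (Suc m) y)) {y..z}" if "m \<ge> 1" "y \<le> z" for m y z
  proof -
    have yz: "real b * y \<le> real b * z" using that b by simp
    have e: "((\<lambda>x. x / real b) ` {real b * y..real b * z}) = {y..z}"
      using b that yz by (simp add: image_divide_atLeastAtMost)
    have "((\<lambda>x. per_bern m (real b * x + 0)) has_integral
       (1 / real b) * (per_bern (Suc m) (real b * z) - per_bern (Suc m) (real b * y))) {y..z}"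
      using has_integral_affinity[of "per_bern m" _ "real b * y" "real b * z" "real b" 0] per_bern_has_integral[OF that(1) yz] b e
      by simp
    from has_integral_mult_right[OF this, of "real b * (1 / real b) ^ m"]
    show ?thesis unfolding R_def using b by (simp add: algebra_simps b0)
  qed
  have LR: "L n y = R n y" for y unfolding L_def R_def using Suc.IH by simp
  have dd: "L (Suc n) y - L (Suc n) x = R (Suc n) y - R (Suc n) x" if "x \<le> y" for x y
    using has_integral_unique[OF iL[OF Suc.hyps that]] iR[OF Suc.hyps that] LR by (metis (no_types, lifting) has_integral_cong)
  define c where "c = L (Suc n) 0 - R (Suc n) 0"
  have cc: "L (Suc n) y - R (Suc n) y = c" for y
    using dd[of 0 y] dd[of y 0] unfolding c_def by (cases "0 \<le> y") auto
  have p1: "L m (0 + 1) = L m 0" for m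
  proof -
    have "per_bern m (0 + 1 - real d / real b) = per_bern m (0 - real d / real b)" for d
      using per_bern_plus_of_int[of m "0 - real d / real b" 1] by (simp add: algebra_simps)
    then show ?thesis by (simp only: L_def)
  qed
  have p2: "R m 1 = R m 0" for m
    unfolding R_def using per_bern_plus_of_nat[of m 0 b] by simp
  have "((\<lambda>y. L (Suc n) y - R (Suc n) y) has_integral 0) {0..1}"
    using has_integral_diff[OF iL[of "Suc n" 0 1] iR[of "Suc n" 0 1]] p1[of "Suc (Suc n)"] p2[of "Suc (Suc n)"] by simp
  then have "((\<lambda>y. c) has_integral 0) {0..1::real}" by (simp add: cc)
  moreover have "((\<lambda>y. c) has_integral c) {0..1::real}" using has_integral_const_real[of c 0 1] by simp
  ultimately have "c = 0" by (rule has_integral_unique[symmetric])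
  then show ?case using cc[of x] unfolding L_def R_def by simp
qed


section \<open>Characters of the digit group\<close>

locale walsh_base =
  fixes b :: nat
  assumes b2: "b \<ge> 2"
begin

lemma b_pos [simp]: "0 < b" using b2 by simp

lemma rb2: "real b \<ge> 2" using b2 by simp

text \<open>
  The additive characters of the integers modulo \<open>b\<close>.
\<close>

definition w :: "nat \<Rightarrow> complex" where "w j = cis (2 * pi * real j / real b)"

lemma norm_w [simp]: "norm (w j) = 1" by (simp add: w_def)

lemma w_0 [simp]: "w 0 = 1" by (simp add: w_def)

lemma w_add: "w (i + j) = w i * w j"
  by (simp add: w_def cis_mult add_divide_distrib algebra_simps)

lemma w_mult: "w (i * j) = w i ^ j"
  by (induction j) (simp_all add: w_add)

lemma w_b: "w b = 1" by (simp add: w_def)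

lemma w_mod: "w (j mod b) = w j"
proof -
  have "w j = w (b * (j div b) + j mod b)" by simp
  also have "\<dots> = w (j mod b)" by (simp only: w_add w_mult w_b power_one mult_1)
  finally show ?thesis by simp
qed

lemma w_cong: "i mod b = j mod b \<Longrightarrow> w i = w j"
  by (metis w_mod)

lemma norm_w_minus_1:
  assumes "0 < j" "j < b"
  shows "norm (w j - 1) \<ge> 2 * sin (pi / real b)"
proof -
  define x where "x = pi * real j / real b"
  have b: "real b > 0" by simp
  have x0: "0 < x" "x < pi" using assms b by (auto simp: x_def field_simps)
  have "w j - 1 = cis (2 * x) - 1" by (simp add: w_def x_def algebra_simps)
  also have "norm \<dots> ^ 2 = (cos (2 * x) - 1)^2 + sin (2 * x)^2"
    by (simp add: cmod_power2)
  also have "\<dots> = 2 - 2 * cos (2 * x)"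
    using sin_cos_squared_add[of "2*x"] by (simp add: power2_eq_square algebra_simps)
  also have "\<dots> = (2 * sin x)^2"
    by (simp add: cos_double_sin power2_eq_square)
  finally have "norm (w j - 1) ^ 2 = (2 * sin x)^2" .
  have n: "norm (w j - 1) = 2 * sin x"
  proof -
    have "0 \<le> 2 * sin x" using sin_gt_zero[OF x0] by simp
    then show ?thesis using \<open>norm (w j - 1) ^ 2 = (2 * sin x)^2\<close> power2_eq_imp_eq norm_ge_zero by blast
  qed
  have "sin (pi / real b) \<le> sin x"
  proof (cases "x \<le> pi / 2")
    case True
    have "- (pi / 2) \<le> pi / real b" using pi_gt_zero by (smt (verit) divide_nonneg_nonneg of_nat_0_le_iff)
    moreover have "pi / real b \<le> x" using assms b by (auto simp: x_def field_simps)
    ultimately show ?thesis using True by (intro sin_monotone_2pi_le) auto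
  next
    case False
    have e: "sin x = sin (pi - x)" by simp
    have "- (pi / 2) \<le> pi / real b" using pi_gt_zero by (smt (verit) divide_nonneg_nonneg of_nat_0_le_iff)
    moreover have "pi / real b \<le> pi - x"
    proof -
      have "real j + 1 \<le> real b" using assms by simp
      then have "pi * (real j + 1) \<le> pi * real b" by (intro mult_left_mono) auto
      then have "pi * (real j + 1) / real b \<le> pi" using b by (simp add: field_simps)
      moreover have "pi * (real j + 1) / real b = x + pi / real b"
        by (simp add: x_def add_divide_distrib distrib_left)
      ultimately show ?thesis by linarith
    qed
    ultimately show ?thesis using False unfolding e by (intro sin_monotone_2pi_le) auto
  qed
  then show ?thesis using n by simp
qed

definition s0 :: real where "s0 = 2 * sin (pi / real b)"

lemma sin_pib_pos: "sin (pi / real b) > 0"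
proof (rule sin_gt_zero)
  have "pi / real b \<le> pi / 2" using rb2 by (intro divide_left_mono) auto
  then show "pi / real b < pi" using pi_gt_zero by linarith
qed simp

lemma s0_pos: "s0 > 0" using sin_pib_pos by (simp add: s0_def)

lemma s0_le_2: "s0 \<le> 2" by (simp add: s0_def)

lemma w_ne_1: "0 < j \<Longrightarrow> j < b \<Longrightarrow> w j \<noteq> 1"
  using norm_w_minus_1[of j] sin_pib_pos by auto

lemma s0_b: "s0 * real b \<ge> 4"
proof (cases "b = 2")
  case True then show ?thesis unfolding s0_def by simp
next
  case False
  then have b3: "real b \<ge> 3" using b2 by simp
  define x where "x = pi / real b"
  have "pi / real b \<le> pi / 3" using b3 pi_gt_zero by (intro divide_left_mono) auto
  then have x: "0 < x" "x \<le> pi / 3" by (auto simp: x_def)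
  have pi4: "pi < 3.1416" using pi_approx by simp
  have pi3: "pi > 3" using pi_approx by simp
  have "x \<le> 1.0472" using x pi4 by simp
  then have "x^2 \<le> 1.0472^2" using x by (intro power_mono) auto
  then have xx: "x^2 \<le> 1.1" by (simp add: power2_eq_square)
  have "sin x \<ge> x - x^3 / 6"
  proof -
    define f where "f = (\<lambda>x::real. sin x - x + x^3/6)"
    have "f 0 \<le> f x"
    proof (rule DERIV_nonneg_imp_nondecreasing[of 0 x])
      fix y :: real assume y: "0 \<le> y" "y \<le> x"
      have "(f has_real_derivative (cos y - 1 + y^2/2)) (at y)"
        unfolding f_def by (auto intro!: derivative_eq_intros simp: power2_eq_square)
      moreover have "cos y - 1 + y^2/2 \<ge> 0"
      proof -
        have "cos y = 1 - 2 * sin (y/2)^2" using cos_double_sin[of "y/2"] by simp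
        moreover have "sin (y/2)^2 \<le> (y/2)^2" using y sin_x_le_x[of "y/2"] abs_sin_x_le_abs_x[of "y/2"]
          by (intro power2_le_iff_abs_le[THEN iffD2]) auto
        ultimately show ?thesis by (simp add: power2_eq_square)
      qed
      ultimately show "\<exists>z. (f has_real_derivative z) (at y) \<and> 0 \<le> z" by blast
    qed (use x in auto)
    then show ?thesis by (simp add: f_def)
  qed
  moreover have "x - x^3/6 \<ge> 0.8 * x"
  proof -
    have "x^3 = x^2 * x" by (simp add: power3_eq_cube power2_eq_square)
    also have "\<dots> \<le> 1.1 * x" using xx x by (intro mult_right_mono) auto
    finally show ?thesis using x by linarith
  qed
  ultimately have "sin x \<ge> 0.8 * x" by linarith
  then have "s0 * real b \<ge> 2 * (0.8 * x) * real b" unfolding s0_def x_def using b3 by (intro mult_right_mono) auto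
  also have "2 * (0.8 * x) * real b = 1.6 * pi" using b3 by (simp add: x_def)
  finally show ?thesis using pi3 by linarith
qed

lemma sum_w_zero:
  assumes "0 < j" "j < b"
  shows "(\<Sum>d<b. w (j * d)) = 0"
proof -
  have "(\<Sum>d<b. w (j * d)) = (\<Sum>d<b. w j ^ d)" by (simp add: w_mult)
  also have "\<dots> = (w j ^ b - 1) / (w j - 1)" using w_ne_1[OF assms] by (rule geometric_sum)
  also have "w j ^ b = w b ^ j" by (metis w_mult mult.commute)
  finally show ?thesis by (simp add: w_b)
qed

text \<open>
  The character sum that appears when the sawtooth function is expanded in the leading digit.
\<close>

lemma sum_d_w:
  assumes "0 < j" "j < b"
  shows "(\<Sum>d<b. w (j * d) * of_nat d) = of_nat b / (w j - 1)"
proof -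
  have "(\<Sum>d<n. z ^ d * of_nat d) * (z - 1) = of_nat n * z ^ n - z * (\<Sum>d<n. z ^ d)" for n and z :: complex
  proof (induction n)
    case (Suc n)
    have "(\<Sum>d<Suc n. z ^ d * of_nat d) * (z - 1) = (\<Sum>d<n. z ^ d * of_nat d) * (z - 1) + z ^ n * of_nat n * (z - 1)"
      by (simp add: algebra_simps)
    also have "\<dots> = of_nat n * z ^ n - z * (\<Sum>d<n. z ^ d) + z ^ n * of_nat n * (z - 1)" by (simp only: Suc.IH)
    also have "\<dots> = of_nat (Suc n) * z ^ Suc n - z * (\<Sum>d<Suc n. z ^ d)" by (simp add: algebra_simps)
    finally show ?case .
  qed simp
  from this[of "w j" b] have "(\<Sum>d<b. w (j * d) * of_nat d) * (w j - 1) = of_nat b * w j ^ b"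
    using sum_w_zero[OF assms] by (simp add: w_mult)
  also have "w j ^ b = 1" by (metis w_mult mult.commute w_b power_one)
  finally show ?thesis using w_ne_1[OF assms] by (simp add: field_simps)
qed

text \<open>
  Over the common denominator \<open>w j - 1\<close>, the numerator is a convex combination of \<open>1\<close> and \<open>w j\<close>.
\<close>

lemma norm_inverse_w_plus:
  assumes "0 < j" "j < b" "0 \<le> t" "t \<le> 1"
  shows "norm (1 / (w j - 1) + of_real t) \<le> 1 / s0"
proof -
  have n: "norm (w j - 1) \<ge> s0" "norm (w j - 1) > 0"
  proof -
    show "norm (w j - 1) \<ge> s0" using norm_w_minus_1[OF assms(1,2)] unfolding s0_def .
    then show "norm (w j - 1) > 0" using s0_pos by linarith
  qed
  have ne: "w j - 1 \<noteq> 0" using w_ne_1[OF assms(1,2)] by simp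
  have "1 / (w j - 1) + of_real t = (of_real (1 - t) + of_real t * w j) / (w j - 1)"
    using ne by (simp add: divide_simps) (simp add: algebra_simps)
  also have "norm \<dots> = norm (of_real (1 - t) + of_real t * w j) / norm (w j - 1)" by (simp add: norm_divide)
  also have "\<dots> \<le> 1 / s0"
  proof (intro frac_le)
    have "norm (of_real (1 - t) + of_real t * w j) \<le> norm (of_real (1 - t) :: complex) + norm (of_real t * w j)"
      by (rule norm_triangle_ineq)
    also have "\<dots> = 1" using assms by (simp add: norm_mult del: of_real_diff)
    finally show "norm (of_real (1 - t) + of_real t * w j) \<le> 1" .
  qed (use n s0_pos in auto)
  finally show ?thesis .
qed

text \<open>
  The Walsh function with index \<open>k\<close> at the grid point \<open>i / b\<^sup>N\<close>. The digits of \<open>i\<close> are read from the most significant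
  one, since the digits of the point behind the radix point are those of \<open>i\<close> in reverse order.
\<close>

definition chi :: "nat \<Rightarrow> nat \<Rightarrow> nat \<Rightarrow> complex" where
  "chi N k i = (\<Prod>a<N. w ((k div b ^ a mod b) * (i div b ^ (N - 1 - a) mod b)))"

lemma norm_chi [simp]: "norm (chi N k i) = 1"
  by (simp add: chi_def prod_norm[symmetric])

lemma chi_0 [simp]: "chi 0 k i = 1" by (simp add: chi_def)

lemma chi_Suc:
  assumes "d < b" "i < b ^ N"
  shows "chi (Suc N) k (d * b ^ N + i) = w (k mod b * d) * chi N (k div b) i"
proof -
  have "(d * b ^ N + i) div b ^ (N - 1 - a) mod b = i div b ^ (N - 1 - a) mod b" if "a < N" for a
  proof -
    have "b ^ N = b ^ (N - 1 - a) * (b * b ^ a)"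
    proof -
      have "N = (N - 1 - a) + Suc a" using that by linarith
      then have "b ^ N = b ^ ((N - 1 - a) + Suc a)" by (rule arg_cong)
      then show ?thesis by (simp only: power_add power_Suc)
    qed
    then have "d * b ^ N + i = i + (d * (b * b ^ a)) * b ^ (N - 1 - a)" by simp
    then have "(d * b ^ N + i) div b ^ (N - 1 - a) = (i + (d * (b * b ^ a)) * b ^ (N - 1 - a)) div b ^ (N - 1 - a)"
      by (simp only:)
    also have "\<dots> = d * (b * b ^ a) + i div b ^ (N - 1 - a)"
      by (rule div_mult_self1) (simp add: b_pos[THEN less_imp_neq, symmetric] del: b_pos)
    also have "\<dots> = b * (d * b ^ a) + i div b ^ (N - 1 - a)" by simp
    finally show ?thesis by (simp only: mod_mult_self4)
  qed
  moreover have "(d * b ^ N + i) div b ^ N mod b = d"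
    using assms by (simp)
  ultimately show ?thesis
    unfolding chi_def prod.lessThan_Suc_shift by (simp add: div_mult2_eq diff_diff_left)
qed

lemma sum_split_top: "(\<Sum>i<b ^ Suc N. f i) = (\<Sum>d<b. \<Sum>i<b ^ N. f (d * b ^ N + i))"
  for f :: "nat \<Rightarrow> 'a::comm_monoid_add"
proof -
  have "(\<Sum>i<b ^ Suc N. f i) = (\<Sum>d<b. sum f {d * b ^ N..<d * b ^ N + b ^ N})"
    by (simp add: sum.nat_group)
  also have "\<dots> = (\<Sum>d<b. \<Sum>i<b ^ N. f (d * b ^ N + i))"
    by (rule sum.cong) (simp_all add: sum.atLeastLessThan_shift_0 atLeast0LessThan add.commute)
  finally show ?thesis .
qed

lemma sum_split_bot: "(\<Sum>i<b ^ Suc N. f i) = (\<Sum>d<b. \<Sum>i<b ^ N. f (b * i + d))"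
  for f :: "nat \<Rightarrow> 'a::comm_monoid_add"
proof -
  have "(\<Sum>i<b ^ Suc N. f i) = (\<Sum>i<b ^ N. sum f {i * b..<i * b + b})"
    by (simp add: sum.nat_group mult.commute)
  also have "\<dots> = (\<Sum>i<b ^ N. \<Sum>d<b. f (b * i + d))"
    by (rule sum.cong) (simp_all add: sum.atLeastLessThan_shift_0 atLeast0LessThan add.commute mult.commute)
  finally show ?thesis by (simp add: sum.swap[of _ "{..<b}"])
qed

lemma chi_k0 [simp]: "chi N 0 i = 1"
  by (simp add: chi_def)

lemma digits_ne_0:
  assumes "0 < k"
  shows "k mod b \<noteq> 0 \<or> 0 < k div b"
  using assms by (metis div_mult_mod_eq mult_is_0 add_0 gr0I)

lemma sum_chi_zero:
  assumes "0 < k" "k < b ^ N"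
  shows "(\<Sum>i<b ^ N. chi N k i) = 0"
  using assms
proof (induction N arbitrary: k)
  case (Suc N)
  have "(\<Sum>i<b ^ Suc N. chi (Suc N) k i) = (\<Sum>d<b. \<Sum>i<b ^ N. w (k mod b * d) * chi N (k div b) i)"
    unfolding sum_split_top by (intro sum.cong refl chi_Suc) auto
  also have "\<dots> = (\<Sum>d<b. w (k mod b * d)) * (\<Sum>i<b ^ N. chi N (k div b) i)"
    by (simp add: sum_product)
  also have "\<dots> = 0"
  proof (cases "k mod b = 0")
    case True
    then have "0 < k div b" using digits_ne_0[OF Suc.prems(1)] by simp
    moreover have "k div b < b ^ N" using Suc.prems by (simp add: less_mult_imp_div_less mult.commute)
    ultimately show ?thesis using Suc.IH by simp
  next
    case False
    then show ?thesis using sum_w_zero[of "k mod b"] by simp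
  qed
  finally show ?case .
qed simp

lemma chi_orthogonal:
  assumes "i < b ^ N" "i' < b ^ N"
  shows "(\<Sum>k<b ^ N. chi N k i * cnj (chi N k i')) = (if i = i' then of_nat (b ^ N) else 0)"
  using assms
proof (induction N arbitrary: i i')
  case (Suc N)
  define d e where "d = i div b ^ N" and "e = i' div b ^ N"
  define j j' where "j = i mod b ^ N" and "j' = i' mod b ^ N"
  have i: "i = d * b ^ N + j" "i' = e * b ^ N + j'" by (simp_all only: d_def e_def j_def j'_def div_mult_mod_eq)
  have lt: "j < b ^ N" "j' < b ^ N" "d < b" "e < b"
    using Suc.prems by (simp_all add: d_def e_def j_def j'_def less_mult_imp_div_less)
  have "(\<Sum>k<b ^ Suc N. chi (Suc N) k i * cnj (chi (Suc N) k i'))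
    = (\<Sum>c<b. \<Sum>k<b ^ N. (w (c * d) * cnj (w (c * e))) * (chi N k j * cnj (chi N k j')))"
    unfolding sum_split_bot i
    by (intro sum.cong refl, subst (1 2) chi_Suc) (use lt in \<open>auto simp: algebra_simps\<close>)
  also have "\<dots> = (\<Sum>c<b. w (c * d) * cnj (w (c * e))) * (if j = j' then of_nat (b ^ N) else 0)"
    by (simp only: sum_product[symmetric] Suc.IH[OF lt(1,2)])
  also have "(\<Sum>c<b. w (c * d) * cnj (w (c * e))) = (if d = e then of_nat b else 0)"
  proof (cases "d = e")
    case True
    have "w (c * e) * cnj (w (c * e)) = 1" for c
      by (simp add: complex_norm_square[symmetric])
    then show ?thesis using True by simp
  next
    case False
    define f where "f = (d + b - e) mod b"
    have f: "0 < f" "f < b"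
    proof -
      show "f < b" by (simp add: f_def)
      have "f \<noteq> 0" 
      proof
        assume "f = 0"
        then have "b dvd d + b - e" by (auto simp: f_def)
        then obtain q where q: "d + b - e = b * q" by blast
        have "0 < b * q" "b * q < b * 2" using q lt by linarith+
        then have "q = 1" by simp
        then show False using q False lt by simp
      qed
      then show "0 < f" by simp
    qed
    have "w (c * d) * cnj (w (c * e)) = w (f * c)" for c
    proof -
      have "w (c * e) * w (f * c) = w (c * e + f * c)" by (simp add: w_add)
      also have "\<dots> = w (c * d)"
      proof (rule w_cong)
        have "(c * e + f * c) mod b = (c * (e + f)) mod b" by (simp add: algebra_simps)
        also have "\<dots> = (c * ((e + (d + b - e)) mod b)) mod b" unfolding f_def by (metis mod_add_right_eq mod_mult_right_eq)
        also have "e + (d + b - e) = d + b" using lt by simp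
        finally show "(c * e + f * c) mod b = (c * d) mod b" by (simp add: mod_simps)
      qed
      finally have "w (c * d) = w (c * e) * w (f * c)" ..
      moreover have "w (c * e) * cnj (w (c * e)) = 1"
        by (simp add: complex_norm_square[symmetric])
      ultimately show ?thesis by (simp add: mult.commute mult.left_commute)
    qed
    then show ?thesis using sum_w_zero[OF f] False by simp
  qed
  also have "(if d = e then of_nat b else 0) * (if j = j' then of_nat (b ^ N) else 0) = (if i = i' then of_nat (b ^ Suc N) else 0 :: complex)"
  proof -
    have "i = i' \<longleftrightarrow> d = e \<and> j = j'" using i d_def e_def j_def j'_def by blast
    then show ?thesis by auto
  qed
  finally show ?case .
qed simp

end


section \<open>Walsh coefficients of sampled Bernoulli functions\<close>

context walsh_base begin

lemma b_ne_0 [simp]: "b \<noteq> 0" using b2 by simp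

text \<open>
  The discrete Walsh transform over the \<open>b\<^sup>N\<close> grid points \<open>y\<close> of the function that sends \<open>y\<close> to \<open>per_bern n (x - y)\<close>.
  Since lattice points lie on this grid, a finite transform is enough, and no convergence of a Walsh
  series is ever at stake.
\<close>

definition F :: "nat \<Rightarrow> nat \<Rightarrow> nat \<Rightarrow> real \<Rightarrow> complex" where
  "F N n k x = (\<Sum>i<b ^ N. chi N k i * of_real (per_bern n (x - real i / real b ^ N))) / of_nat (b ^ N)"

lemma F_inversion:
  assumes "i < b ^ N"
  shows "(\<Sum>k<b ^ N. F N n k x * cnj (chi N k i)) = of_real (per_bern n (x - real i / real b ^ N))"
proof -
  let ?g = "\<lambda>i. complex_of_real (per_bern n (x - real i / real b ^ N))"
  have "(\<Sum>k<b ^ N. F N n k x * cnj (chi N k i))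
      = (\<Sum>k<b ^ N. \<Sum>j<b ^ N. ?g j * (chi N k j * cnj (chi N k i))) / of_nat (b ^ N)"
    unfolding F_def sum_divide_distrib sum_distrib_right
    by (intro sum.cong refl) (simp add: field_simps)
  also have "(\<Sum>k<b ^ N. \<Sum>j<b ^ N. ?g j * (chi N k j * cnj (chi N k i)))
      = (\<Sum>j<b ^ N. ?g j * (\<Sum>k<b ^ N. chi N k j * cnj (chi N k i)))"
    by (subst sum.swap) (simp only: sum_distrib_left)
  also have "\<dots> = (\<Sum>j<b ^ N. if j = i then ?g i * of_nat (b ^ N) else 0)"
    by (intro sum.cong refl) (simp add: chi_orthogonal assms)
  also have "\<dots> = ?g i * of_nat (b ^ N)" using assms by (simp add: sum.delta)
  finally show ?thesis by simp
qed

lemma F_has_integral: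
  assumes "n \<ge> 1" "x \<le> y"
  shows "(F N n k has_integral (F N (Suc n) k y - F N (Suc n) k x)) {x..y}"
proof -
  have i: "((\<lambda>x. chi N k i * of_real (per_bern n (x - real i / real b ^ N))) has_integral
     chi N k i * of_real (per_bern (Suc n) (y - real i / real b ^ N) - per_bern (Suc n) (x - real i / real b ^ N))) {x..y}" for i
    by (intro has_integral_mult_right has_integral_of_real per_bern_affine_has_integral assms)
  have "((\<lambda>x. \<Sum>i<b ^ N. chi N k i * of_real (per_bern n (x - real i / real b ^ N))) has_integral
     (\<Sum>i<b ^ N. chi N k i * of_real (per_bern (Suc n) (y - real i / real b ^ N) - per_bern (Suc n) (x - real i / real b ^ N)))) {x..y}"
    by (intro has_integral_sum i) auto
  from has_integral_divide[OF this, of "of_nat (b ^ N)"]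
  show ?thesis
    unfolding F_def[abs_def] of_real_diff right_diff_distrib sum_subtractf diff_divide_distrib .
qed

lemma F_plus_1: "F N n k (x + 1) = F N n k x"
proof -
  have "per_bern n (x + 1 - y) = per_bern n (x - y)" for y
    using per_bern_plus_of_int[of n "x - y" 1] by (simp add: algebra_simps)
  then show ?thesis by (simp only: F_def)
qed

lemma F_Suc:
  "F (Suc N) n k x = (\<Sum>d<b. w (k mod b * d) *
     ((\<Sum>i<b ^ N. chi N (k div b) i * of_real (per_bern n (x - (real d + real i / real b ^ N) / real b))) / of_nat (b ^ N))) / of_nat b"
proof -
  have e: "real (d * b ^ N + i) / real b ^ Suc N = (real d + real i / real b ^ N) / real b" for d i
  proof -
    have "real b > 0" by simp
    then show ?thesis by (simp add: divide_simps)
  qed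
  have "F (Suc N) n k x = (\<Sum>d<b. \<Sum>i<b ^ N. chi (Suc N) k (d * b ^ N + i) * of_real (per_bern n (x - (real d + real i / real b ^ N) / real b))) / of_nat (b ^ Suc N)"
    unfolding F_def sum_split_top e ..
  also have "(\<Sum>d<b. \<Sum>i<b ^ N. chi (Suc N) k (d * b ^ N + i) * of_real (per_bern n (x - (real d + real i / real b ^ N) / real b)))
     = (\<Sum>d<b. w (k mod b * d) *
     (\<Sum>i<b ^ N. chi N (k div b) i * complex_of_real (per_bern n (x - (real d + real i / real b ^ N) / real b))))"
    unfolding sum_distrib_left by (intro sum.cong refl) (simp add: chi_Suc)
  also have "\<dots> / of_nat (b ^ Suc N) = (\<Sum>d<b. w (k mod b * d) *
     ((\<Sum>i<b ^ N. chi N (k div b) i * complex_of_real (per_bern n (x - (real d + real i / real b ^ N) / real b))) / of_nat (b ^ N))) / of_nat b"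
  proof -
    have "(\<Sum>d<b. w (k mod b * d) * g d) / of_nat (b ^ Suc N) = (\<Sum>d<b. w (k mod b * d) * (g d / of_nat (b ^ N))) / of_nat b"
      for g :: "nat \<Rightarrow> complex"
      unfolding sum_divide_distrib by (intro sum.cong refl) simp
    then show ?thesis .
  qed
  finally show ?thesis .
qed

text \<open>
  A shift by \<open>1 / b\<close> permutes the leading digit of the grid points, hence multiplies by a character value.
  Therefore the size of a coefficient is decided on the single block \<open>[0, 1 / b]\<close>.
\<close>

lemma F_quasi_periodic: "F (Suc N) n k (x + 1 / real b) = w (k mod b) * F (Suc N) n k x"
proof -
  define T where "T = (\<lambda>x. (\<Sum>i<b ^ N. chi N (k div b) i * complex_of_real (per_bern n (x - (real i / real b ^ N) / real b))) / of_nat (b ^ N))"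
  have T1: "T (x + 1) = T x" for x
  proof -
    have "per_bern n (x + 1 - y) = per_bern n (x - y)" for y
      using per_bern_plus_of_int[of n "x - y" 1] by (simp add: algebra_simps)
    then show ?thesis by (simp only: T_def)
  qed
  have F: "F (Suc N) n k x = (\<Sum>d<b. w (k mod b * d) * T (x - real d / real b)) / of_nat b" for x
    unfolding F_Suc T_def by (simp add: add_divide_distrib algebra_simps)
  obtain c where c: "b = Suc c" using b_pos by (metis gr0_implies_Suc)
  have rb: "real b > 0" by simp
  have "(\<Sum>d<b. w (k mod b * d) * T (x + 1 / real b - real d / real b))
      = T (x + 1 / real b) + (\<Sum>d<c. w (k mod b * Suc d) * T (x - real d / real b))"
  proof -
    have e: "x + 1 / real b - real (Suc d) / real b = x - real d / real b" for d
      by (simp add: add_divide_distrib)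
    have "(\<Sum>d<b. w (k mod b * d) * T (x + 1 / real b - real d / real b)) 
      = (\<Sum>d<Suc c. w (k mod b * d) * T (x + 1 / real b - real d / real b))" using c by simp
    also have "\<dots> = T (x + 1 / real b) + (\<Sum>d<c. w (k mod b * Suc d) * T (x - real d / real b))"
      unfolding sum.lessThan_Suc_shift e by simp
    finally show ?thesis .
  qed
  also have "T (x + 1 / real b) = w (k mod b * Suc c) * T (x - real c / real b)"
  proof -
    have "w (k mod b * Suc c) = 1" using w_mult[of b "k mod b"] w_b c by (simp add: mult.commute)
    moreover have "x + 1 / real b = (x - real c / real b) + 1" using rb c by (simp add: field_simps)
    ultimately show ?thesis using T1 by (metis mult_1)
  qed
  also have "w (k mod b * Suc c) * T (x - real c / real b) + (\<Sum>d<c. w (k mod b * Suc d) * T (x - real d / real b))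
     = (\<Sum>d<b. w (k mod b * Suc d) * T (x - real d / real b))" by (subst (3) c) simp
  also have "\<dots> = w (k mod b) * (\<Sum>d<b. w (k mod b * d) * T (x - real d / real b))"
    by (simp add: sum_distrib_left w_add mult.assoc)
  finally show ?thesis unfolding F by simp
qed

lemma norm_F_shift: "norm (F (Suc N) n k (x + of_int j / real b)) = norm (F (Suc N) n k x)"
proof -
  have n: "norm (F (Suc N) n k (x + real j / real b)) = norm (F (Suc N) n k x)" for j x
  proof (induction j)
    case (Suc j)
    have "x + real (Suc j) / real b = (x + real j / real b) + 1 / real b" by (simp add: add_divide_distrib)
    then show ?case unfolding \<open>x + real (Suc j) / real b = _\<close> F_quasi_periodic norm_mult using Suc by simp
  qed simp
  show ?thesis
  proof (cases "j \<ge> 0")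
    case True then show ?thesis using n[of x "nat j"] by simp
  next
    case False then show ?thesis using n[of "x + of_int j / real b" "nat (-j)"] by simp
  qed
qed

lemma norm_F_reduce:
  obtains t where "0 \<le> t" "t \<le> 1" "norm (F (Suc N) n k x) = norm (F (Suc N) n k (t / real b))"
proof
  have rb: "real b > 0" by simp
  have "x = frac (real b * x) / real b + of_int \<lfloor>real b * x\<rfloor> / real b"
    unfolding frac_def using rb by (simp add: field_simps)
  then show "norm (F (Suc N) n k x) = norm (F (Suc N) n k (frac (real b * x) / real b))"
    using norm_F_shift by metis
qed (simp_all add: frac_lt_1 less_imp_le)

text \<open>
  If the lowest digit of \<open>k\<close> vanishes, the leading digit of the grid point is averaged out, and the
  multiplication theorem lowers \<open>N\<close> by one at the price of a factor \<open>b\<^sup>-\<^sup>n\<close>.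
\<close>

lemma F_scale:
  assumes "k mod b = 0" "n \<ge> 1"
  shows "F (Suc N) n k x = of_real ((1 / real b) ^ n) * F N n (k div b) (real b * x)"
proof -
  have rb: "real b > 0" by simp
  have m: "(\<Sum>d<b. per_bern n (x - (real d + y) / real b)) = real b * (1 / real b) ^ n * per_bern n (real b * x - y)" for y
  proof -
    have "(\<Sum>d<b. per_bern n (x - (real d + y) / real b)) = (\<Sum>d<b. per_bern n ((x - y / real b) - real d / real b))"
      by (simp add: add_divide_distrib algebra_simps)
    also have "\<dots> = real b * (1 / real b) ^ n * per_bern n (real b * (x - y / real b))"
      by (rule per_bern_multiplication) (use b2 assms in auto)
    also have "real b * (x - y / real b) = real b * x - y" using rb by (simp add: field_simps)
    finally show ?thesis .
  qed
  have "F (Suc N) n k x = (\<Sum>d<b. \<Sum>i<b ^ N. chi N (k div b) i * of_real (per_bern n (x - (real d + real i / real b ^ N) / real b))) / of_nat (b ^ N) / of_nat b"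
    unfolding F_Suc using assms by (simp add: sum_divide_distrib)
  also have "(\<Sum>d<b. \<Sum>i<b ^ N. chi N (k div b) i * complex_of_real (per_bern n (x - (real d + real i / real b ^ N) / real b)))
     = (\<Sum>i<b ^ N. chi N (k div b) i * of_real (\<Sum>d<b. per_bern n (x - (real d + real i / real b ^ N) / real b)))"
    by (subst sum.swap) (simp add: sum_distrib_left)
  also have "\<dots> = of_real (real b * (1 / real b) ^ n) * (\<Sum>i<b ^ N. chi N (k div b) i * of_real (per_bern n (real b * x - real i / real b ^ N)))"
    unfolding m sum_distrib_left by (intro sum.cong refl) simp
  finally show ?thesis unfolding F_def by simp
qed

lemma F_k0:
  assumes "n \<ge> 1"
  shows "F N n 0 x = of_real ((1 / real b) ^ (N * n) * per_bern n (real b ^ N * x))"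
proof (induction N arbitrary: x)
  case 0 show ?case by (simp add: F_def)
next
  case (Suc N)
  show ?case using F_scale[of 0 n N x] assms by (simp add: Suc power_add mult.assoc mult.commute)
qed

lemma F_1_block:
  assumes k: "k mod b \<noteq> 0" and t: "0 \<le> t" "t \<le> 1"
  shows "F (Suc N) 1 k (t / real b) = - (\<Sum>i<b ^ N. chi N (k div b) i *
     (of_bool (real i / real b ^ N < t) + 1 / (w (k mod b) - 1))) / of_nat (b ^ N) / of_nat b"
proof -
  let ?j = "k mod b"
  have j: "0 < ?j" "?j < b" using k by auto
  have rb: "real b > 0" by simp
  have inner: "(\<Sum>d<b. w (?j * d) * of_real (per_bern 1 (t / real b - (real d + y) / real b)))
     = - (of_bool (y < t) + 1 / (w ?j - 1))" if y: "0 \<le> y" "y < 1" for y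
  proof -
    have "(\<Sum>d<b. w (?j * d) * of_real (per_bern 1 (t / real b - (real d + y) / real b)))
      = (\<Sum>d<b. of_real (1/2 + (t - y) / real b) * w (?j * d) - (1 / of_nat b) * (w (?j * d) * of_nat d) - (if d = 0 then of_bool (y < t) else 0))"
    proof (rule sum.cong)
      fix d assume d: "d \<in> {..<b}"
      have "t / real b - (real d + y) / real b = (t - real d - y) / real b"
        by (simp add: diff_divide_distrib add_divide_distrib)
      then have "per_bern 1 (t / real b - (real d + y) / real b) = 1/2 + (t - y - real d) / real b - of_bool (d = 0 \<and> y < t)"
        using per_bern_1_sub_div[of t y d b] t y d by simp
      then have e: "complex_of_real (per_bern 1 (t / real b - (real d + y) / real b)) = of_real (1/2 + (t - y) / real b) - of_nat d / of_nat b - of_bool (d = 0 \<and> y < t)"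
        by (simp add: diff_divide_distrib)
      show "w (?j * d) * of_real (per_bern 1 (t / real b - (real d + y) / real b)) =
         of_real (1/2 + (t - y) / real b) * w (?j * d) - (1 / of_nat b) * (w (?j * d) * of_nat d) - (if d = 0 then of_bool (y < t) else 0)"
        unfolding e by (auto simp: algebra_simps)
    qed simp
    also have "\<dots> = of_real (1/2 + (t - y) / real b) * (\<Sum>d<b. w (?j * d)) - (1 / of_nat b) * (\<Sum>d<b. w (?j * d) * of_nat d) - of_bool (y < t)"
      by (simp add: sum_subtractf sum_distrib_left[symmetric] sum_divide_distrib[symmetric] sum.delta)
    also have "\<dots> = - (of_bool (y < t) + 1 / (w ?j - 1))"
      using sum_w_zero[OF j] sum_d_w[OF j] rb by (simp add: field_simps)
    finally show ?thesis .
  qed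
  have "F (Suc N) 1 k (t / real b) = (\<Sum>d<b. \<Sum>i<b ^ N. chi N (k div b) i * (w (?j * d) * of_real (per_bern 1 (t / real b - (real d + real i / real b ^ N) / real b)))) / of_nat (b ^ N) / of_nat b"
    unfolding F_Suc sum_divide_distrib sum_distrib_left by (intro sum.cong refl arg_cong2[where f="(/)"]) (simp add: algebra_simps)
  also have "(\<Sum>d<b. \<Sum>i<b ^ N. chi N (k div b) i * (w (?j * d) * of_real (per_bern 1 (t / real b - (real d + real i / real b ^ N) / real b))))
    = (\<Sum>i<b ^ N. chi N (k div b) i * (\<Sum>d<b. w (?j * d) * of_real (per_bern 1 (t / real b - (real d + real i / real b ^ N) / real b))))"
    by (subst sum.swap) (simp only: sum_distrib_left)
  also have "\<dots> = (\<Sum>i<b ^ N. chi N (k div b) i * (- (of_bool (real i / real b ^ N < t) + 1 / (w ?j - 1))))"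
  proof (intro sum.cong refl arg_cong2[where f="(*)"] inner)
    fix i assume "i \<in> {..<b ^ N}"
    then have "real i < real b ^ N" by (metis lessThan_iff of_nat_less_iff of_nat_power)
    then show "real i / real b ^ N < 1" by simp
  qed simp
  finally show ?thesis by (simp only: mult_minus_right sum_negf)
qed

lemma F_1_single:
  assumes k: "k mod b \<noteq> 0" "k div b = 0"
  shows "norm (F (Suc N) 1 k x) \<le> 1 / s0 / real b"
proof -
  obtain t where t: "0 \<le> t" "t \<le> 1" "norm (F (Suc N) 1 k x) = norm (F (Suc N) 1 k (t / real b))"
    by (rule norm_F_reduce)
  have j: "0 < k mod b" "k mod b < b" using k by auto
  have "norm (\<Sum>i<b ^ N. chi N 0 i * (of_bool (real i / real b ^ N < t) + 1 / (w (k mod b) - 1))) \<le> (\<Sum>i<b ^ N. 1 / s0)"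
  proof (rule sum_norm_le)
    fix i
    have "norm (1 / (w (k mod b) - 1) + of_real r) \<le> 1 / s0" if "r = 0 \<or> r = 1" for r
      by (rule norm_inverse_w_plus[OF j]) (use that in auto)
    from this[of 0] this[of 1] show "norm (chi N 0 i * (of_bool (real i / real b ^ N < t) + 1 / (w (k mod b) - 1))) \<le> 1 / s0"
      by (simp add: add.commute norm_mult)
  qed
  then have "norm (\<Sum>i<b ^ N. chi N 0 i * (of_bool (real i / real b ^ N < t) + 1 / (w (k mod b) - 1))) / real (b ^ N) \<le> 1 / s0"
    by (subst pos_divide_le_eq) (auto simp: mult.commute)
  then have "norm (\<Sum>i<b ^ N. chi N 0 i * (of_bool (real i / real b ^ N < t) + 1 / (w (k mod b) - 1))) / real (b ^ N) / real b \<le> 1 / s0 / real b"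
    by (rule divide_right_mono) simp
  then show ?thesis unfolding t(3) F_1_block[OF k(1) t(1,2)] k(2)
    by (simp only: norm_divide norm_minus_cancel norm_of_nat)
qed

text \<open>
  Within a block the sawtooth coefficient is a scaled increment of the coefficient with one digit of \<open>k\<close>
  removed. This is the start of the recursion over digits.
\<close>

lemma F_block_1:
  assumes k: "k mod b \<noteq> 0" "0 < k div b" "k div b < b ^ N" and t: "0 \<le> t" "t \<le> 1"
  shows "F (Suc N) 1 k (t / real b) = of_real (1 / real b) * (F N 1 (k div b) t - F N 1 (k div b) 0)"
proof -
  let ?c = "chi N (k div b)"
  have z: "(\<Sum>i<b ^ N. ?c i) = 0" by (rule sum_chi_zero[OF k(2,3)])
  have lt: "real i / real b ^ N < 1" if "i < b ^ N" for i
    using that by (metis divide_less_eq_1_pos of_nat_less_iff of_nat_power of_nat_0_less_iff b_pos zero_less_power)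
  have "F N 1 (k div b) t - F N 1 (k div b) 0 = (\<Sum>i<b ^ N. ?c i * of_real t - ?c i * of_bool (real i / real b ^ N < t)) / of_nat (b ^ N)"
    unfolding F_def diff_divide_distrib[symmetric] sum_subtractf[symmetric]
  proof (intro arg_cong2[where f="(/)"] sum.cong refl)
    fix i assume "i \<in> {..<b ^ N}"
    then have i: "i < b ^ N" by simp
    have "per_bern 1 (t - real i / real b ^ N) = 1/2 + t - real i / real b ^ N - of_bool (real i / real b ^ N < t)"
      by (rule per_bern_1_sub) (use t lt[OF i] in auto)
    moreover have "per_bern 1 (0 - real i / real b ^ N) = 1/2 + 0 - real i / real b ^ N - of_bool (real i / real b ^ N < 0)"
      by (rule per_bern_1_sub) (use lt[OF i] in auto)
    moreover have "\<not> real i / real b ^ N < 0" by (simp add: not_less)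
    ultimately show "?c i * complex_of_real (per_bern 1 (t - real i / real b ^ N)) - ?c i * complex_of_real (per_bern 1 (0 - real i / real b ^ N))
      = ?c i * of_real t - ?c i * of_bool (real i / real b ^ N < t)"
      by (simp only: right_diff_distrib[symmetric] of_real_diff[symmetric]) (auto simp: algebra_simps)
  qed
  also have "(\<Sum>i<b ^ N. ?c i * of_real t - ?c i * of_bool (real i / real b ^ N < t)) = - (\<Sum>i<b ^ N. ?c i * of_bool (real i / real b ^ N < t))"
    using z by (simp add: sum_subtractf sum_distrib_right[symmetric])
  moreover have "(\<Sum>i<b ^ N. ?c i * (of_bool (real i / real b ^ N < t) + 1 / (w (k mod b) - 1))) = (\<Sum>i<b ^ N. ?c i * of_bool (real i / real b ^ N < t))"
    using z by (simp only: distrib_left sum.distrib sum_distrib_right[symmetric]) simp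
  ultimately show ?thesis unfolding F_1_block[OF k(1) t] by simp
qed

lemma has_integral_norm_le:
  fixes f :: "real \<Rightarrow> complex"
  assumes "(f has_integral I) {x..y}" "\<And>z. norm (f z) \<le> B" "x \<le> y"
  shows "norm I \<le> B * (y - x)"
proof -
  have "0 \<le> B" using assms(2)[of x] norm_ge_zero order.trans by blast
  then have "norm I \<le> B * measure lborel {x..y}"
    by (rule has_integral_bound_real[where S = "{}", OF _ _ assms(1)]) (use assms in auto)
  then show ?thesis using assms(3) by simp
qed

text \<open>
  Quasi-periodicity turns the difference over a block into a multiple of the value itself, so a bound for
  order \<open>n\<close> can be integrated to one for order \<open>n + 1\<close> without a constant of integration.
\<close>

lemma F_integral_step:
  assumes j: "k mod b \<noteq> 0" and n: "n \<ge> 1"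
  shows "(w (k mod b) - 1) * F (Suc N) (Suc n) k x = F (Suc N) (Suc n) k (x + 1 / real b) - F (Suc N) (Suc n) k x"
  unfolding F_quasi_periodic by (simp add: algebra_simps)

lemma norm_F_Suc_le:
  assumes j: "k mod b \<noteq> 0" and n: "n \<ge> 1" and B: "\<And>x. norm (F (Suc N) n k x) \<le> B"
  shows "norm (F (Suc N) (Suc n) k x) \<le> B / 4"
proof -
  have jj: "0 < k mod b" "k mod b < b" using j by auto
  have B0: "0 \<le> B" using B norm_ge_zero order.trans by blast
  have rb: "real b > 0" by simp
  have "norm (F (Suc N) (Suc n) k (x + 1 / real b) - F (Suc N) (Suc n) k x) \<le> B * (x + 1 / real b - x)"
    by (rule has_integral_norm_le[OF F_has_integral[OF n] B]) (use rb in auto)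
  then have 1: "norm (w (k mod b) - 1) * norm (F (Suc N) (Suc n) k x) \<le> B / real b"
    using F_integral_step[OF j n] by (metis norm_mult add_diff_cancel_left' times_divide_eq_right mult.right_neutral)
  have "s0 * norm (F (Suc N) (Suc n) k x) \<le> norm (w (k mod b) - 1) * norm (F (Suc N) (Suc n) k x)"
    using norm_w_minus_1[OF jj] by (intro mult_right_mono) (auto simp: s0_def)
  then have "s0 * norm (F (Suc N) (Suc n) k x) \<le> B / real b" using 1 by linarith
  then have "(s0 * real b) * norm (F (Suc N) (Suc n) k x) \<le> B" using rb by (simp add: field_simps)
  moreover have "4 * norm (F (Suc N) (Suc n) k x) \<le> (s0 * real b) * norm (F (Suc N) (Suc n) k x)"
    using s0_b by (intro mult_right_mono) auto
  ultimately show ?thesis by linarith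
qed

lemma F_block_Suc:
  assumes n: "n \<ge> 1" and t: "0 \<le> t" "t \<le> 1"
    and B: "\<And>t. 0 \<le> t \<Longrightarrow> t \<le> 1 \<Longrightarrow>
       F (Suc N) n k (t / real b) = of_real ((1 / real b) ^ n) * (F N n k' t - F N n k' 0)"
  shows "F (Suc N) (Suc n) k (t / real b) - F (Suc N) (Suc n) k 0 =
    of_real ((1 / real b) ^ Suc n) * (F N (Suc n) k' t - F N (Suc n) k' 0 - of_real t * F N n k' 0)"
proof -
  have rb: "real b > 0" by simp
  have i1: "(F (Suc N) n k has_integral (F (Suc N) (Suc n) k (t / real b) - F (Suc N) (Suc n) k 0)) (cbox 0 (t / real b))"
    using F_has_integral[OF n, of 0 "t / real b"] t rb by (simp add: cbox_interval)
  have img: "(\<lambda>x. x * real b) ` {0..t / real b} = {0..t}"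
    using image_mult_atLeastAtMost_if'[of "real b" 0 "t / real b"] rb t by (simp add: mult.commute)
  have "((\<lambda>x. F (Suc N) n k ((1 / real b) *\<^sub>R x + 0)) has_integral (1 / \<bar>1 / real b\<bar> ^ DIM(real)) *\<^sub>R (F (Suc N) (Suc n) k (t / real b) - F (Suc N) (Suc n) k 0))
     ((\<lambda>x. (1 / (1 / real b)) *\<^sub>R x + - ((1 / (1 / real b)) *\<^sub>R 0)) ` cbox 0 (t / real b))"
    by (rule has_integral_affinity[OF i1]) (use rb in simp)
  then have "((\<lambda>x. F (Suc N) n k (x / real b)) has_integral of_nat b * (F (Suc N) (Suc n) k (t / real b) - F (Suc N) (Suc n) k 0)) {0..t}"
    using rb img by (simp add: scaleR_conv_of_real mult.commute)
  then have i2: "((\<lambda>x. of_real ((1 / real b) ^ n) * (F N n k' x - F N n k' 0)) has_integral of_nat b * (F (Suc N) (Suc n) k (t / real b) - F (Suc N) (Suc n) k 0)) {0..t}"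
    by (rule has_integral_eq[rotated]) (use B t in auto)
  have "((\<lambda>x. of_real ((1 / real b) ^ n) * (F N n k' x - F N n k' 0)) has_integral
      of_real ((1 / real b) ^ n) * ((F N (Suc n) k' t - F N (Suc n) k' 0) - of_real t * F N n k' 0)) {0..t}"
    using has_integral_const_real[of "F N n k' 0" 0 t] t
    by (intro has_integral_mult_right has_integral_diff F_has_integral n) (auto simp: scaleR_conv_of_real)
  from has_integral_unique[OF i2 this]
  have "of_nat b * (F (Suc N) (Suc n) k (t / real b) - F (Suc N) (Suc n) k 0) = 
    of_real ((1 / real b) ^ n) * ((F N (Suc n) k' t - F N (Suc n) k' 0) - of_real t * F N n k' 0)" .
  then have "of_real (1 / real b) * (of_nat b * (F (Suc N) (Suc n) k (t / real b) - F (Suc N) (Suc n) k 0)) = 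
    of_real (1 / real b) * (of_real ((1 / real b) ^ n) * ((F N (Suc n) k' t - F N (Suc n) k' 0) - of_real t * F N n k' 0))"
    by (rule arg_cong)
  then show ?thesis using rb by (simp add: mult.assoc del: b_pos)
qed

lemma F_at_0:
  assumes n: "n \<ge> 1" and j: "k mod b \<noteq> 0"
    and B: "\<And>t. 0 \<le> t \<Longrightarrow> t \<le> 1 \<Longrightarrow>
       F (Suc N) n k (t / real b) = of_real ((1 / real b) ^ n) * (F N n k' t - F N n k' 0)"
  shows "(w (k mod b) - 1) * F (Suc N) (Suc n) k 0 = - of_real ((1 / real b) ^ Suc n) * F N n k' 0"
  using F_block_Suc[OF n _ _ B, of 1] F_integral_step[OF j n, of N 0] F_plus_1[of N "Suc n" k' 0]
  by simp

end


section \<open>Decay of the Walsh coefficients\<close>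

context walsh_base begin

primrec nzd :: "nat \<Rightarrow> nat \<Rightarrow> nat" where
  "nzd 0 k = 0"
| "nzd (Suc N) k = (if k mod b = 0 then 0 else 1) + nzd N (k div b)"

text \<open>
  If \<open>k\<close> has its nonzero digits at the places \<open>p\<^sub>1 > p\<^sub>2 > \<dots>\<close>, counted from \<open>1\<close>, then \<open>mu a N k\<close> is the sum of the
  first \<open>a\<close> of these places. In the recursion a place \<open>p\<close> arises as \<open>p\<close> summands \<open>1\<close>, one for each \<open>k div b\<^sup>i\<close> with
  \<open>i < p\<close>. This is the weight of higher order digital nets.
\<close>

primrec mu :: "nat \<Rightarrow> nat \<Rightarrow> nat \<Rightarrow> nat" where
  "mu a 0 k = 0"
| "mu a (Suc N) k = mu a N (k div b) + min a (nzd (Suc N) k)"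

text \<open>
  The constants that accumulate when the recursion over digits is applied repeatedly.
\<close>

primrec zz :: "nat \<Rightarrow> real" where
  "zz 0 = 0"
| "zz (Suc v) = 1 + s0 / 2 * zz v"

lemma zz_nonneg: "zz v \<ge> 0"
  by (induction v) (use s0_pos in auto)

lemma nzd_k0 [simp]: "nzd N 0 = 0"
  by (induction N) auto

lemma nzd_pos: "0 < k \<Longrightarrow> k < b ^ N \<Longrightarrow> nzd N k > 0"
proof (induction N arbitrary: k)
  case (Suc N)
  have "k div b < b ^ N" using Suc.prems by (simp add: less_mult_imp_div_less mult.commute)
  then show ?case using Suc digits_ne_0[OF Suc.prems(1)] by auto
qed simp

lemma mu_cong: "nzd N k \<le> a \<Longrightarrow> nzd N k \<le> a' \<Longrightarrow> mu a N k = mu a' N k"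
proof (induction N arbitrary: k)
  case (Suc N)
  then have "mu a N (k div b) = mu a' N (k div b)" by (intro Suc.IH) (auto split: if_splits)
  moreover have "min a (nzd (Suc N) k) = nzd (Suc N) k" "min a' (nzd (Suc N) k) = nzd (Suc N) k"
    using Suc.prems by auto
  ultimately show ?case by (simp only: mu.simps)
qed simp

text \<open>
  Induction over the digits of \<open>k\<close>. A nonzero digit raises the order by one through integration over a block, a
  zero digit only rescales. Below the number \<open>v\<close> of nonzero digits the values at \<open>0\<close> vanish, and at order
  \<open>v\<close> the exact value at \<open>0\<close> is better than the uniform bound. This is why the sum over all orders costs
  just a constant.
\<close>

lemma walsh_decay:
  assumes "0 < k" "k < b ^ N"
  defines "v \<equiv> nzd N k"
  shows "(\<forall>n. 1 \<le> n \<and> n < v \<longrightarrow> F N n k 0 = 0)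
     \<and> norm (F N v k 0) \<le> (1 / s0) ^ v * (1 / real b) ^ mu v N k
     \<and> (\<forall>n x. v \<le> n \<longrightarrow> norm (F N n k x) \<le> zz v * (1 / s0) ^ v * (1 / real b) ^ mu v N k * (1 / 4) ^ (n - v))
     \<and> (\<forall>n x. 1 \<le> n \<and> n < v \<longrightarrow> norm (F N n k x) \<le> (1 + zz n) * (1 / s0) ^ n * (1 / real b) ^ mu n N k)"
  using assms(1,2) unfolding v_def
proof (induction N arbitrary: k)
  case 0 then show ?case by simp
next
  case (Suc N)
  define k' where "k' = k div b"
  define v' where "v' = nzd N k'"
  have lt: "k' < b ^ N" using Suc.prems by (simp add: k'_def less_mult_imp_div_less mult.commute)
  have rb: "real b > 0" and sp: "s0 > 0" using s0_pos by auto
  show ?case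
  proof (cases "k' = 0")
    case True
    then have j: "k mod b \<noteq> 0" using digits_ne_0[OF Suc.prems(1)] by (simp add: k'_def)
    have v: "nzd (Suc N) k = 1" using True j by (simp add: k'_def)
    have m: "mu 1 (Suc N) k = 1"
    proof -
      have "mu 1 N 0 = 0" by (induction N) auto
      then show ?thesis using True j by (simp add: k'_def)
    qed
    have b1: "norm (F (Suc N) 1 k x) \<le> 1 / s0 / real b" for x
      by (rule F_1_single) (use j True in \<open>auto simp: k'_def\<close>)
    have "norm (F (Suc N) n k x) \<le> zz 1 * (1 / s0) ^ 1 * (1 / real b) ^ 1 * (1 / 4) ^ (n - 1)" if "1 \<le> n" for n x
      using that
    proof (induction n arbitrary: x rule: nat_induct_at_least)
      case base then show ?case using b1 by simp
    next
      case (Suc n)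
      have "norm (F (Suc N) (Suc n) k x) \<le> (zz 1 * (1 / s0) ^ 1 * (1 / real b) ^ 1 * (1 / 4) ^ (n - 1)) / 4"
        by (rule norm_F_Suc_le[OF j Suc.hyps Suc.IH])
      also have "\<dots> = zz 1 * (1 / s0) ^ 1 * (1 / real b) ^ 1 * (1 / 4) ^ (Suc n - 1)"
        using Suc.hyps by (cases n) auto
      finally show ?case .
    qed
    then show ?thesis unfolding v m using b1 by simp
  next
    case False
    then have k'0: "0 < k'" by simp
    note IH = Suc.IH[OF k'0 lt, folded v'_def]
    have v'1: "v' \<ge> 1" using nzd_pos[OF k'0 lt] by (simp add: v'_def)
    show ?thesis
    proof (cases "k mod b = 0")
      case True
      have v: "nzd (Suc N) k = v'" using True by (simp add: v'_def k'_def)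
      have F: "F (Suc N) n k x = of_real ((1 / real b) ^ n) * F N n k' (real b * x)" if "n \<ge> 1" for n x
        unfolding k'_def by (rule F_scale[OF True that])
      have nF: "norm (F (Suc N) n k x) = (1 / real b) ^ n * norm (F N n k' (real b * x))" if "n \<ge> 1" for n x
        unfolding F[OF that] norm_mult norm_of_real using rb by simp
      have m: "mu n (Suc N) k = mu n N k' + min n v'" for n
        using v by (simp only: mu.simps k'_def)
      have "norm (F (Suc N) v' k 0) \<le> (1 / s0) ^ v' * (1 / real b) ^ mu v' (Suc N) k"
      proof -
        have "norm (F (Suc N) v' k 0) = (1 / real b) ^ v' * norm (F N v' k' 0)" using nF[OF v'1, of 0] by simp
        also have "\<dots> \<le> (1 / real b) ^ v' * ((1 / s0) ^ v' * (1 / real b) ^ mu v' N k')"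
          using IH by (intro mult_left_mono) auto
        finally show ?thesis by (simp add: m power_add mult_ac del: mu.simps nzd.simps)
      qed
      moreover have "norm (F (Suc N) n k x) \<le> zz v' * (1 / s0) ^ v' * (1 / real b) ^ mu v' (Suc N) k * (1 / 4) ^ (n - v')"
        if n: "v' \<le> n" for n x
      proof -
        have "norm (F (Suc N) n k x) = (1 / real b) ^ n * norm (F N n k' (real b * x))" using nF v'1 n by simp
        also have "\<dots> \<le> (1 / real b) ^ v' * (zz v' * (1 / s0) ^ v' * (1 / real b) ^ mu v' N k' * (1 / 4) ^ (n - v'))"
        proof (intro mult_mono)
          show "(1 / real b) ^ n \<le> (1 / real b) ^ v'"
            using n rb2 by (intro power_decreasing) auto
          show "norm (F N n k' (real b * x)) \<le> zz v' * (1 / s0) ^ v' * (1 / real b) ^ mu v' N k' * (1 / 4) ^ (n - v')"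
            using IH n by blast
        qed auto
        finally show ?thesis by (simp add: m power_add mult_ac del: mu.simps nzd.simps)
      qed
      moreover have "norm (F (Suc N) n k x) \<le> (1 + zz n) * (1 / s0) ^ n * (1 / real b) ^ mu n (Suc N) k"
        if n: "1 \<le> n" "n < v'" for n x
      proof -
        have "norm (F (Suc N) n k x) = (1 / real b) ^ n * norm (F N n k' (real b * x))" using nF n by simp
        also have "\<dots> \<le> (1 / real b) ^ n * ((1 + zz n) * (1 / s0) ^ n * (1 / real b) ^ mu n N k')"
          using IH n by (intro mult_left_mono) auto
        finally show ?thesis using n by (simp add: m power_add mult_ac min_def del: mu.simps nzd.simps)
      qed
      moreover have "F (Suc N) n k 0 = 0" if "1 \<le> n \<and> n < v'" for n
        using IH that F by simp
      ultimately show ?thesis unfolding v by blast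
    next
      case j: False
      then have jj: "0 < k mod b" "k mod b < b" by auto
      have v: "nzd (Suc N) k = Suc v'" using j by (simp add: v'_def k'_def)
      have m: "mu n (Suc N) k = mu n N k' + min n (Suc v')" for n
        using v by (simp only: mu.simps k'_def)
      have sn: "s0 \<le> norm (w (k mod b) - 1)" using norm_w_minus_1[OF jj] by (simp add: s0_def)
      have wne: "w (k mod b) - 1 \<noteq> 0" using w_ne_1[OF jj] by simp
      have block: "\<forall>t. 0 \<le> t \<longrightarrow> t \<le> 1 \<longrightarrow> F (Suc N) n k (t / real b) = of_real ((1 / real b) ^ n) * (F N n k' t - F N n k' 0)"
        if "1 \<le> n" "n \<le> v'" for n
        using that
      proof (induction n rule: nat_induct_at_least)
        case base
        then show ?case using F_block_1[OF j, of N] k'0 lt by (simp add: k'_def)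
      next
        case (Suc n)
        have z: "F N n k' 0 = 0" using IH Suc by simp
        have B: "F (Suc N) n k (t / real b) = of_real ((1 / real b) ^ n) * (F N n k' t - F N n k' 0)" if "0 \<le> t" "t \<le> 1" for t
          using Suc that by simp
        have "(w (k mod b) - 1) * F (Suc N) (Suc n) k 0 = 0"
          using F_at_0[OF Suc.hyps j B] z by simp
        then have "F (Suc N) (Suc n) k 0 = 0" using wne by simp
        then show ?case using F_block_Suc[OF Suc.hyps _ _ B] z by simp
      qed
      have zero: "F (Suc N) n k 0 = 0" if "1 \<le> n \<and> n < Suc v'" for n
        using block[of n] that by (metis less_Suc_eq_le div_0 diff_self mult_zero_right order.refl zero_le_one)
      have iv: "norm (F (Suc N) n k x) \<le> (1 + zz n) * (1 / s0) ^ n * (1 / real b) ^ mu n (Suc N) k"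
        if n: "1 \<le> n" "n \<le> v'" for n x
      proof -
        obtain t where t: "0 \<le> t" "t \<le> 1" "norm (F (Suc N) n k x) = norm (F (Suc N) n k (t / real b))"
          by (rule norm_F_reduce)
        have "norm (F N n k' t - F N n k' 0) \<le> (1 + zz n) * (1 / s0) ^ n * (1 / real b) ^ mu n N k'"
        proof (cases "n < v'")
          case True then show ?thesis using IH n by simp
        next
          case False
          then have e: "n = v'" using n by simp
          have "norm (F N n k' t - F N n k' 0) \<le> norm (F N n k' t) + norm (F N n k' 0)" by (rule norm_triangle_ineq4)
          also have "\<dots> \<le> zz n * (1 / s0) ^ n * (1 / real b) ^ mu n N k' * (1/4)^(n - n) + (1 / s0) ^ n * (1 / real b) ^ mu n N k'"
            using IH unfolding e by (intro add_mono) auto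
          finally show ?thesis by (simp add: algebra_simps)
        qed
        then have "(1 / real b) ^ n * norm (F N n k' t - F N n k' 0) \<le> (1 / real b) ^ n * ((1 + zz n) * (1 / s0) ^ n * (1 / real b) ^ mu n N k')"
          by (rule mult_left_mono) simp
        moreover have "norm (F (Suc N) n k x) = (1 / real b) ^ n * norm (F N n k' t - F N n k' 0)"
          using t block[OF n] rb by (simp only: norm_mult norm_of_real) simp
        ultimately show ?thesis using n by (simp add: m power_add mult_ac del: mu.simps nzd.simps)
      qed
      have B: "F (Suc N) v' k (t / real b) = of_real ((1 / real b) ^ v') * (F N v' k' t - F N v' k' 0)" if "0 \<le> t" "t \<le> 1" for t
        using block[OF v'1 order.refl] that by simp
      define A where "A = (1 / real b) ^ Suc v' * ((1 / s0) ^ v' * (1 / real b) ^ mu v' N k')"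
      have A: "A = (1 / s0) ^ v' * (1 / real b) ^ mu (Suc v') (Suc N) k"
      proof -
        have "mu (Suc v') N k' = mu v' N k'" by (rule mu_cong) (auto simp: v'_def)
        then show ?thesis by (simp add: A_def m power_add mult_ac del: mu.simps nzd.simps)
      qed
      have A0: "A \<ge> 0" using s0_pos by (simp add: A_def)
      have nF0: "norm (of_real ((1 / real b) ^ Suc v') * F N v' k' 0) \<le> A"
      proof -
        have "norm (of_real ((1 / real b) ^ Suc v') * F N v' k' 0) = (1 / real b) ^ Suc v' * norm (F N v' k' 0)"
          unfolding norm_mult norm_of_real using rb by simp
        also have "\<dots> \<le> A" unfolding A_def using IH by (intro mult_left_mono) auto
        finally show ?thesis .
      qed
      have F0: "F (Suc N) (Suc v') k 0 = - (of_real ((1 / real b) ^ Suc v') * F N v' k' 0) / (w (k mod b) - 1)"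
        using F_at_0[OF v'1 j B] wne by (simp add: field_simps)
      have ii: "norm (F (Suc N) (Suc v') k 0) \<le> (1 / s0) * A"
      proof -
        have "norm (F (Suc N) (Suc v') k 0) = norm (of_real ((1 / real b) ^ Suc v') * F N v' k' 0) / norm (w (k mod b) - 1)"
          unfolding F0 norm_divide norm_minus_cancel ..
        also have "\<dots> \<le> A / s0" using nF0 sn sp A0 by (intro frac_le) auto
        finally show ?thesis by simp
      qed
      have iii0: "norm (F (Suc N) (Suc v') k x) \<le> zz (Suc v') * ((1 / s0) * A)" for x
      proof -
        obtain t where t: "0 \<le> t" "t \<le> 1" "norm (F (Suc N) (Suc v') k x) = norm (F (Suc N) (Suc v') k (t / real b))"
          by (rule norm_F_reduce)
        let ?c = "of_real ((1 / real b) ^ Suc v') :: complex"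
        let ?I = "1 / (w (k mod b) - 1)"
        have "F (Suc N) (Suc v') k (t / real b) = F (Suc N) (Suc v') k 0 + ?c * (F N (Suc v') k' t - F N (Suc v') k' 0 - of_real t * F N v' k' 0)"
          using F_block_Suc[OF v'1 t(1,2) B] by (simp add: algebra_simps)
        also have "\<dots> = - ((?c * F N v' k' 0) * (?I + of_real t)) + ?c * (F N (Suc v') k' t - F N (Suc v') k' 0)"
        proof -
          have "- (c * y) / W + c * (p - q - u * y) = - ((c * y) * (1 / W + u)) + c * (p - q)" for c y W p q u :: complex
            by (simp add: algebra_simps)
          then show ?thesis unfolding F0 .
        qed
        finally have e: "F (Suc N) (Suc v') k (t / real b) = - ((?c * F N v' k' 0) * (?I + of_real t)) + ?c * (F N (Suc v') k' t - F N (Suc v') k' 0)" .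
        have "norm (F (Suc N) (Suc v') k x) \<le> norm ((?c * F N v' k' 0) * (?I + of_real t)) + norm (?c * (F N (Suc v') k' t - F N (Suc v') k' 0))"
          unfolding t(3) e by (rule order.trans[OF norm_triangle_ineq]) simp
        also have "\<dots> \<le> A * (1 / s0) + A * (zz v' / 2)"
        proof (rule add_mono)
          show "norm ((?c * F N v' k' 0) * (?I + of_real t)) \<le> A * (1 / s0)"
            unfolding norm_mult[of "?c * F N v' k' 0"] using nF0 norm_inverse_w_plus[OF jj t(1,2)] A0 by (intro mult_mono) auto
          have b4: "norm (F N (Suc v') k' y) \<le> zz v' * (1 / s0) ^ v' * (1 / real b) ^ mu v' N k' * (1/4) ^ (Suc v' - v')" for y
            using IH by (meson le_SucI order.refl)
          have "norm (F N (Suc v') k' t - F N (Suc v') k' 0) \<le> norm (F N (Suc v') k' t) + norm (F N (Suc v') k' 0)"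
            by (rule norm_triangle_ineq4)
          also have "\<dots> \<le> (zz v' / 2) * ((1 / s0) ^ v' * (1 / real b) ^ mu v' N k')"
            using b4[of t] b4[of 0] by (simp del: mu.simps nzd.simps)
          finally have "norm (F N (Suc v') k' t - F N (Suc v') k' 0) \<le> (zz v' / 2) * ((1 / s0) ^ v' * (1 / real b) ^ mu v' N k')" .
          then have "(1 / real b) ^ Suc v' * norm (F N (Suc v') k' t - F N (Suc v') k' 0) \<le> (1 / real b) ^ Suc v' * ((zz v' / 2) * ((1 / s0) ^ v' * (1 / real b) ^ mu v' N k'))"
            by (rule mult_left_mono) simp
          also have "\<dots> = A * (zz v' / 2)" by (simp only: A_def mult_ac)
          finally show "norm (?c * (F N (Suc v') k' t - F N (Suc v') k' 0)) \<le> A * (zz v' / 2)"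
            unfolding norm_mult norm_of_real using rb by simp
        qed
        also have "\<dots> = zz (Suc v') * ((1 / s0) * A)" using sp by (simp add: field_simps)
        finally show ?thesis .
      qed
      have A2: "(1 / s0) * A = (1 / s0) ^ Suc v' * (1 / real b) ^ mu (Suc v') (Suc N) k"
        unfolding A by simp
      have iii: "norm (F (Suc N) n k x) \<le> zz (Suc v') * ((1 / s0) * A) * (1 / 4) ^ (n - Suc v')" if "Suc v' \<le> n" for n x
        using that
      proof (induction n arbitrary: x rule: nat_induct_at_least)
        case base then show ?case using iii0 by simp
      next
        case (Suc n)
        have "norm (F (Suc N) (Suc n) k x) \<le> (zz (Suc v') * ((1 / s0) * A) * (1 / 4) ^ (n - Suc v')) / 4"
          by (rule norm_F_Suc_le[OF j _ Suc.IH]) (use Suc.hyps in simp)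
        also have "\<dots> = zz (Suc v') * ((1 / s0) * A) * (1 / 4) ^ (Suc n - Suc v')"
        proof -
          have "Suc n - Suc v' = Suc (n - Suc v')" using Suc.hyps by simp
          then show ?thesis by (simp only: power_Suc)
        qed
        finally show ?case .
      qed
      show ?thesis unfolding v
      proof (intro conjI allI impI)
        fix n x assume n: "Suc v' \<le> n"
        show "norm (F (Suc N) n k x) \<le> zz (Suc v') * (1 / s0) ^ Suc v' * (1 / real b) ^ mu (Suc v') (Suc N) k * (1 / 4) ^ (n - Suc v')"
          using iii[OF n, of x] unfolding A2 by (simp only: mult.assoc)
      qed (use zero ii A2 iv in \<open>auto simp del: mu.simps nzd.simps\<close>)
    qed
  qed
qed

end


section \<open>Bounds by the constants of the error estimate\<close>

context walsh_base begin

text \<open>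
  For \<open>b \<ge> 5\<close> the ratio \<open>s0 / 2\<close> is below \<open>0.63\<close>, and the recursion for \<open>zz\<close> stays bounded. For the smaller \<open>b\<close> it grows at most
  linearly, while the base of the power is at least \<open>1.3\<close>.
\<close>

lemma zz_plus_1_le:
  assumes "v \<ge> 1"
  shows "1 + zz v \<le> 5 * (1 + 1 / real b + 1 / (real b * (real b + 1))) ^ (v - 1)"
    and "v \<ge> 2 \<Longrightarrow> 1 + zz v \<le> 10 * (1 + 1 / real b + 1 / (real b * (real b + 1))) ^ (v - 2)"
proof -
  define \<beta> where "\<beta> = 1 + 1 / real b + 1 / (real b * (real b + 1))"
  have b1: "\<beta> \<ge> 1" by (simp add: \<beta>_def)
  have "1 + zz v \<le> 5 * \<beta> ^ (v - 1) \<and> (v \<ge> 2 \<longrightarrow> 1 + zz v \<le> 10 * \<beta> ^ (v - 2))"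
  proof (cases "b \<ge> 5")
    case True
    have "pi < 3.15" using pi_approx by simp
    moreover have "pi / real b \<le> pi / 5" using True pi_gt_zero by (intro divide_left_mono) auto
    moreover have "sin (pi / real b) \<le> pi / real b" by (rule sin_x_le_x) simp
    ultimately have s: "s0 / 2 \<le> 0.63" by (simp add: s0_def)
    have z3: "zz v \<le> 3" for v
    proof (induction v)
      case (Suc v)
      have "s0 / 2 * zz v \<le> 0.63 * 3" using s Suc zz_nonneg s0_pos by (intro mult_mono) auto
      then show ?case by simp
    qed simp
    have p: "1 \<le> \<beta> ^ n" for n using b1 by (rule one_le_power)
    show ?thesis using z3[of v] p[of "v - 1"] p[of "v - 2"] by (intro conjI impI) linarith+
  next
    case False
    have z: "zz v \<le> real v" for v
    proof (induction v)
      case (Suc v)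
      have "s0 / 2 * zz v \<le> 1 * real v" using s0_le_2 s0_pos Suc zz_nonneg by (intro mult_mono) auto
      then show ?case by simp
    qed simp
    have "real b \<le> 4" using False by simp
    then have q1: "1 / real b \<ge> 1 / 4" by (intro divide_left_mono) auto
    have "real b * (real b + 1) \<le> 4 * (4 + 1)" using \<open>real b \<le> 4\<close> by (intro mult_mono) auto
    then have q2: "1 / (real b * (real b + 1)) \<ge> 1 / (4 * (4 + 1))" by (intro divide_left_mono) auto
    have "\<beta> \<ge> 1 + 1 / 4 + 1 / (4 * (4 + 1))" unfolding \<beta>_def using q1 q2 by (intro add_mono) auto
    then have be: "\<beta> \<ge> 1.3" by simp
    have g: "1 + real (v + m) \<le> c * \<beta> ^ m" if "1 + real v \<le> c" "c \<ge> 5" for v m c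
    proof (induction m)
      case 0 then show ?case using that by simp
    next
      case (Suc m)
      have "5 * 1 \<le> c * \<beta> ^ m" using that b1 by (intro mult_mono one_le_power) auto
      then have "c * \<beta> ^ m + 1 \<le> 1.3 * (c * \<beta> ^ m)" by linarith
      also have "\<dots> \<le> \<beta> * (c * \<beta> ^ m)" using be \<open>5 * 1 \<le> c * \<beta> ^ m\<close> by (intro mult_right_mono) auto
      also have "\<dots> = c * \<beta> ^ Suc m" by (simp add: mult_ac)
      finally show ?case using Suc by (simp del: power_Suc)
    qed
    have "1 + zz v \<le> 5 * \<beta> ^ (v - 1)" using g[of 1 5 "v - 1"] assms z[of v] by simp
    moreover have "1 + zz v \<le> 10 * \<beta> ^ (v - 2)" if "v \<ge> 2" using g[of 2 10 "v - 2"] that z[of v] by simp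
    ultimately show ?thesis by blast
  qed
  then show "1 + zz v \<le> 5 * (1 + 1 / real b + 1 / (real b * (real b + 1))) ^ (v - 1)"
    and "v \<ge> 2 \<Longrightarrow> 1 + zz v \<le> 10 * (1 + 1 / real b + 1 / (real b * (real b + 1))) ^ (v - 2)"
    unfolding \<beta>_def by blast+
qed

lemma C_const_ge:
  assumes "\<alpha> \<ge> 2" "1 \<le> v" "v \<le> \<alpha>"
  shows "(1 + zz v) * (1 / s0) ^ v \<le> C_const b \<alpha>"
proof -
  define \<beta> where "\<beta> = 1 + 1 / real b + 1 / (real b * (real b + 1))"
  define K where "K = 3 + 2 / real b + (2 * real b + 1) / (real b - 1)"
  define mx where "mx = max (2 / s0 ^ \<alpha>) (MAX z\<in>{1..\<alpha> - 1}. 1 / s0 ^ z)"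
  have C: "C_const b \<alpha> = mx * \<beta> ^ (\<alpha> - 2) * K"
    by (simp add: C_const_def mx_def \<beta>_def K_def s0_def)
  have b1: "\<beta> \<ge> 1" by (simp add: \<beta>_def)
  have "(2 * real b + 1) / (real b - 1) \<ge> 2" using rb2 by (simp add: field_simps)
  then have K5: "K \<ge> 5" unfolding K_def by (smt (verit) divide_nonneg_nonneg of_nat_0_le_iff)
  have sp: "(1 / s0) ^ v > 0" using s0_pos by simp
  show ?thesis
  proof (cases "v < \<alpha>")
    case True
    have "1 / s0 ^ v \<le> (MAX z\<in>{1..\<alpha> - 1}. 1 / s0 ^ z)"
      using assms True by (intro Max_ge) auto
    then have m: "(1 / s0) ^ v \<le> mx" by (simp add: mx_def power_one_over)
    have "1 + zz v \<le> 5 * \<beta> ^ (v - 1)" using zz_plus_1_le(1)[OF assms(2)] by (simp add: \<beta>_def)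
    also have "\<dots> \<le> K * \<beta> ^ (\<alpha> - 2)" using K5 b1 True by (intro mult_mono power_increasing) auto
    finally have "(1 + zz v) * (1 / s0) ^ v \<le> (K * \<beta> ^ (\<alpha> - 2)) * mx"
      using m sp zz_nonneg[of v] K5 b1 by (intro mult_mono) auto
    then show ?thesis by (simp add: C mult_ac)
  next
    case False
    then have v: "v = \<alpha>" using assms by simp
    have m: "2 * (1 / s0) ^ v \<le> mx" by (simp add: mx_def v power_one_over)
    have "(1 + zz v) / 2 \<le> 5 * \<beta> ^ (\<alpha> - 2)" using zz_plus_1_le(2)[OF assms(2)] v assms by (simp add: \<beta>_def)
    also have "\<dots> \<le> K * \<beta> ^ (\<alpha> - 2)" using K5 b1 by (intro mult_mono) auto
    finally have "((1 + zz v) / 2) * (2 * (1 / s0) ^ v) \<le> (K * \<beta> ^ (\<alpha> - 2)) * mx"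
      using m sp zz_nonneg[of v] K5 b1 by (intro mult_mono) auto
    then show ?thesis by (simp add: C mult_ac)
  qed
qed

lemma C_const_ge_2:
  assumes "\<alpha> \<ge> 2"
  shows "C_const b \<alpha> \<ge> 2"
proof -
  define K where "K = 3 + 2 / real b + (2 * real b + 1) / (real b - 1)"
  define \<beta> where "\<beta> = 1 + 1 / real b + 1 / (real b * (real b + 1))"
  define mx where "mx = max (2 / s0 ^ \<alpha>) (MAX z\<in>{1..\<alpha> - 1}. 1 / s0 ^ z)"
  have C: "C_const b \<alpha> = mx * \<beta> ^ (\<alpha> - 2) * K"
    by (simp add: C_const_def mx_def \<beta>_def K_def s0_def)
  have "1 / 2 \<le> 1 / s0 ^ 1" using s0_le_2 s0_pos by (simp add: field_simps)
  also have "\<dots> \<le> (MAX z\<in>{1..\<alpha> - 1}. 1 / s0 ^ z)"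
  proof (rule Max_ge)
    show "1 / s0 ^ 1 \<in> (\<lambda>z. 1 / s0 ^ z) ` {1..\<alpha> - 1}" by (rule imageI) (use assms in simp)
  qed simp
  finally have m: "1 / 2 \<le> mx" by (simp add: mx_def)
  have "(2 * real b + 1) / (real b - 1) \<ge> 2" using rb2 by (simp add: field_simps)
  then have K5: "K \<ge> 5" unfolding K_def by (smt (verit) divide_nonneg_nonneg of_nat_0_le_iff)
  have "1 / 2 * 1 * 5 \<le> mx * \<beta> ^ (\<alpha> - 2) * K"
    using m K5 by (intro mult_mono one_le_power) (auto simp: \<beta>_def)
  then show ?thesis by (simp add: C)
qed

text \<open>
  The decay rate of all kernel coefficients with index \<open>k\<close>. For \<open>k = 0\<close> the coefficient of order one is of size
  \<open>b\<^sup>-\<^sup>N\<close>, and this is the largest.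
\<close>

definition rho :: "nat \<Rightarrow> nat \<Rightarrow> nat \<Rightarrow> real" where
  "rho \<alpha> N k = (1 / real b) ^ (if k = 0 then N else mu \<alpha> N k)"

lemma rho_pos: "rho \<alpha> N k > 0" by (simp add: rho_def)

text \<open>
  The kernels of orders \<open>1, \<dots>, \<alpha>\<close> enter with \<open>x = 0\<close>, the one that carries the highest derivative with arbitrary
  \<open>x\<close>. Bounding their sum, rather than each of them, is what gives the constant \<open>C_const\<close> per coordinate.
\<close>

lemma walsh_coeff_bound:
  assumes "\<alpha> \<ge> 2" "N \<ge> 1" "k < b ^ N"
  shows "\<exists>B. (\<forall>x. norm (F N \<alpha> k x) \<le> B) \<and> (\<Sum>\<tau>=1..\<alpha>. norm (F N \<tau> k 0)) + B \<le> C_const b \<alpha> * rho \<alpha> N k"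
proof (cases "k = 0")
  case True
  have r: "(1 / real b) ^ (N * \<tau>) \<le> (1 / real b) ^ N * (1 / 2) ^ (\<tau> - 1)" if "\<tau> \<ge> 1" for \<tau>
  proof -
    have "N * \<tau> \<ge> N + (\<tau> - 1)" using that assms(2) by (cases \<tau>; cases N) auto
    then have "(1 / real b) ^ (N * \<tau>) \<le> (1 / real b) ^ (N + (\<tau> - 1))"
      using rb2 by (intro power_decreasing) auto
    also have "\<dots> \<le> (1 / real b) ^ N * (1 / 2) ^ (\<tau> - 1)"
      unfolding power_add using rb2 by (intro mult_left_mono power_mono divide_left_mono) auto
    finally show ?thesis .
  qed
  have n: "norm (F N \<tau> 0 x) \<le> (1 / real b) ^ N * (1 / 2) ^ \<tau>" if t: "\<tau> \<ge> 1" for \<tau> x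
  proof -
    have "norm (F N \<tau> 0 x) = (1 / real b) ^ (N * \<tau>) * \<bar>per_bern \<tau> (real b ^ N * x)\<bar>"
      unfolding F_k0[OF t] norm_of_real abs_mult by simp
    also have "\<dots> \<le> ((1 / real b) ^ N * (1 / 2) ^ (\<tau> - 1)) * (1 / 2)"
      by (intro mult_mono r abs_per_bern_le t) auto
    also have "\<dots> = (1 / real b) ^ N * (1 / 2) ^ \<tau>" using t by (cases \<tau>) auto
    finally show ?thesis .
  qed
  have "(\<Sum>\<tau>=1..\<alpha>. norm (F N \<tau> 0 0)) \<le> (\<Sum>\<tau>=1..\<alpha>. (1 / real b) ^ N * (1 / 2) ^ \<tau>)"
    by (intro sum_mono n) auto
  also have "\<dots> = (1 / real b) ^ N * (\<Sum>\<tau>=1..\<alpha>. (1 / 2) ^ \<tau>)" by (simp add: sum_distrib_left)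
  also have "(\<Sum>\<tau>=1..\<alpha>. (1 / 2 :: real) ^ \<tau>) = 1 - (1 / 2) ^ \<alpha>" by (induction \<alpha>) auto
  finally have "(\<Sum>\<tau>=1..\<alpha>. norm (F N \<tau> 0 0)) + (1 / real b) ^ N * (1 / 2) ^ \<alpha> \<le> (1 / real b) ^ N"
    by (simp add: algebra_simps)
  also have "\<dots> \<le> C_const b \<alpha> * rho \<alpha> N k"
    using C_const_ge_2[OF assms(1)] True by (simp add: rho_def)
  finally show ?thesis using n[of \<alpha>] assms True by (intro exI[of _ "(1 / real b) ^ N * (1 / 2) ^ \<alpha>"]) auto
next
  case False
  then have k: "0 < k" by simp
  define v where "v = nzd N k"
  note D = walsh_decay[OF k assms(3), folded v_def]
  have v1: "v \<ge> 1" using nzd_pos[OF k assms(3)] by (simp add: v_def)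
  have sp: "0 < 1 / s0" using s0_pos by simp
  show ?thesis
  proof (cases "v \<le> \<alpha>")
    case True
    define W where "W = (1 / s0) ^ v * (1 / real b) ^ mu v N k"
    have W: "W > 0" using sp by (simp add: W_def)
    have mu: "mu v N k = mu \<alpha> N k" by (rule mu_cong) (use True in \<open>auto simp: v_def\<close>)
    have g: "(\<Sum>j=1..d. (1 / 4 :: real) ^ j) + (1 / 4) ^ d \<le> 1" for d
    proof (induction d)
      case (Suc d)
      have "(1 / 4 :: real) ^ d \<ge> 0" by simp
      then have "(1 / 4 :: real) ^ Suc d + (1 / 4) ^ Suc d \<le> (1 / 4) ^ d" by simp
      moreover have "(\<Sum>j=1..Suc d. (1 / 4 :: real) ^ j) = (\<Sum>j=1..d. (1 / 4) ^ j) + (1 / 4) ^ Suc d" by simp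
      ultimately show ?case using Suc by linarith
    qed simp
    have "(\<Sum>\<tau>=1..\<alpha>. norm (F N \<tau> k 0)) = (\<Sum>\<tau>=v..\<alpha>. norm (F N \<tau> k 0))"
      using D v1 by (intro sum.mono_neutral_right) auto
    also have "\<dots> = norm (F N v k 0) + (\<Sum>\<tau>=Suc v..\<alpha>. norm (F N \<tau> k 0))"
      using True by (simp add: sum.atLeast_Suc_atMost)
    also have "\<dots> \<le> W + (\<Sum>\<tau>=Suc v..\<alpha>. zz v * W * (1/4) ^ (\<tau> - v))"
      using D by (intro add_mono sum_mono) (auto simp: W_def mult.assoc)
    also have "(\<Sum>\<tau>=Suc v..\<alpha>. zz v * W * (1/4) ^ (\<tau> - v)) = zz v * W * (\<Sum>j=1..\<alpha> - v. (1/4) ^ j)"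
    proof -
      have "(\<Sum>\<tau>=Suc v..\<alpha>. (1/4 :: real) ^ (\<tau> - v)) = (\<Sum>j=1..\<alpha> - v. (1/4) ^ j)"
        using True by (intro sum.reindex_bij_witness[of _ "\<lambda>j. j + v" "\<lambda>j. j - v"]) auto
      then show ?thesis by (simp add: sum_distrib_left[symmetric])
    qed
    finally have "(\<Sum>\<tau>=1..\<alpha>. norm (F N \<tau> k 0)) + zz v * W * (1/4) ^ (\<alpha> - v)
        \<le> W + zz v * W * ((\<Sum>j=1..\<alpha> - v. (1/4) ^ j) + (1/4) ^ (\<alpha> - v))"
      by (simp add: algebra_simps)
    also have "\<dots> \<le> W + zz v * W * 1" using g W zz_nonneg by (intro add_left_mono mult_left_mono) auto
    also have "\<dots> = ((1 + zz v) * (1 / s0) ^ v) * (1 / real b) ^ mu \<alpha> N k" by (simp add: W_def mu algebra_simps)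
    also have "\<dots> \<le> C_const b \<alpha> * rho \<alpha> N k"
      unfolding rho_def using C_const_ge[OF assms(1) v1 True] C_const_ge_2[OF assms(1)] False by (intro mult_mono) (use zz_nonneg sp in auto)
    finally show ?thesis
      using D True by (intro exI[of _ "zz v * W * (1/4) ^ (\<alpha> - v)"]) (auto simp: W_def mult.assoc)
  next
    case F: False
    have z: "(\<Sum>\<tau>=1..\<alpha>. norm (F N \<tau> k 0)) = 0" using D F by (intro sum.neutral) auto
    have "(1 + zz \<alpha>) * (1 / s0) ^ \<alpha> * (1 / real b) ^ mu \<alpha> N k \<le> C_const b \<alpha> * rho \<alpha> N k"
      unfolding rho_def using C_const_ge[OF assms(1), of \<alpha>] C_const_ge_2[OF assms(1)] False assms by (intro mult_mono) (use zz_nonneg sp in auto)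
    moreover have "norm (F N \<alpha> k x) \<le> (1 + zz \<alpha>) * (1 / s0) ^ \<alpha> * (1 / real b) ^ mu \<alpha> N k" for x
      using D F assms by simp
    ultimately show ?thesis unfolding z
      by (intro exI[of _ "(1 + zz \<alpha>) * (1 / s0) ^ \<alpha> * (1 / real b) ^ mu \<alpha> N k"]) auto
  qed
qed

text \<open>
  The part of \<open>\<Sum>k. r ^ mu \<alpha> N k\<close> from the \<open>k\<close> with \<open>c\<close> nonzero digits (at least \<open>\<alpha>\<close> of them if \<open>c = \<alpha>\<close>). These parts satisfy a
  linear recursion in \<open>N\<close>.
\<close>

definition g_sum :: "nat \<Rightarrow> real \<Rightarrow> nat \<Rightarrow> nat \<Rightarrow> real" where
  "g_sum \<alpha> r N c = (\<Sum>k<b ^ N. if min \<alpha> (nzd N k) = c then r ^ mu \<alpha> N k else 0)"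

lemma g_sum_Suc:
  assumes "c \<le> \<alpha>" "\<alpha> \<ge> 1"
  shows "g_sum \<alpha> r (Suc N) c = r ^ c * (g_sum \<alpha> r N c + (real b - 1) *
     ((if c = \<alpha> then g_sum \<alpha> r N \<alpha> else 0) + (if c = 0 then 0 else g_sum \<alpha> r N (c - 1))))"
proof -
  let ?h = "\<lambda>\<delta> i. if min \<alpha> (\<delta> + nzd N i) = c then r ^ mu \<alpha> N i else 0"
  have nz: "nzd (Suc N) (b * i + d) = (if d = 0 then 0 else 1) + nzd N i" if "d < b" for i d
    using that by simp
  have "g_sum \<alpha> r (Suc N) c = (\<Sum>d<b. \<Sum>i<b ^ N. r ^ c * ?h (if d = 0 then 0 else 1) i)"
    unfolding g_sum_def sum_split_bot
  proof (intro sum.cong refl)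
    fix d i assume "d \<in> {..<b}"
    then have d: "d < b" by simp
    have "mu \<alpha> (Suc N) (b * i + d) = mu \<alpha> N i + min \<alpha> (nzd (Suc N) (b * i + d))"
      using d by (simp del: nzd.simps)
    then show "(if min \<alpha> (nzd (Suc N) (b * i + d)) = c then r ^ mu \<alpha> (Suc N) (b * i + d) else 0)
       = r ^ c * ?h (if d = 0 then 0 else 1) i"
      unfolding nz[OF d] by (auto simp: power_add mult.commute simp del: mu.simps)
  qed
  also have "\<dots> = r ^ c * ((\<Sum>i<b ^ N. ?h 0 i) + (real b - 1) * (\<Sum>i<b ^ N. ?h 1 i))"
  proof -
    obtain m where m: "b = Suc m" using b_pos by (metis gr0_implies_Suc)
    have "(\<Sum>d<b. G (if d = 0 then 0 else 1 :: nat)) = G 0 + (real b - 1) * G 1" for G :: "nat \<Rightarrow> real"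
      unfolding m sum.lessThan_Suc_shift by simp
    from this[of "\<lambda>\<delta>. \<Sum>i<b ^ N. r ^ c * ?h \<delta> i"]
    show ?thesis by (simp only: sum_distrib_left[symmetric] distrib_left mult.left_commute)
  qed
  also have "(\<Sum>i<b ^ N. ?h 0 i) = g_sum \<alpha> r N c" by (simp add: g_sum_def)
  also have "(\<Sum>i<b ^ N. ?h 1 i) = (if c = \<alpha> then g_sum \<alpha> r N \<alpha> else 0) + (if c = 0 then 0 else g_sum \<alpha> r N (c - 1))"
  proof -
    have "?h 1 i = (if c = \<alpha> then (if min \<alpha> (nzd N i) = \<alpha> then r ^ mu \<alpha> N i else 0) else 0)
       + (if c = 0 then 0 else (if min \<alpha> (nzd N i) = c - 1 then r ^ mu \<alpha> N i else 0))" for i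
      using assms by (cases c) (auto simp: min_def)
    then show ?thesis by (simp add: g_sum_def sum.distrib)
  qed
  finally show ?thesis .
qed

text \<open>
  The bounds on the parts \<open>g_sum\<close> propagate along the recursion in \<open>N\<close>; the last part is a geometric series with ratio
  \<open>b r\<^sup>\<alpha>\<close>, which converges because \<open>lam > 1 / \<alpha>\<close>.
\<close>

lemma sum_rho_powr_le:
  assumes "\<alpha> \<ge> 2" "1 / real \<alpha> < lam" "lam \<le> 1"
  shows "(\<Sum>k<b ^ N. rho \<alpha> N k powr lam) \<le> E_const b \<alpha> lam"
proof -
  define r where "r = real b powr (- lam)"
  have lam: "lam > 0" using assms by (smt (verit) divide_nonneg_nonneg of_nat_0_le_iff)
  have rb: "real b > 1" using rb2 by simp
  have r: "0 < r" "r < 1" using lam rb by (auto simp: r_def powr_less_one)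
  have rinv: "real b powr (lam * real i) = (1 / r) ^ i" for i
  proof -
    have "1 / r = real b powr lam" by (simp add: r_def powr_minus field_simps)
    then show ?thesis using rb by (simp add: powr_powr powr_realpow[symmetric])
  qed
  define e where "e = (\<lambda>w. \<Prod>i=1..w. (real b - 1) / ((1 / r) ^ i - 1))"
  define x where "x = (1 / r) ^ \<alpha>"
  define es where "es = (x - 1) / (x - real b) * e \<alpha>"
  have E: "E_const b \<alpha> lam = (\<Sum>w=1..\<alpha> - 1. e w) + es"
    by (simp add: E_const_def e_def es_def x_def rinv)
  have r1: "(1 / r) ^ i > 1" if "i \<ge> 1" for i using r that by (intro one_less_power) auto
  have xb: "x > real b"
  proof -
    have "x = real b powr (lam * real \<alpha>)" by (simp add: x_def rinv)
    moreover have "lam * real \<alpha> > 1" using assms by (simp add: field_simps)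
    ultimately show ?thesis using powr_less_mono[of 1 "lam * real \<alpha>" "real b"] rb by simp
  qed
  have e_nonneg: "e w \<ge> 0" for w unfolding e_def using rb r1 by (intro prod_nonneg ballI divide_nonneg_nonneg) (auto simp: less_imp_le)
  have e_fix: "r ^ w * (e w + (real b - 1) * e (w - 1)) = e w" if w: "w \<ge> 1" for w
  proof -
    obtain u where u: "w = Suc u" using w by (cases w) auto
    have "e w = e u * ((real b - 1) / ((1 / r) ^ w - 1))" by (simp add: e_def u)
    then have "e w * ((1 / r) ^ w - 1) = (real b - 1) * e u" using r1[OF w] by simp
    then have "e w + (real b - 1) * e u = e w * (1 / r) ^ w" by (simp add: algebra_simps)
    then have "r ^ w * (e w + (real b - 1) * e u) = r ^ w * (e w * (1 / r) ^ w)" by (rule arg_cong)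
    also have "\<dots> = e w" using r by (simp add: power_one_over)
    finally show ?thesis by (simp add: u)
  qed
  have es_fix: "r ^ \<alpha> * (es + (real b - 1) * (es + e (\<alpha> - 1))) = es"
  proof -
    obtain u where u: "\<alpha> = Suc u" using assms by (cases \<alpha>) auto
    have x1: "x > 1" using xb rb by simp
    have "e \<alpha> = e u * ((real b - 1) / (x - 1))" by (simp add: e_def u x_def)
    then have "es = e u * (real b - 1) / (x - real b)" using x1 by (simp add: es_def)
    then have "es * (x - real b) = e u * (real b - 1)" using xb by simp
    then have "es + (real b - 1) * (es + e u) = es * x" by (simp add: algebra_simps)
    then show ?thesis using r by (simp add: u x_def power_one_over)
  qed
  have es0: "es \<ge> 0" unfolding es_def using xb rb e_nonneg by (intro mult_nonneg_nonneg divide_nonneg_nonneg) auto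
  have bound: "g_sum \<alpha> r N 0 \<le> 1 \<and> g_sum \<alpha> r N 1 + r ^ N \<le> e 1 \<and> (\<forall>w. 1 \<le> w \<and> w < \<alpha> \<longrightarrow> g_sum \<alpha> r N w \<le> e w) \<and> g_sum \<alpha> r N \<alpha> \<le> es"
  proof (induction N)
    case 0
    have e1: "e 1 \<ge> 1"
    proof -
      have "1 / r = real b powr lam" using rinv[of 1] by simp
      also have "\<dots> \<le> real b powr 1" using rb assms by (intro powr_mono) auto
      finally have "1 / r \<le> real b" by simp
      then show ?thesis using r1[of 1] by (simp add: e_def)
    qed
    have g0: "g_sum \<alpha> r 0 w = (if w = 0 then 1 else 0)" for w by (auto simp: g_sum_def)
    show ?case unfolding g0 using e1 e_nonneg es0 assms by auto
  next
    case (Suc N)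
    have "g_sum \<alpha> r (Suc N) 0 \<le> 1" using g_sum_Suc[of 0 \<alpha> r N] assms Suc by simp
    moreover have "g_sum \<alpha> r (Suc N) 1 + r ^ Suc N \<le> e 1"
    proof -
      have "(real b - 1) * g_sum \<alpha> r N 0 \<le> (real b - 1) * 1" using Suc rb by (intro mult_left_mono) auto
      then have "r * (g_sum \<alpha> r N 1 + (real b - 1) * g_sum \<alpha> r N 0) \<le> r * ((e 1 - r ^ N) + (real b - 1))"
        using Suc r by (intro mult_left_mono add_mono) auto
      moreover have "r * (e 1 + (real b - 1)) = e 1" using e_fix[of 1] by (simp add: e_def)
      ultimately show ?thesis using g_sum_Suc[of 1 \<alpha> r N] assms by (simp add: algebra_simps)
    qed
    moreover have "g_sum \<alpha> r (Suc N) w \<le> e w" if w: "1 \<le> w" "w < \<alpha>" for w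
    proof -
      have prev: "g_sum \<alpha> r N (w - 1) \<le> e (w - 1)"
      proof (cases "w = 1")
        case True then show ?thesis using Suc by (simp add: e_def)
      next
        case False
        then have "1 \<le> w - 1 \<and> w - 1 < \<alpha>" using w by linarith
        then show ?thesis using Suc by blast
      qed
      have "g_sum \<alpha> r (Suc N) w = r ^ w * (g_sum \<alpha> r N w + (real b - 1) * g_sum \<alpha> r N (w - 1))"
        using g_sum_Suc[of w \<alpha> r N] w by simp
      also have "\<dots> \<le> r ^ w * (e w + (real b - 1) * e (w - 1))"
        using Suc w r rb prev by (intro mult_left_mono add_mono) auto
      finally show ?thesis using e_fix[OF w(1)] by simp
    qed
    moreover have "g_sum \<alpha> r (Suc N) \<alpha> \<le> es"
    proof -
      have prev: "g_sum \<alpha> r N (\<alpha> - 1) \<le> e (\<alpha> - 1)"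
      proof -
        have "1 \<le> \<alpha> - 1 \<and> \<alpha> - 1 < \<alpha>" using assms(1) by linarith
        then show ?thesis using Suc by blast
      qed
      have "g_sum \<alpha> r (Suc N) \<alpha> = r ^ \<alpha> * (g_sum \<alpha> r N \<alpha> + (real b - 1) * (g_sum \<alpha> r N \<alpha> + g_sum \<alpha> r N (\<alpha> - 1)))"
        using g_sum_Suc[of \<alpha> \<alpha> r N] assms by simp
      also have "\<dots> \<le> r ^ \<alpha> * (es + (real b - 1) * (es + e (\<alpha> - 1)))"
        using Suc r rb prev by (intro mult_left_mono add_mono) auto
      finally show ?thesis using es_fix by simp
    qed
    ultimately show ?case by blast
  qed
  have rp: "rho \<alpha> N k powr lam = (if k = 0 then r ^ N else r ^ mu \<alpha> N k)" for k
  proof -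
    have "((1 / real b) ^ m) powr lam = r ^ m" for m
    proof -
      have "((1 / real b) ^ m) powr lam = (real b powr (- real m)) powr lam"
        using rb by (simp add: powr_minus powr_realpow divide_inverse power_inverse)
      also have "\<dots> = (real b powr (- lam)) powr real m" by (simp add: powr_powr mult.commute)
      also have "\<dots> = r ^ m" using r by (simp add: r_def[symmetric] powr_realpow)
      finally show ?thesis .
    qed
    then show ?thesis by (simp add: rho_def)
  qed
  have "(\<Sum>k<b ^ N. rho \<alpha> N k powr lam) \<le> (\<Sum>k<b ^ N. (if k = 0 then r ^ N else 0) + (\<Sum>w=1..\<alpha>. if min \<alpha> (nzd N k) = w then r ^ mu \<alpha> N k else 0))"
  proof (rule sum_mono)
    fix k assume "k \<in> {..<b ^ N}"
    then have k: "k < b ^ N" by simp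
    have "k \<noteq> 0 \<Longrightarrow> nzd N k \<ge> 1" using nzd_pos[OF _ k] by simp
    then show "rho \<alpha> N k powr lam \<le> (if k = 0 then r ^ N else 0) + (\<Sum>w=1..\<alpha>. if min \<alpha> (nzd N k) = w then r ^ mu \<alpha> N k else 0)"
      unfolding rp using assms(1) by (auto simp: sum.delta)
  qed
  also have "\<dots> = r ^ N + (\<Sum>w=1..\<alpha>. g_sum \<alpha> r N w)"
    unfolding sum.distrib g_sum_def by (subst sum.swap[of _ "{..<b ^ N}" "{1..\<alpha>}"]) (simp add: sum.delta)
  also have "(\<Sum>w=1..\<alpha>. g_sum \<alpha> r N w) = g_sum \<alpha> r N 1 + (\<Sum>w=2..\<alpha> - 1. g_sum \<alpha> r N w) + g_sum \<alpha> r N \<alpha>"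
  proof -
    have "{1..\<alpha>} = insert 1 (insert \<alpha> {2..\<alpha> - 1})" using assms(1) by auto
    then show ?thesis using assms(1) by simp
  qed
  also have "r ^ N + (g_sum \<alpha> r N 1 + (\<Sum>w=2..\<alpha> - 1. g_sum \<alpha> r N w) + g_sum \<alpha> r N \<alpha>) \<le> e 1 + (\<Sum>w=2..\<alpha> - 1. e w) + es"
  proof -
    have "(\<Sum>w=2..\<alpha> - 1. g_sum \<alpha> r N w) \<le> (\<Sum>w=2..\<alpha> - 1. e w)" using bound by (intro sum_mono) auto
    then show ?thesis using bound by linarith
  qed
  also have "\<dots> = E_const b \<alpha> lam"
  proof -
    have "{1..\<alpha> - 1} = insert 1 {2..\<alpha> - 1}" using assms(1) by auto
    then show ?thesis unfolding E by simp
  qed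
  finally show ?thesis .
qed

end


section \<open>Laurent coefficients and irreducible polynomials\<close>

lemma fls_const_comm_ring_hom: "comm_ring_hom (fls_const :: 'a::field \<Rightarrow> 'a fls)"
  by unfold_locales (auto intro: fls_eqI)

lemma laurent_of_poly_mult: "laurent_of_poly (p * q) = laurent_of_poly p * laurent_of_poly q"
proof -
  interpret comm_ring_hom "fls_const :: 'a \<Rightarrow> 'a fls" by (rule fls_const_comm_ring_hom)
  interpret m: map_poly_comm_ring_hom "fls_const :: 'a \<Rightarrow> 'a fls" ..
  show ?thesis by (simp add: laurent_of_poly_def m.hom_mult)
qed

lemma laurent_of_poly_add: "laurent_of_poly (p + q) = laurent_of_poly p + laurent_of_poly q"
proof -
  interpret comm_ring_hom "fls_const :: 'a \<Rightarrow> 'a fls" by (rule fls_const_comm_ring_hom)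
  interpret m: map_poly_comm_ring_hom "fls_const :: 'a \<Rightarrow> 'a fls" ..
  show ?thesis by (simp add: laurent_of_poly_def m.hom_add)
qed

lemma laurent_of_poly_nth:
  "fls_nth (laurent_of_poly q) j = (if j \<le> 0 then Polynomial.coeff q (nat (- j)) else 0)"
proof -
  have d: "Polynomial.degree (map_poly fls_const q) = Polynomial.degree q"
    by (rule degree_map_poly) simp
  have "laurent_of_poly q = (\<Sum>i\<le>Polynomial.degree q. fls_const (Polynomial.coeff q i) * fls_X_inv ^ i)"
    unfolding laurent_of_poly_def poly_altdef d by (simp add: coeff_map_poly)
  then have "fls_nth (laurent_of_poly q) j = (\<Sum>i\<le>Polynomial.degree q. Polynomial.coeff q i * (if j = - int i then 1 else 0))"
    by (simp add: fls_nth_sum)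
  also have "\<dots> = (\<Sum>i\<le>Polynomial.degree q. if i = nat (- j) then (if j \<le> 0 then Polynomial.coeff q i else 0) else 0)"
    by (intro sum.cong) auto
  also have "\<dots> = (if j \<le> 0 then Polynomial.coeff q (nat (- j)) else 0)"
    by (auto simp: sum.delta coeff_eq_0)
  finally show ?thesis .
qed

lemma laurent_of_poly_0 [simp]: "laurent_of_poly 0 = 0"
  by (simp add: laurent_of_poly_def)

lemma laurent_of_poly_eq_0_iff: "laurent_of_poly q = 0 \<longleftrightarrow> q = 0"
proof
  assume a: "laurent_of_poly q = 0"
  show "q = 0"
  proof (rule poly_eqI)
    fix n
    have "fls_nth (laurent_of_poly q) (- int n) = Polynomial.coeff q n" by (simp add: laurent_of_poly_nth)
    then show "Polynomial.coeff q n = Polynomial.coeff 0 n" using a by simp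
  qed
qed simp

lemma laurent_of_poly_monom: "laurent_of_poly (Polynomial.monom 1 j) = fls_X_inv ^ j"
  by (rule fls_eqI) (auto simp: laurent_of_poly_nth)

lemma fls_subdegree_laurent_of_poly:
  assumes "q \<noteq> 0"
  shows "fls_subdegree (laurent_of_poly q) = - int (Polynomial.degree q)"
proof (rule fls_subdegree_eqI)
  show "fls_nth (laurent_of_poly q) (- int (Polynomial.degree q)) \<noteq> 0"
    using assms by (simp add: laurent_of_poly_nth)
  fix k assume "k < - int (Polynomial.degree q)"
  then show "fls_nth (laurent_of_poly q) k = 0" by (auto simp: laurent_of_poly_nth intro!: coeff_eq_0)
qed

definition frac_coeff :: "'a::field poly \<Rightarrow> 'a poly \<Rightarrow> nat \<Rightarrow> 'a" where
  "frac_coeff p h a = fls_nth (laurent_of_poly h / laurent_of_poly p) (int a)"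

lemma frac_coeff_add: "frac_coeff p (g + h) a = frac_coeff p g a + frac_coeff p h a"
  by (simp add: frac_coeff_def laurent_of_poly_add add_divide_distrib)

lemma frac_coeff_0 [simp]: "frac_coeff p 0 a = 0"
  by (simp add: frac_coeff_def)

lemma frac_coeff_sum: "frac_coeff p (\<Sum>i\<in>A. g i) a = (\<Sum>i\<in>A. frac_coeff p (g i) a)"
  by (induction A rule: infinite_finite_induct) (simp_all add: frac_coeff_add)

lemma frac_coeff_smult: "frac_coeff p (Polynomial.smult c h) a = c * frac_coeff p h a"
proof -
  have "laurent_of_poly (Polynomial.smult c h) = fls_const c * laurent_of_poly h"
    by (rule fls_eqI) (simp add: laurent_of_poly_nth)
  then show ?thesis by (simp add: frac_coeff_def flip: times_divide_eq_right)
qed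

lemma frac_coeff_monom_mult:
  "frac_coeff p (Polynomial.monom 1 j * h) a = frac_coeff p h (a + j)"
proof -
  have "frac_coeff p (Polynomial.monom 1 j * h) a = fls_nth (fls_X_inv ^ j * (laurent_of_poly h / laurent_of_poly p)) (int a)"
    by (simp add: frac_coeff_def laurent_of_poly_mult laurent_of_poly_monom)
  also have "\<dots> = frac_coeff p h (a + j)"
    unfolding fls_X_inv_power_times_conv_shift(1) by (simp add: frac_coeff_def)
  finally show ?thesis .
qed

text \<open>
  The quotient of \<open>h\<close> by \<open>p\<close> is a polynomial plus \<open>r / p\<close>, where \<open>r\<close> is the nonzero remainder; the leading
  coefficient of \<open>r / p\<close> is the one that is looked for.
\<close>

lemma frac_coeff_nonzero:
  assumes p: "p \<noteq> 0" and h: "\<not> p dvd h"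
  obtains a where "1 \<le> a" "a \<le> Polynomial.degree p" "frac_coeff p h a \<noteq> 0"
proof -
  define g r where "g = h div p" and "r = h mod p"
  have hgr: "h = p * g + r" by (simp add: g_def r_def)
  have r0: "r \<noteq> 0" using h by (auto simp: r_def dvd_eq_mod_eq_0)
  have dr: "Polynomial.degree r < Polynomial.degree p"
    using r0 p unfolding r_def using degree_mod_less' by blast
  let ?R = "laurent_of_poly r / laurent_of_poly p"
  have lp: "laurent_of_poly p \<noteq> 0" and lr: "laurent_of_poly r \<noteq> 0"
    using p r0 by (simp_all add: laurent_of_poly_eq_0_iff)
  have R0: "?R \<noteq> 0" using lp lr by simp
  define a where "a = Polynomial.degree p - Polynomial.degree r"
  have "?R * laurent_of_poly p = laurent_of_poly r" using lp by simp
  then have "fls_subdegree ?R + fls_subdegree (laurent_of_poly p) = fls_subdegree (laurent_of_poly r)"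
    using R0 lp by (metis fls_subdegree_mult)
  then have sd: "fls_subdegree ?R = int a"
    using p r0 dr by (simp add: fls_subdegree_laurent_of_poly a_def)
  have "laurent_of_poly h / laurent_of_poly p = laurent_of_poly g + ?R"
    unfolding hgr laurent_of_poly_add laurent_of_poly_mult using lp by (simp add: add_divide_distrib)
  moreover have "a \<ge> 1" using dr by (simp add: a_def)
  ultimately have "frac_coeff p h a = fls_nth ?R (int a)"
    by (simp add: frac_coeff_def laurent_of_poly_nth)
  moreover have "fls_nth ?R (int a) \<noteq> 0" using R0 sd nth_fls_subdegree_nonzero by metis
  ultimately show ?thesis using that[of a] \<open>a \<ge> 1\<close> by (simp add: a_def)
qed


text \<open>
  Counting. The polynomial \<open>X ^ (b ^ N) - X\<close> is squarefree, and an irreducible factor of it has degree at most \<open>N\<close>. If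
  no factor of degree \<open>N\<close> existed, it would divide the product of the \<open>X ^ (b ^ d) - X\<close> over \<open>d < N\<close>, whose
  degree is too small.
\<close>

lemma exists_irreducible_poly_degree:
  assumes "N \<ge> 1"
  shows "\<exists>p :: 'p::prime_card mod_ring poly. irreducible p \<and> Polynomial.degree p = N"
proof (rule ccontr)
  assume no: "\<not> ?thesis"
  let ?X = "Polynomial.monom 1 1 :: 'p mod_ring poly"
  let ?b = "CARD('p)"
  have b2: "?b \<ge> 2" using prime_card[where 'a='p] prime_ge_2_nat by blast
  define G where "G = (\<lambda>d. ?X ^ (?b ^ d) - ?X)"
  have mon: "?X ^ k = Polynomial.monom 1 k" for k by (simp add: Polynomial.monom_power)
  have d1: "Polynomial.degree (- ?X) = 1" by (simp add: Polynomial.degree_monom_eq)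
  have d2: "Polynomial.degree (?X ^ k) = k" for k unfolding mon by (simp add: Polynomial.degree_monom_eq)
  have bd: "?b ^ d > 1" if "d \<ge> 1" for d using b2 that by (intro one_less_power) auto
  have degG: "Polynomial.degree (G d) = ?b ^ d" and G0: "G d \<noteq> 0" if "d \<ge> 1" for d
  proof -
    have "Polynomial.degree (G d) = Polynomial.degree (?X ^ (?b ^ d))"
      unfolding G_def diff_conv_add_uminus by (rule Polynomial.degree_add_eq_left) (simp only: d1 d2 bd[OF that])
    also have "\<dots> = ?b ^ d" by (rule d2)
    finally show "Polynomial.degree (G d) = ?b ^ d" .
    then show "G d \<noteq> 0" using bd[OF that] by auto
  qed
  have small: "d < N" "d \<ge> 1" if "irreducible \<pi>" "\<pi> dvd G N" "Polynomial.degree \<pi> = d" for \<pi> d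
  proof -
    show "d < N"
    proof (rule ccontr)
      assume "\<not> d < N"
      moreover have "d \<noteq> N" using no that by blast
      ultimately show False using degree_divisor2[OF that(1) that(3) assms] that(2) by (simp add: G_def)
    qed
    show "d \<ge> 1" using that(1,3) irreducible_def is_unit_iff_degree[of \<pi>] by (metis One_nat_def Suc_leI neq0_conv)
  qed
  have sf: "\<not> \<pi> ^ 2 dvd G N" if "irreducible \<pi>" for \<pi>
  proof
    assume "\<pi> ^ 2 dvd G N"
    then obtain c where c: "G N = \<pi> * (\<pi> * c)" by (metis dvdE power2_eq_square mult.assoc)
    have "\<pi> dvd pderiv (G N)" unfolding c by (simp add: pderiv_mult)
    moreover have "pderiv (G N) = - 1"
    proof -
      have "(of_nat (?b ^ N) :: 'p mod_ring) = 0" using assms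
        by (metis of_nat_power of_nat_card_eq_0 power_0_left not_one_le_zero)
      then have "pderiv (?X ^ (?b ^ N)) = 0"
        unfolding mon by (simp add: pderiv_monom)
      then show ?thesis by (simp add: G_def pderiv_diff pderiv_monom)
    qed
    ultimately show False using that by (metis dvd_minus_iff irreducible_not_unit)
  qed
  have "G N dvd (\<Prod>d=1..<N. G d)"
  proof -
    have "a dvd (\<Prod>d=1..<N. G d)" if "a dvd G N" for a
      using that
    proof (induction "Polynomial.degree a" arbitrary: a rule: less_induct)
      case less
      have a0: "a \<noteq> 0" using less.prems G0[OF assms] by auto
      show ?case
      proof (cases "is_unit a")
        case True then show ?thesis by blast
      next
        case False
        then have "Polynomial.degree a > 0" using is_unit_iff_degree[OF a0] a0 by auto
        from irreducible\<^sub>d_factor[OF this] obtain \<pi> c where irr: "irreducible \<pi>" and c: "a = \<pi> * c" by auto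
        have \<pi>: "prime_elem \<pi>" "\<pi> dvd a" using field_poly_irreducible_imp_prime[OF irr] c by auto
        define d where "d = Polynomial.degree \<pi>"
        have dd: "d < N" "1 \<le> d" using small[OF irr _ d_def[symmetric]] \<pi>(2) less.prems dvd_trans by blast+
        have "Polynomial.degree c < Polynomial.degree a"
          using a0 dd unfolding c by (subst degree_mult_eq) (auto simp: d_def)
        moreover have "c dvd G N" using c less.prems by (metis dvd_mult_right)
        ultimately have cd: "c dvd (\<Prod>d=1..<N. G d)" by (rule less.hyps)
        have "\<pi> dvd G d" unfolding G_def by (rule degree_divisor1[OF irr d_def[symmetric]])
        then have pd: "\<pi> dvd (\<Prod>d=1..<N. G d)" using dd by (meson atLeastLessThan_iff dvd_prodI dvd_trans finite_atLeastLessThan)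
        have "\<not> \<pi> dvd c"
        proof
          assume "\<pi> dvd c"
          then have "\<pi> ^ 2 dvd a" unfolding c power2_eq_square by (rule mult_dvd_mono[OF dvd_refl])
          then show False using sf[OF irr] less.prems dvd_trans by blast
        qed
        obtain e where e: "(\<Prod>d=1..<N. G d) = c * e" using cd by blast
        have "\<pi> dvd e" using pd \<pi>(1) \<open>\<not> \<pi> dvd c\<close> unfolding e by (simp add: prime_elem_dvd_mult_iff)
        then show ?thesis unfolding e c mult.commute[of \<pi> c] by (rule mult_dvd_mono[OF dvd_refl])
      qed
    qed
    from this[OF dvd_refl] show ?thesis .
  qed
  moreover have nz: "\<forall>d\<in>{1..<N}. G d \<noteq> 0"
  proof
    fix d assume "d \<in> {1..<N}"
    then have "d \<ge> 1" by simp
    then show "G d \<noteq> 0" by (rule G0)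
  qed
  moreover from nz have "(\<Prod>d=1..<N. G d) \<noteq> 0" using prod_zero_iff[of "{1..<N}" G] by blast
  ultimately have "Polynomial.degree (G N) \<le> Polynomial.degree (\<Prod>d=1..<N. G d)" by (intro dvd_imp_degree_le)
  also have "\<dots> = (\<Sum>d=1..<N. Polynomial.degree (G d))" by (rule degree_prod_eq_sum_degree) (use nz in blast)
  also have "\<dots> = (\<Sum>d=1..<N. ?b ^ d)" 
  proof (rule sum.cong[OF refl])
    fix d assume "d \<in> {1..<N}"
    then have "d \<ge> 1" by simp
    then show "Polynomial.degree (G d) = ?b ^ d" by (rule degG)
  qed
  also have "\<dots> < ?b ^ N"
  proof -
    have "(\<Sum>d=1..<N. ?b ^ d) < ?b ^ N" if "N \<ge> 1" for N using that
    proof (induction N rule: nat_induct_at_least)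
      case base then show ?case using b2 by simp
    next
      case (Suc N)
      have "2 * ?b ^ N \<le> ?b * ?b ^ N" using b2 by (intro mult_right_mono) auto
      moreover have "(\<Sum>d=1..<Suc N. ?b ^ d) = (\<Sum>d=1..<N. ?b ^ d) + ?b ^ N" using Suc.hyps by simp
      ultimately show ?case using Suc.IH unfolding power_Suc by linarith
    qed
    then show ?thesis using assms .
  qed
  finally show False unfolding degG[OF assms] by simp
qed


section \<open>Polynomial lattice points on the regular grid\<close>

locale poly_lattice_base = walsh_base b for b :: nat +
  fixes ty :: "'p::prime_card itself"
  assumes b_card: "b = CARD('p)"
begin

definition dig :: "'p mod_ring \<Rightarrow> nat" where "dig c = nat (to_int_mod_ring c)"

lemma to_int_range: "0 \<le> to_int_mod_ring (c :: 'p mod_ring)" "to_int_mod_ring (c :: 'p mod_ring) < int b"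
  using range_to_int_mod_ring[where 'a='p] b_card by (metis atLeastLessThan_iff rangeI)+

lemma dig_lt: "dig c < b" using to_int_range[of c] by (simp add: dig_def)

lemma int_dig: "int (dig c) = to_int_mod_ring c" using to_int_range[of c] by (simp add: dig_def)

lemma dig_add: "dig (c + d) = (dig c + dig d) mod b"
  by (rule int_int_eq[THEN iffD1]) (simp add: int_dig zmod_int to_int_mod_ring_add b_card)

lemma dig_mult: "dig (c * d) = (dig c * dig d) mod b"
  by (rule int_int_eq[THEN iffD1]) (simp add: int_dig zmod_int to_int_mod_ring_mult b_card)

lemma dig_of_nat: "dig (of_nat n) = n mod b"
proof (induction n)
  case (Suc n)
  have "dig (1 :: 'p mod_ring) = 1" by (simp add: dig_def)
  then show ?case using Suc by (simp add: dig_add mod_simps)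
qed (simp add: dig_def)

lemma of_nat_dig: "of_nat (dig c) = c"
proof -
  have "(of_nat (dig c) :: 'p mod_ring) = of_int_mod_ring (int (dig c))" 
    by (simp add: of_nat_of_int_mod_ring)
  then show ?thesis by (simp add: int_dig)
qed

lemma dig_inj: "dig c = dig d \<Longrightarrow> c = d" by (metis of_nat_dig)

definition ec :: "'p mod_ring \<Rightarrow> complex" where "ec c = w (dig c)"

lemma ec_add: "ec (c + d) = ec c * ec d"
  by (simp add: ec_def dig_add w_mod w_add)

lemma ec_0 [simp]: "ec 0 = 1" by (simp add: ec_def dig_def)

lemma norm_ec [simp]: "norm (ec c) = 1" by (simp add: ec_def)

lemma ec_sum: "ec (\<Sum>i\<in>A. f i) = (\<Prod>i\<in>A. ec (f i))"
  by (induction A rule: infinite_finite_induct) (simp_all add: ec_add)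

lemma ec_ne_1: "c \<noteq> 0 \<Longrightarrow> ec c \<noteq> 1"
proof -
  assume c: "c \<noteq> 0"
  have "dig (0 :: 'p mod_ring) = 0" by (simp add: dig_def)
  then have "dig c \<noteq> 0" using c dig_inj[of c 0] by metis
  then show ?thesis unfolding ec_def by (intro w_ne_1 dig_lt) simp
qed

lemma coeff_poly_of_nat:
  "Polynomial.coeff (poly_of_nat n :: 'p mod_ring poly) i = of_nat (n div b ^ i mod b)"
proof -
  have "Polynomial.coeff (poly_of_nat n :: 'p mod_ring poly) i
      = (\<Sum>j\<le>n. if j = i then of_nat (n div b ^ i mod b) else 0)"
    unfolding poly_of_nat_def Polynomial.coeff_sum b_card[symmetric] by (intro sum.cong) auto
  also have "\<dots> = of_nat (n div b ^ i mod b)"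
  proof (cases "i \<le> n")
    case False
    then have "n < b ^ i" using b2 by (metis less_exp not_le order.strict_trans power_gt_expt One_nat_def Suc_1 Suc_le_lessD less_trans)
    then show ?thesis using False by simp
  qed (simp add: sum.delta)
  finally show ?thesis .
qed

lemma poly_of_nat_inj_on: "inj_on (poly_of_nat :: nat \<Rightarrow> 'p mod_ring poly) {..<b ^ N}"
proof -
  have A: "n = m" if "n < b ^ N" "m < b ^ N" "\<forall>i<N. n div b ^ i mod b = m div b ^ i mod b" for n m
    using that
  proof (induction N arbitrary: n m)
    case (Suc N)
    have "n mod b = m mod b" using Suc.prems(3)[rule_format, of 0] by simp
    moreover have "n div b = m div b"
    proof (rule Suc.IH)
      show "\<forall>i<N. n div b div b ^ i mod b = m div b div b ^ i mod b"
        using Suc.prems(3) by (auto simp: div_mult2_eq[symmetric] dest: spec[of _ "Suc _"])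
    qed (use Suc.prems in \<open>auto simp: less_mult_imp_div_less mult.commute\<close>)
    ultimately show ?case by (metis div_mult_mod_eq)
  qed simp
  have B: "n div b ^ i mod b = m div b ^ i mod b" if "poly_of_nat n = (poly_of_nat m :: 'p mod_ring poly)" for n m i
  proof -
    have "dig (of_nat (n div b ^ i mod b)) = dig (of_nat (m div b ^ i mod b))"
      using that coeff_poly_of_nat by metis
    then show ?thesis by (simp add: dig_of_nat)
  qed
  show ?thesis
  proof (rule inj_onI)
    fix n m assume n: "n \<in> {..<b ^ N}" and m: "m \<in> {..<b ^ N}" and e: "poly_of_nat n = (poly_of_nat m :: 'p mod_ring poly)"
    show "n = m"
    proof (rule A)
      show "\<forall>i<N. n div b ^ i mod b = m div b ^ i mod b" using B[OF e] by (intro allI impI)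
    qed (use n m in simp_all)
  qed
qed

lemma coeff_poly_of_nat_ge: "n < b ^ N \<Longrightarrow> N \<le> i \<Longrightarrow> Polynomial.coeff (poly_of_nat n :: 'p mod_ring poly) i = 0"
proof -
  assume a: "n < b ^ N" "N \<le> i"
  have "b ^ N \<le> b ^ i" using a b2 by (intro power_increasing) auto
  then show ?thesis using a unfolding coeff_poly_of_nat by simp
qed

lemma poly_of_nat_eq_0_iff: "poly_of_nat n = (0 :: 'p mod_ring poly) \<longleftrightarrow> n = 0"
proof
  have z: "poly_of_nat 0 = (0 :: 'p mod_ring poly)" by (rule poly_eqI) (simp add: coeff_poly_of_nat)
  then show "n = 0 \<Longrightarrow> poly_of_nat n = (0 :: 'p mod_ring poly)" by simp
  assume "poly_of_nat n = (0 :: 'p mod_ring poly)"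
  moreover have "n < b ^ n" using b2 by (metis less_exp power_mono order.strict_trans2 zero_le)
  ultimately show "n = 0" using poly_of_nat_inj_on[of n] z by (auto dest!: inj_onD[of _ _ n 0])
qed

lemma digits_exist:
  assumes "\<And>a. y a < b"
  shows "\<exists>I<b ^ N. real I / real b ^ N = (\<Sum>a=1..N. real (y a) / real b ^ a) \<and>
     (\<forall>a<N. I div b ^ (N - 1 - a) mod b = y (Suc a))"
proof (induction N)
  case (Suc N)
  then obtain I where I: "I < b ^ N" "real I / real b ^ N = (\<Sum>a=1..N. real (y a) / real b ^ a)"
    "\<forall>a<N. I div b ^ (N - 1 - a) mod b = y (Suc a)" by blast
  define J where "J = b * I + y (Suc N)"
  have "Suc I \<le> b ^ N" using I by simp
  then have "b * Suc I \<le> b * b ^ N" by (rule mult_le_mono2)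
  then have 1: "J < b ^ Suc N" using assms[of "Suc N"] by (simp add: J_def)
  have 2: "real J / real b ^ Suc N = (\<Sum>a=1..Suc N. real (y a) / real b ^ a)"
    using I(2) by (simp add: J_def add_divide_distrib)
  have Jb: "J div b = I" "J mod b = y (Suc N)" using assms[of "Suc N"] by (simp_all add: J_def)
  have 3: "J div b ^ (Suc N - 1 - a) mod b = y (Suc a)" if "a < Suc N" for a
  proof (cases "a = N")
    case True then show ?thesis using Jb by simp
  next
    case False
    then have "Suc N - 1 - a = Suc (N - 1 - a)" using that by simp
    then have "J div b ^ (Suc N - 1 - a) = I div b ^ (N - 1 - a)"
      by (simp add: div_mult2_eq Jb)
    then show ?thesis using I(3) False that by simp
  qed
  show ?case using 1 2 3 by blast
qed simp

lemma poly_of_nat_surj: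
  assumes "\<And>i. N \<le> i \<Longrightarrow> Polynomial.coeff q i = 0"
  shows "\<exists>n<b ^ N. poly_of_nat n = (q :: 'p mod_ring poly)"
proof -
  define y where "y = (\<lambda>a. dig (Polynomial.coeff q (N - a)))"
  have "y a < b" for a by (simp add: y_def dig_lt)
  from digits_exist[of y N, OF this] obtain I where I: "I < b ^ N" "\<forall>a<N. I div b ^ (N - 1 - a) mod b = y (Suc a)" by blast
  have "poly_of_nat I = q"
  proof (rule poly_eqI)
    fix i
    show "Polynomial.coeff (poly_of_nat I) i = Polynomial.coeff q i"
    proof (cases "i < N")
      case True
      have "I div b ^ (N - 1 - (N - 1 - i)) mod b = y (Suc (N - 1 - i))"
        by (rule I(2)[rule_format]) (use True in simp)
      moreover have "N - 1 - (N - 1 - i) = i" "N - Suc (N - 1 - i) = i" using True by auto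
      ultimately have "I div b ^ i mod b = dig (Polynomial.coeff q i)" by (simp add: y_def)
      then show ?thesis by (simp add: coeff_poly_of_nat of_nat_dig)
    next
      case False then show ?thesis using assms[of i] coeff_poly_of_nat_ge[OF I(1), of i] by simp
    qed
  qed
  then show ?thesis using I by blast
qed


text \<open>
  Truncation to \<open>N\<close> digits puts the point on the grid. Its digits are the Laurent coefficients, and
  multiplication by \<open>x\<^sup>j\<close> shifts them, so a Walsh function of the point is a character of one single Laurent
  coefficient.
\<close>

lemma v_map_grid:
  fixes h p :: "'p mod_ring poly"
  shows "\<exists>I<b ^ N. v_map N (laurent_of_poly h / laurent_of_poly p) = real I / real b ^ N \<and>
     (\<forall>k<b ^ N. chi N k I = ec (frac_coeff p (poly_of_nat k * h) 1))"
proof -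
  define y where "y = (\<lambda>a. dig (frac_coeff p h a))"
  have "y a < b" for a by (simp add: y_def dig_lt)
  from digits_exist[of y N, OF this] obtain I where I: "I < b ^ N" "real I / real b ^ N = (\<Sum>a=1..N. real (y a) / real b ^ a)"
    "\<forall>a<N. I div b ^ (N - 1 - a) mod b = y (Suc a)" by blast
  have "v_map N (laurent_of_poly h / laurent_of_poly p) = (\<Sum>a=1..N. real (y a) / real b ^ a)"
    unfolding v_map_def b_card[symmetric]
  proof (rule sum.cong[OF refl])
    fix a
    have "real (y a) = of_int (int (y a))" by simp
    also have "int (y a) = to_int_mod_ring (fls_nth (laurent_of_poly h / laurent_of_poly p) (int a))"
      unfolding y_def int_dig by (simp add: frac_coeff_def)
    finally show "of_int (to_int_mod_ring (fls_nth (laurent_of_poly h / laurent_of_poly p) (int a))) / real b ^ a = real (y a) / real b ^ a"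
      by simp
  qed
  moreover have "chi N k I = ec (frac_coeff p (poly_of_nat k * h) 1)" if k: "k < b ^ N" for k
  proof -
    have e: "poly_of_nat k = (\<Sum>a<N. Polynomial.smult (of_nat (k div b ^ a mod b)) (Polynomial.monom 1 a) :: 'p mod_ring poly)"
    proof (rule poly_eqI)
      fix i
      have "Polynomial.coeff (\<Sum>a<N. Polynomial.smult (of_nat (k div b ^ a mod b)) (Polynomial.monom 1 a) :: 'p mod_ring poly) i
         = (\<Sum>a<N. if a = i then of_nat (k div b ^ i mod b) else 0)"
        unfolding Polynomial.coeff_sum by (intro sum.cong) auto
      also have "\<dots> = Polynomial.coeff (poly_of_nat k :: 'p mod_ring poly) i"
        using coeff_poly_of_nat_ge[OF k, of i] by (simp add: sum.delta coeff_poly_of_nat)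
      finally show "Polynomial.coeff (poly_of_nat k :: 'p mod_ring poly) i = Polynomial.coeff (\<Sum>a<N. Polynomial.smult (of_nat (k div b ^ a mod b)) (Polynomial.monom 1 a)) i" by simp
    qed
    have "frac_coeff p (poly_of_nat k * h) 1 = (\<Sum>a<N. of_nat (k div b ^ a mod b) * frac_coeff p h (Suc a))"
      unfolding e sum_distrib_right frac_coeff_sum mult_smult_left frac_coeff_smult frac_coeff_monom_mult by simp
    also have "ec \<dots> = (\<Prod>a<N. ec (of_nat (k div b ^ a mod b) * frac_coeff p h (Suc a)))" by (rule ec_sum)
    also have "\<dots> = chi N k I"
      unfolding chi_def ec_def
    proof (rule prod.cong[OF refl])
      fix a assume a: "a \<in> {..<N}"
      then have "I div b ^ (N - 1 - a) mod b = dig (frac_coeff p h (Suc a))" using I(3) by (simp add: y_def)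
      then show "w (dig (of_nat (k div b ^ a mod b) * frac_coeff p h (Suc a))) = w ((k div b ^ a mod b) * (I div b ^ (N - 1 - a) mod b))"
        by (intro w_cong) (simp add: dig_mult dig_of_nat)
    qed
    finally show ?thesis ..
  qed
  ultimately show ?thesis using I by metis
qed

definition grid_index :: "nat \<Rightarrow> 'p mod_ring poly \<Rightarrow> 'p mod_ring poly \<Rightarrow> nat" where
  "grid_index N p h = (SOME I. I < b ^ N \<and> v_map N (laurent_of_poly h / laurent_of_poly p) = real I / real b ^ N \<and>
     (\<forall>k<b ^ N. chi N k I = ec (frac_coeff p (poly_of_nat k * h) 1)))"

lemma grid_index:
  "grid_index N p h < b ^ N"
  "v_map N (laurent_of_poly h / laurent_of_poly p) = real (grid_index N p h) / real b ^ N"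
  "k < b ^ N \<Longrightarrow> chi N k (grid_index N p h) = ec (frac_coeff p (poly_of_nat k * h) 1)"
  using someI_ex[OF v_map_grid[of N h p]] unfolding grid_index_def by blast+

text \<open>
  Some shift of the functional \<open>frac_coeff p h\<close> is nonzero when \<open>p\<close> does not divide \<open>h\<close>, and the sum of a nontrivial
  character over a group vanishes.
\<close>

lemma character_sum_zero:
  fixes p h :: "'p mod_ring poly"
  assumes p: "p \<noteq> 0" "Polynomial.degree p = N" and h: "\<not> p dvd h"
  shows "(\<Sum>n<b ^ N. ec (frac_coeff p (poly_of_nat n * h) 1)) = 0"
proof -
  obtain a where a: "1 \<le> a" "a \<le> N" "frac_coeff p h a \<noteq> 0"
    using frac_coeff_nonzero[OF p(1) h] p(2) by blast
  define V where "V = {q :: 'p mod_ring poly. \<forall>i\<ge>N. Polynomial.coeff q i = 0}"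
  define m :: "'p mod_ring poly" where "m = Polynomial.monom 1 (a - 1)"
  have bij: "bij_betw poly_of_nat {..<b ^ N} V"
    unfolding bij_betw_def
  proof (intro conjI poly_of_nat_inj_on subset_antisym subsetI)
    show "q \<in> V" if "q \<in> poly_of_nat ` {..<b ^ N}" for q
      using that coeff_poly_of_nat_ge by (auto simp: V_def)
    show "q \<in> poly_of_nat ` {..<b ^ N}" if "q \<in> V" for q
      using poly_of_nat_surj[of N q] that by (force simp: V_def)
  qed
  have "(\<Sum>n<b ^ N. ec (frac_coeff p (poly_of_nat n * h) 1)) = (\<Sum>q\<in>V. ec (frac_coeff p (q * h) 1))"
    by (rule sum.reindex_bij_betw[OF bij])
  also have "\<dots> = 0"
  proof -
    let ?S = "\<Sum>q\<in>V. ec (frac_coeff p (q * h) 1)"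
    have mV: "m \<in> V" using a by (auto simp: V_def m_def)
    have bV: "bij_betw (\<lambda>q. q + m) V V"
      by (rule bij_betw_byWitness[of _ "\<lambda>q. q - m"]) (use mV in \<open>auto simp: V_def\<close>)
    have "?S = (\<Sum>q\<in>V. ec (frac_coeff p ((q + m) * h) 1))"
      by (rule sum.reindex_bij_betw[OF bV, symmetric])
    also have "\<dots> = ec (frac_coeff p (m * h) 1) * ?S"
    proof -
      have "ec (frac_coeff p ((q + m) * h) 1) = ec (frac_coeff p (m * h) 1) * ec (frac_coeff p (q * h) 1)" for q
        unfolding distrib_right frac_coeff_add ec_add by (rule mult.commute)
      then show ?thesis by (simp only: sum_distrib_left)
    qed
    finally have "(1 - ec (frac_coeff p (m * h) 1)) * ?S = 0" by (simp add: algebra_simps)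
    moreover have "frac_coeff p (m * h) 1 \<noteq> 0"
      using a unfolding m_def frac_coeff_monom_mult by simp
    ultimately show ?thesis using ec_ne_1 by auto
  qed
  finally show ?thesis .
qed

end


section \<open>Existence of good polynomial lattices\<close>

text \<open>
  Jensen's inequality in the form of subadditivity of concave powers.
\<close>

lemma powr_sum_le:
  fixes x :: "'a \<Rightarrow> real"
  assumes "finite A" "\<And>i. i \<in> A \<Longrightarrow> 0 \<le> x i" "0 < l" "l \<le> 1"
  shows "(\<Sum>i\<in>A. x i) powr l \<le> (\<Sum>i\<in>A. x i powr l)"
  using assms(1,2)
proof (induction A rule: finite_induct)
  case (insert a A)
  define u v where "u = x a" and "v = (\<Sum>i\<in>A. x i)"
  have uv: "0 \<le> u" "0 \<le> v" using insert.prems by (auto simp: u_def v_def intro!: sum_nonneg)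
  have "(u + v) powr l \<le> u powr l + v powr l"
  proof (cases "u + v = 0")
    case False
    then have t: "0 < u + v" using uv by linarith
    have a: "z \<le> z powr l" if "0 \<le> z" "z \<le> 1" for z :: real
      using powr_mono'[of l 1 z] that assms(3,4) by (cases "z = 0") auto
    have "1 = u / (u + v) + v / (u + v)" using t by (simp add: add_divide_distrib[symmetric])
    also have "\<dots> \<le> (u / (u + v)) powr l + (v / (u + v)) powr l"
      using uv t by (intro add_mono a) auto
    also have "\<dots> = (u powr l + v powr l) / (u + v) powr l"
      using uv t by (simp add: powr_divide add_divide_distrib)
    finally show ?thesis using t by (simp add: field_simps)
  qed simp
  then show ?case using insert by (simp add: u_def v_def)
qed simp

context poly_lattice_base
begin

text \<open>
  The nonzero frequencies that the lattice rule cannot tell from the constant.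
\<close>

definition dual_net :: "nat \<Rightarrow> 'p mod_ring poly \<Rightarrow> (nat \<Rightarrow> 'p mod_ring poly) \<Rightarrow> nat set \<Rightarrow> (nat \<Rightarrow> nat) set" where
  "dual_net N p q S = {k \<in> S \<rightarrow>\<^sub>E {..<b ^ N}. (\<exists>j\<in>S. k j \<noteq> 0) \<and> p dvd (\<Sum>j\<in>S. poly_of_nat (k j) * q j)}"

text \<open>
  Expand the product into characters of \<open>\<Sum>j. k\<^sub>j q\<^sub>j\<close>. Averaging over the lattice leaves the frequencies with
  \<open>p\<close> dividing that sum: the zero frequency and the dual net.
\<close>

lemma lattice_product_error:
  fixes c :: "nat \<Rightarrow> nat \<Rightarrow> complex"
  assumes S: "finite S" and p: "p \<noteq> 0" "Polynomial.degree p = N"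
  shows "norm ((\<Sum>n<b ^ N. \<Prod>j\<in>S. \<Sum>k<b ^ N. c j k * cnj (chi N k (grid_index N p (poly_of_nat n * q j)))) / of_nat (b ^ N)
      - (\<Prod>j\<in>S. c j 0)) \<le> (\<Sum>k\<in>dual_net N p q S. \<Prod>j\<in>S. norm (c j (k j)))"
proof -
  let ?K = "S \<rightarrow>\<^sub>E {..<b ^ N}"
  let ?h = "\<lambda>k. \<Sum>j\<in>S. poly_of_nat (k j) * q j"
  let ?T = "\<lambda>k. (\<Sum>n<b ^ N. ec (frac_coeff p (poly_of_nat n * ?h k) 1)) / of_nat (b ^ N)"
  let ?k0 = "\<lambda>j\<in>S. 0 :: nat"
  have fK: "finite ?K" using S by (intro finite_PiE) auto
  have k0: "?k0 \<in> ?K" by auto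
  have ch: "(\<Prod>j\<in>S. cnj (chi N (k j) (grid_index N p (poly_of_nat n * q j)))) = cnj (ec (frac_coeff p (poly_of_nat n * ?h k) 1))"
    if k: "k \<in> ?K" for k n
  proof -
    have "(\<Prod>j\<in>S. chi N (k j) (grid_index N p (poly_of_nat n * q j))) = (\<Prod>j\<in>S. ec (frac_coeff p (poly_of_nat (k j) * (poly_of_nat n * q j)) 1))"
      by (intro prod.cong refl grid_index(3)) (use k in auto)
    also have "\<dots> = ec (frac_coeff p (\<Sum>j\<in>S. poly_of_nat (k j) * (poly_of_nat n * q j)) 1)"
      by (simp only: ec_sum frac_coeff_sum)
    also have "(\<Sum>j\<in>S. poly_of_nat (k j) * (poly_of_nat n * q j)) = poly_of_nat n * ?h k"
      by (simp add: sum_distrib_left mult_ac)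
    finally show ?thesis by (simp flip: cnj_prod)
  qed
  have "(\<Sum>n<b ^ N. \<Prod>j\<in>S. \<Sum>k<b ^ N. c j k * cnj (chi N k (grid_index N p (poly_of_nat n * q j))))
     = (\<Sum>n<b ^ N. \<Sum>k\<in>?K. (\<Prod>j\<in>S. c j (k j)) * cnj (ec (frac_coeff p (poly_of_nat n * ?h k) 1)))"
  proof (intro sum.cong refl)
    fix n
    have "(\<Prod>j\<in>S. \<Sum>k<b ^ N. c j k * cnj (chi N k (grid_index N p (poly_of_nat n * q j))))
      = (\<Sum>k\<in>?K. \<Prod>j\<in>S. c j (k j) * cnj (chi N (k j) (grid_index N p (poly_of_nat n * q j))))"
      by (rule prod_sum_PiE) (use S in auto)
    then show "(\<Prod>j\<in>S. \<Sum>k<b ^ N. c j k * cnj (chi N k (grid_index N p (poly_of_nat n * q j))))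
      = (\<Sum>k\<in>?K. (\<Prod>j\<in>S. c j (k j)) * cnj (ec (frac_coeff p (poly_of_nat n * ?h k) 1)))"
      by (simp add: prod.distrib ch)
  qed
  also have "\<dots> = (\<Sum>k\<in>?K. (\<Prod>j\<in>S. c j (k j)) * (\<Sum>n<b ^ N. cnj (ec (frac_coeff p (poly_of_nat n * ?h k) 1))))"
    by (subst sum.swap) (simp only: sum_distrib_left)
  finally have e1: "(\<Sum>n<b ^ N. \<Prod>j\<in>S. \<Sum>k<b ^ N. c j k * cnj (chi N k (grid_index N p (poly_of_nat n * q j)))) / of_nat (b ^ N)
     = (\<Sum>k\<in>?K. (\<Prod>j\<in>S. c j (k j)) * cnj (?T k))"
    unfolding complex_cnj_divide cnj_sum complex_cnj_of_nat times_divide_eq_right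
    by (simp only: sum_divide_distrib[of _ ?K])
  have T0: "?T ?k0 = 1"
  proof -
    have "?h ?k0 = 0" by (intro sum.neutral) (simp add: poly_of_nat_eq_0_iff)
    then show ?thesis by simp
  qed
  have e2: "(\<Sum>k\<in>?K. (\<Prod>j\<in>S. c j (k j)) * cnj (?T k)) = (\<Prod>j\<in>S. c j 0) + (\<Sum>k\<in>?K - {?k0}. (\<Prod>j\<in>S. c j (k j)) * cnj (?T k))"
    unfolding sum.remove[OF fK k0] T0 by simp
  have e3: "(\<Sum>k\<in>?K - {?k0}. (\<Prod>j\<in>S. c j (k j)) * cnj (?T k)) = (\<Sum>k\<in>dual_net N p q S. (\<Prod>j\<in>S. c j (k j)) * cnj (?T k))"
  proof (rule sum.mono_neutral_right)
    show "finite (?K - {?k0})" using fK by simp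
    show "dual_net N p q S \<subseteq> ?K - {?k0}" by (auto simp: dual_net_def)
    show "\<forall>k\<in>?K - {?k0} - dual_net N p q S. (\<Prod>j\<in>S. c j (k j)) * cnj (?T k) = 0"
    proof
      fix k assume k: "k \<in> ?K - {?k0} - dual_net N p q S"
      have "\<exists>j\<in>S. k j \<noteq> 0"
      proof (rule ccontr)
        assume a: "\<not> (\<exists>j\<in>S. k j \<noteq> 0)"
        have kK: "k \<in> ?K" and ne: "k \<noteq> ?k0" using k by simp_all
        have "k = ?k0"
        proof (rule ext)
          fix x
          show "k x = ?k0 x"
          proof (cases "x \<in> S")
            case True then show ?thesis using a by simp
          next
            case False then show ?thesis using PiE_arb[OF kK False] by simp
          qed
        qed
        then show False using ne by contradiction
      qed
      moreover have "k \<in> ?K" "k \<notin> dual_net N p q S" using k by simp_all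
      ultimately have "\<not> p dvd ?h k" unfolding dual_net_def by blast
      then have "?T k = 0" using character_sum_zero[OF p] by simp
      then show "(\<Prod>j\<in>S. c j (k j)) * cnj (?T k) = 0" by simp
    qed
  qed
  have "norm (\<Sum>k\<in>dual_net N p q S. (\<Prod>j\<in>S. c j (k j)) * cnj (?T k)) \<le> (\<Sum>k\<in>dual_net N p q S. \<Prod>j\<in>S. norm (c j (k j)))"
  proof (rule sum_norm_le)
    fix k
    have "norm (\<Sum>n<b ^ N. ec (frac_coeff p (poly_of_nat n * ?h k) 1)) \<le> (\<Sum>n<b ^ N. 1)"
      by (rule sum_norm_le) simp
    then have "norm (?T k) \<le> 1" by (simp add: norm_divide divide_le_eq norm_power)
    then have "norm (\<Prod>j\<in>S. c j (k j)) * norm (cnj (?T k)) \<le> norm (\<Prod>j\<in>S. c j (k j)) * 1"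
      unfolding complex_mod_cnj by (rule mult_left_mono) simp
    then show "norm ((\<Prod>j\<in>S. c j (k j)) * cnj (?T k)) \<le> (\<Prod>j\<in>S. norm (c j (k j)))"
      unfolding norm_mult prod_norm mult_1_right .
  qed
  then show ?thesis unfolding e1 e2 e3 by simp
qed

definition gen_polys :: "nat \<Rightarrow> 'p mod_ring poly set" where
  "gen_polys N = {q. q \<noteq> 0 \<and> Polynomial.degree q < N}"

lemma card_gen_polys:
  assumes "N \<ge> 1"
  shows "finite (gen_polys N)" "card (gen_polys N) = b ^ N - 1"
proof -
  have "gen_polys N = poly_of_nat ` {1..<b ^ N}"
  proof (intro subset_antisym subsetI)
    fix q :: "'p mod_ring poly" assume "q \<in> gen_polys N"
    then have q: "q \<noteq> 0" "Polynomial.degree q < N" by (auto simp: gen_polys_def)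
    obtain n where n: "n < b ^ N" "poly_of_nat n = q" using poly_of_nat_surj[of N q] coeff_eq_0 q(2) by (metis order.strict_trans2)
    moreover have "n \<noteq> 0" using n q poly_of_nat_eq_0_iff by blast
    ultimately show "q \<in> poly_of_nat ` {1..<b ^ N}" by force
  next
    fix q :: "'p mod_ring poly" assume "q \<in> poly_of_nat ` {1..<b ^ N}"
    then obtain n where n: "1 \<le> n" "n < b ^ N" "q = poly_of_nat n" by auto
    have "q \<noteq> 0" using n poly_of_nat_eq_0_iff by auto
    moreover have "Polynomial.degree q \<le> N - 1" using n coeff_poly_of_nat_ge[OF n(2)] assms by (intro degree_le) auto
    ultimately show "q \<in> gen_polys N" using assms by (auto simp: gen_polys_def)
  qed
  moreover have "inj_on (poly_of_nat :: nat \<Rightarrow> 'p mod_ring poly) {1..<b ^ N}"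
    by (rule inj_on_subset[OF poly_of_nat_inj_on[of N]]) auto
  ultimately show "finite (gen_polys N)" "card (gen_polys N) = b ^ N - 1"
    by (simp_all add: card_image)
qed

text \<open>
  If \<open>k\<^sub>i \<noteq> 0\<close>, fix all other components of \<open>q\<close>. Because \<open>p\<close> is irreducible of degree larger than that of \<open>k\<^sub>i\<close>, the
  residue of \<open>q\<^sub>i\<close> is then determined. So a nonzero frequency is dual to at most one out of \<open>b\<^sup>N - 1\<close> choices.
\<close>

lemma card_dual_le:
  fixes p :: "'p mod_ring poly"
  assumes p: "irreducible p" "Polynomial.degree p = N" and N: "N \<ge> 1"
    and T: "finite T" and S: "S \<subseteq> T" and k: "k \<in> S \<rightarrow>\<^sub>E {..<b ^ N}" "\<exists>j\<in>S. k j \<noteq> 0"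
  shows "card {q \<in> T \<rightarrow>\<^sub>E gen_polys N. p dvd (\<Sum>j\<in>S. poly_of_nat (k j) * q j)} * (b ^ N - 1) \<le> card (T \<rightarrow>\<^sub>E gen_polys N)"
proof -
  obtain j0 where j0: "j0 \<in> S" "k j0 \<noteq> 0" using k by blast
  let ?B = "{q \<in> T \<rightarrow>\<^sub>E gen_polys N. p dvd (\<Sum>j\<in>S. poly_of_nat (k j) * q j)}"
  let ?f = "\<lambda>(q, g). q(j0 := g :: 'p mod_ring poly)"
  have prime: "prime_elem p" using p(1) by (rule field_poly_irreducible_imp_prime)
  have small: "r = 0" if "p dvd r" "Polynomial.degree r < N" for r
    using that p(2) dvd_imp_degree_le by (metis not_le)
  have fS: "finite S" using S T finite_subset by blast
  have inj: "inj_on ?f (?B \<times> gen_polys N)"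
  proof (rule inj_onI)
    fix x y assume x: "x \<in> ?B \<times> gen_polys N" and y: "y \<in> ?B \<times> gen_polys N" and e: "?f x = ?f y"
    obtain q g q' g' where xy: "x = (q, g)" "y = (q', g')" by (metis surj_pair)
    have e': "q(j0 := g) = q'(j0 := g')" using e by (simp add: xy)
    have g: "g = g'" using fun_cong[OF e', of j0] by simp
    have off: "q j = q' j" if "j \<noteq> j0" for j using fun_cong[OF e', of j] that by simp
    have d1: "p dvd (\<Sum>j\<in>S. poly_of_nat (k j) * q j)" and d2: "p dvd (\<Sum>j\<in>S. poly_of_nat (k j) * q' j)"
      using x y by (auto simp: xy)
    have "(\<Sum>j\<in>S. poly_of_nat (k j) * q j) - (\<Sum>j\<in>S. poly_of_nat (k j) * q' j) = (\<Sum>j\<in>S. poly_of_nat (k j) * (q j - q' j))"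
      by (simp add: sum_subtractf right_diff_distrib)
    also have "\<dots> = (\<Sum>j\<in>S. if j = j0 then poly_of_nat (k j0) * (q j0 - q' j0) else 0)"
      by (intro sum.cong) (use off in auto)
    also have "\<dots> = poly_of_nat (k j0) * (q j0 - q' j0)" using j0 fS by (simp add: sum.delta)
    finally have "p dvd poly_of_nat (k j0) * (q j0 - q' j0)" using dvd_diff[OF d1 d2] by simp
    moreover have "\<not> p dvd poly_of_nat (k j0)"
    proof
      assume a: "p dvd poly_of_nat (k j0)"
      have "k j0 < b ^ N" using k j0 by auto
      then have "Polynomial.degree (poly_of_nat (k j0) :: 'p mod_ring poly) \<le> N - 1"
        using coeff_poly_of_nat_ge N by (intro degree_le) auto
      then have "poly_of_nat (k j0) = (0 :: 'p mod_ring poly)" using small[OF a] N by simp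
      then show False using j0(2) poly_of_nat_eq_0_iff[of "k j0"] by simp
    qed
    ultimately have "p dvd q j0 - q' j0" using prime by (simp add: prime_elem_dvd_mult_iff)
    moreover have "Polynomial.degree (q j0 - q' j0) < N"
    proof -
      have "q j0 \<in> gen_polys N" "q' j0 \<in> gen_polys N" using x y j0 S by (auto simp: xy PiE_iff)
      then show ?thesis by (intro degree_diff_less) (auto simp: gen_polys_def)
    qed
    ultimately have "q j0 - q' j0 = 0" by (rule small)
    then have "q = q'" using off by (intro ext) (metis eq_iff_diff_eq_0)
    then show "x = y" using g xy by simp
  qed
  have sub: "?f ` (?B \<times> gen_polys N) \<subseteq> T \<rightarrow>\<^sub>E gen_polys N"
  proof
    fix z assume "z \<in> ?f ` (?B \<times> gen_polys N)"
    then obtain q g where z: "z = q(j0 := g)" "q \<in> T \<rightarrow>\<^sub>E gen_polys N" "g \<in> gen_polys N" by auto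
    then show "z \<in> T \<rightarrow>\<^sub>E gen_polys N" using j0 S by (auto simp: PiE_iff extensional_def)
  qed
  have "card ?B * (b ^ N - 1) = card (?f ` (?B \<times> gen_polys N))"
    using card_image[OF inj] card_gen_polys[OF N] by (simp add: card_cartesian_product)
  also have "\<dots> \<le> card (T \<rightarrow>\<^sub>E gen_polys N)"
    by (rule card_mono[OF _ sub]) (use T card_gen_polys[OF N] in \<open>auto intro: finite_PiE\<close>)
  finally show ?thesis .
qed

text \<open>
  The quality criterion. It is independent of \<open>lam\<close>, so a single choice of generating vector can serve every
  rate of convergence.
\<close>

definition lattice_crit :: "nat \<Rightarrow> (nat set \<Rightarrow> real) \<Rightarrow> nat \<Rightarrow> nat \<Rightarrow> 'p mod_ring poly \<Rightarrow> (nat \<Rightarrow> 'p mod_ring poly) \<Rightarrow> real" where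
  "lattice_crit \<alpha> \<gamma> s N p q = (\<Sum>u\<in>Pow {1..s} - {{}}. \<gamma> u * (\<Sum>k\<in>dual_net N p q u. \<Prod>j\<in>u. C_const b \<alpha> * rho \<alpha> N (k j)))"

text \<open>
  By subadditivity the power \<open>lam\<close> moves onto the single terms. Exchanging the sums, each frequency is counted for at
  most a fraction \<open>1 / (b\<^sup>N - 1)\<close> of the vectors \<open>q\<close>, and the sum over all frequencies factorizes.
\<close>

lemma lattice_crit_average:
  assumes \<alpha>: "\<alpha> \<ge> 2" and N: "N \<ge> 1" and p: "irreducible p" "Polynomial.degree p = N"
    and \<gamma>: "\<And>u. finite u \<Longrightarrow> u \<subseteq> {1..} \<Longrightarrow> \<gamma> u \<ge> 0"
    and lam: "1 / real \<alpha> < lam" "lam \<le> 1"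
  shows "(\<Sum>q\<in>{1..s} \<rightarrow>\<^sub>E gen_polys N. lattice_crit \<alpha> \<gamma> s N p q powr lam) * (real b ^ N - 1)
     \<le> card ({1..s} \<rightarrow>\<^sub>E gen_polys N) * J_const s b \<alpha> lam \<gamma> powr lam"
proof -
  define C where "C = C_const b \<alpha>"
  define Q where "Q = {1..s} \<rightarrow>\<^sub>E gen_polys N"
  define U where "U = Pow {1..s} - {{}}"
  have fQ: "finite Q" unfolding Q_def using card_gen_polys[OF N] by (intro finite_PiE) auto
  have C: "C > 0" using C_const_ge_2[OF \<alpha>] by (simp add: C_def)
  have l0: "lam > 0" using lam by (smt (verit) divide_nonneg_nonneg of_nat_0_le_iff)
  have fU: "finite U" by (simp add: U_def)
  have u: "finite u" "u \<subseteq> {1..s}" "u \<noteq> {}" "\<gamma> u \<ge> 0" if "u \<in> U" for u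
  proof -
    show 1: "u \<subseteq> {1..s}" "u \<noteq> {}" using that by (auto simp: U_def)
    then show 2: "finite u" using finite_subset by blast
    show "\<gamma> u \<ge> 0" using 1 2 by (intro \<gamma>) auto
  qed
  define K where "K = (\<lambda>u :: nat set. {k \<in> u \<rightarrow>\<^sub>E {..<b ^ N}. \<exists>j\<in>u. k j \<noteq> 0})"
  have fK: "finite (K u)" if "u \<in> U" for u
    unfolding K_def by (rule finite_subset[of _ "u \<rightarrow>\<^sub>E {..<b ^ N}"]) (use u[OF that] in \<open>auto intro!: finite_PiE\<close>)
  define D where "D = (\<lambda>q u. {k \<in> K u. p dvd (\<Sum>j\<in>u. poly_of_nat (k j) * q j)})"
  have D: "dual_net N p q u = D q u" for q u by (auto simp: dual_net_def D_def K_def)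
  define R where "R = (\<lambda>(u :: nat set) k. (\<Prod>j\<in>u. C * rho \<alpha> N (k j)))"
  have R: "R u k > 0" for u k unfolding R_def using C rho_pos by (intro prod_pos) auto
  have Bq: "lattice_crit \<alpha> \<gamma> s N p q powr lam \<le> (\<Sum>u\<in>U. \<gamma> u powr lam * (\<Sum>k\<in>D q u. R u k powr lam))" for q
  proof -
    have fD: "finite (D q u)" if "u \<in> U" for u using fK[OF that] by (simp add: D_def)
    have "lattice_crit \<alpha> \<gamma> s N p q powr lam = (\<Sum>u\<in>U. \<gamma> u * (\<Sum>k\<in>D q u. R u k)) powr lam"
      by (simp add: lattice_crit_def D U_def R_def C_def)
    also have "\<dots> \<le> (\<Sum>u\<in>U. (\<gamma> u * (\<Sum>k\<in>D q u. R u k)) powr lam)"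
      using u R by (intro powr_sum_le fU l0 lam mult_nonneg_nonneg sum_nonneg) (auto simp: less_imp_le)
    also have "\<dots> \<le> (\<Sum>u\<in>U. \<gamma> u powr lam * (\<Sum>k\<in>D q u. R u k powr lam))"
    proof (rule sum_mono)
      fix v assume v: "v \<in> U"
      have "(\<gamma> v * (\<Sum>k\<in>D q v. R v k)) powr lam = \<gamma> v powr lam * (\<Sum>k\<in>D q v. R v k) powr lam"
        by (rule powr_mult)
      also have "\<dots> \<le> \<gamma> v powr lam * (\<Sum>k\<in>D q v. R v k powr lam)"
        by (intro mult_left_mono powr_sum_le fD v l0 lam less_imp_le[OF R] powr_ge_zero)
      finally show "(\<gamma> v * (\<Sum>k\<in>D q v. R v k)) powr lam \<le> \<gamma> v powr lam * (\<Sum>k\<in>D q v. R v k powr lam)" .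
    qed
    finally show ?thesis .
  qed
  have bN: "real (b ^ N - 1) = real b ^ N - 1"
    using one_le_power[of b N] b2 by (simp add: of_nat_diff)
  have "(\<Sum>q\<in>Q. lattice_crit \<alpha> \<gamma> s N p q powr lam) \<le> (\<Sum>q\<in>Q. \<Sum>u\<in>U. \<gamma> u powr lam * (\<Sum>k\<in>D q u. R u k powr lam))"
    by (intro sum_mono Bq)
  also have "\<dots> = (\<Sum>u\<in>U. \<gamma> u powr lam * (\<Sum>k\<in>K u. R u k powr lam * card {q \<in> Q. p dvd (\<Sum>j\<in>u. poly_of_nat (k j) * q j)}))"
  proof -
    have "(\<Sum>q\<in>Q. \<Sum>k\<in>D q v. R v k powr lam) = (\<Sum>k\<in>K v. R v k powr lam * card {q \<in> Q. p dvd (\<Sum>j\<in>v. poly_of_nat (k j) * q j)})"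
      if v: "v \<in> U" for v
    proof -
      have "(\<Sum>q\<in>Q. \<Sum>k\<in>D q v. R v k powr lam) = (\<Sum>q\<in>Q. \<Sum>k\<in>K v. if p dvd (\<Sum>j\<in>v. poly_of_nat (k j) * q j) then R v k powr lam else 0)"
        unfolding D_def using fK[OF v] by (simp only: sum.inter_filter)
      also have "\<dots> = (\<Sum>k\<in>K v. \<Sum>q\<in>Q. if p dvd (\<Sum>j\<in>v. poly_of_nat (k j) * q j) then R v k powr lam else 0)"
        by (rule sum.swap)
      also have "\<dots> = (\<Sum>k\<in>K v. R v k powr lam * card {q \<in> Q. p dvd (\<Sum>j\<in>v. poly_of_nat (k j) * q j)})"
        using fQ by (simp add: sum.inter_filter[symmetric] mult.commute)
      finally show ?thesis .
    qed
    then show ?thesis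
      by (subst sum.swap) (simp add: sum_distrib_left[symmetric])
  qed
  finally have "(\<Sum>q\<in>Q. lattice_crit \<alpha> \<gamma> s N p q powr lam) * (real b ^ N - 1) \<le>
     (\<Sum>u\<in>U. \<gamma> u powr lam * (\<Sum>k\<in>K u. R u k powr lam * card {q \<in> Q. p dvd (\<Sum>j\<in>u. poly_of_nat (k j) * q j)})) * (real b ^ N - 1)"
    by (rule mult_right_mono) (use rb2 in simp)
  also have "\<dots> = (\<Sum>u\<in>U. \<gamma> u powr lam * (\<Sum>k\<in>K u. R u k powr lam * real (card {q \<in> Q. p dvd (\<Sum>j\<in>u. poly_of_nat (k j) * q j)} * (b ^ N - 1))))"
    unfolding bN of_nat_mult by (simp add: sum_distrib_right sum_distrib_left mult_ac)
  also have "\<dots> \<le> (\<Sum>u\<in>U. \<gamma> u powr lam * (\<Sum>k\<in>K u. R u k powr lam * real (card Q)))"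
  proof (intro sum_mono mult_left_mono)
    fix v k assume v: "v \<in> U" and k: "k \<in> K v"
    have "card {q \<in> Q. p dvd (\<Sum>j\<in>v. poly_of_nat (k j) * q j)} * (b ^ N - 1) \<le> card Q"
      unfolding Q_def by (rule card_dual_le[OF p N]) (use u[OF v] k in \<open>auto simp: K_def\<close>)
    then show "real (card {q \<in> Q. p dvd (\<Sum>j\<in>v. poly_of_nat (k j) * q j)} * (b ^ N - 1)) \<le> real (card Q)"
      by (rule of_nat_mono)
  qed auto
  also have "\<dots> = real (card Q) * (\<Sum>u\<in>U. \<gamma> u powr lam * (\<Sum>k\<in>K u. R u k powr lam))"
    by (simp add: sum_distrib_left sum_distrib_right mult_ac)
  also have "\<dots> \<le> real (card Q) * (\<Sum>u\<in>U. \<gamma> u powr lam * C powr (lam * real (card u)) * E_const b \<alpha> lam ^ card u)"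
  proof (intro mult_left_mono sum_mono)
    fix v assume v: "v \<in> U"
    have "(\<Sum>k\<in>K v. R v k powr lam) \<le> (\<Sum>k\<in>v \<rightarrow>\<^sub>E {..<b ^ N}. R v k powr lam)"
      by (rule sum_mono2) (use u[OF v] in \<open>auto simp: K_def intro!: finite_PiE\<close>)
    also have "\<dots> = (\<Sum>k\<in>v \<rightarrow>\<^sub>E {..<b ^ N}. \<Prod>j\<in>v. (C * rho \<alpha> N (k j)) powr lam)"
      unfolding R_def using C rho_pos by (intro sum.cong refl prod_powr_distrib)
    also have "\<dots> = (\<Prod>j\<in>v. \<Sum>k<b ^ N. (C * rho \<alpha> N k) powr lam)"
      by (rule prod_sum_PiE[symmetric]) (use u[OF v] in auto)
    also have "\<dots> = (C powr lam * (\<Sum>k<b ^ N. rho \<alpha> N k powr lam)) ^ card v"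
    proof -
      have "(C * rho \<alpha> N k) powr lam = C powr lam * rho \<alpha> N k powr lam" for k
        by (rule powr_mult)
      then show ?thesis by (simp add: sum_distrib_left)
    qed
    also have "\<dots> \<le> (C powr lam * E_const b \<alpha> lam) ^ card v"
      using sum_rho_powr_le[OF \<alpha> lam, of N] by (intro power_mono mult_left_mono mult_nonneg_nonneg sum_nonneg) auto
    also have "\<dots> = C powr (lam * real (card v)) * E_const b \<alpha> lam ^ card v"
      using C by (simp add: power_mult_distrib powr_powr[symmetric] powr_realpow)
    finally have "\<gamma> v powr lam * (\<Sum>k\<in>K v. R v k powr lam) \<le> \<gamma> v powr lam * (C powr (lam * real (card v)) * E_const b \<alpha> lam ^ card v)"
      by (rule mult_left_mono) simp
    then show "\<gamma> v powr lam * (\<Sum>k\<in>K v. R v k powr lam) \<le> \<gamma> v powr lam * C powr (lam * real (card v)) * E_const b \<alpha> lam ^ card v"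
      by (simp add: mult.assoc)
  qed simp
  also have "(\<Sum>u\<in>U. \<gamma> u powr lam * C powr (lam * real (card u)) * E_const b \<alpha> lam ^ card u) = J_const s b \<alpha> lam \<gamma> powr lam"
  proof -
    have E0: "0 \<le> E_const b \<alpha> lam"
      using sum_rho_powr_le[OF \<alpha> lam, of 1] by (rule order.trans[rotated]) (auto intro!: sum_nonneg)
    have "0 \<le> (\<Sum>u\<in>U. \<gamma> u powr lam * C powr (lam * real (card u)) * E_const b \<alpha> lam ^ card u)"
      using E0 by (intro sum_nonneg mult_nonneg_nonneg) auto
    then show ?thesis using l0 by (simp add: J_const_def U_def C_def powr_powr)
  qed
  finally show ?thesis unfolding Q_def .
qed

text \<open>
  The minimizer of the criterion is at most the average in the sense of every power mean, hence satisfies the bounds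
  for all \<open>lam\<close> simultaneously.
\<close>

lemma good_lattice_exists:
  assumes \<alpha>: "\<alpha> \<ge> 2" and N: "N \<ge> 1"
    and \<gamma>: "\<And>u. finite u \<Longrightarrow> u \<subseteq> {1..} \<Longrightarrow> \<gamma> u \<ge> 0"
  shows "\<exists>(p :: 'p mod_ring poly) q. irreducible p \<and> Polynomial.degree p = N \<and> (\<forall>j\<in>{1..s}. q j \<noteq> 0 \<and> Polynomial.degree (q j) < N) \<and>
     (\<forall>lam. 1 / real \<alpha> < lam \<and> lam \<le> 1 \<longrightarrow>
        lattice_crit \<alpha> \<gamma> s N p q \<le> J_const s b \<alpha> lam \<gamma> * (real b ^ N - 1) powr (- 1 / lam))"
proof -
  obtain p :: "'p mod_ring poly" where p: "irreducible p" "Polynomial.degree p = N"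
    using exists_irreducible_poly_degree[OF N] by blast
  define Q where "Q = {1..s} \<rightarrow>\<^sub>E gen_polys N"
  have fQ: "finite Q" unfolding Q_def using card_gen_polys[OF N] by (intro finite_PiE) auto
  have bN: "real b ^ N > 1" using rb2 N by (intro one_less_power) auto
  have "card (gen_polys N) > 0"
    unfolding card_gen_polys(2)[OF N] using one_less_power[of b N] b2 N by simp
  then have "gen_polys N \<noteq> {}" by auto
  then obtain g where "g \<in> gen_polys N" by blast
  then have "(\<lambda>j\<in>{1..s}. g) \<in> Q" by (auto simp: Q_def)
  then have Q0: "Q \<noteq> {}" by blast
  define q where "q = arg_min_on (lattice_crit \<alpha> \<gamma> s N p) Q"
  have q: "q \<in> Q" "\<And>q'. q' \<in> Q \<Longrightarrow> lattice_crit \<alpha> \<gamma> s N p q \<le> lattice_crit \<alpha> \<gamma> s N p q'"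
    unfolding q_def using arg_min_if_finite(1)[OF fQ Q0] arg_min_least[OF fQ Q0] by auto
  have C: "C_const b \<alpha> > 0" using C_const_ge_2[OF \<alpha>] by simp
  have B0: "0 \<le> lattice_crit \<alpha> \<gamma> s N p q" for q
    unfolding lattice_crit_def
  proof (intro sum_nonneg mult_nonneg_nonneg prod_nonneg ballI)
    fix u assume "u \<in> Pow {1..s} - {{}}"
    then have "u \<subseteq> {1..s}" by blast
    then show "0 \<le> \<gamma> u" by (intro \<gamma>) (auto dest: finite_subset[OF _ finite_atLeastAtMost])
  qed (use C rho_pos in \<open>auto simp: less_imp_le\<close>)
  have crit: "lattice_crit \<alpha> \<gamma> s N p q \<le> J_const s b \<alpha> lam \<gamma> * (real b ^ N - 1) powr (- 1 / lam)"
    if lam: "1 / real \<alpha> < lam" "lam \<le> 1" for lam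
  proof -
    have l0: "lam > 0" using lam by (smt (verit) divide_nonneg_nonneg of_nat_0_le_iff)
    define B where "B = lattice_crit \<alpha> \<gamma> s N p q"
    have cQ: "real (card Q) > 0" using fQ Q0 by (simp add: card_gt_0_iff)
    have "real (card Q) * B powr lam * (real b ^ N - 1) = (\<Sum>q'\<in>Q. B powr lam) * (real b ^ N - 1)" by simp
    also have "\<dots> \<le> (\<Sum>q'\<in>Q. lattice_crit \<alpha> \<gamma> s N p q' powr lam) * (real b ^ N - 1)"
      using q B0 l0 bN by (intro mult_right_mono sum_mono powr_mono2) (auto simp: B_def)
    also have "\<dots> \<le> real (card Q) * J_const s b \<alpha> lam \<gamma> powr lam"
      unfolding Q_def by (rule lattice_crit_average[OF \<alpha> N p \<gamma> lam])
    finally have "real (card Q) * (B powr lam * (real b ^ N - 1)) \<le> real (card Q) * J_const s b \<alpha> lam \<gamma> powr lam"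
      by (simp add: mult.assoc)
    then have "B powr lam * (real b ^ N - 1) \<le> J_const s b \<alpha> lam \<gamma> powr lam" using cQ by simp
    then have "(B powr lam * (real b ^ N - 1)) powr (1 / lam) \<le> (J_const s b \<alpha> lam \<gamma> powr lam) powr (1 / lam)"
      using l0 bN by (intro powr_mono2) auto
    moreover have "(B powr lam * (real b ^ N - 1)) powr (1 / lam) = B * (real b ^ N - 1) powr (1 / lam)"
      using l0 bN B0[of q] by (simp add: powr_mult powr_powr B_def)
    moreover have "(J_const s b \<alpha> lam \<gamma> powr lam) powr (1 / lam) = J_const s b \<alpha> lam \<gamma>"
    proof -
      have "J_const s b \<alpha> lam \<gamma> \<ge> 0" by (simp add: J_const_def)
      then show ?thesis using l0 by (simp add: powr_powr)
    qed
    ultimately have le: "B * (real b ^ N - 1) powr (1 / lam) \<le> J_const s b \<alpha> lam \<gamma>" by simp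
    have "B = B * (real b ^ N - 1) powr (1 / lam) * (real b ^ N - 1) powr (- 1 / lam)"
      using bN by (simp add: mult.assoc powr_add[symmetric])
    also have "\<dots> \<le> J_const s b \<alpha> lam \<gamma> * (real b ^ N - 1) powr (- 1 / lam)"
      by (rule mult_right_mono[OF le]) simp
    finally show ?thesis by (simp add: B_def)
  qed
  have "\<forall>j\<in>{1..s}. q j \<noteq> 0 \<and> Polynomial.degree (q j) < N"
    using q(1) by (auto simp: Q_def PiE_iff gen_polys_def)
  then have "irreducible p \<and> Polynomial.degree p = N \<and> (\<forall>j\<in>{1..s}. q j \<noteq> 0 \<and> Polynomial.degree (q j) < N) \<and>
     (\<forall>lam. 1 / real \<alpha> < lam \<and> lam \<le> 1 \<longrightarrow>
        lattice_crit \<alpha> \<gamma> s N p q \<le> J_const s b \<alpha> lam \<gamma> * (real b ^ N - 1) powr (- 1 / lam))"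
    using p crit by (intro conjI allI impI) simp_all
  then show ?thesis by (intro exI)
qed

end


section \<open>Smooth bumps on the unit interval\<close>


text \<open>
  Test functions of one variable, given with all their derivatives. Products of them are the only test functions
  in several variables that are used.
\<close>

definition test1 :: "(nat \<Rightarrow> real \<Rightarrow> real) \<Rightarrow> bool" where
  "test1 \<phi> \<longleftrightarrow> (\<forall>n x. (\<phi> n has_real_derivative \<phi> (Suc n) x) (at x)) \<and>
     (\<exists>l r. 0 < l \<and> r < 1 \<and> (\<forall>x. x \<notin> {l..r} \<longrightarrow> \<phi> 0 x = 0))"

lemma test1_deriv: "test1 \<phi> \<Longrightarrow> (\<phi> n has_real_derivative \<phi> (Suc n) x) (at x)"
  by (simp add: test1_def)

lemma test1_cont: "test1 \<phi> \<Longrightarrow> continuous_on A (\<phi> n)"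
  by (meson DERIV_continuous_on DERIV_subset has_field_derivative_at_within test1_deriv)

lemma test1_support:
  assumes "test1 \<phi>"
  obtains l r where "0 < l" "r < 1" "\<And>n x. x \<notin> {l..r} \<Longrightarrow> \<phi> n x = 0"
proof -
  obtain l r where lr: "0 < l" "r < 1" "\<And>x. x \<notin> {l..r} \<Longrightarrow> \<phi> 0 x = 0"
    using assms unfolding test1_def by blast
  have "\<phi> n x = 0" if "x \<notin> {l..r}" for n x
    using that
  proof (induction n arbitrary: x)
    case 0 then show ?case using lr by simp
  next
    case (Suc n)
    have "((\<lambda>_. 0) has_real_derivative 0) (at x)" by simp
    then have "(\<phi> n has_real_derivative 0) (at x)"
      by (rule has_field_derivative_transform_within_open[of _ _ _ "- {l..r}"]) (use Suc in auto)
    then show ?case using test1_deriv[OF assms, of n x] DERIV_unique by blast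
  qed
  then show ?thesis using that lr by blast
qed

text \<open>
  Bounded Borel functions: the class to which statements about test functions are extended, large enough for
  discontinuous kernels.
\<close>

definition bb :: "(real \<Rightarrow> real) \<Rightarrow> bool" where
  "bb w \<longleftrightarrow> w \<in> borel_measurable borel \<and> (\<exists>B. \<forall>x. \<bar>w x\<bar> \<le> B)"

lemma bb_measurable: "bb w \<Longrightarrow> w \<in> borel_measurable borel" by (simp add: bb_def)

lemma bb_bound: "bb w \<Longrightarrow> \<exists>B>0. \<forall>x. \<bar>w x\<bar> \<le> B"
proof -
  assume "bb w"
  then obtain B where "\<forall>x. \<bar>w x\<bar> \<le> B" by (auto simp: bb_def)
  then have "\<forall>x. \<bar>w x\<bar> \<le> max B 1" by (auto simp: le_max_iff_disj)
  then show ?thesis by (intro exI[of _ "max B 1"]) auto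
qed

lemma test1_bb:
  assumes "test1 \<phi>"
  shows "bb (\<phi> n)"
proof -
  obtain l r where lr: "\<And>n x. x \<notin> {l..r} \<Longrightarrow> \<phi> n x = 0" using test1_support[OF assms] by metis
  have "compact (\<phi> n ` {l..r})" by (intro compact_continuous_image test1_cont[OF assms]) simp
  then obtain B where B: "\<And>x. x \<in> {l..r} \<Longrightarrow> \<bar>\<phi> n x\<bar> \<le> B"
    using compact_imp_bounded by (force simp: bounded_iff)
  have "\<bar>\<phi> n x\<bar> \<le> max B 0" for x using B[of x] lr[of x n] by (cases "x \<in> {l..r}") auto
  moreover have "\<phi> n \<in> borel_measurable borel"
    using test1_cont[OF assms, of UNIV n] by (rule borel_measurable_continuous_onI)
  ultimately show ?thesis by (auto simp: bb_def)
qed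


text \<open>
  Every derivative of \<open>exp (- \<epsilon> / u)\<close> is a combination of such functions, and all of them are flat at \<open>0\<close>.
\<close>

definition flat :: "real \<Rightarrow> nat \<Rightarrow> real \<Rightarrow> real" where
  "flat \<epsilon> m u = (if u > 0 then (1 / u) ^ m * exp (- \<epsilon> / u) else 0)"

lemma flat_mult: "u * flat \<epsilon> (Suc m) u = flat \<epsilon> m u"
  by (simp add: flat_def)

lemma flat_tendsto_0:
  assumes "\<epsilon> > 0"
  shows "(flat \<epsilon> m \<longlongrightarrow> 0) (at 0)"
proof -
  have "((\<lambda>t. (\<epsilon> * t) ^ m / exp (\<epsilon> * t) / \<epsilon> ^ m) \<longlongrightarrow> 0 / \<epsilon> ^ m) at_top"
    by (intro tendsto_divide tendsto_const filterlim_compose[OF tendsto_power_div_exp_0] filterlim_tendsto_pos_mult_at_top[OF tendsto_const])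
      (use assms in \<open>auto intro: filterlim_ident\<close>)
  moreover have "(\<epsilon> * t) ^ m / exp (\<epsilon> * t) / \<epsilon> ^ m = t ^ m * exp (- \<epsilon> * t)" for t
    using assms by (simp add: power_mult_distrib exp_minus divide_inverse)
  ultimately have "((\<lambda>t. t ^ m * exp (- \<epsilon> * t)) \<longlongrightarrow> 0) at_top" by simp
  then have "((\<lambda>u. (inverse u) ^ m * exp (- \<epsilon> * inverse u)) \<longlongrightarrow> 0) (at_right 0)"
    by (rule filterlim_compose) (rule filterlim_inverse_at_top_right)
  moreover have "eventually (\<lambda>u. (inverse u) ^ m * exp (- \<epsilon> * inverse u) = flat \<epsilon> m u) (at_right 0)"
    by (auto simp: eventually_at_filter flat_def divide_inverse)
  ultimately have r: "(flat \<epsilon> m \<longlongrightarrow> 0) (at_right 0)" by (rule Lim_transform_eventually)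
  have "((\<lambda>_. 0) \<longlongrightarrow> (0::real)) (at_left 0)" by simp
  moreover have "eventually (\<lambda>u. 0 = flat \<epsilon> m u) (at_left 0)"
    by (auto simp: eventually_at_filter flat_def)
  ultimately have "(flat \<epsilon> m \<longlongrightarrow> 0) (at_left 0)" by (rule Lim_transform_eventually)
  then show ?thesis using r filterlim_split_at_real by blast
qed

lemma flat_deriv:
  assumes "\<epsilon> > 0"
  shows "(flat \<epsilon> m has_real_derivative (- real m * flat \<epsilon> (Suc m) u + \<epsilon> * flat \<epsilon> (Suc (Suc m)) u)) (at u)"
proof -
  consider "u > 0" | "u < 0" | "u = 0" by linarith
  then show ?thesis
  proof cases
    case 1
    have "((\<lambda>u. (inverse u) ^ m * exp (- \<epsilon> * inverse u)) has_real_derivative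
       (- real m * flat \<epsilon> (Suc m) u + \<epsilon> * flat \<epsilon> (Suc (Suc m)) u)) (at u)"
    proof -
      have d2: "((\<lambda>u. exp (- \<epsilon> * inverse u)) has_real_derivative exp (- \<epsilon> * inverse u) * (\<epsilon> * inverse u ^ 2)) (at u)"
        using 1 by (auto intro!: derivative_eq_intros simp: power2_eq_square)
      show ?thesis
      proof (cases m)
        case 0
        then show ?thesis using d2 1 by (simp add: flat_def divide_inverse power2_eq_square mult_ac)
      next
        case (Suc k)
        have "u \<noteq> 0" using 1 by simp
        from DERIV_mult[OF DERIV_power_Suc[OF DERIV_inverse[OF this], of k] d2] show ?thesis
          unfolding Suc by (rule DERIV_cong) (use 1 in \<open>simp add: flat_def divide_inverse power2_eq_square algebra_simps\<close>)
      qed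
    qed
    then show ?thesis
      by (rule has_field_derivative_transform_within_open[of _ _ _ "{0<..}"]) (use 1 in \<open>auto simp: flat_def divide_inverse\<close>)
  next
    case 2
    have "((\<lambda>u. 0) has_real_derivative 0) (at u)" by simp
    then have "(flat \<epsilon> m has_real_derivative 0) (at u)"
      by (rule has_field_derivative_transform_within_open[of _ _ _ "{..<0}"]) (use 2 in \<open>auto simp: flat_def\<close>)
    then show ?thesis using 2 by (simp add: flat_def)
  next
    case 3
    have "eventually (\<lambda>h. flat \<epsilon> (Suc m) h = (flat \<epsilon> m h - flat \<epsilon> m 0) / (h - 0)) (at 0)"
      by (auto simp: eventually_at_filter flat_def)
    with flat_tendsto_0[OF assms, of "Suc m"]
    have "((\<lambda>h. (flat \<epsilon> m h - flat \<epsilon> m 0) / (h - 0)) \<longlongrightarrow> 0) (at 0)" by (rule Lim_transform_eventually)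
    then show ?thesis unfolding 3 by (simp add: has_field_derivative_iff flat_def)
  qed
qed

definition bump_u :: "real \<Rightarrow> real \<Rightarrow> real poly" where "bump_u c d = [:- c, 1:] * [:d, - 1:]"

lemma poly_bump_u: "poly (bump_u c d) x = (x - c) * (d - x)"
  by (simp add: bump_u_def algebra_simps)

primrec bump_poly :: "real \<Rightarrow> real \<Rightarrow> real \<Rightarrow> nat \<Rightarrow> real poly" where
  "bump_poly \<epsilon> c d 0 = 1"
| "bump_poly \<epsilon> c d (Suc n) = pderiv (bump_poly \<epsilon> c d n) * bump_u c d ^ 2
     - Polynomial.smult (2 * real n) (bump_poly \<epsilon> c d n * pderiv (bump_u c d) * bump_u c d)
     + Polynomial.smult \<epsilon> (bump_poly \<epsilon> c d n * pderiv (bump_u c d))"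

text \<open>
  The \<open>n\<close>-th derivative of \<open>exp (- \<epsilon> / ((x - c) (d - x)))\<close>, extended by \<open>0\<close> outside \<open>(c, d)\<close>. As \<open>\<epsilon>\<close> tends to \<open>0\<close>, the bumps
  increase to the indicator of \<open>(c, d)\<close>.
\<close>

definition bump :: "real \<Rightarrow> real \<Rightarrow> real \<Rightarrow> nat \<Rightarrow> real \<Rightarrow> real" where
  "bump \<epsilon> c d n x = poly (bump_poly \<epsilon> c d n) x * flat \<epsilon> (2 * n) (poly (bump_u c d) x)"

lemma bump_deriv:
  assumes "\<epsilon> > 0"
  shows "(bump \<epsilon> c d n has_real_derivative bump \<epsilon> c d (Suc n) x) (at x)"
proof -
  let ?Q = "bump_poly \<epsilon> c d n" and ?u = "bump_u c d"
  let ?v = "poly ?u x" and ?v' = "poly (pderiv ?u) x"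
  have "((\<lambda>x. flat \<epsilon> (2 * n) (poly ?u x)) has_real_derivative
     (- real (2 * n) * flat \<epsilon> (Suc (2 * n)) ?v + \<epsilon> * flat \<epsilon> (Suc (Suc (2 * n))) ?v) * ?v') (at x)"
    by (rule DERIV_chain2[OF flat_deriv[OF assms] poly_DERIV])
  from DERIV_mult[OF poly_DERIV this]
  have "(bump \<epsilon> c d n has_real_derivative poly (pderiv ?Q) x * flat \<epsilon> (2 * n) ?v
     + (- real (2 * n) * flat \<epsilon> (Suc (2 * n)) ?v + \<epsilon> * flat \<epsilon> (Suc (Suc (2 * n))) ?v) * ?v' * poly ?Q x) (at x)"
    unfolding bump_def[abs_def] .
  moreover have "flat \<epsilon> (2 * n) ?v = ?v * (?v * flat \<epsilon> (Suc (Suc (2 * n))) ?v)" "flat \<epsilon> (Suc (2 * n)) ?v = ?v * flat \<epsilon> (Suc (Suc (2 * n))) ?v"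
    by (simp_all only: flat_mult)
  ultimately show ?thesis
    by (simp add: bump_def power2_eq_square algebra_simps)
qed

lemma bump_0: "bump \<epsilon> c d 0 x = (if c < x \<and> x < d then exp (- \<epsilon> / ((x - c) * (d - x))) else 0)"
  if "c \<le> d"
  using that by (auto simp: bump_def flat_def poly_bump_u zero_less_mult_iff not_less)

lemma test1_bump:
  assumes "\<epsilon> > 0" "0 < c" "c \<le> d" "d < 1"
  shows "test1 (bump \<epsilon> c d)"
  unfolding test1_def
proof (intro conjI allI bump_deriv[OF assms(1)])
  have "0 < c \<and> d < 1 \<and> (\<forall>x. x \<notin> {c..d} \<longrightarrow> bump \<epsilon> c d 0 x = 0)" using assms by (auto simp: bump_0)
  then show "\<exists>l r. 0 < l \<and> r < 1 \<and> (\<forall>x. x \<notin> {l..r} \<longrightarrow> bump \<epsilon> c d 0 x = 0)" by blast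
qed

lemma bump_0_bounds: "c \<le> d \<Longrightarrow> \<epsilon> > 0 \<Longrightarrow> 0 \<le> bump \<epsilon> c d 0 x \<and> bump \<epsilon> c d 0 x \<le> 1"
  by (auto simp: bump_0)


definition U1 :: "real measure" where "U1 = restrict_space lborel {0..<1}"

lemma space_U1 [simp]: "space U1 = {0..<1}" by (simp add: U1_def)

lemma prob_space_U1: "prob_space U1"
proof
  show "emeasure U1 (space U1) = 1" by (simp add: U1_def emeasure_restrict_space)
qed

lemma measurable_U1 [measurable (raw)]: "w \<in> borel_measurable borel \<Longrightarrow> w \<in> borel_measurable U1"
  unfolding U1_def by (intro measurable_restrict_space1) simp

lemma sets_U1: "A \<in> sets U1 \<longleftrightarrow> A \<in> sets borel \<and> A \<subseteq> {0..<1}"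
  by (auto simp: U1_def sets_restrict_space_iff)

lemma AE_U1_ne: "AE x in U1. x \<noteq> a"
proof -
  have "AE x in lborel. x \<noteq> (a::real)" by (rule AE_lborel_singleton)
  then show ?thesis unfolding U1_def by (subst AE_restrict_space_iff) auto
qed

lemma integrable_U1_bb: "bb w \<Longrightarrow> integrable U1 w"
proof -
  assume w: "bb w"
  interpret prob_space U1 by (rule prob_space_U1)
  obtain B where "\<forall>x. \<bar>w x\<bar> \<le> B" using w by (auto simp: bb_def)
  then show ?thesis by (intro integrable_const_bound[of _ B]) (use bb_measurable[OF w] in auto)
qed

lemma integrable_mult_bb: "integrable M k \<Longrightarrow> f \<in> borel_measurable M \<Longrightarrow> (\<And>x. \<bar>f x\<bar> \<le> B) \<Longrightarrow> integrable M (\<lambda>x. k x * f x)"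
  for k f :: "'a \<Rightarrow> real"
proof -
  assume a: "integrable M k" "f \<in> borel_measurable M" "\<And>x. \<bar>f x\<bar> \<le> B"
  have B: "B \<ge> 0" using a(3) abs_ge_zero order.trans by blast
  show ?thesis
  proof (rule Bochner_Integration.integrable_bound)
    show "integrable M (\<lambda>x. B * k x)" using a by simp
    show "AE x in M. norm (k x * f x) \<le> norm (B * k x)"
      using a(3) B by (auto simp: abs_mult mult.commute intro!: mult_right_mono)
  qed (use a in measurable)
qed

lemma bump_interval_limit:
  assumes k: "integrable U1 k"
    and z: "\<And>\<epsilon> c d. \<epsilon> > 0 \<Longrightarrow> 0 < c \<Longrightarrow> c < d \<Longrightarrow> d < 1 \<Longrightarrow> (\<integral>x. k x * bump \<epsilon> c d 0 x \<partial>U1) = 0"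
  shows "(\<integral>x. indicator {a<..<e} x * k x \<partial>U1) = 0"
proof -
  define c d where "c = max a 0" and "d = min e 1"
  show ?thesis
  proof (cases "c < d")
    case False
    have "AE x in U1. indicator {a<..<e} x * k x = 0"
      using AE_U1_ne[of 0] AE_space[of U1] by eventually_elim (use False in \<open>auto simp: c_def d_def indicator_def split: if_splits\<close>)
    then have "(\<integral>x. indicator {a<..<e} x * k x \<partial>U1) = (\<integral>x. 0 \<partial>U1)"
      by (intro integral_cong_AE) (use k in auto)
    then show ?thesis by simp
  next
    case True
    define \<delta> where "\<delta> = (\<lambda>n::nat. (d - c) / (real n + 3))"
    have \<delta>: "\<delta> n > 0" "2 * \<delta> n < d - c" for n
    proof -
      show "\<delta> n > 0" using True by (auto simp: \<delta>_def)
      have "\<delta> n \<le> (d - c) / 3" unfolding \<delta>_def using True by (intro divide_left_mono) auto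
      then have "2 * \<delta> n \<le> 2 * ((d - c) / 3)" by simp
      also have "\<dots> < d - c" using True by simp
      finally show "2 * \<delta> n < d - c" .
    qed
    have \<delta>0: "\<delta> \<longlonglongrightarrow> 0" unfolding \<delta>_def by real_asymp
    define B where "B = (\<lambda>n. bump (inverse (real (Suc n))) (c + \<delta> n) (d - \<delta> n) 0)"
    have cd: "c + \<delta> n < d - \<delta> n" for n using \<delta>[of n] by linarith
    have c0: "0 \<le> c" "d \<le> 1" by (auto simp: c_def d_def)
    have lim: "(\<lambda>n. B n x) \<longlonglongrightarrow> indicator {c<..<d} x" for x
    proof (cases "c < x \<and> x < d")
      case True
      have "(\<lambda>n. c + \<delta> n) \<longlonglongrightarrow> c + 0" "(\<lambda>n. d - \<delta> n) \<longlonglongrightarrow> d - 0" by (intro tendsto_intros \<delta>0)+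
      then have "eventually (\<lambda>n. c + \<delta> n < x) sequentially" "eventually (\<lambda>n. x < d - \<delta> n) sequentially"
        using True by (auto dest: order_tendstoD)
      then have "eventually (\<lambda>n. exp (- inverse (real (Suc n)) / ((x - (c + \<delta> n)) * (d - \<delta> n - x))) = B n x) sequentially"
        by eventually_elim (use cd in \<open>auto simp: B_def bump_0 less_imp_le\<close>)
      moreover have "(\<lambda>n. exp (- inverse (real (Suc n)) / ((x - (c + \<delta> n)) * (d - \<delta> n - x)))) \<longlonglongrightarrow> exp (- 0 / ((x - (c + 0)) * (d - 0 - x)))"
        by (intro tendsto_intros \<delta>0 LIMSEQ_inverse_real_of_nat) (use True in auto)
      ultimately show ?thesis using True by (auto intro: Lim_transform_eventually)
    next
      case False
      then have "B n x = 0" for n using cd[of n] \<delta>[of n] by (auto simp: B_def bump_0)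
      then show ?thesis using False by (auto simp: indicator_def)
    qed
    have "(\<lambda>n. \<integral>x. k x * B n x \<partial>U1) \<longlonglongrightarrow> (\<integral>x. k x * indicator {c<..<d} x \<partial>U1)"
    proof (rule integral_dominated_convergence[where w = "\<lambda>x. \<bar>k x\<bar>"])
      show "AE x in U1. (\<lambda>n. k x * B n x) \<longlonglongrightarrow> k x * indicator {c<..<d} x"
        by (intro AE_I2 tendsto_intros lim)
      fix n
      have t: "test1 (bump (inverse (real (Suc n))) (c + \<delta> n) (d - \<delta> n))"
        by (rule test1_bump) (use \<delta>[of n] c0 cd[of n] in auto)
      have [measurable]: "B n \<in> borel_measurable borel"
        using test1_bb[OF t, of 0] by (simp add: B_def bb_def)
      show "(\<lambda>x. k x * B n x) \<in> borel_measurable U1" using k by measurable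
      show "AE x in U1. norm (k x * B n x) \<le> \<bar>k x\<bar>"
      proof (intro AE_I2)
        fix x
        have "\<bar>B n x\<bar> \<le> 1" using bump_0_bounds[of "c + \<delta> n" "d - \<delta> n" "inverse (real (Suc n))" x] cd[of n] by (simp add: B_def)
        then show "norm (k x * B n x) \<le> \<bar>k x\<bar>" by (simp add: abs_mult mult_left_le)
      qed
    qed (use k in auto)
    moreover have Bz: "(\<integral>x. k x * B n x \<partial>U1) = 0" for n
      unfolding B_def by (rule z) (use \<delta>[of n] c0 cd[of n] in auto)
    ultimately have "(\<lambda>n. 0) \<longlonglongrightarrow> (\<integral>x. k x * indicator {c<..<d} x \<partial>U1)" by (simp only: Bz)
    then have "(\<integral>x. k x * indicator {c<..<d} x \<partial>U1) = 0"
      by (rule LIMSEQ_unique[OF _ tendsto_const])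
    moreover have "(\<integral>x. indicator {a<..<e} x * k x \<partial>U1) = (\<integral>x. k x * indicator {c<..<d} x \<partial>U1)"
    proof (intro integral_cong_AE)
      show "AE x in U1. indicator {a<..<e} x * k x = k x * indicator {c<..<d} x"
        using AE_U1_ne[of 0] AE_space[of U1] by eventually_elim (auto simp: c_def d_def indicator_def)
    qed (use k in auto)
    ultimately show ?thesis by simp
  qed
qed

text \<open>
  The bumps converge boundedly to indicators of intervals, which generate the Borel sets.
\<close>

lemma fundamental_lemma_U1:
  assumes k: "integrable U1 k"
    and z: "\<And>\<epsilon> c d. \<epsilon> > 0 \<Longrightarrow> 0 < c \<Longrightarrow> c < d \<Longrightarrow> d < 1 \<Longrightarrow> (\<integral>x. k x * bump \<epsilon> c d 0 x \<partial>U1) = 0"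
  shows "AE x in U1. k x = 0"
proof -
  interpret prob_space U1 by (rule prob_space_U1)
  define P where "P = (\<lambda>A. (\<integral>x. indicator A x * k x \<partial>U1) = 0)"
  have ind: "integrable U1 (\<lambda>x. indicator A x * k x)" if "A \<in> sets borel" for A
    using integrable_mult_bb[OF k, of "indicator A" 1] that by (auto simp: mult.commute)
  have iv: "P {a<..<e}" for a e unfolding P_def by (rule bump_interval_limit[OF k z])
  have P: "P A" if "A \<in> sets borel" for A
    using that
  proof (induction rule: borel_set_induct)
    case empty show ?case by (simp add: P_def)
  next
    case (interval a e)
    have "(\<integral>x. indicator {a..e} x * k x \<partial>U1) = (\<integral>x. indicator {a<..<e} x * k x \<partial>U1)"
    proof (intro integral_cong_AE)
      show "AE x in U1. indicator {a..e} x * k x = indicator {a<..<e} x * k x"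
        using AE_U1_ne[of a] AE_U1_ne[of e] by eventually_elim (auto simp: indicator_def)
    qed (use k in auto)
    then show ?case using iv[of a e] by (simp add: P_def)
  next
    case (compl A)
    have "(\<integral>x. k x \<partial>U1) = (\<integral>x. indicator {-1<..<2} x * k x \<partial>U1)"
      by (intro Bochner_Integration.integral_cong) auto
    also have "\<dots> = 0" using iv[of "-1" 2] by (simp add: P_def)
    finally have k0: "(\<integral>x. k x \<partial>U1) = 0" .
    have "(\<integral>x. indicator (- A) x * k x \<partial>U1) = (\<integral>x. k x - indicator A x * k x \<partial>U1)"
      by (intro Bochner_Integration.integral_cong) (auto simp: indicator_def)
    also have "\<dots> = 0" using k0 compl ind[OF compl(1)] k by (simp add: P_def)
    finally show ?case by (simp add: P_def)
  next
    case (union A)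
    let ?A = "\<lambda>i. A i \<inter> {0..<1}"
    have e: "(\<integral>x. indicator B x * k x \<partial>U1) = (LINT x:(B \<inter> {0..<1})|U1. k x)" for B
      unfolding set_lebesgue_integral_def by (intro Bochner_Integration.integral_cong) (auto simp: indicator_def)
    have z: "(LINT x:(?A i)|U1. k x) = 0" for i using union(3)[of i] unfolding P_def e .
    have "(LINT x:(\<Union>i. ?A i)|U1. k x) = (\<Sum>i. (LINT x:(?A i)|U1. k x))"
    proof (rule lebesgue_integral_countable_add)
      show "?A i \<in> sets U1" for i using union by (auto simp: sets_U1)
      show "i \<noteq> j \<Longrightarrow> ?A i \<inter> ?A j = {}" for i j using union by (auto simp: disjoint_family_on_def)
      have "integrable U1 (\<lambda>x. indicator (\<Union>i. ?A i) x * k x)" using union by (intro ind) auto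
      then show "set_integrable U1 (\<Union>i. ?A i) k" by (simp add: set_integrable_def)
    qed
    then have "(LINT x:(\<Union>i. ?A i)|U1. k x) = 0" using z by simp
    moreover have "(\<Union>i. ?A i) = (\<Union>i. A i) \<inter> {0..<1}" by blast
    ultimately show ?case unfolding P_def e by simp
  qed
  show ?thesis
  proof (rule density_zero[OF k])
    fix A assume "A \<in> sets U1"
    then have "P A" using P by (simp add: sets_U1)
    then show "set_lebesgue_integral U1 A k = 0" by (simp add: P_def set_lebesgue_integral_def)
  qed
qed


section \<open>Integration by parts for weak derivatives\<close>

lemma cube_measure_eq: "cube_measure v = PiM v (\<lambda>_. U1)"
  by (simp add: cube_measure_def U1_def)

lemma prob_space_cube: "prob_space (cube_measure v)"
  unfolding cube_measure_eq by (intro prob_space_PiM prob_space_U1)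

lemma space_cube: "space (cube_measure v) = v \<rightarrow>\<^sub>E {0..<1}"
  by (simp add: cube_measure_eq space_PiM)

lemma measurable_cube_component [measurable (raw)]:
  assumes "f \<in> borel_measurable borel" "j \<in> I"
  shows "(\<lambda>x. f (x j)) \<in> borel_measurable (cube_measure I)"
  unfolding cube_measure_eq
  by (rule measurable_compose[OF measurable_component_singleton[OF assms(2)]]) (use assms in measurable)

lemma prod_bb:
  assumes "finite T" "S \<subseteq> T" "\<And>i. i \<in> S \<Longrightarrow> bb (w i)"
  shows "(\<lambda>x. \<Prod>i\<in>S. w i (x i)) \<in> borel_measurable (cube_measure T)"
    and "\<exists>B>0. \<forall>x. \<bar>\<Prod>i\<in>S. w i (x i)\<bar> \<le> B"
proof -
  show "(\<lambda>x. \<Prod>i\<in>S. w i (x i)) \<in> borel_measurable (cube_measure T)"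
    by (intro borel_measurable_prod measurable_cube_component bb_measurable assms) (use assms in auto)
  have "\<forall>i\<in>S. \<exists>B>0. \<forall>x. \<bar>w i x\<bar> \<le> B" using assms(3) bb_bound by blast
  then obtain B where B: "\<forall>i\<in>S. B i > 0 \<and> (\<forall>x. \<bar>w i x\<bar> \<le> B i)" by metis
  have "\<bar>\<Prod>i\<in>S. w i (x i)\<bar> \<le> (\<Prod>i\<in>S. B i)" for x
    unfolding abs_prod by (rule prod_mono) (use B in auto)
  moreover have "(\<Prod>i\<in>S. B i) > 0" using B by (intro prod_pos) auto
  ultimately show "\<exists>B>0. \<forall>x. \<bar>\<Prod>i\<in>S. w i (x i)\<bar> \<le> B" by blast
qed

lemma integrable_mult_prod_bb:
  assumes "finite T" "S \<subseteq> T" "\<And>i. i \<in> S \<Longrightarrow> bb (w i)" "integrable (cube_measure T) G"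
  shows "integrable (cube_measure T) (\<lambda>x. G x * (\<Prod>i\<in>S. w i (x i)))"
proof -
  have "\<exists>B>0. \<forall>x. \<bar>\<Prod>i\<in>S. w i (x i)\<bar> \<le> B"
    by (rule prod_bb(2)[OF assms(1,2)]) (rule assms(3))
  then obtain B where B: "\<And>x. \<bar>\<Prod>i\<in>S. w i (x i)\<bar> \<le> B" by blast
  have "(\<lambda>x. \<Prod>i\<in>S. w i (x i)) \<in> borel_measurable (cube_measure T)"
    by (rule prod_bb(1)[OF assms(1,2)]) (rule assms(3))
  then show ?thesis by (rule integrable_mult_bb[OF assms(4) _ B])
qed

lemma integrable_mult_component:
  assumes "integrable (cube_measure T) K" "bb f" "j \<in> T"
  shows "integrable (cube_measure T) (\<lambda>x. K x * f (x j))"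
proof -
  obtain B where "\<forall>x. \<bar>f x\<bar> \<le> B" using assms(2) by (auto simp: bb_def)
  then show ?thesis by (intro integrable_mult_bb[OF assms(1) measurable_cube_component[OF bb_measurable[OF assms(2)] assms(3)]]) auto
qed

text \<open>
  Integrate out all other coordinates: by Fubini the integral against a function of \<open>x j\<close> is one over the unit interval.
\<close>

lemma cube_marginal:
  assumes I: "finite T" "j \<in> T" and K: "integrable (cube_measure T) K"
  shows "\<exists>k. integrable U1 k \<and> (\<forall>f. bb f \<longrightarrow> (\<integral>x. K x * f (x j) \<partial>cube_measure T) = (\<integral>t. k t * f t \<partial>U1))"
proof -
  define J where "J = T - {j}"
  have T: "T = insert j J" using I by (auto simp: J_def)
  let ?N = "PiM J (\<lambda>_. U1)"
  interpret U: prob_space U1 by (rule prob_space_U1)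
  interpret N: prob_space ?N by (intro prob_space_PiM prob_space_U1)
  interpret P: pair_sigma_finite U1 ?N ..
  let ?T = "\<lambda>(t, X). X(j := t)"
  have meas: "?T \<in> measurable (U1 \<Otimes>\<^sub>M ?N) (PiM T (\<lambda>_. U1))"
  proof -
    have "(\<lambda>(f, y). f(j := y)) \<circ> (\<lambda>(x, y). (y, x)) \<in> measurable (U1 \<Otimes>\<^sub>M ?N) (PiM (insert j J) (\<lambda>_. U1))"
      by (intro measurable_comp[OF measurable_pair_swap' measurable_add_dim])
    then show ?thesis unfolding T by (simp add: comp_def case_prod_beta')
  qed
  have D: "distr (U1 \<Otimes>\<^sub>M ?N) (PiM T (\<lambda>_. U1)) ?T = cube_measure T"
    unfolding cube_measure_eq T by (rule distr_pair_PiM_eq_PiM) (rule prob_space_U1)+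
  define k where "k = (\<lambda>t. \<integral>X. K (X(j := t)) \<partial>?N)"
  have int: "integrable (U1 \<Otimes>\<^sub>M ?N) (\<lambda>z. L (?T z))" if "integrable (cube_measure T) L" for L :: "(nat \<Rightarrow> real) \<Rightarrow> real"
    using integrable_distr[OF meas, of L] that D by simp
  have val: "(\<integral>x. L x \<partial>cube_measure T) = (\<integral>t. \<integral>X. L (X(j := t)) \<partial>?N \<partial>U1)" if L: "integrable (cube_measure T) L" for L :: "(nat \<Rightarrow> real) \<Rightarrow> real"
  proof -
    have "(\<integral>x. L x \<partial>cube_measure T) = (\<integral>z. L (?T z) \<partial>(U1 \<Otimes>\<^sub>M ?N))"
      unfolding D[symmetric] by (rule integral_distr[OF meas]) (use L in \<open>simp add: cube_measure_eq borel_measurable_integrable\<close>)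
    also have "\<dots> = (\<integral>t. \<integral>X. L (?T (t, X)) \<partial>?N \<partial>U1)"
      by (rule P.integral_fst'[symmetric, OF int[OF L]])
    finally show ?thesis by simp
  qed
  have "integrable U1 k"
    unfolding k_def using P.integrable_fst'[OF int[OF K]] by simp
  moreover have "(\<integral>x. K x * f (x j) \<partial>cube_measure T) = (\<integral>t. k t * f t \<partial>U1)" if f: "bb f" for f
    unfolding val[OF integrable_mult_component[OF K f I(2)]] k_def by simp
  ultimately show ?thesis by blast
qed

lemma cube_marginal_zero:
  assumes I: "finite T" "j \<in> T" and K: "integrable (cube_measure T) K"
    and z: "\<And>\<psi>. test1 \<psi> \<Longrightarrow> (\<integral>x. K x * \<psi> 0 (x j) \<partial>cube_measure T) = 0"
    and f: "bb f"
  shows "(\<integral>x. K x * f (x j) \<partial>cube_measure T) = 0"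
proof -
  obtain k where k: "integrable U1 k" "\<And>f. bb f \<Longrightarrow> (\<integral>x. K x * f (x j) \<partial>cube_measure T) = (\<integral>t. k t * f t \<partial>U1)"
    using cube_marginal[OF I K] by blast
  have "AE t in U1. k t = 0"
  proof (rule fundamental_lemma_U1[OF k(1)])
    fix \<epsilon> c d :: real assume a: "\<epsilon> > 0" "0 < c" "c < d" "d < 1"
    have t: "test1 (bump \<epsilon> c d)" by (rule test1_bump) (use a in auto)
    show "(\<integral>x. k x * bump \<epsilon> c d 0 x \<partial>U1) = 0"
      using k(2)[OF test1_bb[OF t, of 0]] z[OF t] by simp
  qed
  then have "(\<integral>t. k t * f t \<partial>U1) = (\<integral>t. 0 \<partial>U1)"
    by (intro integral_cong_AE) (use k(1) bb_measurable[OF f] in auto)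
  then show ?thesis using k(2)[OF f] by simp
qed

lemma U1_integral_eq:
  assumes f: "bb f" and I: "(f has_integral I) {0..x}" and x: "0 \<le> x" "x \<le> 1"
  shows "(\<integral>t. f t * indicator {0..<x} t \<partial>U1) = I"
proof -
  obtain B where B: "\<forall>x. \<bar>f x\<bar> \<le> B" using f by (auto simp: bb_def)
  have [measurable]: "f \<in> borel_measurable borel" by (rule bb_measurable[OF f])
  have "integrable lborel (\<lambda>t. indicator {0..x} t *\<^sub>R f t)"
    by (rule integrableI_bounded_set_indicator[where B = B]) (use B x in auto)
  then have "set_integrable lborel {0..x} f" by (simp add: set_integrable_def)
  then have I': "(LINT t:{0..x}|lborel. f t) = I"
    using set_borel_integral_eq_integral(2) integral_unique[OF I] by metis
  have "(\<integral>t. f t * indicator {0..<x} t \<partial>U1) = (\<integral>t. indicator {0..<1} t *\<^sub>R (f t * indicator {0..<x} t) \<partial>lborel)"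
    unfolding U1_def by (rule integral_restrict_space) simp
  also have "\<dots> = (\<integral>t. indicator {0..x} t *\<^sub>R f t \<partial>lborel)"
  proof (rule integral_cong_AE)
    have "AE t in lborel. t \<noteq> x" by (rule AE_lborel_singleton)
    then show "AE t in lborel. indicator {0..<1} t *\<^sub>R (f t * indicator {0..<x} t) = indicator {0..x} t *\<^sub>R f t"
      by eventually_elim (use x in \<open>auto simp: indicator_def\<close>)
  qed auto
  also have "\<dots> = I" using I' by (simp add: set_lebesgue_integral_def)
  finally show ?thesis .
qed

lemma U1_integral_eq_1:
  assumes f: "bb f" and I: "(f has_integral I) {0..1}"
  shows "(\<integral>t. f t \<partial>U1) = I"
proof -
  have "(\<integral>t. f t \<partial>U1) = (\<integral>t. f t * indicator {0..<1} t \<partial>U1)"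
    by (intro Bochner_Integration.integral_cong) auto
  then show ?thesis using U1_integral_eq[OF f I] by simp
qed

lemma test1_FTC:
  assumes "test1 \<phi>" "0 \<le> x"
  shows "(\<phi> (Suc 0) has_integral \<phi> 0 x) {0..x}"
proof -
  have "(\<phi> (Suc 0) has_integral (\<phi> 0 x - \<phi> 0 0)) {0..x}"
    by (rule fundamental_theorem_of_calculus[OF assms(2)])
      (use test1_deriv[OF assms(1)] in \<open>auto simp: has_real_derivative_iff_has_vector_derivative[symmetric] intro: has_field_derivative_at_within\<close>)
  moreover have "\<phi> 0 0 = 0" using assms(1) by (auto elim!: test1_support[of \<phi>])
  ultimately show ?thesis by simp
qed

lemma test1_diff_scale:
  assumes "test1 \<psi>" "test1 \<rho>"
  shows "test1 (\<lambda>n x. \<psi> n x - a * \<rho> n x)"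
proof -
  obtain l r where lr: "0 < l" "r < 1" "\<And>n x. x \<notin> {l..r} \<Longrightarrow> \<psi> n x = 0" using test1_support[OF assms(1)] by metis
  obtain l' r' where lr': "0 < l'" "r' < 1" "\<And>n x. x \<notin> {l'..r'} \<Longrightarrow> \<rho> n x = 0" using test1_support[OF assms(2)] by metis
  have "\<psi> 0 x - a * \<rho> 0 x = 0" if "x \<notin> {min l l'..max r r'}" for x
  proof -
    have "\<psi> 0 x = 0" by (rule lr(3)) (use that in auto)
    moreover have "\<rho> 0 x = 0" by (rule lr'(3)) (use that in auto)
    ultimately show ?thesis by simp
  qed
  moreover have "0 < min l l'" "max r r' < 1" using lr lr' by auto
  ultimately have "\<exists>l r. 0 < l \<and> r < 1 \<and> (\<forall>x. x \<notin> {l..r} \<longrightarrow> \<psi> 0 x - a * \<rho> 0 x = 0)" by blast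
  moreover have "\<forall>n x. ((\<lambda>x. \<psi> n x - a * \<rho> n x) has_real_derivative \<psi> (Suc n) x - a * \<rho> (Suc n) x) (at x)"
    by (intro allI DERIV_diff DERIV_cmult test1_deriv assms)
  ultimately show ?thesis unfolding test1_def by blast
qed

lemma test1_primitive:
  assumes \<eta>: "test1 \<eta>" and z: "(\<integral>t. \<eta> 0 t \<partial>U1) = 0"
  shows "\<exists>\<Phi>. test1 \<Phi> \<and> \<Phi> (Suc 0) = \<eta> 0"
proof -
  obtain l r where lr: "0 < l" "r < 1" "\<And>n x. x \<notin> {l..r} \<Longrightarrow> \<eta> n x = 0" using test1_support[OF \<eta>] by metis
  obtain g where g: "\<And>x. x \<in> {0..1} \<Longrightarrow> (g has_vector_derivative \<eta> 0 x) (at x within {0..1})"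
    using antiderivative_continuous[OF test1_cont[OF \<eta>, of "{0..1}" 0]] by metis
  have ftc: "(\<eta> 0 has_integral (g y - g x)) {x..y}" if "0 \<le> x" "x \<le> y" "y \<le> 1" for x y
  proof (rule fundamental_theorem_of_calculus[OF that(2)])
    fix t assume "t \<in> {x..y}"
    then show "(g has_vector_derivative \<eta> 0 t) (at t within {x..y})"
      using that by (intro has_vector_derivative_within_subset[OF g]) auto
  qed
  have zero: "g y = g x" if "0 \<le> x" "x \<le> y" "y \<le> 1" "\<And>t. t \<in> {x..y} \<Longrightarrow> \<eta> 0 t = 0" for x y
  proof -
    have "(\<eta> 0 has_integral 0) {x..y}" by (rule has_integral_is_0) (use that(4) in auto)
    from has_integral_unique[OF ftc[OF that(1-3)] this] show ?thesis by simp
  qed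
  have g10: "g 1 = g 0"
    using U1_integral_eq_1[OF test1_bb[OF \<eta>] ftc[of 0 1]] z by simp
  define \<Phi>0 where "\<Phi>0 = (\<lambda>x. if 0 < x \<and> x < 1 then g x - g 0 else 0)"
  have left: "\<Phi>0 x = 0" if "x < l" for x
  proof (cases "0 < x \<and> x < 1")
    case True
    then have "g x = g 0" using that lr by (intro zero) auto
    then show ?thesis by (simp add: \<Phi>0_def)
  qed (auto simp: \<Phi>0_def)
  have right: "\<Phi>0 x = 0" if "r < x" for x
  proof (cases "0 < x \<and> x < 1")
    case True
    then have "g 1 = g x" using that lr by (intro zero) auto
    then show ?thesis using g10 by (simp add: \<Phi>0_def)
  qed (auto simp: \<Phi>0_def)
  have "(\<Phi>0 has_real_derivative \<eta> 0 x) (at x)" for x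
  proof -
    consider "x < l" | "r < x" | "0 < x" "x < 1" using lr by linarith
    then show ?thesis
    proof cases
      case 1
      have "((\<lambda>_. 0) has_real_derivative 0) (at x)" by simp
      then have "(\<Phi>0 has_real_derivative 0) (at x)"
        by (rule has_field_derivative_transform_within_open[of _ _ _ "{..<l}"]) (use 1 left in auto)
      then show ?thesis using lr(3)[of x 0] 1 by simp
    next
      case 2
      have "((\<lambda>_. 0) has_real_derivative 0) (at x)" by simp
      then have "(\<Phi>0 has_real_derivative 0) (at x)"
        by (rule has_field_derivative_transform_within_open[of _ _ _ "{r<..}"]) (use 2 right in auto)
      then show ?thesis using lr(3)[of x 0] 2 by simp
    next
      case 3
      have "(g has_vector_derivative \<eta> 0 x) (at x within {0..1})" using g 3 by simp
      then have "(g has_vector_derivative \<eta> 0 x) (at x within {0<..<1})"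
        by (rule has_vector_derivative_within_subset) auto
      then have "(g has_vector_derivative \<eta> 0 x) (at x)"
        using 3 at_within_open[of x "{0<..<1}"] by simp
      then have "(g has_real_derivative \<eta> 0 x) (at x)"
        unfolding has_real_derivative_iff_has_vector_derivative .
      then have "((\<lambda>x. g x - g 0) has_real_derivative \<eta> 0 x) (at x)"
        by (auto intro!: derivative_eq_intros)
      then show ?thesis
        by (rule has_field_derivative_transform_within_open[of _ _ _ "{0<..<1}"]) (use 3 in \<open>auto simp: \<Phi>0_def\<close>)
    qed
  qed
  moreover define \<Phi> where "\<Phi> = (\<lambda>n. case n of 0 \<Rightarrow> \<Phi>0 | Suc m \<Rightarrow> \<eta> m)"
  ultimately have "(\<Phi> n has_real_derivative \<Phi> (Suc n) x) (at x)" for n x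
    using test1_deriv[OF \<eta>] by (cases n) (auto simp: \<Phi>_def)
  moreover have "\<forall>x. x \<notin> {l..r} \<longrightarrow> \<Phi> 0 x = 0" using left right by (auto simp: \<Phi>_def)
  ultimately have "test1 \<Phi>" unfolding test1_def using lr by blast
  then show ?thesis by (intro exI[of _ \<Phi>]) (simp add: \<Phi>_def)
qed

text \<open>
  An integral primitive that starts at \<open>0\<close>; together with mean zero of \<open>w\<close> it vanishes at both ends.
\<close>

definition primitive_of :: "(real \<Rightarrow> real) \<Rightarrow> (real \<Rightarrow> real) \<Rightarrow> bool" where
  "primitive_of w W \<longleftrightarrow> (\<forall>x\<in>{0..<1}. W x = (\<integral>t. w t * indicator {0..<x} t \<partial>U1))"

text \<open>
  The hypothesis says that \<open>k2\<close> is the weak derivative of \<open>k1\<close>. Subtracting a multiple of a fixed bump makes the mean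
  of a test function zero, and its primitive is again a test function. Hence \<open>k1\<close> is an integral of \<open>k2\<close> up to a constant, which
  the mean-zero function \<open>w\<close> does not see.
\<close>

lemma du_bois_reymond:
  assumes k: "integrable U1 k1" "integrable U1 k2"
    and hyp: "\<And>\<phi>. test1 \<phi> \<Longrightarrow> (\<integral>t. k1 t * \<phi> (Suc 0) t \<partial>U1) + (\<integral>t. k2 t * \<phi> 0 t \<partial>U1) = 0"
    and w: "bb w" "(\<integral>t. w t \<partial>U1) = 0" and W: "bb W" "primitive_of w W"
  shows "(\<integral>t. k1 t * w t \<partial>U1) + (\<integral>t. k2 t * W t \<partial>U1) = 0"
proof -
  interpret U: prob_space U1 by (rule prob_space_U1)
  interpret P: pair_sigma_finite U1 U1 ..
  define K where "K = (\<lambda>t. \<integral>x. k2 x * of_bool (t < x) \<partial>U1)"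
  have k2f: "integrable (U1 \<Otimes>\<^sub>M U1) (\<lambda>z. k2 (fst z))"
  proof -
    have "integrable (distr (U1 \<Otimes>\<^sub>M U1) U1 fst) k2" unfolding U.distr_pair_fst by (rule k(2))
    then show ?thesis by (subst (asm) integrable_distr_eq) (use k(2) in auto)
  qed
  have pm: "(\<lambda>z. of_bool (snd z < fst z) :: real) \<in> borel_measurable (U1 \<Otimes>\<^sub>M U1)"
  proof -
    have [measurable]: "(\<lambda>x. x) \<in> borel_measurable U1" by (rule measurable_U1) simp
    have "(\<lambda>z. fst z) \<in> borel_measurable (U1 \<Otimes>\<^sub>M U1)" "(\<lambda>z. snd z) \<in> borel_measurable (U1 \<Otimes>\<^sub>M U1)"
      by (auto intro: measurable_compose[OF measurable_fst] measurable_compose[OF measurable_snd])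
    then show ?thesis by measurable
  qed
  have int2: "integrable (U1 \<Otimes>\<^sub>M U1) (\<lambda>z. k2 (fst z) * (u (snd z) * of_bool (snd z < fst z)))" if u: "bb u" for u
  proof -
    obtain B where B: "\<forall>x. \<bar>u x\<bar> \<le> B" using u by (auto simp: bb_def)
    have "(\<lambda>z. u (snd z)) \<in> borel_measurable (U1 \<Otimes>\<^sub>M U1)"
      by (rule measurable_compose[OF measurable_snd measurable_U1[OF bb_measurable[OF u]]])
    then show ?thesis
      by (intro integrable_mult_bb[OF k2f, where B = B] borel_measurable_times pm)
        (use B abs_ge_zero order.trans in \<open>auto simp: abs_mult of_bool_def\<close>)
  qed
  have Kint: "integrable U1 K"
  proof -
    have "bb (\<lambda>_. 1)" by (auto simp: bb_def)
    from P.integrable_snd[of "\<lambda>x t. k2 x * of_bool (t < x)"] int2[OF this]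
    show ?thesis by (simp add: K_def case_prod_beta')
  qed
  have fub: "(\<integral>x. k2 x * V x \<partial>U1) = (\<integral>t. K t * u t \<partial>U1)" if u: "bb u" and V: "primitive_of u V" for u V
  proof -
    have "(\<integral>x. k2 x * V x \<partial>U1) = (\<integral>x. \<integral>t. k2 x * (u t * of_bool (t < x)) \<partial>U1 \<partial>U1)"
    proof (rule Bochner_Integration.integral_cong[OF refl])
      fix x assume x: "x \<in> space U1"
      have "V x = (\<integral>t. u t * indicator {0..<x} t \<partial>U1)" using V x by (simp add: primitive_of_def)
      also have "\<dots> = (\<integral>t. u t * of_bool (t < x) \<partial>U1)"
        by (intro Bochner_Integration.integral_cong) (auto simp: indicator_def)
      finally show "k2 x * V x = (\<integral>t. k2 x * (u t * of_bool (t < x)) \<partial>U1)" by simp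
    qed
    also have "\<dots> = (\<integral>t. \<integral>x. k2 x * (u t * of_bool (t < x)) \<partial>U1 \<partial>U1)"
      by (rule P.Fubini_integral[symmetric]) (use int2[OF u] in \<open>simp add: case_prod_beta'\<close>)
    also have "\<dots> = (\<integral>t. K t * u t \<partial>U1)"
    proof (rule Bochner_Integration.integral_cong[OF refl])
      fix t
      have "(\<integral>x. k2 x * (u t * of_bool (t < x)) \<partial>U1) = (\<integral>x. u t * (k2 x * of_bool (t < x)) \<partial>U1)"
        by (simp only: mult.left_commute)
      also have "\<dots> = u t * K t" unfolding K_def by (rule integral_mult_right_zero)
      finally show "(\<integral>x. k2 x * (u t * of_bool (t < x)) \<partial>U1) = K t * u t" by simp
    qed
    finally show ?thesis .
  qed
  have prim: "primitive_of (\<phi> (Suc 0)) (\<phi> 0)" if "test1 \<phi>" for \<phi>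
    unfolding primitive_of_def using U1_integral_eq[OF test1_bb[OF that] test1_FTC[OF that]] by auto
  define \<kappa> where "\<kappa> = (\<lambda>t. k1 t + K t)"
  have \<kappa>int: "integrable U1 \<kappa>" unfolding \<kappa>_def using k(1) Kint by simp
  have km: "integrable U1 (\<lambda>t. f t * u t)" if f: "integrable U1 f" and u: "bb u" for f u
  proof -
    obtain B where B: "\<forall>x. \<bar>u x\<bar> \<le> B" using u unfolding bb_def by blast
    show ?thesis by (rule integrable_mult_bb[OF f measurable_U1[OF bb_measurable[OF u]]]) (use B in auto)
  qed
  have ksum: "(\<integral>t. k1 t * u t \<partial>U1) + (\<integral>t. k2 t * V t \<partial>U1) = (\<integral>t. \<kappa> t * u t \<partial>U1)"
    if "bb u" "primitive_of u V" for u V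
    unfolding fub[OF that] \<kappa>_def distrib_right using km[OF k(1) that(1)] km[OF Kint that(1)] by simp
  define \<rho> where "\<rho> = bump 1 (1/3) (2/3)"
  have \<rho>: "test1 \<rho>" unfolding \<rho>_def by (rule test1_bump) auto
  define r where "r = (\<integral>t. \<rho> 0 t \<partial>U1)"
  have r0: "r \<noteq> 0"
  proof
    assume "r = 0"
    moreover have "AE t in U1. 0 \<le> \<rho> 0 t" using bump_0_bounds[of "1/3" "2/3" 1] by (auto simp: \<rho>_def)
    ultimately have "AE t in U1. \<rho> 0 t = 0"
      using integral_nonneg_eq_0_iff_AE[OF integrable_U1_bb[OF test1_bb[OF \<rho>]], of 0] by (simp add: r_def)
    then have "AE t in U1. t \<notin> {1/3<..<2/3}" by eventually_elim (auto simp: \<rho>_def bump_0)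
    then have "emeasure U1 {1/3<..<2/3} = 0"
      by (subst (asm) AE_iff_measurable[of "{1/3<..<2/3}"]) (auto simp: sets_U1)
    moreover have "emeasure U1 {1/3<..<2/3} = emeasure lborel {1/3<..<2/3::real}"
      unfolding U1_def by (rule emeasure_restrict_space) auto
    ultimately show False by simp
  qed
  define c where "c = (\<integral>t. \<kappa> t * \<rho> 0 t \<partial>U1) / r"
  have "AE t in U1. \<kappa> t - c = 0"
  proof (rule fundamental_lemma_U1)
    show "integrable U1 (\<lambda>t. \<kappa> t - c)" using \<kappa>int by simp
    fix \<epsilon> c' d :: real assume a: "\<epsilon> > 0" "0 < c'" "c' < d" "d < 1"
    define \<psi> where "\<psi> = bump \<epsilon> c' d"
    have \<psi>: "test1 \<psi>" unfolding \<psi>_def by (rule test1_bump) (use a in auto)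
    define m where "m = (\<integral>t. \<psi> 0 t \<partial>U1)"
    let ?\<eta> = "\<lambda>n x. \<psi> n x - m / r * \<rho> n x"
    have \<eta>: "test1 ?\<eta>" by (rule test1_diff_scale[OF \<psi> \<rho>])
    have ip: "integrable U1 (\<psi> 0)" "integrable U1 (\<rho> 0)" by (intro integrable_U1_bb test1_bb \<psi> \<rho>)+
    have "(\<integral>t. ?\<eta> 0 t \<partial>U1) = m - m / r * r" using ip by (simp add: m_def r_def)
    then have "(\<integral>t. ?\<eta> 0 t \<partial>U1) = 0" using r0 by simp
    from test1_primitive[OF \<eta> this] obtain \<Phi> where \<Phi>: "test1 \<Phi>" "\<Phi> (Suc 0) = ?\<eta> 0" by blast
    have "0 = (\<integral>t. \<kappa> t * ?\<eta> 0 t \<partial>U1)"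
      using hyp[OF \<Phi>(1)] ksum[OF test1_bb[OF \<Phi>(1)] prim[OF \<Phi>(1)]] unfolding \<Phi>(2) by simp
    also have "\<dots> = (\<integral>t. \<kappa> t * \<psi> 0 t - m / r * (\<kappa> t * \<rho> 0 t) \<partial>U1)"
      by (simp add: algebra_simps)
    also have "\<dots> = (\<integral>t. \<kappa> t * \<psi> 0 t \<partial>U1) - m / r * (\<integral>t. \<kappa> t * \<rho> 0 t \<partial>U1)"
      using km[OF \<kappa>int test1_bb[OF \<psi>, of 0]] km[OF \<kappa>int test1_bb[OF \<rho>, of 0]] by simp
    also have "\<dots> = (\<integral>t. \<kappa> t * \<psi> 0 t \<partial>U1) - c * m" by (simp add: c_def)
    also have "\<dots> = (\<integral>t. (\<kappa> t - c) * \<psi> 0 t \<partial>U1)"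
      using km[OF \<kappa>int test1_bb[OF \<psi>, of 0]] ip by (simp add: left_diff_distrib m_def)
    finally show "(\<integral>t. (\<kappa> t - c) * bump \<epsilon> c' d 0 t \<partial>U1) = 0" by (simp add: \<psi>_def)
  qed
  then have "(\<integral>t. \<kappa> t * w t \<partial>U1) = (\<integral>t. c * w t \<partial>U1)"
    by (intro integral_cong_AE) (use \<kappa>int bb_measurable[OF w(1)] in auto)
  also have "\<dots> = 0" using w(2) by simp
  finally show ?thesis using ksum[OF w(1) W(2)] by simp
qed

text \<open>
  Weak derivatives are tested against smooth functions with compact support; the kernels are neither. One coordinate at a
  time, the remaining factors are frozen and the one-dimensional statement is applied to the marginals.
\<close>

theorem weak_integration_by_parts:
  assumes T: "finite T" "j \<in> T"
    and G: "integrable (cube_measure T) G" and H: "integrable (cube_measure T) H"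
    and hyp: "\<And>\<phi>. (\<And>i. i \<in> T \<Longrightarrow> test1 (\<phi> i)) \<Longrightarrow>
       (\<integral>x. G x * (\<phi> j (Suc 0) (x j) * (\<Prod>i\<in>T - {j}. \<phi> i 0 (x i))) \<partial>cube_measure T)
     + (\<integral>x. H x * (\<phi> j 0 (x j) * (\<Prod>i\<in>T - {j}. \<phi> i 0 (x i))) \<partial>cube_measure T) = 0"
    and w: "\<And>i. i \<in> T - {j} \<Longrightarrow> bb (w i)"
    and u: "bb u" "(\<integral>t. u t \<partial>U1) = 0" and U: "bb U" "primitive_of u U"
  shows "(\<integral>x. G x * (u (x j) * (\<Prod>i\<in>T - {j}. w i (x i))) \<partial>cube_measure T)
     + (\<integral>x. H x * (U (x j) * (\<Prod>i\<in>T - {j}. w i (x i))) \<partial>cube_measure T) = 0"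
proof -
  let ?M = "cube_measure T"
  define L where "L = (\<lambda>w f g. (\<integral>x. G x * (f (x j) * (\<Prod>i\<in>T - {j}. w i (x i))) \<partial>?M)
     + (\<integral>x. H x * (g (x j) * (\<Prod>i\<in>T - {j}. w i (x i))) \<partial>?M))"
  have step: "\<forall>w \<phi>. test1 \<phi> \<and> (\<forall>i\<in>I. bb (w i)) \<and> (\<forall>i\<in>T - {j} - I. \<exists>\<psi>. test1 \<psi> \<and> w i = \<psi> 0) \<longrightarrow> L w (\<phi> (Suc 0)) (\<phi> 0) = 0"
    if "finite I" "I \<subseteq> T - {j}" for I
    using that
  proof (induction I rule: finite_induct)
    case empty
    show ?case
    proof (intro allI impI)
      fix w \<phi> assume a: "test1 \<phi> \<and> (\<forall>i\<in>{}. bb (w i)) \<and> (\<forall>i\<in>T - {j} - {}. \<exists>\<psi>. test1 \<psi> \<and> w i = \<psi> 0)"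
      then obtain \<psi> where \<psi>: "\<forall>i\<in>T - {j}. test1 (\<psi> i) \<and> w i = \<psi> i 0" by (simp, metis)
      have "test1 ((\<psi>(j := \<phi>)) i)" if "i \<in> T" for i using a \<psi> that by auto
      note h = hyp[of "\<psi>(j := \<phi>)", OF this]
      show "L w (\<phi> (Suc 0)) (\<phi> 0) = 0"
      proof -
        have "(\<Prod>i\<in>T - {j}. (\<psi>(j := \<phi>)) i 0 (x i)) = (\<Prod>i\<in>T - {j}. w i (x i))" for x :: "nat \<Rightarrow> real"
          using \<psi> by (intro prod.cong) auto
        then show ?thesis
          using h unfolding L_def by (simp only: fun_upd_same)
      qed
    qed
  next
    case (insert i I)
    then have i: "i \<in> T" "i \<noteq> j" "i \<notin> I" by auto
    show ?case
    proof (intro allI impI)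
      fix w \<phi> assume a: "test1 \<phi> \<and> (\<forall>i\<in>insert i I. bb (w i)) \<and> (\<forall>i\<in>T - {j} - insert i I. \<exists>\<psi>. test1 \<psi> \<and> w i = \<psi> 0)"
      have bbw: "bb (w l)" if l: "l \<in> T - {j}" for l
      proof (cases "l \<in> insert i I")
        case True
        then show ?thesis using a by blast
      next
        case False
        then have "l \<in> T - {j} - insert i I" using l by simp
        from a[THEN conjunct2, THEN conjunct2, rule_format, OF this]
        obtain \<psi> where "test1 \<psi>" "w l = \<psi> 0" by (elim exE conjE)
        then show ?thesis using test1_bb by simp
      qed
      define K where "K = (\<lambda>x. (G x * \<phi> (Suc 0) (x j) + H x * \<phi> 0 (x j)) * (\<Prod>l\<in>T - {j} - {i}. w l (x l)))"
      have \<phi>: "bb (\<phi> n)" for n by (rule test1_bb[OF a[THEN conjunct1]])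
      note a1 = integrable_mult_component[OF G \<phi>[of "Suc 0"] T(2)] and a2 = integrable_mult_component[OF H \<phi>[of 0] T(2)]
      have Kint: "integrable ?M K"
        unfolding K_def
        by (rule integrable_mult_prod_bb[OF T(1) _ _ Bochner_Integration.integrable_add[OF a1 a2]]) (use bbw in auto)
      have LK: "L (w(i := f)) (\<phi> (Suc 0)) (\<phi> 0) = (\<integral>x. K x * f (x i) \<partial>?M)" if f: "bb f" for f
      proof -
        have e: "(\<Prod>l\<in>T - {j}. (w(i := f)) l (x l)) = f (x i) * (\<Prod>l\<in>T - {j} - {i}. w l (x l))" for x
          using T i by (subst prod.remove[of _ i]) (auto intro!: prod.cong)
        have i1: "integrable ?M (\<lambda>x. G x * (\<phi> (Suc 0) (x j) * (f (x i) * (\<Prod>l\<in>T - {j} - {i}. w l (x l)))))"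
          and i2: "integrable ?M (\<lambda>x. H x * (\<phi> 0 (x j) * (f (x i) * (\<Prod>l\<in>T - {j} - {i}. w l (x l)))))"
          unfolding mult.assoc[symmetric]
          by (rule integrable_mult_prod_bb[OF T(1) _ _ integrable_mult_component[OF a1 f i(1)]], use bbw in auto)
            (rule integrable_mult_prod_bb[OF T(1) _ _ integrable_mult_component[OF a2 f i(1)]], use bbw in auto)
        show ?thesis
          unfolding L_def e K_def Bochner_Integration.integral_add[OF i1 i2, symmetric]
          by (intro Bochner_Integration.integral_cong refl) (simp add: algebra_simps)
      qed
      have "(\<integral>x. K x * w i (x i) \<partial>?M) = 0"
      proof (rule cube_marginal_zero[OF T(1) i(1) Kint])
        show "bb (w i)" using a by simp
        fix \<psi> assume \<psi>: "test1 \<psi>"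
        have "L (w(i := \<psi> 0)) (\<phi> (Suc 0)) (\<phi> 0) = 0"
        proof (rule insert.IH[rule_format])
          show "I \<subseteq> T - {j}" using insert.prems by auto
          show "test1 \<phi> \<and> (\<forall>l\<in>I. bb ((w(i := \<psi> 0)) l)) \<and> (\<forall>l\<in>T - {j} - I. \<exists>\<psi>'. test1 \<psi>' \<and> (w(i := \<psi> 0)) l = \<psi>' 0)"
            using a \<psi> i by auto
        qed
        then show "(\<integral>x. K x * \<psi> 0 (x i) \<partial>?M) = 0" using LK[OF test1_bb[OF \<psi>]] by simp
      qed
      then show "L w (\<phi> (Suc 0)) (\<phi> 0) = 0" using LK[of "w i"] a by simp
    qed
  qed
  define G' H' where "G' = (\<lambda>x. G x * (\<Prod>i\<in>T - {j}. w i (x i)))" and "H' = (\<lambda>x. H x * (\<Prod>i\<in>T - {j}. w i (x i)))"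
  have GH: "integrable ?M G'" "integrable ?M H'"
    unfolding G'_def H'_def
    by (rule integrable_mult_prod_bb[OF T(1) _ _ G], use w in auto)
      (rule integrable_mult_prod_bb[OF T(1) _ _ H], use w in auto)
  obtain k1 where k1: "integrable U1 k1" "\<And>f. bb f \<Longrightarrow> (\<integral>x. G' x * f (x j) \<partial>?M) = (\<integral>t. k1 t * f t \<partial>U1)"
    using cube_marginal[OF T GH(1)] by blast
  obtain k2 where k2: "integrable U1 k2" "\<And>f. bb f \<Longrightarrow> (\<integral>x. H' x * f (x j) \<partial>?M) = (\<integral>t. k2 t * f t \<partial>U1)"
    using cube_marginal[OF T GH(2)] by blast
  have Lk: "L w f g = (\<integral>t. k1 t * f t \<partial>U1) + (\<integral>t. k2 t * g t \<partial>U1)" if "bb f" "bb g" for f g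
    unfolding k1(2)[OF that(1), symmetric] k2(2)[OF that(2), symmetric] L_def G'_def H'_def by (simp add: mult_ac)
  have "(\<integral>t. k1 t * u t \<partial>U1) + (\<integral>t. k2 t * U t \<partial>U1) = 0"
  proof (rule du_bois_reymond[OF k1(1) k2(1) _ u U])
    fix \<phi> assume \<phi>: "test1 \<phi>"
    have "L w (\<phi> (Suc 0)) (\<phi> 0) = 0"
      by (rule step[of "T - {j}", rule_format]) (use T \<phi> w in auto)
    then show "(\<integral>t. k1 t * \<phi> (Suc 0) t \<partial>U1) + (\<integral>t. k2 t * \<phi> 0 t \<partial>U1) = 0"
      using Lk[OF test1_bb[OF \<phi>] test1_bb[OF \<phi>]] by simp
  qed
  then show ?thesis using Lk[OF u(1) U(1)] by (simp add: L_def)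
qed


section \<open>The representation of Sobolev functions\<close>

lemma bb_const: "bb (\<lambda>_. c)" by (auto simp: bb_def)

lemma bb_add: "bb u \<Longrightarrow> bb v \<Longrightarrow> bb (\<lambda>x. a * u x + c * v x)"
proof -
  assume u: "bb u" and v: "bb v"
  obtain A B where "\<forall>x. \<bar>u x\<bar> \<le> A" "\<forall>x. \<bar>v x\<bar> \<le> B" using u v by (auto simp: bb_def)
  then have "\<bar>a * u x + c * v x\<bar> \<le> \<bar>a\<bar> * A + \<bar>c\<bar> * B" for x
    by (intro order.trans[OF abs_triangle_ineq] add_mono) (auto simp: abs_mult intro: mult_left_mono)
  moreover have "(\<lambda>x. a * u x + c * v x) \<in> borel_measurable borel"
    using bb_measurable[OF u] bb_measurable[OF v] by measurable
  ultimately show ?thesis by (auto simp: bb_def)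
qed

lemma per_bern_measurable: "n \<ge> 1 \<Longrightarrow> per_bern n \<in> borel_measurable borel"
proof (cases "n = 1")
  case True
  have "(\<lambda>x::real. x - of_int \<lceil>x\<rceil> + 1 / 2) \<in> borel_measurable borel" by measurable
  then show ?thesis using True by (simp add: per_bern_def[abs_def])
next
  case False
  assume "n \<ge> 1"
  then show ?thesis using False
    by (intro borel_measurable_continuous_onI continuous_at_imp_continuous_on ballI isCont_per_bern) auto
qed

lemma per_bern_measurable' [measurable (raw)]:
  assumes "n \<ge> 1" "f \<in> borel_measurable M"
  shows "(\<lambda>x. per_bern n (f x)) \<in> borel_measurable M"
  using measurable_compose[OF assms(2) per_bern_measurable[OF assms(1)]] .

lemma per_bern_left_continuous:
  assumes "n \<ge> 1" "e > 0"
  shows "\<exists>d>0. \<forall>x\<in>{z - d..z}. \<bar>per_bern n x - per_bern n z\<bar> \<le> e"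
proof (cases "n = 1")
  case True
  define r where "r = z - (of_int \<lceil>z\<rceil> - 1)"
  define d where "d = min e (r / 2)"
  have z: "r > 0" "z \<le> of_int \<lceil>z\<rceil>" unfolding r_def by linarith+
  have d: "d > 0" "d \<le> e" "d \<le> r / 2" using z assms by (auto simp: d_def)
  then have dr: "d < z - (of_int \<lceil>z\<rceil> - 1)" using z(1) unfolding r_def[symmetric] by simp
  have "\<bar>per_bern n x - per_bern n z\<bar> \<le> e" if x: "x \<in> {z - d..z}" for x
  proof -
    have "x \<le> of_int \<lceil>z\<rceil>" using x z(2) by (meson atLeastAtMost_iff order.trans)
    moreover have "of_int \<lceil>z\<rceil> - 1 < x" using x dr by simp
    ultimately have "\<lceil>x\<rceil> = \<lceil>z\<rceil>" by (intro ceiling_unique)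
    then show ?thesis using x d True by (auto simp: per_bern_def)
  qed
  then show ?thesis using d by blast
next
  case False
  then have "isCont (per_bern n) z" using assms by (intro isCont_per_bern) auto
  then obtain d where d: "d > 0" "\<And>x. dist x z < d \<Longrightarrow> dist (per_bern n x) (per_bern n z) < e"
    using assms unfolding continuous_at_eps_delta by blast
  have "\<bar>per_bern n x - per_bern n z\<bar> \<le> e" if "x \<in> {z - d / 2..z}" for x
    using d(2)[of x] that d(1) by (auto simp: dist_real_def)
  then show ?thesis using d(1) by (intro exI[of _ "d / 2"]) auto
qed


text \<open>
  The mean of \<open>per_bern n\<close> over the interval of length \<open>\<epsilon>\<close> to the left of \<open>x - y\<close>, written as a difference quotient of the
  primitive. The formula also makes sense for \<open>n = 0\<close>, where it is \<open>1\<close> minus an approximate point mass.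
\<close>

definition quot :: "real \<Rightarrow> real \<Rightarrow> nat \<Rightarrow> real \<Rightarrow> real" where
  "quot \<epsilon> y n x = (per_bern (Suc n) (x - y) - per_bern (Suc n) (x - y - \<epsilon>)) / \<epsilon>"

lemma quot_has_integral_avg:
  assumes "\<epsilon> > 0" "n \<ge> 1"
  shows "(per_bern n has_integral \<epsilon> * quot \<epsilon> y n x) {x - y - \<epsilon>..x - y}"
  using per_bern_has_integral[OF assms(2), of "x - y - \<epsilon>" "x - y"] assms by (simp add: quot_def)

lemma abs_quot_le:
  assumes "\<epsilon> > 0" "n \<ge> 1"
  shows "\<bar>quot \<epsilon> y n x\<bar> \<le> 1 / 2"
proof -
  have "norm (\<epsilon> * quot \<epsilon> y n x) \<le> 1/2 * measure lborel {x - y - \<epsilon>..x - y}"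
    by (rule has_integral_bound_real[where S = "{}", OF _ _ quot_has_integral_avg[OF assms]])
      (use abs_per_bern_le[OF assms(2)] in auto)
  then show ?thesis using assms by (simp add: abs_mult)
qed

lemma quot_tendsto:
  assumes e0: "\<And>i. \<epsilon> i > 0" "\<epsilon> \<longlonglongrightarrow> 0" and n: "n \<ge> 1"
  shows "(\<lambda>i. quot (\<epsilon> i) y n x) \<longlonglongrightarrow> per_bern n (x - y)"
proof (rule LIMSEQ_I)
  fix e :: real assume e: "e > 0"
  obtain d where d: "d > 0" "\<forall>z\<in>{x - y - d..x - y}. \<bar>per_bern n z - per_bern n (x - y)\<bar> \<le> e / 2"
    using per_bern_left_continuous[OF n, of "e / 2" "x - y"] e by auto
  have "eventually (\<lambda>i. \<epsilon> i < d) sequentially" using e0(2) d(1) by (rule order_tendstoD)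
  then obtain N where N: "\<And>i. i \<ge> N \<Longrightarrow> \<epsilon> i < d" by (auto simp: eventually_sequentially)
  have "norm (quot (\<epsilon> i) y n x - per_bern n (x - y)) < e" if i: "i \<ge> N" for i
  proof -
    let ?c = "per_bern n (x - y)"
    have p: "\<epsilon> i > 0" by (rule e0)
    have "((\<lambda>z. ?c) has_integral \<epsilon> i * ?c) {x - y - \<epsilon> i..x - y}"
      using has_integral_const_real[of ?c "x - y - \<epsilon> i" "x - y"] p by simp
    from has_integral_diff[OF quot_has_integral_avg[OF p n] this]
    have "((\<lambda>z. per_bern n z - ?c) has_integral \<epsilon> i * (quot (\<epsilon> i) y n x - ?c)) {x - y - \<epsilon> i..x - y}"
      by (simp add: right_diff_distrib)
    then have "norm (\<epsilon> i * (quot (\<epsilon> i) y n x - ?c)) \<le> e / 2 * measure lborel {x - y - \<epsilon> i..x - y}"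
      by (rule has_integral_bound_real[where S = "{}", rotated 2]) (use d N[OF i] e in auto)
    then have "\<epsilon> i * \<bar>quot (\<epsilon> i) y n x - ?c\<bar> \<le> \<epsilon> i * (e / 2)" using p by (simp add: abs_mult)
    then have "\<bar>quot (\<epsilon> i) y n x - ?c\<bar> \<le> e / 2" using p by (simp only: mult_le_cancel_left_pos)
    then show ?thesis using e by simp
  qed
  then show "\<exists>N. \<forall>i\<ge>N. norm (quot (\<epsilon> i) y n x - per_bern n (x - y)) < e" by blast
qed

lemma bb_quot: "\<epsilon> > 0 \<Longrightarrow> bb (quot \<epsilon> y n)"
proof -
  assume e: "\<epsilon> > 0"
  have "\<bar>quot \<epsilon> y n x\<bar> \<le> 1 / \<epsilon>" for x
  proof -
    have "\<bar>per_bern (Suc n) (x - y) - per_bern (Suc n) (x - y - \<epsilon>)\<bar> \<le> 1"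
      using abs_per_bern_le[of "Suc n" "x - y"] abs_per_bern_le[of "Suc n" "x - y - \<epsilon>"] by simp
    then show ?thesis using e by (simp add: quot_def abs_divide divide_right_mono)
  qed
  moreover have "quot \<epsilon> y n \<in> borel_measurable borel"
    unfolding quot_def by measurable
  ultimately show ?thesis by (auto simp: bb_def)
qed

lemma quot_has_integral:
  assumes "\<epsilon> > 0" "0 \<le> x"
  shows "(quot \<epsilon> y n has_integral (quot \<epsilon> y (Suc n) x - quot \<epsilon> y (Suc n) 0)) {0..x}"
proof -
  have "((\<lambda>x. per_bern (Suc n) (x - y) - per_bern (Suc n) (x - (y + \<epsilon>))) has_integral
     (per_bern (Suc (Suc n)) (x - y) - per_bern (Suc (Suc n)) (0 - y)) - (per_bern (Suc (Suc n)) (x - (y + \<epsilon>)) - per_bern (Suc (Suc n)) (0 - (y + \<epsilon>)))) {0..x}"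
    by (intro has_integral_diff per_bern_affine_has_integral assms) auto
  from has_integral_divide[OF this, of \<epsilon>]
  have "(quot \<epsilon> y n has_integral
     ((per_bern (Suc (Suc n)) (x - y) - per_bern (Suc (Suc n)) (0 - y)) - (per_bern (Suc (Suc n)) (x - (y + \<epsilon>)) - per_bern (Suc (Suc n)) (0 - (y + \<epsilon>)))) / \<epsilon>) {0..x}"
    by (simp add: quot_def[abs_def] diff_diff_eq)
  moreover have "((per_bern (Suc (Suc n)) (x - y) - per_bern (Suc (Suc n)) (0 - y)) - (per_bern (Suc (Suc n)) (x - (y + \<epsilon>)) - per_bern (Suc (Suc n)) (0 - (y + \<epsilon>)))) / \<epsilon>
     = quot \<epsilon> y (Suc n) x - quot \<epsilon> y (Suc n) 0"
    unfolding quot_def diff_diff_eq[symmetric] diff_divide_distrib by simp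
  ultimately show ?thesis by simp
qed

lemma quot_primitive:
  assumes "\<epsilon> > 0"
  shows "primitive_of (quot \<epsilon> y n) (\<lambda>x. 1 * quot \<epsilon> y (Suc n) x + (- quot \<epsilon> y (Suc n) 0) * 1)"
  unfolding primitive_of_def using U1_integral_eq[OF bb_quot[OF assms] quot_has_integral[OF assms]] by auto

lemma quot_zero_mean:
  assumes "\<epsilon> > 0"
  shows "(\<integral>t. quot \<epsilon> y n t \<partial>U1) = 0"
proof -
  have "per_bern m (1 + z) = per_bern m z" for m z
    using per_bern_plus_of_int[of m z 1] by (simp add: add.commute)
  from this[of "Suc (Suc n)" "- y"] this[of "Suc (Suc n)" "- y - \<epsilon>"]
  have "quot \<epsilon> y (Suc n) 1 - quot \<epsilon> y (Suc n) 0 = 0" by (simp add: quot_def algebra_simps)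
  then show ?thesis using U1_integral_eq_1[OF bb_quot[OF assms] quot_has_integral[OF assms, of 1]] by simp
qed

text \<open>
  It is \<open>1 / \<epsilon>\<close> for \<open>y < x \<le> y + \<epsilon>\<close> and \<open>0\<close> otherwise, an approximate point mass at \<open>y\<close>. The odd
  spelling is a linear combination to which linearity applies directly.
\<close>

definition delta :: "real \<Rightarrow> real \<Rightarrow> real \<Rightarrow> real" where
  "delta \<epsilon> y = (\<lambda>x. 1 * 1 + (-1) * quot \<epsilon> y 0 x)"

lemma bb_delta: "\<epsilon> > 0 \<Longrightarrow> bb (delta \<epsilon> y)"
  unfolding delta_def by (intro bb_add bb_const bb_quot)

lemma delta_eq:
  assumes "\<epsilon> > 0" "0 \<le> y" "y + \<epsilon> < 1" "0 \<le> x" "x < 1"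
  shows "delta \<epsilon> y x = (if y < x \<and> x \<le> y + \<epsilon> then 1 / \<epsilon> else 0)"
proof -
  have 1: "\<lceil>x - y\<rceil> = of_bool (y < x)" using assms by (intro ceiling_unique) auto
  have 2: "\<lceil>x - y - \<epsilon>\<rceil> = of_bool (y + \<epsilon> < x)" using assms by (intro ceiling_unique) auto
  show ?thesis using assms unfolding delta_def quot_def per_bern_def 1 2 by (auto simp: field_simps)
qed

lemma integral_delta: "\<epsilon> > 0 \<Longrightarrow> (\<integral>t. delta \<epsilon> y t \<partial>U1) = 1"
proof -
  assume e: "\<epsilon> > 0"
  interpret prob_space U1 by (rule prob_space_U1)
  show ?thesis unfolding delta_def
    using quot_zero_mean[OF e, of y 0] integrable_U1_bb[OF bb_quot[OF e], of y 0] prob_space by (simp del: space_U1)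
qed

lemma sum_PiE_insert:
  assumes "i \<notin> I"
  shows "(\<Sum>g\<in>insert i I \<rightarrow>\<^sub>E F. h g) = (\<Sum>g\<in>I \<rightarrow>\<^sub>E F. \<Sum>y\<in>F. h (g(i := y)))"
proof -
  have "(\<Sum>g\<in>insert i I \<rightarrow>\<^sub>E F. h g) = (\<Sum>(y, g)\<in>F \<times> (I \<rightarrow>\<^sub>E F). h (g(i := y)))"
    unfolding PiE_insert_eq by (subst sum.reindex[OF inj_combinator[OF assms]]) (simp add: case_prod_beta' comp_def)
  also have "\<dots> = (\<Sum>y\<in>F. \<Sum>g\<in>I \<rightarrow>\<^sub>E F. h (g(i := y)))" by (rule sum.cartesian_product[symmetric])
  finally show ?thesis by (subst sum.swap)
qed

lemma test_function_tensor:
  assumes "\<And>i. i \<in> {1..s} \<Longrightarrow> test1 (\<phi> i)"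
  shows "test_function s (\<lambda>\<beta> x. \<Prod>i\<in>{1..s}. \<phi> i (\<beta> i) (x i))"
  unfolding test_function_def
proof (intro conjI allI ballI)
  fix \<beta> :: "nat \<Rightarrow> nat"
  have c: "continuous_on UNIV (\<lambda>x :: nat \<Rightarrow> real. \<phi> i (\<beta> i) (x i))" if "i \<in> {1..s}" for i
    by (rule continuous_on_compose2[OF test1_cont[OF assms[OF that], of UNIV] continuous_on_product_coordinates]) auto
  have "continuous_on UNIV (\<lambda>x :: nat \<Rightarrow> real. \<Prod>i\<in>{1..s}. \<phi> i (\<beta> i) (x i))"
    by (intro continuous_on_prod c)
  then show "continuous_on ({1..s} \<rightarrow>\<^sub>E UNIV) (\<lambda>x :: nat \<Rightarrow> real. \<Prod>i\<in>{1..s}. \<phi> i (\<beta> i) (x i))"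
    by (rule continuous_on_subset) auto
next
  fix \<beta> :: "nat \<Rightarrow> nat" and j and x :: "nat \<Rightarrow> real" assume j: "j \<in> {1..s}"
  have e: "(\<Prod>i\<in>{1..s}. \<phi> i (\<beta> i) ((x(j := t)) i)) = \<phi> j (\<beta> j) t * (\<Prod>i\<in>{1..s} - {j}. \<phi> i (\<beta> i) (x i))" for t
    using j by (subst prod.remove[of _ j]) (auto intro!: prod.cong)
  have e2: "(\<Prod>i\<in>{1..s}. \<phi> i ((\<beta>(j := Suc (\<beta> j))) i) (x i)) = \<phi> j (Suc (\<beta> j)) (x j) * (\<Prod>i\<in>{1..s} - {j}. \<phi> i (\<beta> i) (x i))"
    using j by (subst prod.remove[of _ j]) (auto intro!: prod.cong)
  show "((\<lambda>t. \<Prod>i\<in>{1..s}. \<phi> i (\<beta> i) ((x(j := t)) i)) has_real_derivative (\<Prod>i\<in>{1..s}. \<phi> i ((\<beta>(j := Suc (\<beta> j))) i) (x i))) (at (x j))"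
    unfolding e e2 by (intro DERIV_cmult_right test1_deriv assms j)
next
  have "\<forall>i\<in>{1..s}. \<exists>lr. 0 < fst lr \<and> snd lr < 1 \<and> (\<forall>x. x \<notin> {fst lr..snd lr} \<longrightarrow> \<phi> i 0 x = 0)"
    using assms unfolding test1_def by (metis fst_conv snd_conv)
  then obtain lr where lr: "\<forall>i\<in>{1..s}. 0 < fst (lr i) \<and> snd (lr i) < 1 \<and> (\<forall>x. x \<notin> {fst (lr i)..snd (lr i)} \<longrightarrow> \<phi> i 0 x = 0)"
    by metis
  define l where "l = Min (insert (1/2) ((\<lambda>i. fst (lr i)) ` {1..s}))"
  define r where "r = Max (insert (1/2) ((\<lambda>i. snd (lr i)) ` {1..s}))"
  have "0 < l" unfolding l_def using lr by (subst Min_gr_iff) auto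
  moreover have "r < 1" unfolding r_def using lr by (subst Max_less_iff) auto
  moreover have "(\<Prod>i\<in>{1..s}. \<phi> i 0 (x i)) = 0" if j: "j \<in> {1..s}" "x j \<notin> {l..r}" for x j
  proof -
    have "l \<le> fst (lr j)" unfolding l_def using j by (intro Min_le) auto
    moreover have "snd (lr j) \<le> r" unfolding r_def using j by (intro Max_ge) auto
    ultimately have "x j \<notin> {fst (lr j)..snd (lr j)}" using j by auto
    then have "\<phi> j 0 (x j) = 0" using lr j by blast
    then show ?thesis using j by (intro prod_zero) auto
  qed
  ultimately show "\<exists>l r. 0 < l \<and> r < 1 \<and> (\<forall>x\<in>{1..s} \<rightarrow>\<^sub>E UNIV. (\<exists>j\<in>{1..s}. x j \<notin> {l..r}) \<longrightarrow> (\<Prod>i\<in>{1..s}. \<phi> i 0 (x i)) = 0)"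
    by blast
qed

text \<open>
  The kernels of the representation. The index \<open>t = 0\<close> stands for a coordinate that is integrated out, \<open>t = 1, \<dots>, \<alpha>\<close> for a
  derivative of order \<open>t\<close> that is integrated, and \<open>t = Suc \<alpha>\<close> for the remainder with the derivative of order \<open>\<alpha>\<close>.
\<close>

definition bern_kernel :: "nat \<Rightarrow> nat \<Rightarrow> real \<Rightarrow> real \<Rightarrow> real" where
  "bern_kernel \<alpha> t y x = (if t = 0 then 1 else if t \<le> \<alpha> then (-1) ^ t * per_bern t (- y) else (-1) ^ Suc \<alpha> * per_bern \<alpha> (x - y))"

text \<open>
  All weak derivatives of \<open>f\<close> of order at most \<open>\<alpha>\<close> per variable, where \<open>f\<close> itself represents its derivative of
  order zero.
\<close>

locale weak_family =
  fixes s \<alpha> :: nat and f :: "(nat \<Rightarrow> real) \<Rightarrow> real" and G :: "(nat \<Rightarrow> nat) \<Rightarrow> (nat \<Rightarrow> real) \<Rightarrow> real"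
  assumes G0: "G (\<lambda>_. 0) = f"
    and weak: "\<And>\<beta>. (\<forall>j\<in>{1..s}. \<beta> j \<le> \<alpha>) \<Longrightarrow> (\<forall>j. j \<notin> {1..s} \<longrightarrow> \<beta> j = 0) \<Longrightarrow> has_weak_deriv s \<beta> f (G \<beta>)"
begin

abbreviation "M \<equiv> cube_measure {1..s}"

definition adm :: "(nat \<Rightarrow> nat) \<Rightarrow> bool" where
  "adm \<beta> \<longleftrightarrow> (\<forall>j\<in>{1..s}. \<beta> j \<le> \<alpha>) \<and> (\<forall>j. j \<notin> {1..s} \<longrightarrow> \<beta> j = 0)"

lemma integrable_G: "adm \<beta> \<Longrightarrow> integrable M (G \<beta>)"
  using weak[of \<beta>] by (simp add: adm_def has_weak_deriv_def)

definition L :: "(nat \<Rightarrow> nat) \<Rightarrow> (nat \<Rightarrow> real \<Rightarrow> real) \<Rightarrow> real" where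
  "L \<beta> w = (\<integral>x. G \<beta> x * (\<Prod>i\<in>{1..s}. w i (x i)) \<partial>M)"

lemma L_upd:
  assumes "j \<in> {1..s}"
  shows "L \<beta> (w(j := u)) = (\<integral>x. G \<beta> x * (u (x j) * (\<Prod>i\<in>{1..s} - {j}. w i (x i))) \<partial>M)"
proof -
  have "(\<Prod>i\<in>{1..s}. (w(j := u)) i (x i)) = u (x j) * (\<Prod>i\<in>{1..s} - {j}. w i (x i))" for x
    using assms by (subst prod.remove[of _ j]) (auto intro!: prod.cong)
  then show ?thesis by (simp add: L_def)
qed

lemma L_linear:
  assumes "j \<in> {1..s}" "adm \<beta>" "\<And>i. i \<in> {1..s} - {j} \<Longrightarrow> bb (w i)" "bb u" "bb v"
  shows "L \<beta> (w(j := \<lambda>x. a * u x + c * v x)) = a * L \<beta> (w(j := u)) + c * L \<beta> (w(j := v))"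
proof -
  have i: "integrable M (\<lambda>x. G \<beta> x * (u (x j) * (\<Prod>i\<in>{1..s} - {j}. w i (x i))))" if "bb u" for u
    unfolding mult.assoc[symmetric]
    by (rule integrable_mult_prod_bb[OF _ _ _ integrable_mult_component[OF integrable_G[OF assms(2)] that assms(1)]]) (use assms in auto)
  have "L \<beta> (w(j := \<lambda>x. a * u x + c * v x)) = (\<integral>x. a * (G \<beta> x * (u (x j) * (\<Prod>i\<in>{1..s} - {j}. w i (x i)))) + c * (G \<beta> x * (v (x j) * (\<Prod>i\<in>{1..s} - {j}. w i (x i)))) \<partial>M)"
    unfolding L_upd[OF assms(1)] by (intro Bochner_Integration.integral_cong refl) (simp add: algebra_simps)
  also have "\<dots> = a * L \<beta> (w(j := u)) + c * L \<beta> (w(j := v))"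
    unfolding L_upd[OF assms(1)] using i[OF assms(4)] i[OF assms(5)] by simp
  finally show ?thesis .
qed

lemma L_by_parts:
  assumes j: "j \<in> {1..s}" and \<beta>: "adm \<beta>" "\<beta> j < \<alpha>"
    and w: "\<And>i. i \<in> {1..s} - {j} \<Longrightarrow> bb (w i)"
    and u: "bb u" "(\<integral>t. u t \<partial>U1) = 0" and U: "bb U" "primitive_of u U"
  shows "L \<beta> (w(j := u)) = - L (\<beta>(j := Suc (\<beta> j))) (w(j := U))"
proof -
  define \<beta>' where "\<beta>' = \<beta>(j := Suc (\<beta> j))"
  have \<beta>': "adm \<beta>'" using \<beta> j by (auto simp: adm_def \<beta>'_def)
  have "(\<integral>x. G \<beta> x * (u (x j) * (\<Prod>i\<in>{1..s} - {j}. w i (x i))) \<partial>M)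
      + (\<integral>x. G \<beta>' x * (U (x j) * (\<Prod>i\<in>{1..s} - {j}. w i (x i))) \<partial>M) = 0"
  proof (rule weak_integration_by_parts[OF _ j integrable_G[OF \<beta>(1)] integrable_G[OF \<beta>'] _ w u U])
    fix \<phi> assume \<phi>: "\<And>i. i \<in> {1..s} \<Longrightarrow> test1 (\<phi> i)"
    define \<phi>' where "\<phi>' = \<phi>(j := \<lambda>n. \<phi> j (Suc n))"
    have "test1 (\<lambda>n. \<phi> j (Suc n))"
    proof -
      obtain l r where lr: "0 < l" "r < 1" "\<And>n x. x \<notin> {l..r} \<Longrightarrow> \<phi> j n x = 0" using test1_support[OF \<phi>[OF j]] by metis
      have "0 < l \<and> r < 1 \<and> (\<forall>x. x \<notin> {l..r} \<longrightarrow> \<phi> j (Suc 0) x = 0)" using lr by blast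
      then show ?thesis using test1_deriv[OF \<phi>[OF j]] unfolding test1_def by blast
    qed
    then have \<phi>': "test1 (\<phi>' i)" if "i \<in> {1..s}" for i using \<phi>[OF that] by (simp add: \<phi>'_def)
    let ?t = "\<lambda>\<phi> \<beta> x. \<Prod>i\<in>{1..s}. \<phi> i (\<beta> i) (x i) :: real"
    have e1: "?t \<phi>' \<beta> x = ?t \<phi> \<beta>' x" for x
      by (intro prod.cong) (auto simp: \<phi>'_def \<beta>'_def)
    have w1: "(\<integral>x. f x * ?t \<phi>' \<beta> x \<partial>M) = (-1) ^ (\<Sum>j=1..s. \<beta> j) * (\<integral>x. G \<beta> x * ?t \<phi>' (\<lambda>_. 0) x \<partial>M)"
      using weak[of \<beta>] \<beta>(1) test_function_tensor[of s \<phi>', OF \<phi>'] unfolding has_weak_deriv_def adm_def by blast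
    have w2: "(\<integral>x. f x * ?t \<phi> \<beta>' x \<partial>M) = (-1) ^ (\<Sum>j=1..s. \<beta>' j) * (\<integral>x. G \<beta>' x * ?t \<phi> (\<lambda>_. 0) x \<partial>M)"
      using weak[of \<beta>'] \<beta>' test_function_tensor[of s \<phi>, OF \<phi>] unfolding has_weak_deriv_def adm_def by blast
    have sg: "(\<Sum>j=1..s. \<beta>' j) = Suc (\<Sum>j=1..s. \<beta> j)"
    proof -
      have "(\<Sum>i=1..s. \<beta>' i) = \<beta>' j + (\<Sum>i\<in>{1..s} - {j}. \<beta>' i)" using j by (intro sum.remove) auto
      also have "(\<Sum>i\<in>{1..s} - {j}. \<beta>' i) = (\<Sum>i\<in>{1..s} - {j}. \<beta> i)" by (intro sum.cong) (auto simp: \<beta>'_def)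
      also have "\<beta>' j + (\<Sum>i\<in>{1..s} - {j}. \<beta> i) = Suc (\<Sum>i=1..s. \<beta> i)"
        using j by (subst sum.remove[of "{1..s}" j \<beta>]) (auto simp: \<beta>'_def)
      finally show ?thesis .
    qed
    have pr1: "?t \<phi>' (\<lambda>_. 0) x = \<phi> j (Suc 0) (x j) * (\<Prod>i\<in>{1..s} - {j}. \<phi> i 0 (x i))" for x
      using j by (subst prod.remove[of _ j]) (auto simp: \<phi>'_def intro!: prod.cong)
    have pr2: "?t \<phi> (\<lambda>_. 0) x = \<phi> j 0 (x j) * (\<Prod>i\<in>{1..s} - {j}. \<phi> i 0 (x i))" for x
      using j by (subst prod.remove[of _ j]) auto
    let ?I1 = "\<integral>x. G \<beta> x * ?t \<phi>' (\<lambda>_. 0) x \<partial>M" and ?I2 = "\<integral>x. G \<beta>' x * ?t \<phi> (\<lambda>_. 0) x \<partial>M"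
    have "(-1) ^ (\<Sum>j=1..s. \<beta> j) * ?I1 = (-1) ^ (\<Sum>j=1..s. \<beta> j) * (- ?I2)"
      using w1 w2 unfolding e1 sg by simp
    then have "?I1 = - ?I2" by (simp only: mult_cancel_left power_eq_0_iff) simp
    then have "?I1 + ?I2 = 0" by simp
    then show "(\<integral>x. G \<beta> x * (\<phi> j (Suc 0) (x j) * (\<Prod>i\<in>{1..s} - {j}. \<phi> i 0 (x i))) \<partial>M)
       + (\<integral>x. G \<beta>' x * (\<phi> j 0 (x j) * (\<Prod>i\<in>{1..s} - {j}. \<phi> i 0 (x i))) \<partial>M) = 0"
      unfolding pr1 pr2 .
  qed auto
  then show ?thesis unfolding L_upd[OF j] \<beta>'_def by linarith
qed

definition kere :: "real \<Rightarrow> nat \<Rightarrow> real \<Rightarrow> real \<Rightarrow> real" where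
  "kere \<epsilon> t y x = (if t = 0 then 1 else if t \<le> \<alpha> then (-1) ^ t * quot \<epsilon> y t 0 else (-1) ^ Suc \<alpha> * quot \<epsilon> y \<alpha> x)"

lemma bb_kere: "\<epsilon> > 0 \<Longrightarrow> bb (kere \<epsilon> t y)"
proof -
  assume e: "\<epsilon> > 0"
  have "bb (\<lambda>x. (-1) ^ Suc \<alpha> * quot \<epsilon> y \<alpha> x + 0 * quot \<epsilon> y \<alpha> x)" by (intro bb_add bb_quot e)
  then show ?thesis unfolding kere_def by (cases "t = 0"; cases "t \<le> \<alpha>") (auto intro: bb_const)
qed

lemma adm_upd: "adm \<beta> \<Longrightarrow> j \<in> {1..s} \<Longrightarrow> m \<le> \<alpha> \<Longrightarrow> adm (\<beta>(j := m))"
  by (auto simp: adm_def)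

text \<open>
  A Taylor expansion in one coordinate. The approximate point mass is \<open>1\<close> minus the mean of a sawtooth, and each
  integration by parts moves a derivative from the periodic Bernoulli function to \<open>f\<close>; the constants of
  integration are the terms with \<open>t \<le> \<alpha>\<close>.
\<close>

lemma L_expand_coordinate:
  assumes j: "j \<in> {1..s}" and \<beta>: "adm \<beta>" "\<beta> j = 0" and e: "\<epsilon> > 0"
    and w: "\<And>i. i \<in> {1..s} - {j} \<Longrightarrow> bb (w i)"
  shows "L \<beta> (w(j := delta \<epsilon> y)) = (\<Sum>t\<le>Suc \<alpha>. L (\<beta>(j := min t \<alpha>)) (w(j := kere \<epsilon> t y)))"
proof -
  let ?one = "\<lambda>_::real. 1 :: real"
  define c where "c = (\<lambda>t. if t = 0 then 1 else (-1) ^ t * quot \<epsilon> y t 0)"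
  have scale: "L \<gamma> (w(j := \<lambda>x. a * u x)) = a * L \<gamma> (w(j := u))" if "adm \<gamma>" "bb u" for \<gamma> a u
    using L_linear[OF j that(1) w that(2) that(2), where a = a and c = 0] by simp
  have main: "L \<beta> (w(j := delta \<epsilon> y)) = (\<Sum>t\<le>m. c t * L (\<beta>(j := t)) (w(j := ?one))) + (-1) ^ Suc m * L (\<beta>(j := m)) (w(j := quot \<epsilon> y m))"
    if "m \<le> \<alpha>" for m
    using that
  proof (induction m)
    case 0
    have "\<beta>(j := 0) = \<beta>" using \<beta>(2) by auto
    have c0: "c 0 = 1" by (simp add: c_def)
    have E: "L \<beta> (w(j := delta \<epsilon> y)) = 1 * L \<beta> (w(j := ?one)) + (-1) * L \<beta> (w(j := quot \<epsilon> y 0))"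
      unfolding delta_def by (rule L_linear[OF j \<beta>(1) w bb_const bb_quot[OF e]])
    have s0: "(\<Sum>t\<le>0::nat. h t) = h 0" for h :: "nat \<Rightarrow> real" by simp
    show ?case
      unfolding s0 c0 \<open>\<beta>(j := 0) = \<beta>\<close> power_Suc power_0 mult_1_right by (rule E)
  next
    case (Suc m)
    let ?\<gamma> = "\<beta>(j := m)"
    have a: "adm ?\<gamma>" "adm (\<beta>(j := Suc m))" using adm_upd[OF \<beta>(1) j] Suc.prems by auto
    have "L ?\<gamma> (w(j := quot \<epsilon> y m)) = - L (?\<gamma>(j := Suc (?\<gamma> j))) (w(j := \<lambda>x. 1 * quot \<epsilon> y (Suc m) x + (- quot \<epsilon> y (Suc m) 0) * 1))"
    proof (rule L_by_parts[OF j a(1) _ w bb_quot[OF e] quot_zero_mean[OF e] bb_add[OF bb_quot[OF e] bb_const] quot_primitive[OF e]])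
      show "?\<gamma> j < \<alpha>" using Suc.prems by simp
    qed
    also have "?\<gamma>(j := Suc (?\<gamma> j)) = \<beta>(j := Suc m)" by simp
    also have "L (\<beta>(j := Suc m)) (w(j := \<lambda>x. 1 * quot \<epsilon> y (Suc m) x + (- quot \<epsilon> y (Suc m) 0) * 1))
       = 1 * L (\<beta>(j := Suc m)) (w(j := quot \<epsilon> y (Suc m))) + (- quot \<epsilon> y (Suc m) 0) * L (\<beta>(j := Suc m)) (w(j := ?one))"
      by (rule L_linear[OF j a(2) w bb_quot[OF e] bb_const])
    finally have st: "L ?\<gamma> (w(j := quot \<epsilon> y m)) = quot \<epsilon> y (Suc m) 0 * L (\<beta>(j := Suc m)) (w(j := ?one)) - L (\<beta>(j := Suc m)) (w(j := quot \<epsilon> y (Suc m)))"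
      by (simp add: fun_upd_def)
    have step: "l = S + (p * Q) * Y + (- p) * Z" if "l = S + p * X" "X = Q * Y - Z" for l S p X Q Y Z :: real
      using that by (simp add: algebra_simps)
    have "L \<beta> (w(j := delta \<epsilon> y)) = (\<Sum>t\<le>m. c t * L (\<beta>(j := t)) (w(j := ?one))) + (-1) ^ Suc m * L ?\<gamma> (w(j := quot \<epsilon> y m))"
      using Suc.IH Suc.prems Suc_leD by blast
    note step[OF this st]
    moreover have "c (Suc m) = (-1) ^ Suc m * quot \<epsilon> y (Suc m) 0" by (simp add: c_def)
    moreover have "(-1::real) ^ Suc (Suc m) = - ((-1) ^ Suc m)" by simp
    ultimately show ?case unfolding sum.atMost_Suc by (simp only:)
  qed
  have k1: "L (\<beta>(j := t)) (w(j := kere \<epsilon> t y)) = c t * L (\<beta>(j := t)) (w(j := ?one))" if t: "t \<le> \<alpha>" for t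
  proof -
    have "kere \<epsilon> t y = (\<lambda>x. c t * ?one x)" using t by (auto simp: kere_def c_def fun_eq_iff)
    show ?thesis unfolding \<open>kere \<epsilon> t y = (\<lambda>x. c t * ?one x)\<close> by (rule scale[OF adm_upd[OF \<beta>(1) j t] bb_const])
  qed
  have k2: "L (\<beta>(j := \<alpha>)) (w(j := kere \<epsilon> (Suc \<alpha>) y)) = (-1) ^ Suc \<alpha> * L (\<beta>(j := \<alpha>)) (w(j := quot \<epsilon> y \<alpha>))"
  proof -
    have "kere \<epsilon> (Suc \<alpha>) y = (\<lambda>x. (-1) ^ Suc \<alpha> * quot \<epsilon> y \<alpha> x)" by (simp add: kere_def fun_eq_iff)
    show ?thesis unfolding \<open>kere \<epsilon> (Suc \<alpha>) y = (\<lambda>x. (-1) ^ Suc \<alpha> * quot \<epsilon> y \<alpha> x)\<close>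
      by (rule scale[OF adm_upd[OF \<beta>(1) j order.refl] bb_quot[OF e]])
  qed
  have "(\<Sum>t\<le>Suc \<alpha>. L (\<beta>(j := min t \<alpha>)) (w(j := kere \<epsilon> t y)))
     = (\<Sum>t\<le>\<alpha>. L (\<beta>(j := t)) (w(j := kere \<epsilon> t y))) + L (\<beta>(j := \<alpha>)) (w(j := kere \<epsilon> (Suc \<alpha>) y))"
    by simp
  also have "\<dots> = (\<Sum>t\<le>\<alpha>. c t * L (\<beta>(j := t)) (w(j := ?one))) + (-1) ^ Suc \<alpha> * L (\<beta>(j := \<alpha>)) (w(j := quot \<epsilon> y \<alpha>))"
    unfolding k2 by (simp add: k1)
  finally show ?thesis using main[OF order.refl] by simp
qed

definition mindex :: "(nat \<Rightarrow> nat) \<Rightarrow> nat \<Rightarrow> nat" where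
  "mindex t = (\<lambda>j. if j \<in> {1..s} then min (t j) \<alpha> else 0)"

lemma L_expand:
  assumes e: "\<epsilon> > 0"
  shows "L (\<lambda>_. 0) (\<lambda>j. delta \<epsilon> (y j)) = (\<Sum>t\<in>{1..s} \<rightarrow>\<^sub>E {..Suc \<alpha>}. L (mindex t) (\<lambda>j. kere \<epsilon> (t j) (y j)))"
proof -
  let ?mi = "\<lambda>J t j. if j \<in> J then min (t j) \<alpha> else 0"
  let ?w = "\<lambda>J t j. if j \<in> J then kere \<epsilon> (t j) (y j) else delta \<epsilon> (y j)"
  have "L (\<lambda>_. 0) (\<lambda>j. delta \<epsilon> (y j)) = (\<Sum>t\<in>J \<rightarrow>\<^sub>E {..Suc \<alpha>}. L (?mi J t) (?w J t))"
    if "finite J" "J \<subseteq> {1..s}" for J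
    using that
  proof (induction J rule: finite_induct)
    case empty then show ?case by simp
  next
    case (insert j J)
    have j: "j \<in> {1..s}" "J \<subseteq> {1..s}" using insert.prems by auto
    have "L (?mi J t) (?w J t) = (\<Sum>k\<le>Suc \<alpha>. L (?mi (insert j J) (t(j := k))) (?w (insert j J) (t(j := k))))" for t
    proof -
      have a: "adm (?mi J t)" using j by (auto simp: adm_def)
      have "?w J t = (?w J t)(j := delta \<epsilon> (y j))" using insert.hyps by auto
      then have "L (?mi J t) (?w J t) = L (?mi J t) ((?w J t)(j := delta \<epsilon> (y j)))" by simp
      also have "\<dots> = (\<Sum>k\<le>Suc \<alpha>. L ((?mi J t)(j := min k \<alpha>)) ((?w J t)(j := kere \<epsilon> k (y j))))"
        by (rule L_expand_coordinate[OF j(1) a _ e]) (use insert.hyps bb_kere[OF e] bb_delta[OF e] in auto)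
      also have "\<dots> = (\<Sum>k\<le>Suc \<alpha>. L (?mi (insert j J) (t(j := k))) (?w (insert j J) (t(j := k))))"
      proof (rule sum.cong[OF refl])
        fix k
        have "(?mi J t)(j := min k \<alpha>) = ?mi (insert j J) (t(j := k))" by (auto simp: fun_eq_iff)
        moreover have "(?w J t)(j := kere \<epsilon> k (y j)) = ?w (insert j J) (t(j := k))" by (auto simp: fun_eq_iff)
        ultimately show "L ((?mi J t)(j := min k \<alpha>)) ((?w J t)(j := kere \<epsilon> k (y j))) = L (?mi (insert j J) (t(j := k))) (?w (insert j J) (t(j := k)))"
          by simp
      qed
      finally show ?thesis .
    qed
    then show ?case unfolding sum_PiE_insert[OF insert.hyps(2)] using insert.IH j by simp
  qed
  from this[of "{1..s}"]
  have "L (\<lambda>_. 0) (\<lambda>j. delta \<epsilon> (y j)) = (\<Sum>t\<in>{1..s} \<rightarrow>\<^sub>E {..Suc \<alpha>}. L (?mi {1..s} t) (?w {1..s} t))" by simp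
  also have "\<dots> = (\<Sum>t\<in>{1..s} \<rightarrow>\<^sub>E {..Suc \<alpha>}. L (mindex t) (\<lambda>j. kere \<epsilon> (t j) (y j)))"
    unfolding L_def mindex_def by (intro sum.cong refl Bochner_Integration.integral_cong arg_cong2[where f = "(*)"] prod.cong) auto
  finally show ?thesis .
qed

abbreviation "ker \<equiv> bern_kernel \<alpha>"

lemma kere_tendsto:
  assumes "\<And>i. \<epsilon> i > 0" "\<epsilon> \<longlonglongrightarrow> 0" "\<alpha> \<ge> 1"
  shows "(\<lambda>i. kere (\<epsilon> i) t y x) \<longlonglongrightarrow> ker t y x"
proof -
  have "(\<lambda>i. quot (\<epsilon> i) y t 0) \<longlonglongrightarrow> per_bern t (- y)" if "t \<ge> 1"
    using quot_tendsto[OF assms(1,2) that, of y 0] by simp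
  then show ?thesis
    using quot_tendsto[OF assms(1,2,3), of y x] unfolding kere_def bern_kernel_def
    by (cases "t = 0"; cases "t \<le> \<alpha>") (auto intro!: tendsto_intros)
qed

lemma abs_kere_le: "\<epsilon> > 0 \<Longrightarrow> \<alpha> \<ge> 1 \<Longrightarrow> \<bar>kere \<epsilon> t y x\<bar> \<le> 1"
  using abs_quot_le[of \<epsilon> t y 0] abs_quot_le[of \<epsilon> \<alpha> y x] by (auto simp: kere_def abs_mult power_abs)

lemma adm_mindex: "adm (mindex t)"
  by (auto simp: adm_def mindex_def)

lemma L_kere_tendsto:
  assumes e: "\<And>i. \<epsilon> i > 0" "\<epsilon> \<longlonglongrightarrow> 0" and \<alpha>: "\<alpha> \<ge> 1"
  shows "(\<lambda>i. L (mindex t) (\<lambda>j. kere (\<epsilon> i) (t j) (y j))) \<longlonglongrightarrow> (\<integral>x. G (mindex t) x * (\<Prod>j\<in>{1..s}. ker (t j) (y j) (x j)) \<partial>M)"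
  unfolding L_def
proof (rule integral_dominated_convergence[where w = "\<lambda>x. \<bar>G (mindex t) x\<bar>"])
  have int: "integrable M (G (mindex t))" by (rule integrable_G[OF adm_mindex])
  have m: "(\<lambda>x. G (mindex t) x * (\<Prod>j\<in>{1..s}. kere (\<epsilon> i) (t j) (y j) (x j))) \<in> borel_measurable M" for i
    by (rule borel_measurable_integrable, rule integrable_mult_prod_bb[OF _ _ _ int]) (use bb_kere[OF e(1)] in auto)
  show "(\<lambda>x. G (mindex t) x * (\<Prod>j\<in>{1..s}. kere (\<epsilon> i) (t j) (y j) (x j))) \<in> borel_measurable M" for i by (rule m)
  have lim: "(\<lambda>i. G (mindex t) x * (\<Prod>j\<in>{1..s}. kere (\<epsilon> i) (t j) (y j) (x j))) \<longlonglongrightarrow> G (mindex t) x * (\<Prod>j\<in>{1..s}. ker (t j) (y j) (x j))" for x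
    by (intro tendsto_mult tendsto_const tendsto_prod kere_tendsto[OF e \<alpha>])
  then show "AE x in M. (\<lambda>i. G (mindex t) x * (\<Prod>j\<in>{1..s}. kere (\<epsilon> i) (t j) (y j) (x j))) \<longlonglongrightarrow> G (mindex t) x * (\<Prod>j\<in>{1..s}. ker (t j) (y j) (x j))"
    by simp
  show "(\<lambda>x. G (mindex t) x * (\<Prod>j\<in>{1..s}. ker (t j) (y j) (x j))) \<in> borel_measurable M"
    by (rule borel_measurable_LIMSEQ_real[OF lim m])
  show "integrable M (\<lambda>x. \<bar>G (mindex t) x\<bar>)" using int by simp
  show "AE x in M. norm (G (mindex t) x * (\<Prod>j\<in>{1..s}. kere (\<epsilon> i) (t j) (y j) (x j))) \<le> \<bar>G (mindex t) x\<bar>" for i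
  proof (intro AE_I2)
    fix x
    have "(\<Prod>j\<in>{1..s}. \<bar>kere (\<epsilon> i) (t j) (y j) (x j)\<bar>) \<le> (\<Prod>j\<in>{1..s}. 1)"
      by (intro prod_mono) (use abs_kere_le[OF e(1) \<alpha>] in auto)
    then show "norm (G (mindex t) x * (\<Prod>j\<in>{1..s}. kere (\<epsilon> i) (t j) (y j) (x j))) \<le> \<bar>G (mindex t) x\<bar>"
      by (simp add: abs_mult abs_prod mult_left_le)
  qed
qed

lemma continuous_on_cube_delta:
  assumes f: "continuous_on (cube {1..s}) f" and y: "y \<in> cube {1..s}" and e: "e > 0"
  shows "\<exists>d>0. \<forall>x\<in>cube {1..s}. (\<forall>j\<in>{1..s}. \<bar>x j - y j\<bar> < d) \<longrightarrow> \<bar>f x - f y\<bar> < e"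
proof -
  obtain U where U: "open U" "y \<in> U" "\<And>x. x \<in> cube {1..s} \<Longrightarrow> x \<in> U \<Longrightarrow> f x \<in> ball (f y) e"
    using f[unfolded continuous_on_topological, rule_format, OF y, of "ball (f y) e"] e by auto
  have "openin (product_topology (\<lambda>i. euclidean) UNIV) U" using U(1) unfolding open_fun_def .
  from product_topology_open_contains_basis[OF this U(2)]
  obtain X where X: "y \<in> (\<Pi>\<^sub>E i\<in>UNIV. X i)" "\<And>i. open (X i)" "(\<Pi>\<^sub>E i\<in>UNIV. X i) \<subseteq> U"
    by (metis open_openin)
  have "\<forall>j\<in>{1..s}. \<exists>d>0. \<forall>z. \<bar>z - y j\<bar> < d \<longrightarrow> z \<in> X j"
  proof
    fix j
    have "y j \<in> X j" using X(1) by auto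
    then obtain d where "d > 0" "ball (y j) d \<subseteq> X j" using X(2) openE by metis
    then show "\<exists>d>0. \<forall>z. \<bar>z - y j\<bar> < d \<longrightarrow> z \<in> X j"
      by (intro exI[of _ d]) (auto simp: dist_real_def subset_iff abs_minus_commute)
  qed
  then obtain d where d: "\<And>j. j \<in> {1..s} \<Longrightarrow> d j > 0 \<and> (\<forall>z. \<bar>z - y j\<bar> < d j \<longrightarrow> z \<in> X j)" by metis
  define d0 where "d0 = Min (insert 1 (d ` {1..s}))"
  have "d0 > 0" unfolding d0_def using d by (subst Min_gr_iff) auto
  moreover have "\<bar>f x - f y\<bar> < e" if x: "x \<in> cube {1..s}" "\<forall>j\<in>{1..s}. \<bar>x j - y j\<bar> < d0" for x
  proof -
    have "x i \<in> X i" for i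
    proof (cases "i \<in> {1..s}")
      case True
      then have "d0 \<le> d i" unfolding d0_def by (intro Min_le) auto
      have "\<bar>x i - y i\<bar> < d i" using x(2) True \<open>d0 \<le> d i\<close> by fastforce
      then show ?thesis using d[OF True] by blast
    next
      case False
      have "x i = undefined" using x(1) False unfolding cube_def by (rule PiE_arb)
      also have "undefined = y i" using y False unfolding cube_def by (rule PiE_arb[symmetric])
      finally have "x i = y i" .
      moreover have "y i \<in> X i" using PiE_mem[OF X(1) UNIV_I] .
      ultimately show ?thesis by (simp only:)
    qed
    then have "x \<in> (\<Pi>\<^sub>E i\<in>UNIV. X i)" by (simp only: PiE_UNIV_domain Pi_iff) blast
    then have "x \<in> U" by (rule subsetD[OF X(3)])
    then show ?thesis using U(3)[OF x(1)] by (simp add: dist_real_def abs_minus_commute)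
  qed
  ultimately show ?thesis by blast
qed

lemma L_delta_tendsto:
  assumes f: "continuous_on (cube {1..s}) f" and y: "y \<in> cube {1..s}"
    and e: "\<And>i. \<epsilon> i > 0" "\<epsilon> \<longlonglongrightarrow> 0" "\<And>i j. j \<in> {1..s} \<Longrightarrow> y j + \<epsilon> i < 1"
  shows "(\<lambda>i. L (\<lambda>_. 0) (\<lambda>j. delta (\<epsilon> i) (y j))) \<longlonglongrightarrow> f y"
proof (rule LIMSEQ_I)
  fix e0 :: real assume e0: "e0 > 0"
  interpret product_sigma_finite "\<lambda>_::nat. U1"
    by (rule product_sigma_finite.intro) (rule prob_space_imp_sigma_finite[OF prob_space_U1])
  interpret P: prob_space M by (rule prob_space_cube)
  have yj: "0 \<le> y j" if "j \<in> {1..s}" for j using y that by (auto simp: cube_def PiE_iff)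
  obtain d where d: "d > 0" "\<And>x. x \<in> cube {1..s} \<Longrightarrow> (\<forall>j\<in>{1..s}. \<bar>x j - y j\<bar> < d) \<Longrightarrow> \<bar>f x - f y\<bar> < e0 / 2"
    using continuous_on_cube_delta[OF f y, of "e0 / 2"] e0 by auto
  have "eventually (\<lambda>i. \<epsilon> i < d) sequentially" using e(2) d(1) by (rule order_tendstoD)
  then obtain N where N: "\<And>i. i \<ge> N \<Longrightarrow> \<epsilon> i < d" by (auto simp: eventually_sequentially)
  have "norm (L (\<lambda>_. 0) (\<lambda>j. delta (\<epsilon> i) (y j)) - f y) < e0" if i: "i \<ge> N" for i
  proof -
    let ?D = "\<lambda>x. \<Prod>j\<in>{1..s}. delta (\<epsilon> i) (y j) (x j)"
    have fi: "integrable M f"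
      using integrable_G[of "\<lambda>_. 0"] G0 by (simp add: adm_def)
    have bd: "bb (delta (\<epsilon> i) (y j))" for j by (rule bb_delta[OF e(1)])
    have Di: "integrable M ?D"
      using integrable_mult_prod_bb[of "{1..s}" "{1..s}" "\<lambda>j. delta (\<epsilon> i) (y j)" "\<lambda>_. 1"] bd P.integrable_const[of 1] by simp
    have fDi: "integrable M (\<lambda>x. f x * ?D x)"
      by (rule integrable_mult_prod_bb[OF _ _ _ fi]) (use bd in auto)
    have D1: "(\<integral>x. ?D x \<partial>M) = 1"
      unfolding cube_measure_eq
      by (subst product_integral_prod) (use integral_delta[OF e(1)] integrable_U1_bb[OF bd] in auto)
    have pt: "0 \<le> ?D x \<and> \<bar>(f x - f y) * ?D x\<bar> \<le> e0 / 2 * ?D x" if x: "x \<in> space M" for x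
    proof -
      have xc: "x \<in> cube {1..s}" using x by (simp add: space_cube cube_def)
      have xj: "0 \<le> x j \<and> x j < 1" if "j \<in> {1..s}" for j using xc that by (auto simp: cube_def PiE_iff)
      have de: "delta (\<epsilon> i) (y j) (x j) = (if y j < x j \<and> x j \<le> y j + \<epsilon> i then 1 / \<epsilon> i else 0)" if j: "j \<in> {1..s}" for j
        by (rule delta_eq) (use e(1) e(3)[OF j] yj[OF j] xj[OF j] in auto)
      have D0: "0 \<le> ?D x" using de e(1)[of i] by (intro prod_nonneg) auto
      show ?thesis
      proof (cases "\<forall>j\<in>{1..s}. y j < x j \<and> x j \<le> y j + \<epsilon> i")
        case True
        then have "\<forall>j\<in>{1..s}. \<bar>x j - y j\<bar> < d" using N[OF i] by force
        then have "\<bar>f x - f y\<bar> \<le> e0 / 2" using d(2)[OF xc] by (simp add: less_imp_le)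
        from mult_right_mono[OF this D0] show ?thesis using D0 by (simp add: abs_mult)
      next
        case False
        then obtain j where "j \<in> {1..s}" "\<not> (y j < x j \<and> x j \<le> y j + \<epsilon> i)" by blast
        then have "delta (\<epsilon> i) (y j) (x j) = 0" using de by simp
        then have "?D x = 0" using \<open>j \<in> {1..s}\<close> by (intro prod_zero) auto
        then show ?thesis by (simp only:) simp
      qed
    qed
    have "L (\<lambda>_. 0) (\<lambda>j. delta (\<epsilon> i) (y j)) - f y = (\<integral>x. f x * ?D x \<partial>M) - f y * (\<integral>x. ?D x \<partial>M)"
      by (simp only: L_def G0 D1 mult_1_right)
    also have "\<dots> = (\<integral>x. (f x - f y) * ?D x \<partial>M)"
      using fDi Di by (simp add: left_diff_distrib)
    finally have eq: "L (\<lambda>_. 0) (\<lambda>j. delta (\<epsilon> i) (y j)) - f y = (\<integral>x. (f x - f y) * ?D x \<partial>M)" .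
    have int: "integrable M (\<lambda>x. (f x - f y) * ?D x)" using fDi Di by (simp add: left_diff_distrib)
    have "norm (\<integral>x. (f x - f y) * ?D x \<partial>M) \<le> (\<integral>x. norm ((f x - f y) * ?D x) \<partial>M)"
      by (rule integral_norm_bound)
    also have "\<dots> \<le> (\<integral>x. e0 / 2 * ?D x \<partial>M)"
      by (rule integral_mono) (use int Di pt in auto)
    also have "\<dots> = e0 / 2" using D1 by simp
    finally show ?thesis unfolding eq using e0 by simp
  qed
  then show "\<exists>N. \<forall>i\<ge>N. norm (L (\<lambda>_. 0) (\<lambda>j. delta (\<epsilon> i) (y j)) - f y) < e0" by blast
qed

text \<open>
  Apply the expansion in every coordinate to the mean of \<open>f\<close> over the cube with corner \<open>y\<close> and side \<open>\<epsilon>\<close>, and let \<open>\<epsilon>\<close> tend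
  to \<open>0\<close>. The left side converges to \<open>f y\<close> by continuity, the right side by dominated convergence. Working with means avoids any
  regularity theory for weakly differentiable functions.
\<close>

theorem representation:
  assumes \<alpha>: "\<alpha> \<ge> 1" and f: "continuous_on (cube {1..s}) f" and y: "y \<in> cube {1..s}"
  shows "f y = (\<Sum>t\<in>{1..s} \<rightarrow>\<^sub>E {..Suc \<alpha>}. \<integral>x. G (mindex t) x * (\<Prod>j\<in>{1..s}. ker (t j) (y j) (x j)) \<partial>M)"
proof -
  have yj: "y j < 1" if "j \<in> {1..s}" for j using y that by (auto simp: cube_def PiE_iff)
  define \<delta> where "\<delta> = Min (insert 1 ((\<lambda>j. 1 - y j) ` {1..s}))"
  have \<delta>: "\<delta> > 0" unfolding \<delta>_def using yj by (subst Min_gr_iff) auto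
  have \<delta>j: "\<delta> \<le> 1 - y j" if "j \<in> {1..s}" for j unfolding \<delta>_def using that by (intro Min_le) auto
  define \<epsilon> where "\<epsilon> = (\<lambda>i::nat. \<delta> / (real i + 2))"
  have e: "\<And>i. \<epsilon> i > 0" "\<epsilon> \<longlonglongrightarrow> 0" "\<And>i. \<epsilon> i < \<delta>"
  proof -
    show "\<epsilon> i > 0" for i using \<delta> by (simp add: \<epsilon>_def)
    show "\<epsilon> \<longlonglongrightarrow> 0" unfolding \<epsilon>_def by real_asymp
    show "\<epsilon> i < \<delta>" for i using \<delta> by (simp add: \<epsilon>_def divide_less_eq)
  qed
  have "y j + \<epsilon> i < 1" if "j \<in> {1..s}" for i j using \<delta>j[OF that] e(3)[of i] by linarith
  from L_delta_tendsto[OF f y e(1,2) this]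
  have "(\<lambda>i. L (\<lambda>_. 0) (\<lambda>j. delta (\<epsilon> i) (y j))) \<longlonglongrightarrow> f y" .
  moreover have "(\<lambda>i. L (\<lambda>_. 0) (\<lambda>j. delta (\<epsilon> i) (y j))) \<longlonglongrightarrow>
     (\<Sum>t\<in>{1..s} \<rightarrow>\<^sub>E {..Suc \<alpha>}. \<integral>x. G (mindex t) x * (\<Prod>j\<in>{1..s}. ker (t j) (y j) (x j)) \<partial>M)"
    unfolding L_expand[OF e(1)] by (intro tendsto_sum L_kere_tendsto[OF e(1,2) \<alpha>])
  ultimately show ?thesis by (rule LIMSEQ_unique)
qed

end


section \<open>The norm and averaged derivatives\<close>

text \<open>
  If \<open>E\<close> depends on the coordinates in \<open>v\<close> alone, Fubini integrates \<open>g\<close> over all other coordinates first, before the absolute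
  value is taken. This is why the norm contains means of derivatives.
\<close>

lemma cube_integral_abs_le:
  fixes g E :: "(nat \<Rightarrow> real) \<Rightarrow> real"
  assumes v: "v \<subseteq> T" "finite T" and g: "integrable (cube_measure T) g"
    and E: "integrable (cube_measure T) (\<lambda>x. g x * E x)"
    and dep: "\<And>x x'. (\<And>j. j \<in> v \<Longrightarrow> x j = x' j) \<Longrightarrow> E x = E x'"
    and bound: "\<And>x. \<bar>E x\<bar> \<le> e"
  shows "\<bar>\<integral>x. g x * E x \<partial>cube_measure T\<bar>
      \<le> e * (\<integral>x. \<bar>\<integral>z. g (merge v (T - v) (x, z)) \<partial>cube_measure (T - v)\<bar> \<partial>cube_measure v)"
    and "integrable (cube_measure v) (\<lambda>x. \<integral>z. g (merge v (T - v) (x, z)) \<partial>cube_measure (T - v))"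
proof -
  interpret product_sigma_finite "\<lambda>_::nat. U1"
    by (rule product_sigma_finite.intro) (rule prob_space_imp_sigma_finite[OF prob_space_U1])
  have fin: "finite v" "finite (T - v)" and dj: "v \<inter> (T - v) = {}" and un: "v \<union> (T - v) = T"
    using v finite_subset by auto
  interpret I: finite_product_sigma_finite "\<lambda>_::nat. U1" v by standard (rule fin)
  interpret J: finite_product_sigma_finite "\<lambda>_::nat. U1" "T - v" by standard (rule fin)
  interpret P: pair_sigma_finite "Pi\<^sub>M v (\<lambda>_. U1)" "Pi\<^sub>M (T - v) (\<lambda>_. U1)" ..
  let ?m = "\<lambda>x z. merge v (T - v) (x, z)"
  let ?A = "\<lambda>x. \<integral>z. g (?m x z) \<partial>cube_measure (T - v)"
  have g': "integrable (Pi\<^sub>M (v \<union> (T - v)) (\<lambda>_. U1)) g" using g by (simp only: un cube_measure_eq)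
  have E': "integrable (Pi\<^sub>M (v \<union> (T - v)) (\<lambda>_. U1)) (\<lambda>x. g x * E x)" using E by (simp only: un cube_measure_eq)
  have "integrable (Pi\<^sub>M v (\<lambda>_. U1) \<Otimes>\<^sub>M Pi\<^sub>M (T - v) (\<lambda>_. U1)) (\<lambda>x. g (merge v (T - v) x))"
    by (rule integrable_distr[OF measurable_merge[of v "T - v" "\<lambda>_. U1"], where f = g]) (simp only: distr_merge[OF dj fin] g')
  from P.integrable_fst'[OF this]
  show A: "integrable (cube_measure v) ?A" by (simp add: cube_measure_eq)
  have mE: "E (?m x z) = E x" for x z
    by (rule dep) (simp add: merge_def)
  have "(\<integral>x. g x * E x \<partial>cube_measure T) = (\<integral>x. (\<integral>z. g (?m x z) * E (?m x z) \<partial>cube_measure (T - v)) \<partial>cube_measure v)"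
    using product_integral_fold[OF dj fin E'] by (simp only: un cube_measure_eq)
  also have "\<dots> = (\<integral>x. ?A x * E x \<partial>cube_measure v)"
    unfolding mE by simp
  finally have "\<bar>\<integral>x. g x * E x \<partial>cube_measure T\<bar> \<le> (\<integral>x. norm (?A x * E x) \<partial>cube_measure v)"
    using integral_norm_bound[of "cube_measure v" "\<lambda>x. ?A x * E x"] by simp
  also have "\<dots> \<le> (\<integral>x. e * \<bar>?A x\<bar> \<partial>cube_measure v)"
  proof (rule integral_mono')
    show "integrable (cube_measure v) (\<lambda>x. e * \<bar>?A x\<bar>)" using A by simp
    have "0 \<le> e" using bound[of undefined] by linarith
    then show "0 \<le> e * \<bar>?A x\<bar>" for x by simp
    show "norm (?A x * E x) \<le> e * \<bar>?A x\<bar>" for x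
      using mult_right_mono[OF bound[of x], of "\<bar>?A x\<bar>"] by (simp add: abs_mult mult.commute)
  qed
  also have "\<dots> = e * (\<integral>x. \<bar>?A x\<bar> \<partial>cube_measure v)" by simp
  finally show "\<bar>\<integral>x. g x * E x \<partial>cube_measure T\<bar> \<le> e * (\<integral>x. \<bar>?A x\<bar> \<partial>cube_measure v)" .
qed

lemma young_scaled:
  fixes x c r :: real
  assumes "x \<ge> 0" "c > 0" "r \<ge> 1"
  shows "x \<le> x powr r * (c powr (1 - r) / r) + c * (1 - 1 / r)"
proof -
  define z where "z = x / c"
  have z: "z \<ge> 0" "x = c * z" using assms by (auto simp: z_def)
  have "z \<le> z powr r / r + (1 - 1 / r)"
  proof (cases "z = 0")
    case True
    have "1 / r \<le> 1" using assms(3) by (intro divide_le_eq_1_pos[THEN iffD2]) auto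
    then show ?thesis using True by simp
  next
    case False
    have "(z powr r) powr (1 / r) * 1 powr (1 - 1 / r) \<le> (1 / r) * z powr r + (1 - 1 / r) * 1"
      by (rule Youngs_inequality_0) (use assms z False in auto)
    then show ?thesis using assms z by (simp add: powr_powr)
  qed
  from mult_left_mono[OF this, of c] have "x \<le> c * (z powr r / r) + c * (1 - 1 / r)"
    using assms z by (simp add: distrib_left)
  also have "c * (z powr r / r) = x powr r * (c powr (1 - r) / r)"
    using assms by (simp add: z_def powr_divide powr_diff)
  finally show ?thesis .
qed

text \<open>Holder's inequality, from Young's inequality with the right scaling.\<close>

lemma sum_integrals_le_power_norm:
  fixes g :: "'i \<Rightarrow> 'a \<Rightarrow> real"
  assumes fin: "finite I" and prob: "\<And>i. i \<in> I \<Longrightarrow> prob_space (M i)" and int: "\<And>i. i \<in> I \<Longrightarrow> integrable (M i) (g i)"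
    and r: "r \<ge> 1" and y: "y \<ge> 0"
    and le: "(\<Sum>i\<in>I. \<integral>\<^sup>+x. ennreal (\<bar>g i x\<bar> powr r) \<partial>M i) \<le> ennreal (y powr r)"
  shows "(\<Sum>i\<in>I. \<integral>x. \<bar>g i x\<bar> \<partial>M i) \<le> y * real (card I) powr (1 - 1 / r)"
proof (cases "I = {}")
  case False
  define K where "K = real (card I)"
  have K: "K \<ge> 1" using False fin by (simp add: K_def Suc_leI card_gt_0_iff)
  have meas: "(\<lambda>x. ennreal (\<bar>g i x\<bar> powr r)) \<in> borel_measurable (M i)" if "i \<in> I" for i
    using borel_measurable_integrable[OF int[OF that]] by measurable
  have each: "(\<integral>\<^sup>+x. ennreal (\<bar>g i x\<bar> powr r) \<partial>M i) \<le> ennreal (y powr r)" if "i \<in> I" for i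
    using member_le_sum[OF that _ fin, of "\<lambda>i. \<integral>\<^sup>+x. ennreal (\<bar>g i x\<bar> powr r) \<partial>M i"] le by (meson order_trans zero_le)
  have intr: "integrable (M i) (\<lambda>x. \<bar>g i x\<bar> powr r)" if "i \<in> I" for i
  proof (rule integrableI_nonneg)
    show "(\<lambda>x. \<bar>g i x\<bar> powr r) \<in> borel_measurable (M i)"
      using borel_measurable_integrable[OF int[OF that]] by measurable
    show "(\<integral>\<^sup>+x. ennreal (\<bar>g i x\<bar> powr r) \<partial>M i) < \<infinity>" using each[OF that] by (simp add: order.strict_trans1)
  qed simp
  have S: "(\<Sum>i\<in>I. \<integral>x. \<bar>g i x\<bar> powr r \<partial>M i) \<le> y powr r"
  proof -
    have "ennreal (\<Sum>i\<in>I. \<integral>x. \<bar>g i x\<bar> powr r \<partial>M i) = (\<Sum>i\<in>I. \<integral>\<^sup>+x. ennreal (\<bar>g i x\<bar> powr r) \<partial>M i)"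
    proof -
      have "(\<Sum>i\<in>I. \<integral>\<^sup>+x. ennreal (\<bar>g i x\<bar> powr r) \<partial>M i) = (\<Sum>i\<in>I. ennreal (\<integral>x. \<bar>g i x\<bar> powr r \<partial>M i))"
        by (intro sum.cong refl nn_integral_eq_integral intr AE_I2) auto
      also have "\<dots> = ennreal (\<Sum>i\<in>I. \<integral>x. \<bar>g i x\<bar> powr r \<partial>M i)" by (rule sum_ennreal) simp
      finally show ?thesis by simp
    qed
    then have "ennreal (\<Sum>i\<in>I. \<integral>x. \<bar>g i x\<bar> powr r \<partial>M i) \<le> ennreal (y powr r)" using le by (simp only:)
    then show ?thesis by (simp add: ennreal_le_iff)
  qed
  show ?thesis
  proof (cases "y = 0")
    case True
    have "(\<integral>x. \<bar>g i x\<bar> \<partial>M i) = 0" if i: "i \<in> I" for i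
    proof -
      have "(\<integral>\<^sup>+x. ennreal (\<bar>g i x\<bar> powr r) \<partial>M i) = 0" using each[OF i] True by simp
      then have "AE x in M i. ennreal (\<bar>g i x\<bar> powr r) = 0" using nn_integral_0_iff_AE[OF meas[OF i]] by simp
      then have "AE x in M i. \<bar>g i x\<bar> = 0" by (rule AE_mp) (auto intro!: AE_I2)
      then show ?thesis by (rule integral_eq_zero_AE)
    qed
    then show ?thesis using True by simp
  next
    case False
    then have y0: "y > 0" using y by simp
    define c where "c = y * K powr (- 1 / r)"
    have c: "c > 0" using y0 K by (simp add: c_def)
    have "(\<integral>x. \<bar>g i x\<bar> \<partial>M i) \<le> (\<integral>x. \<bar>g i x\<bar> powr r \<partial>M i) * (c powr (1 - r) / r) + c * (1 - 1 / r)" if i: "i \<in> I" for i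
    proof -
      interpret prob_space "M i" by (rule prob[OF i])
      have "(\<integral>x. \<bar>g i x\<bar> \<partial>M i) \<le> (\<integral>x. \<bar>g i x\<bar> powr r * (c powr (1 - r) / r) + c * (1 - 1 / r) \<partial>M i)"
        by (rule integral_mono) (use int[OF i] intr[OF i] young_scaled[OF _ c r] in auto)
      also have "\<dots> = (\<integral>x. \<bar>g i x\<bar> powr r \<partial>M i) * (c powr (1 - r) / r) + c * (1 - 1 / r)"
        using intr[OF i] by (subst Bochner_Integration.integral_add) (auto simp: prob_space)
      finally show ?thesis .
    qed
    then have "(\<Sum>i\<in>I. \<integral>x. \<bar>g i x\<bar> \<partial>M i) \<le> (\<Sum>i\<in>I. (\<integral>x. \<bar>g i x\<bar> powr r \<partial>M i) * (c powr (1 - r) / r) + c * (1 - 1 / r))"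
      by (rule sum_mono)
    also have "\<dots> = (\<Sum>i\<in>I. \<integral>x. \<bar>g i x\<bar> powr r \<partial>M i) * (c powr (1 - r) / r) + K * (c * (1 - 1 / r))"
      by (simp only: sum.distrib sum_distrib_right[symmetric] sum_constant K_def)
    also have "\<dots> \<le> y powr r * (c powr (1 - r) / r) + K * (c * (1 - 1 / r))"
      using S r by (intro add_right_mono mult_right_mono) auto
    also have "y powr r * (c powr (1 - r) / r) = y * K powr (1 - 1 / r) / r"
    proof -
      have e: "- 1 / r * (1 - r) = 1 - 1 / r" using r by (simp add: field_simps)
      have c': "c powr (1 - r) = y powr (1 - r) * K powr (1 - 1 / r)"
        unfolding c_def powr_mult powr_powr e by (rule refl)
      have "y powr r * y powr (1 - r) = y" using y0 by (simp add: powr_add[symmetric])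
      then have "(y powr r * y powr (1 - r)) * K powr (1 - 1 / r) / r = y * K powr (1 - 1 / r) / r" by (simp only:)
      then show ?thesis unfolding c' by (simp only: times_divide_eq_right mult.assoc)
    qed
    also have "K * (c * (1 - 1 / r)) = y * K powr (1 - 1 / r) * (1 - 1 / r)"
    proof -
      have "K * K powr (- 1 / r) = K powr (1 - 1 / r)" using K by (simp add: powr_mult_base)
      then show ?thesis by (simp add: c_def mult_ac)
    qed
    also have "y * K powr (1 - 1 / r) / r + y * K powr (1 - 1 / r) * (1 - 1 / r) = y * K powr (1 - 1 / r)"
      by (simp add: algebra_simps)
    finally show ?thesis by (simp add: K_def)
  qed
qed simp

text \<open>
  The pairs \<open>(v, \<tau>)\<close> of the norm are encoded by one function \<open>\<sigma>\<close> with values in \<open>{1..Suc \<alpha>}\<close>: the value \<open>Suc \<alpha>\<close> marks the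
  coordinates of \<open>v\<close>, elsewhere \<open>\<sigma>\<close> is \<open>\<tau>\<close>. This matches the index of the kernels.
\<close>

definition top_set :: "nat \<Rightarrow> nat set \<Rightarrow> (nat \<Rightarrow> nat) \<Rightarrow> nat set" where
  "top_set \<alpha> u \<sigma> = {j \<in> u. \<sigma> j = Suc \<alpha>}"

lemma restrict_top_set:
  assumes "\<sigma> \<in> u \<rightarrow>\<^sub>E {1..Suc \<alpha>}"
  shows "restrict \<sigma> (u - top_set \<alpha> u \<sigma>) \<in> (\<Pi>\<^sub>E j\<in>u - top_set \<alpha> u \<sigma>. {1..\<alpha>})" "top_set \<alpha> u \<sigma> \<in> Pow u"
proof -
  have "\<sigma> j \<in> {1..\<alpha>}" if "j \<in> u - top_set \<alpha> u \<sigma>" for j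
    using PiE_mem[OF assms, of j] that by (auto simp: top_set_def)
  then show "restrict \<sigma> (u - top_set \<alpha> u \<sigma>) \<in> (\<Pi>\<^sub>E j\<in>u - top_set \<alpha> u \<sigma>. {1..\<alpha>})"
    by (intro PiE_I) (simp_all only: restrict_def if_True if_False)
  show "top_set \<alpha> u \<sigma> \<in> Pow u" by (auto simp: top_set_def)
qed

lemma top_set_combine:
  assumes "v \<subseteq> u" "\<tau> \<in> (\<Pi>\<^sub>E j\<in>u - v. {1..\<alpha>})"
  shows "top_set \<alpha> u (\<lambda>j\<in>u. if j \<in> v then Suc \<alpha> else \<tau> j) = v"
    and "restrict (\<lambda>j\<in>u. if j \<in> v then Suc \<alpha> else \<tau> j) (u - v) = \<tau>"
proof -
  have "\<tau> j \<noteq> Suc \<alpha>" if "j \<in> u - v" for j using PiE_mem[OF assms(2) that] by simp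
  then show "top_set \<alpha> u (\<lambda>j\<in>u. if j \<in> v then Suc \<alpha> else \<tau> j) = v"
    using assms(1) by (auto simp: top_set_def)
  have "restrict (\<lambda>j\<in>u. if j \<in> v then Suc \<alpha> else \<tau> j) (u - v) j = \<tau> j" for j
    using PiE_arb[OF assms(2), of j] by (cases "j \<in> u - v") auto
  then show "restrict (\<lambda>j\<in>u. if j \<in> v then Suc \<alpha> else \<tau> j) (u - v) = \<tau>" by blast
qed

lemma sum_top_set:
  fixes h :: "nat set \<Rightarrow> (nat \<Rightarrow> nat) \<Rightarrow> 'a::comm_monoid_add"
  assumes u: "finite u"
  shows "(\<Sum>v\<in>Pow u. \<Sum>\<tau>\<in>(\<Pi>\<^sub>E j\<in>u - v. {1..\<alpha>}). h v \<tau>)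
     = (\<Sum>\<sigma>\<in>u \<rightarrow>\<^sub>E {1..Suc \<alpha>}. h (top_set \<alpha> u \<sigma>) (restrict \<sigma> (u - top_set \<alpha> u \<sigma>)))"
proof -
  have "(\<Sum>v\<in>Pow u. \<Sum>\<tau>\<in>(\<Pi>\<^sub>E j\<in>u - v. {1..\<alpha>}). h v \<tau>) = (\<Sum>(v, \<tau>)\<in>(SIGMA v:Pow u. \<Pi>\<^sub>E j\<in>u - v. {1..\<alpha>}). h v \<tau>)"
    using u by (intro sum.Sigma) (auto intro!: finite_PiE)
  also have "\<dots> = (\<Sum>\<sigma>\<in>u \<rightarrow>\<^sub>E {1..Suc \<alpha>}. h (top_set \<alpha> u \<sigma>) (restrict \<sigma> (u - top_set \<alpha> u \<sigma>)))"
  proof (rule sum.reindex_bij_witness[where i = "\<lambda>\<sigma>. (top_set \<alpha> u \<sigma>, restrict \<sigma> (u - top_set \<alpha> u \<sigma>))"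
        and j = "\<lambda>(v, \<tau>). \<lambda>j\<in>u. if j \<in> v then Suc \<alpha> else \<tau> j"], goal_cases)
    case (1 a)
    obtain v \<tau> where a: "a = (v, \<tau>)" "v \<subseteq> u" "\<tau> \<in> (\<Pi>\<^sub>E j\<in>u - v. {1..\<alpha>})" using 1 by auto
    show ?case unfolding a(1) prod.case top_set_combine[OF a(2,3)] by (rule refl)
  next
    case (2 a)
    obtain v \<tau> where a: "a = (v, \<tau>)" "v \<subseteq> u" "\<tau> \<in> (\<Pi>\<^sub>E j\<in>u - v. {1..\<alpha>})" using 2 by auto
    have "\<tau> j \<in> {1..\<alpha>}" if "j \<in> u - v" for j using PiE_mem[OF a(3) that] .
    then show ?case unfolding a(1) prod.case by (intro PiE_I) (auto simp: le_SucI)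
  next
    case (3 \<sigma>)
    have "(\<lambda>j\<in>u. if j \<in> top_set \<alpha> u \<sigma> then Suc \<alpha> else restrict \<sigma> (u - top_set \<alpha> u \<sigma>) j) j = \<sigma> j" for j
      using PiE_arb[OF 3, of j] by (cases "j \<in> u") (auto simp: top_set_def)
    then have "(\<lambda>j\<in>u. if j \<in> top_set \<alpha> u \<sigma> then Suc \<alpha> else restrict \<sigma> (u - top_set \<alpha> u \<sigma>) j) = \<sigma>" by blast
    then show ?case unfolding prod.case .
  next
    case (4 \<sigma>)
    show ?case using restrict_top_set[OF 4] by blast
  next
    case (5 a)
    obtain v \<tau> where a: "a = (v, \<tau>)" "v \<subseteq> u" "\<tau> \<in> (\<Pi>\<^sub>E j\<in>u - v. {1..\<alpha>})" using 5 by auto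
    show ?case unfolding a(1) prod.case top_set_combine[OF a(2,3)] by (rule refl)
  qed
  finally show ?thesis .
qed

definition mean_abs :: "nat \<Rightarrow> nat \<Rightarrow> nat set \<Rightarrow> ((nat \<Rightarrow> real) \<Rightarrow> real) \<Rightarrow> (nat \<Rightarrow> nat) \<Rightarrow> real" where
  "mean_abs s \<alpha> u f \<sigma> = (\<integral>x. \<bar>deriv_mean s \<alpha> u (top_set \<alpha> u \<sigma>) (restrict \<sigma> (u - top_set \<alpha> u \<sigma>)) f x\<bar>
      \<partial>cube_measure (top_set \<alpha> u \<sigma>))"

lemma ennreal_div_le_1D:
  assumes "x / ennreal y \<le> 1"
  shows "x \<le> ennreal y"
proof (cases "ennreal y = 0")
  case True
  have "x = 0"
  proof (rule ccontr)
    assume "x \<noteq> 0"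
    then have "x / ennreal y = Orderings.top_class.top" using True by (simp add: ennreal_divide_eq_top_iff)
    then show False using assms by (simp add: top_unique)
  qed
  then show ?thesis by simp
next
  case False
  have "x = x * (ennreal y / ennreal y)" using False by (subst ennreal_divide_self) auto
  also have "\<dots> = x / ennreal y * ennreal y" by (simp only: divide_ennreal_def mult_ac)
  also have "\<dots> \<le> 1 * ennreal y" using assms by (rule mult_right_mono) simp
  finally show ?thesis by simp
qed

text \<open>
  The first bound is for the part of the error that is summed with its own decay, the second for the part where all \<open>\<sigma>\<close> have the
  same weight; there Holder's inequality over the \<open>(\<alpha> + 1)\<^bsup>card u\<^esup>\<close> functions \<open>\<sigma>\<close> produces the factor of \<open>H_const\<close>.
\<close>

lemma mean_abs_bounds:
  assumes u: "u \<subseteq> {1..s}" and q: "1 \<le> q" and \<gamma>: "\<gamma> u \<ge> 0" and n: "norm_term s \<alpha> \<gamma> q f u \<le> 1"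
    and int: "\<And>\<sigma>. \<sigma> \<in> u \<rightarrow>\<^sub>E {1..Suc \<alpha>} \<Longrightarrow> integrable (cube_measure (top_set \<alpha> u \<sigma>))
        (deriv_mean s \<alpha> u (top_set \<alpha> u \<sigma>) (restrict \<sigma> (u - top_set \<alpha> u \<sigma>)) f)"
  shows "\<sigma> \<in> u \<rightarrow>\<^sub>E {1..Suc \<alpha>} \<Longrightarrow> mean_abs s \<alpha> u f \<sigma> \<le> \<gamma> u"
    and "(\<Sum>\<sigma>\<in>u \<rightarrow>\<^sub>E {1..Suc \<alpha>}. mean_abs s \<alpha> u f \<sigma>)
       \<le> \<gamma> u * (real \<alpha> + 1) powr real_of_ereal (ereal (real (card u)) / conj_exponent q)"
proof -
  let ?S = "u \<rightarrow>\<^sub>E {1..Suc \<alpha>}"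
  let ?V = "top_set \<alpha> u" and ?g = "\<lambda>\<sigma>. deriv_mean s \<alpha> u (top_set \<alpha> u \<sigma>) (restrict \<sigma> (u - top_set \<alpha> u \<sigma>)) f"
  have fu: "finite u" using u finite_subset by auto
  have fS: "finite ?S" using fu by (intro finite_PiE) auto
  have cS: "real (card ?S) = (real \<alpha> + 1) powr real (card u)"
    using fu by (subst card_PiE) (auto simp: powr_realpow add.commute)
  have "(\<forall>\<sigma>\<in>?S. mean_abs s \<alpha> u f \<sigma> \<le> \<gamma> u) \<and> (\<Sum>\<sigma>\<in>?S. mean_abs s \<alpha> u f \<sigma>)
       \<le> \<gamma> u * (real \<alpha> + 1) powr real_of_ereal (ereal (real (card u)) / conj_exponent q)"
  proof (cases "q = \<infinity>")
    case True
    define h where "h = (\<lambda>v \<tau>. esssup (cube_measure v) (\<lambda>x. ennreal \<bar>deriv_mean s \<alpha> u v \<tau> f x\<bar>))"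
    have le: "(SUP v\<in>Pow u. SUP \<tau>\<in>(\<Pi>\<^sub>E j\<in>u - v. {1..\<alpha>}). h v \<tau>) \<le> ennreal (\<gamma> u)"
      using n True by (intro ennreal_div_le_1D) (simp add: norm_term_def h_def)
    have a: "mean_abs s \<alpha> u f \<sigma> \<le> \<gamma> u" if \<sigma>: "\<sigma> \<in> ?S" for \<sigma>
    proof -
      interpret prob_space "cube_measure (?V \<sigma>)" by (rule prob_space_cube)
      have "h (?V \<sigma>) (restrict \<sigma> (u - ?V \<sigma>)) \<le> (SUP \<tau>\<in>(\<Pi>\<^sub>E j\<in>u - ?V \<sigma>. {1..\<alpha>}). h (?V \<sigma>) \<tau>)"
        by (rule SUP_upper[OF restrict_top_set(1)[OF \<sigma>], where f = "h (?V \<sigma>)"])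
      also have "\<dots> \<le> (SUP v\<in>Pow u. SUP \<tau>\<in>(\<Pi>\<^sub>E j\<in>u - v. {1..\<alpha>}). h v \<tau>)"
        by (rule SUP_upper[OF restrict_top_set(2)[OF \<sigma>], where f = "\<lambda>v. SUP \<tau>\<in>(\<Pi>\<^sub>E j\<in>u - v. {1..\<alpha>}). h v \<tau>"])
      finally have h\<gamma>: "h (?V \<sigma>) (restrict \<sigma> (u - ?V \<sigma>)) \<le> ennreal (\<gamma> u)" using le by (rule order_trans)
      have "AE x in cube_measure (?V \<sigma>). ennreal \<bar>?g \<sigma> x\<bar> \<le> h (?V \<sigma>) (restrict \<sigma> (u - ?V \<sigma>))"
        unfolding h_def by (rule esssup_AE)
      then have "AE x in cube_measure (?V \<sigma>). ennreal \<bar>?g \<sigma> x\<bar> \<le> ennreal (\<gamma> u)"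
        by eventually_elim (rule order_trans[OF _ h\<gamma>])
      then have "AE x in cube_measure (?V \<sigma>). \<bar>?g \<sigma> x\<bar> \<le> \<gamma> u" using \<gamma> by simp
      then have "mean_abs s \<alpha> u f \<sigma> \<le> (\<integral>x. \<gamma> u \<partial>cube_measure (?V \<sigma>))"
        unfolding mean_abs_def by (intro integral_mono_AE) (use int[OF \<sigma>] in auto)
      then show ?thesis by (simp add: prob_space)
    qed
    then have "(\<Sum>\<sigma>\<in>?S. mean_abs s \<alpha> u f \<sigma>) \<le> real (card ?S) * \<gamma> u" by (intro sum_bounded_above) auto
    moreover have "real_of_ereal (ereal (real (card u)) / conj_exponent q) = real (card u)"
      using True by (simp add: conj_exponent_def)
    ultimately show ?thesis using a cS by (simp add: mult.commute)
  next
    case False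
    define r where "r = real_of_ereal q"
    have qr: "q = ereal r" and r: "r \<ge> 1" using False q by (cases q; auto simp: r_def)+
    let ?X = "(\<Sum>v\<in>Pow u. \<Sum>\<tau>\<in>(\<Pi>\<^sub>E j\<in>u - v. {1..\<alpha>}). \<integral>\<^sup>+x. ennreal (\<bar>deriv_mean s \<alpha> u v \<tau> f x\<bar> powr r) \<partial>cube_measure v)"
    have n': "ennroot r (?X / ennreal (\<gamma> u powr r)) \<le> 1" using n False by (simp add: norm_term_def r_def)
    have "?X / ennreal (\<gamma> u powr r) \<le> 1"
    proof (cases "?X / ennreal (\<gamma> u powr r)")
      case (real z)
      then have "z powr (1 / r) \<le> 1" using n' by (simp add: ennroot_def flip: ennreal_1)
      have "z \<le> 1"
      proof (rule ccontr)
        assume "\<not> z \<le> 1"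
        then have "1 < z powr (1 / r)" using r by (intro gr_one_powr) auto
        with \<open>z powr (1 / r) \<le> 1\<close> show False by linarith
      qed
      then show ?thesis using real by (simp flip: ennreal_1)
    next
      case top then show ?thesis using n' by (simp add: ennroot_def)
    qed
    then have "?X \<le> ennreal (\<gamma> u powr r)" by (rule ennreal_div_le_1D)
    then have X: "(\<Sum>\<sigma>\<in>?S. \<integral>\<^sup>+x. ennreal (\<bar>?g \<sigma> x\<bar> powr r) \<partial>cube_measure (?V \<sigma>)) \<le> ennreal (\<gamma> u powr r)"
      by (simp only: sum_top_set[OF fu])
    have "mean_abs s \<alpha> u f \<sigma> \<le> \<gamma> u" if \<sigma>: "\<sigma> \<in> ?S" for \<sigma>
    proof -
      have "(\<integral>\<^sup>+x. ennreal (\<bar>?g \<sigma> x\<bar> powr r) \<partial>cube_measure (?V \<sigma>)) \<le> ennreal (\<gamma> u powr r)"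
        by (rule order_trans[OF member_le_sum[OF \<sigma> _ fS] X]) simp
      then show ?thesis
        using sum_integrals_le_power_norm[of "{\<sigma>}" "\<lambda>\<sigma>. cube_measure (?V \<sigma>)" ?g r "\<gamma> u"] int[OF \<sigma>] prob_space_cube r \<gamma>
        by (simp add: mean_abs_def)
    qed
    moreover have "(\<Sum>\<sigma>\<in>?S. mean_abs s \<alpha> u f \<sigma>) \<le> \<gamma> u * (real \<alpha> + 1) powr (real (card u) * (1 - 1 / r))"
    proof -
      have "(\<Sum>\<sigma>\<in>?S. mean_abs s \<alpha> u f \<sigma>) \<le> \<gamma> u * real (card ?S) powr (1 - 1 / r)"
        unfolding mean_abs_def by (rule sum_integrals_le_power_norm[OF fS prob_space_cube int r \<gamma> X])
      then show ?thesis unfolding cS powr_powr .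
    qed
    moreover have "real_of_ereal (ereal (real (card u)) / conj_exponent q) = real (card u) * (1 - 1 / r)"
    proof (cases "r = 1")
      case False
      then have "conj_exponent q = ereal (r / (r - 1))" by (simp add: qr conj_exponent_def one_ereal_def)
      then have "real_of_ereal (ereal (real (card u)) / conj_exponent q) = real (card u) * ((r - 1) / r)"
        using r False by simp
      also have "(r - 1) / r = 1 - 1 / r" using r by (simp add: diff_divide_distrib)
      finally show ?thesis .
    qed (simp add: qr conj_exponent_def)
    ultimately show ?thesis by simp
  qed
  then show "\<sigma> \<in> ?S \<Longrightarrow> mean_abs s \<alpha> u f \<sigma> \<le> \<gamma> u"
    and "(\<Sum>\<sigma>\<in>?S. mean_abs s \<alpha> u f \<sigma>)
       \<le> \<gamma> u * (real \<alpha> + 1) powr real_of_ereal (ereal (real (card u)) / conj_exponent q)" by blast+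
qed


section \<open>Extrapolation and the error of the kernels\<close>

definition weight_L :: "nat \<Rightarrow> nat \<Rightarrow> real" where
  "weight_L b k = (\<Prod>j=1..k. - 1 / (real b ^ j - 1))"

definition weight_R :: "nat \<Rightarrow> nat \<Rightarrow> real" where
  "weight_R b k = (\<Prod>j=1..k. real b ^ j / (real b ^ j - 1))"

text \<open>
  The \<open>q\<close>-binomial theorem: the weights are the coefficients of a polynomial in \<open>y\<close> with the roots \<open>b, b\<^sup>2, \<dots>, b\<^sup>n\<close>.
\<close>

lemma extrap_generating_function:
  assumes b: "b \<ge> 2"
  shows "(\<Sum>k\<le>n. weight_L b k * weight_R b (n - k) * y ^ k) = (\<Prod>j=1..n. (real b ^ j - y) / (real b ^ j - 1))"
proof (induction n)
  case 0 show ?case by (simp add: weight_L_def weight_R_def)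
next
  case (Suc n)
  let ?c = "\<lambda>j. real b ^ j"
  let ?L = "weight_L b" and ?R = "weight_R b"
  have e: "?c (Suc j) - 1 \<noteq> 0" for j
  proof -
    have "?c (Suc j) > 1" using b by (intro one_less_power) auto
    then show ?thesis by simp
  qed
  have g1: "(- 1 / x) * P * x = - P" and g2: "(z / x) * P * x = z * P" if "x \<noteq> 0" for x P z :: real using that by simp_all
  have L: "?L (Suc k) * (?c (Suc k) - 1) = - ?L k" for k
    unfolding weight_L_def by (subst prod.nat_ivl_Suc') (simp, rule g1[OF e])
  have R: "?R (Suc k) * (?c (Suc k) - 1) = ?c (Suc k) * ?R k" for k
    unfolding weight_R_def by (subst prod.nat_ivl_Suc') (simp, rule g2[OF e])
  have coef: "(?c (Suc n) - 1) * (?L k * ?R (Suc n - k))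
     = (if k \<le> n then ?c (Suc n) * (?L k * ?R (n - k)) else 0) - (if k = 0 then 0 else ?L (k - 1) * ?R (Suc n - k))"
    if kn: "k \<le> Suc n" for k
  proof -
    consider "k = 0" | "k = Suc n" | i m where "k = Suc i" "n = Suc i + m"
    proof (cases k)
      case (Suc i)
      show ?thesis
      proof (cases "k = Suc n")
        case False
        then have "n = Suc i + (n - Suc i)" using kn Suc by simp
        then show ?thesis by (rule that(3)[OF Suc])
      qed (rule that(2))
    qed (rule that(1))
    then show ?thesis
    proof cases
      case 1
      have "?L 0 = 1" by (simp add: weight_L_def)
      then show ?thesis using R[of n] 1 by (simp add: mult.commute del: power_Suc)
    next
      case 2
      have "?R 0 = 1" by (simp add: weight_R_def)
      then show ?thesis using L[of n] 2 by (simp add: mult.commute del: power_Suc)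
    next
      case 3
      have cd: "?c (Suc n) = ?c (Suc i) * ?c (Suc m)" using 3 by (simp flip: power_add)
      have gen: "(d * c - 1) * (l1 * r1) = d * c * (l1 * r) - l * r1"
        if "l1 * (d - 1) = - l" "r1 * (c - 1) = c * r" for d c l1 r1 l r :: real
      proof -
        have l: "l = - (l1 * (d - 1))" using that(1) by simp
        have "d * c * (l1 * r) = d * l1 * (c * r)" by simp
        also have "\<dots> = d * l1 * (r1 * (c - 1))" by (simp only: that(2))
        finally show ?thesis unfolding l by (simp add: algebra_simps)
      qed
      have s: "Suc n - k = Suc m" "n - k = m" "k \<le> n" "k \<noteq> 0" "k - 1 = i" using 3 by auto
      show ?thesis using gen[OF L[of i] R[of m]] unfolding cd s using s(3,4) 3(1) by simp
    qed
  qed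
  have e1: "(\<Sum>k\<le>Suc n. (if k \<le> n then ?c (Suc n) * (?L k * ?R (n - k)) else 0) * y ^ k)
     = ?c (Suc n) * (\<Sum>k\<le>n. ?L k * ?R (n - k) * y ^ k)"
    by (simp add: sum_distrib_left mult.assoc del: power_Suc)
  have e2: "(\<Sum>k\<le>Suc n. (if k = 0 then 0 else ?L (k - 1) * ?R (Suc n - k)) * y ^ k)
     = y * (\<Sum>k\<le>n. ?L k * ?R (n - k) * y ^ k)"
    by (subst sum.atMost_Suc_shift) (simp add: sum_distrib_left mult_ac)
  have "(?c (Suc n) - 1) * (\<Sum>k\<le>Suc n. ?L k * ?R (Suc n - k) * y ^ k)
     = (\<Sum>k\<le>Suc n. ((?c (Suc n) - 1) * (?L k * ?R (Suc n - k))) * y ^ k)"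
    by (simp only: sum_distrib_left mult.assoc)
  also have "\<dots> = (\<Sum>k\<le>Suc n. ((if k \<le> n then ?c (Suc n) * (?L k * ?R (n - k)) else 0) - (if k = 0 then 0 else ?L (k - 1) * ?R (Suc n - k))) * y ^ k)"
    by (intro sum.cong refl arg_cong2[where f = "(*)"] coef) simp
  also have "\<dots> = (?c (Suc n) - y) * (\<Sum>k\<le>n. ?L k * ?R (n - k) * y ^ k)"
    by (simp only: left_diff_distrib sum_subtractf e1 e2)
  finally have main: "(?c (Suc n) - 1) * (\<Sum>k\<le>Suc n. ?L k * ?R (Suc n - k) * y ^ k)
     = (?c (Suc n) - y) * (\<Prod>j=1..n. (?c j - y) / (?c j - 1))" unfolding Suc.IH .
  have g3: "X = z / x * P" if "x * X = z * P" "x \<noteq> 0" for x X z P :: real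
    using that by (simp add: nonzero_eq_divide_eq mult.commute)
  show ?case by (subst prod.nat_ivl_Suc') (simp, rule g3[OF main e])
qed

text \<open>
  The weights sum to \<open>1\<close> and remove all terms of order \<open>b\<^bsup>- w n\<^esup>\<close> with \<open>1 \<le> w < \<alpha>\<close> from an expansion in the exponent
  \<open>n\<close> of the number of points.
\<close>

lemma extrap_coeff_moments:
  assumes b: "b \<ge> 2" and w: "w < \<alpha>"
  shows "(\<Sum>\<nu>=1..\<alpha>. extrap_coeff b \<alpha> \<nu> * (real b ^ w) ^ (\<nu> - 1)) = of_bool (w = 0)"
proof -
  obtain n where n: "\<alpha> = Suc n" using w by (cases \<alpha>) auto
  have "(\<Sum>\<nu>=1..\<alpha>. extrap_coeff b \<alpha> \<nu> * (real b ^ w) ^ (\<nu> - 1)) = (\<Sum>k\<le>n. weight_L b k * weight_R b (n - k) * (real b ^ w) ^ k)"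
    by (rule sum.reindex_bij_witness[where i = Suc and j = "\<lambda>\<nu>. \<nu> - 1"])
      (auto simp: n extrap_coeff_def weight_L_def weight_R_def)
  also have "\<dots> = (\<Prod>j=1..n. (real b ^ j - real b ^ w) / (real b ^ j - 1))" by (rule extrap_generating_function[OF b])
  also have "\<dots> = of_bool (w = 0)"
  proof (cases "w = 0")
    case True
    have "real b ^ j - 1 \<noteq> 0" if "j \<ge> 1" for j
    proof -
      have "real b ^ j > 1" using b that by (intro one_less_power) auto
      then show ?thesis by simp
    qed
    then show ?thesis using True by (simp add: prod.neutral)
  next
    case False
    then have "w \<in> {1..n}" using w n by auto
    have "(\<Prod>j=1..n. (real b ^ j - real b ^ w) / (real b ^ j - 1)) = 0"
      by (rule prod_zero) (simp, rule bexI[OF _ \<open>w \<in> {1..n}\<close>], simp)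
    then show ?thesis using False by simp
  qed
  finally show ?thesis .
qed

lemma abs_per_bern_le_D_const:
  assumes "\<alpha> \<ge> 2"
  shows "\<bar>per_bern \<alpha> x\<bar> \<le> D_const \<alpha>"
proof -
  have pb: "per_bern \<alpha> y = bern_periodic \<alpha> y" for y using assms by (simp add: per_bern_def)
  have "frac (frac x) = frac x" by (simp add: frac_eq frac_lt_1)
  then have "\<bar>per_bern \<alpha> x\<bar> = \<bar>bern_periodic \<alpha> (frac x)\<bar>" by (simp add: pb bern_periodic_def)
  also have "\<dots> \<le> (SUP x\<in>{0..<1}. \<bar>bern_periodic \<alpha> x\<bar>)"
  proof (rule cSUP_upper)
    show "frac x \<in> {0..<1}" by (simp add: frac_lt_1)
    show "bdd_above ((\<lambda>x. \<bar>bern_periodic \<alpha> x\<bar>) ` {0..<1})"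
      by (rule bdd_aboveI2[of _ _ "1 / 2"]) (use abs_per_bern_le[of \<alpha>] assms in \<open>simp add: pb\<close>)
  qed
  also have "\<dots> \<le> D_const \<alpha>" unfolding D_const_def by (rule Max_ge) auto
  finally show ?thesis .
qed

lemma abs_per_bern_0_le_D_const:
  assumes "\<alpha> \<ge> 2" "1 \<le> t" "t \<le> \<alpha>"
  shows "\<bar>per_bern t 0\<bar> \<le> D_const \<alpha>"
proof (cases "t = \<alpha>")
  case False
  have "\<bar>per_bern t 0\<bar> = \<bar>bern t 0\<bar>"
  proof (cases "t = 1")
    case True
    then show ?thesis by (simp add: per_bern_def bern_def bernoulli_poly_def)
  qed (simp add: per_bern_def bern_periodic_def)
  also have "\<dots> \<le> D_const \<alpha>" unfolding D_const_def
    by (rule Max_ge) (use assms False in auto)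
  finally show ?thesis .
qed (use abs_per_bern_le_D_const[OF assms(1)] in simp)

lemma D_const_nonneg: "\<alpha> \<ge> 2 \<Longrightarrow> D_const \<alpha> \<ge> 0"
  using abs_per_bern_le_D_const[of \<alpha> 0] by linarith

lemma bb_bern_kernel: "\<alpha> \<ge> 1 \<Longrightarrow> bb (bern_kernel \<alpha> t y)"
proof -
  assume \<alpha>: "\<alpha> \<ge> 1"
  have "bb (\<lambda>x. per_bern \<alpha> (x - y))"
    unfolding bb_def using abs_per_bern_le[OF \<alpha>] \<alpha> by (auto intro!: exI[of _ "1 / 2"])
  from bb_add[OF this this, of "(-1) ^ Suc \<alpha>" 0]
  have "bb (\<lambda>x. (-1) ^ Suc \<alpha> * per_bern \<alpha> (x - y))" by (simp del: power_Suc)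
  then show ?thesis unfolding bern_kernel_def by (cases "t = 0"; cases "t \<le> \<alpha>") (auto intro: bb_const simp del: power_Suc)
qed

lemma bern_kernel_indep: "t \<le> \<alpha> \<Longrightarrow> bern_kernel \<alpha> t y x = bern_kernel \<alpha> t y x'"
  by (simp add: bern_kernel_def)

context poly_lattice_base
begin

text \<open>
  A bound for the coefficient of the remainder kernel that is uniform in \<open>x\<close>, so that the derivative which multiplies it can be
  integrated freely.
\<close>

definition sup_coeff :: "nat \<Rightarrow> nat \<Rightarrow> nat \<Rightarrow> real" where
  "sup_coeff N \<alpha> k = (SOME B. (\<forall>x. norm (F N \<alpha> k x) \<le> B) \<and> (\<Sum>\<tau>=1..\<alpha>. norm (F N \<tau> k 0)) + B \<le> C_const b \<alpha> * rho \<alpha> N k)"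

definition ker_coeff :: "nat \<Rightarrow> nat \<Rightarrow> nat \<Rightarrow> nat \<Rightarrow> real \<Rightarrow> complex" where
  "ker_coeff N \<alpha> t k x = (if t \<le> \<alpha> then (-1) ^ t * F N t k 0 else (-1) ^ Suc \<alpha> * F N \<alpha> k x)"

definition ker_bound :: "nat \<Rightarrow> nat \<Rightarrow> nat \<Rightarrow> nat \<Rightarrow> real" where
  "ker_bound N \<alpha> t k = (if t \<le> \<alpha> then norm (F N t k 0) else sup_coeff N \<alpha> k)"

text \<open>
  The zero frequency of a kernel, freed from its power of \<open>b\<^sup>-\<^sup>N\<close>. It depends on \<open>N\<close> only for the remainder kernel.
\<close>

definition ker_const :: "nat \<Rightarrow> nat \<Rightarrow> nat \<Rightarrow> real \<Rightarrow> real" where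
  "ker_const N \<alpha> t x = (if t \<le> \<alpha> then (-1) ^ t * per_bern t 0 else (-1) ^ Suc \<alpha> * per_bern \<alpha> (real b ^ N * x))"

lemma sup_coeff:
  assumes "\<alpha> \<ge> 2" "N \<ge> 1" "k < b ^ N"
  shows "norm (F N \<alpha> k x) \<le> sup_coeff N \<alpha> k"
    and "(\<Sum>\<tau>=1..\<alpha>. norm (F N \<tau> k 0)) + sup_coeff N \<alpha> k \<le> C_const b \<alpha> * rho \<alpha> N k"
  using someI_ex[OF walsh_coeff_bound[OF assms]] unfolding sup_coeff_def by blast+

lemma norm_ker_coeff_le:
  assumes "\<alpha> \<ge> 2" "N \<ge> 1" "k < b ^ N"
  shows "norm (ker_coeff N \<alpha> t k x) \<le> ker_bound N \<alpha> t k"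
  using sup_coeff(1)[OF assms, of x] by (simp add: ker_coeff_def ker_bound_def norm_mult norm_power)

lemma ker_bound_nonneg: "\<alpha> \<ge> 2 \<Longrightarrow> N \<ge> 1 \<Longrightarrow> k < b ^ N \<Longrightarrow> ker_bound N \<alpha> t k \<ge> 0"
  using norm_ker_coeff_le norm_ge_zero order_trans by blast

lemma sum_ker_bound:
  assumes "\<alpha> \<ge> 2" "N \<ge> 1" "k < b ^ N"
  shows "(\<Sum>t=1..Suc \<alpha>. ker_bound N \<alpha> t k) \<le> C_const b \<alpha> * rho \<alpha> N k"
proof -
  have "(\<Sum>t=1..\<alpha>. ker_bound N \<alpha> t k) = (\<Sum>t=1..\<alpha>. norm (F N t k 0))"
    by (intro sum.cong refl) (simp add: ker_bound_def)
  then show ?thesis using sup_coeff(2)[OF assms] by (simp add: ker_bound_def)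
qed

lemma bern_kernel_grid:
  assumes "i < b ^ N" "t \<ge> 1"
  shows "(\<Sum>k<b ^ N. ker_coeff N \<alpha> t k x * cnj (chi N k i)) = of_real (bern_kernel \<alpha> t (real i / real b ^ N) x)"
proof (cases "t \<le> \<alpha>")
  case True
  have "(\<Sum>k<b ^ N. ker_coeff N \<alpha> t k x * cnj (chi N k i)) = (-1) ^ t * (\<Sum>k<b ^ N. F N t k 0 * cnj (chi N k i))"
    using True by (simp add: ker_coeff_def sum_distrib_left mult.assoc)
  also have "\<dots> = of_real (bern_kernel \<alpha> t (real i / real b ^ N) x)"
    unfolding F_inversion[OF assms(1)] using True assms(2) by (simp add: bern_kernel_def)
  finally show ?thesis .
next
  case False
  have "(\<Sum>k<b ^ N. ker_coeff N \<alpha> t k x * cnj (chi N k i)) = (-1) ^ Suc \<alpha> * (\<Sum>k<b ^ N. F N \<alpha> k x * cnj (chi N k i))"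
    unfolding sum_distrib_left using False by (intro sum.cong refl) (simp add: ker_coeff_def mult.assoc)
  also have "\<dots> = of_real (bern_kernel \<alpha> t (real i / real b ^ N) x)"
    unfolding F_inversion[OF assms(1)] using False by (simp add: bern_kernel_def)
  finally show ?thesis .
qed

lemma ker_coeff_0:
  assumes "\<alpha> \<ge> 1" "t \<ge> 1"
  shows "ker_coeff N \<alpha> t 0 x = of_real ((1 / real b) ^ (N * min t \<alpha>) * ker_const N \<alpha> t x)"
  using F_k0[OF assms(2), of N 0] F_k0[OF assms(1), of N x]
  by (simp add: ker_coeff_def ker_const_def min_def mult_ac del: power_Suc)

lemma abs_ker_const_le: "\<alpha> \<ge> 2 \<Longrightarrow> t \<ge> 1 \<Longrightarrow> \<bar>ker_const N \<alpha> t x\<bar> \<le> D_const \<alpha>"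
  using abs_per_bern_0_le_D_const[of \<alpha> t] abs_per_bern_le_D_const[of \<alpha> "real b ^ N * x"]
  by (simp add: ker_const_def abs_mult power_abs)

text \<open>
  The average of a product of kernels over the lattice is that over the regular grid, up to the dual net.
\<close>

lemma lattice_kernel_error:
  assumes \<alpha>: "\<alpha> \<ge> 2" and N: "N \<ge> 1" and u: "finite u" and t: "\<And>j. j \<in> u \<Longrightarrow> t j \<ge> 1"
    and p: "p \<noteq> 0" "Polynomial.degree p = N"
  shows "\<bar>(\<Sum>n<b ^ N. \<Prod>j\<in>u. bern_kernel \<alpha> (t j) (real (grid_index N p (poly_of_nat n * q j)) / real b ^ N) (x j)) / real (b ^ N)
      - (1 / real b) ^ (N * (\<Sum>j\<in>u. min (t j) \<alpha>)) * (\<Prod>j\<in>u. ker_const N \<alpha> (t j) (x j))\<bar>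
     \<le> (\<Sum>k\<in>dual_net N p q u. \<Prod>j\<in>u. ker_bound N \<alpha> (t j) (k j))"
proof -
  let ?c = "\<lambda>j k. ker_coeff N \<alpha> (t j) k (x j)"
  let ?i = "\<lambda>n j. grid_index N p (poly_of_nat n * q j)"
  have "(\<Sum>n<b ^ N. \<Prod>j\<in>u. \<Sum>k<b ^ N. ?c j k * cnj (chi N k (?i n j)))
     = of_real (\<Sum>n<b ^ N. \<Prod>j\<in>u. bern_kernel \<alpha> (t j) (real (?i n j) / real b ^ N) (x j))"
    unfolding of_real_sum of_real_prod
    by (intro sum.cong prod.cong refl bern_kernel_grid grid_index(1) t)
  then have e1: "(\<Sum>n<b ^ N. \<Prod>j\<in>u. \<Sum>k<b ^ N. ?c j k * cnj (chi N k (?i n j))) / of_nat (b ^ N)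
     = of_real ((\<Sum>n<b ^ N. \<Prod>j\<in>u. bern_kernel \<alpha> (t j) (real (?i n j) / real b ^ N) (x j)) / real (b ^ N))"
    by (simp only: of_real_divide of_real_of_nat_eq)
  have "(\<Prod>j\<in>u. ?c j 0) = (\<Prod>j\<in>u. of_real ((1 / real b) ^ (N * min (t j) \<alpha>) * ker_const N \<alpha> (t j) (x j)))"
    using \<alpha> t by (intro prod.cong refl ker_coeff_0) auto
  also have "\<dots> = of_real ((1 / real b) ^ (N * (\<Sum>j\<in>u. min (t j) \<alpha>)) * (\<Prod>j\<in>u. ker_const N \<alpha> (t j) (x j)))"
    by (simp only: of_real_prod[symmetric] prod.distrib power_sum[symmetric] sum_distrib_left[symmetric])
  finally have e2: "(\<Prod>j\<in>u. ?c j 0) = of_real ((1 / real b) ^ (N * (\<Sum>j\<in>u. min (t j) \<alpha>)) * (\<Prod>j\<in>u. ker_const N \<alpha> (t j) (x j)))" .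
  have "\<bar>(\<Sum>n<b ^ N. \<Prod>j\<in>u. bern_kernel \<alpha> (t j) (real (?i n j) / real b ^ N) (x j)) / real (b ^ N)
      - (1 / real b) ^ (N * (\<Sum>j\<in>u. min (t j) \<alpha>)) * (\<Prod>j\<in>u. ker_const N \<alpha> (t j) (x j))\<bar>
     \<le> (\<Sum>k\<in>dual_net N p q u. \<Prod>j\<in>u. norm (?c j (k j)))"
    using lattice_product_error[OF u p, of ?c q] unfolding e1 e2 by (simp only: of_real_diff[symmetric] norm_of_real)
  also have "\<dots> \<le> (\<Sum>k\<in>dual_net N p q u. \<Prod>j\<in>u. ker_bound N \<alpha> (t j) (k j))"
  proof (rule sum_mono, rule prod_mono, rule conjI)
    fix k j assume "k \<in> dual_net N p q u" "j \<in> u"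
    then have "k j < b ^ N" by (auto simp: dual_net_def PiE_iff)
    then show "norm (?c j (k j)) \<le> ker_bound N \<alpha> (t j) (k j)" by (rule norm_ker_coeff_le[OF \<alpha> N])
  qed simp
  finally show ?thesis .
qed

text \<open>The extrapolation removes the part of the error that comes from the regular grid.\<close>

lemma extrap_grid_part:
  assumes \<alpha>: "\<alpha> \<ge> 2" and m: "m \<ge> \<alpha>" and u: "finite u" "u \<noteq> {}" and t: "\<And>j. j \<in> u \<Longrightarrow> t j \<ge> 1"
  shows "\<bar>\<Sum>\<nu>=1..\<alpha>. extrap_coeff b \<alpha> \<nu> * ((1 / real b) ^ ((m - \<nu> + 1) * (\<Sum>j\<in>u. min (t j) \<alpha>)) * (\<Prod>j\<in>u. ker_const (m - \<nu> + 1) \<alpha> (t j) (x j)))\<bar>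
     \<le> (\<Sum>\<nu>=1..\<alpha>. \<bar>extrap_coeff b \<alpha> \<nu>\<bar>) * ((1 / real b) ^ (\<alpha> * (m - \<alpha> + 1)) * D_const \<alpha> ^ card u)"
proof (cases "(\<Sum>j\<in>u. min (t j) \<alpha>) < \<alpha>")
  case True
  define W where "W = (\<Sum>j\<in>u. min (t j) \<alpha>)"
  have tj: "t j < \<alpha>" if "j \<in> u" for j
    using member_le_sum[OF that _ u(1), of "\<lambda>j. min (t j) \<alpha>"] True by (simp add: min_def split: if_splits)
  have "W \<ge> 1"
  proof -
    obtain j where j: "j \<in> u" using u by blast
    have "1 \<le> min (t j) \<alpha>" using t[OF j] \<alpha> by simp
    also have "\<dots> \<le> W" unfolding W_def by (rule member_le_sum[OF j _ u(1)]) simp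
    finally show ?thesis .
  qed
  define c where "c = (\<Prod>j\<in>u. (-1) ^ t j * per_bern (t j) 0)"
  have c: "(\<Prod>j\<in>u. ker_const N \<alpha> (t j) (x j)) = c" for N
    unfolding c_def using tj by (intro prod.cong refl) (auto simp: ker_const_def less_imp_le)
  have pw: "(1 / real b) ^ ((m - \<nu> + 1) * W) = (1 / real b) ^ (m * W) * (real b ^ W) ^ (\<nu> - 1)" if "\<nu> \<in> {1..\<alpha>}" for \<nu>
  proof -
    have "m * W = (m - \<nu> + 1) * W + W * (\<nu> - 1)"
    proof -
      have "m = (m - \<nu> + 1) + (\<nu> - 1)" using that m by auto
      then have "m * W = ((m - \<nu> + 1) + (\<nu> - 1)) * W" by simp
      then show ?thesis by (simp add: algebra_simps)
    qed
    then have "(1 / real b) ^ (m * W) = (1 / real b) ^ ((m - \<nu> + 1) * W) * (1 / real b) ^ (W * (\<nu> - 1))"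
      by (simp only: power_add)
    then show ?thesis by (simp add: power_mult[symmetric] power_one_over)
  qed
  have "(\<Sum>\<nu>=1..\<alpha>. extrap_coeff b \<alpha> \<nu> * ((1 / real b) ^ ((m - \<nu> + 1) * W) * c))
     = (\<Sum>\<nu>=1..\<alpha>. (1 / real b) ^ (m * W) * c * (extrap_coeff b \<alpha> \<nu> * (real b ^ W) ^ (\<nu> - 1)))"
    by (intro sum.cong refl, simp only: pw, simp only: mult_ac)
  also have "\<dots> = (1 / real b) ^ (m * W) * c * (\<Sum>\<nu>=1..\<alpha>. extrap_coeff b \<alpha> \<nu> * (real b ^ W) ^ (\<nu> - 1))"
    by (simp only: sum_distrib_left)
  also have "\<dots> = 0" using extrap_coeff_moments[OF b2, of W \<alpha>] True \<open>W \<ge> 1\<close> by (simp add: W_def)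
  finally have "(\<Sum>\<nu>=1..\<alpha>. extrap_coeff b \<alpha> \<nu> * ((1 / real b) ^ ((m - \<nu> + 1) * W) * c)) = 0" .
  moreover have "0 \<le> (\<Sum>\<nu>=1..\<alpha>. \<bar>extrap_coeff b \<alpha> \<nu>\<bar>) * ((1 / real b) ^ (\<alpha> * (m - \<alpha> + 1)) * D_const \<alpha> ^ card u)"
    using D_const_nonneg[OF \<alpha>] by (intro mult_nonneg_nonneg sum_nonneg) auto
  ultimately show ?thesis by (simp only: c W_def abs_zero)
next
  case False
  let ?W = "\<Sum>j\<in>u. min (t j) \<alpha>"
  have "\<bar>extrap_coeff b \<alpha> \<nu> * ((1 / real b) ^ ((m - \<nu> + 1) * ?W) * (\<Prod>j\<in>u. ker_const (m - \<nu> + 1) \<alpha> (t j) (x j)))\<bar>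
     \<le> \<bar>extrap_coeff b \<alpha> \<nu>\<bar> * ((1 / real b) ^ (\<alpha> * (m - \<alpha> + 1)) * D_const \<alpha> ^ card u)" if \<nu>: "\<nu> \<in> {1..\<alpha>}" for \<nu>
  proof -
    have "\<alpha> * (m - \<alpha> + 1) \<le> (m - \<nu> + 1) * ?W"
    proof -
      have "m - \<alpha> + 1 \<le> m - \<nu> + 1" using \<nu> by auto
      then have "(m - \<alpha> + 1) * \<alpha> \<le> (m - \<nu> + 1) * ?W" by (rule mult_mono) (use False in auto)
      then show ?thesis by (simp only: mult.commute)
    qed
    then have "(1 / real b) ^ ((m - \<nu> + 1) * ?W) \<le> (1 / real b) ^ (\<alpha> * (m - \<alpha> + 1))"
      by (rule power_decreasing) (use b2 in auto)
    moreover have "\<bar>\<Prod>j\<in>u. ker_const (m - \<nu> + 1) \<alpha> (t j) (x j)\<bar> \<le> D_const \<alpha> ^ card u"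
    proof -
      have "(\<Prod>j\<in>u. \<bar>ker_const (m - \<nu> + 1) \<alpha> (t j) (x j)\<bar>) \<le> (\<Prod>j\<in>u. D_const \<alpha>)"
        by (intro prod_mono) (use abs_ker_const_le[OF \<alpha> t] in auto)
      then show ?thesis by (simp add: abs_prod)
    qed
    ultimately have "(1 / real b) ^ ((m - \<nu> + 1) * ?W) * \<bar>\<Prod>j\<in>u. ker_const (m - \<nu> + 1) \<alpha> (t j) (x j)\<bar>
      \<le> (1 / real b) ^ (\<alpha> * (m - \<alpha> + 1)) * D_const \<alpha> ^ card u"
      by (intro mult_mono) auto
    then have "\<bar>extrap_coeff b \<alpha> \<nu>\<bar> * ((1 / real b) ^ ((m - \<nu> + 1) * ?W) * \<bar>\<Prod>j\<in>u. ker_const (m - \<nu> + 1) \<alpha> (t j) (x j)\<bar>)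
      \<le> \<bar>extrap_coeff b \<alpha> \<nu>\<bar> * ((1 / real b) ^ (\<alpha> * (m - \<alpha> + 1)) * D_const \<alpha> ^ card u)"
      by (rule mult_left_mono) simp
    moreover have "\<bar>(1 / real b) ^ ((m - \<nu> + 1) * ?W)\<bar> = (1 / real b) ^ ((m - \<nu> + 1) * ?W)" by (rule abs_of_nonneg) simp
    ultimately show ?thesis by (simp only: abs_mult)
  qed
  then show ?thesis unfolding sum_distrib_right by (intro order_trans[OF sum_abs] sum_mono)
qed

end


section \<open>The error of the extrapolated rule\<close>

text \<open>
  Group the indices by their support, which is the set \<open>u\<close> of the norm.
\<close>

lemma sum_PiE_support:
  fixes h :: "(nat \<Rightarrow> nat) \<Rightarrow> 'a::comm_monoid_add"
  assumes T: "finite T"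
  shows "(\<Sum>t\<in>T \<rightarrow>\<^sub>E {..n}. h t) = (\<Sum>u\<in>Pow T. \<Sum>\<sigma>\<in>u \<rightarrow>\<^sub>E {1..n}. h (\<lambda>j\<in>T. if j \<in> u then \<sigma> j else 0))"
proof -
  let ?s = "\<lambda>t :: nat \<Rightarrow> nat. {j \<in> T. t j \<noteq> 0}"
  have inverse: "(\<lambda>j\<in>T. if j \<in> ?s t then restrict t (?s t) j else 0) = t" if "t \<in> T \<rightarrow>\<^sub>E {..n}" for t
  proof
    show "(\<lambda>j\<in>T. if j \<in> ?s t then restrict t (?s t) j else 0) j = t j" for j
      using PiE_arb[OF that, of j] by (cases "j \<in> T") auto
  qed
  have "(\<Sum>t\<in>T \<rightarrow>\<^sub>E {..n}. h t) = (\<Sum>(u, \<sigma>)\<in>(SIGMA u:Pow T. u \<rightarrow>\<^sub>E {1..n}). h (\<lambda>j\<in>T. if j \<in> u then \<sigma> j else 0))"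
  proof (rule sum.reindex_bij_witness[where i = "\<lambda>(u, \<sigma>). \<lambda>j\<in>T. if j \<in> u then \<sigma> j else 0" and j = "\<lambda>t. (?s t, restrict t (?s t))"], goal_cases)
    case (1 t) then show ?case unfolding prod.case by (rule inverse)
  next
    case (2 t)
    have "restrict t (?s t) \<in> ?s t \<rightarrow>\<^sub>E {1..n}" using PiE_mem[OF 2] by (auto simp: Suc_le_eq)
    then show ?case by auto
  next
    case (3 a)
    obtain u \<sigma> where a: "a = (u, \<sigma>)" "u \<subseteq> T" "\<sigma> \<in> u \<rightarrow>\<^sub>E {1..n}" using 3 by auto
    have "\<sigma> j \<noteq> 0" if "j \<in> u" for j using PiE_mem[OF a(3) that] by simp
    then have s: "?s (\<lambda>j\<in>T. if j \<in> u then \<sigma> j else 0) = u" using a(2) by auto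
    have "restrict (\<lambda>j\<in>T. if j \<in> u then \<sigma> j else 0) u j = \<sigma> j" for j
      using PiE_arb[OF a(3), of j] a(2) by (cases "j \<in> u") auto
    then have "restrict (\<lambda>j\<in>T. if j \<in> u then \<sigma> j else 0) u = \<sigma>" by blast
    then show ?case unfolding a(1) prod.case s by simp
  next
    case (4 a)
    obtain u \<sigma> where a: "a = (u, \<sigma>)" "u \<subseteq> T" "\<sigma> \<in> u \<rightarrow>\<^sub>E {1..n}" using 4 by auto
    have "\<sigma> j \<le> n" if "j \<in> u" for j using PiE_mem[OF a(3) that] by simp
    then show ?case unfolding a(1) prod.case by (intro PiE_I) auto
  next
    case (5 t) then show ?case unfolding prod.case by (simp only: inverse)
  qed
  also have "\<dots> = (\<Sum>u\<in>Pow T. \<Sum>\<sigma>\<in>u \<rightarrow>\<^sub>E {1..n}. h (\<lambda>j\<in>T. if j \<in> u then \<sigma> j else 0))"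
    using T by (intro sum.Sigma[symmetric]) (auto intro!: finite_PiE intro: finite_subset)
  finally show ?thesis .
qed

context poly_lattice_base
begin

text \<open>
  Insert the representation into the rule. The term without derivatives is the integral, as the weights sum to \<open>1\<close>. For every
  other index the dual net contributes to the criterion of the lattices, and the regular grid contributes terms
  which the extrapolation cancels up to order \<open>b\<^bsup>- \<alpha> n\<^esup>\<close>.
\<close>

theorem extrap_error_bound:
  fixes f :: "(nat \<Rightarrow> real) \<Rightarrow> real" and p :: "nat \<Rightarrow> 'p mod_ring poly"
  assumes \<alpha>: "\<alpha> \<ge> 2" and m: "m \<ge> \<alpha>" and q: "1 \<le> q" and \<gamma>: "\<And>u. u \<subseteq> {1..s} \<Longrightarrow> \<gamma> u \<ge> 0"
    and f: "f \<in> sobolev_space s \<alpha> \<gamma> q" "sobolev_norm s \<alpha> \<gamma> q f \<le> 1"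
    and p: "\<And>n. n \<in> {m - \<alpha> + 1..m} \<Longrightarrow> p n \<noteq> 0 \<and> Polynomial.degree (p n) = n"
  shows "\<bar>extrap_rule b \<alpha> m (\<lambda>n. image_mset (poly_lattice_point s (p n) (Q n)) (mset_set {0..<b ^ n})) f - (\<integral>x. f x \<partial>cube_measure {1..s})\<bar>
    \<le> (\<Sum>\<nu>=1..\<alpha>. \<bar>extrap_coeff b \<alpha> \<nu>\<bar> * lattice_crit \<alpha> \<gamma> s (m - \<nu> + 1) (p (m - \<nu> + 1)) (Q (m - \<nu> + 1)))
      + (\<Sum>\<nu>=1..\<alpha>. \<bar>extrap_coeff b \<alpha> \<nu>\<bar>) * (1 / real b) ^ (\<alpha> * (m - \<alpha> + 1)) * H_const s \<alpha> \<gamma> q"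
proof -
  define G where "G = (\<lambda>\<beta>. if \<beta> = (\<lambda>_. 0) then f else weak_deriv s \<beta> f)"
  have cf: "continuous_on (cube {1..s}) f"
    and wd: "\<And>\<beta>. (\<forall>j\<in>{1..s}. \<beta> j \<le> \<alpha>) \<Longrightarrow> (\<forall>j. j \<notin> {1..s} \<longrightarrow> \<beta> j = 0) \<Longrightarrow> \<exists>g. has_weak_deriv s \<beta> f g"
    using f(1) unfolding sobolev_space_def by blast+
  interpret W: weak_family s \<alpha> f G
  proof
    show "G (\<lambda>_. 0) = f" by (simp add: G_def)
    show "has_weak_deriv s \<beta> f (G \<beta>)" if ad: "\<forall>j\<in>{1..s}. \<beta> j \<le> \<alpha>" "\<forall>j. j \<notin> {1..s} \<longrightarrow> \<beta> j = 0" for \<beta>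
    proof (cases "\<beta> = (\<lambda>_. 0)")
      case True
      obtain g where "has_weak_deriv s \<beta> f g" using wd[OF ad] by blast
      then have "integrable (cube_measure {1..s}) f" unfolding has_weak_deriv_def by blast
      then show ?thesis using True by (simp add: G_def has_weak_deriv_def)
    next
      case False
      then show ?thesis using someI_ex[OF wd[OF ad]] by (simp add: G_def weak_deriv_def)
    qed
  qed
  let ?M = "cube_measure {1..s}" and ?N = "\<lambda>\<nu>. m - \<nu> + 1"
  define y where "y = (\<lambda>\<nu> n j. real (grid_index (?N \<nu>) (p (?N \<nu>)) (poly_of_nat n * Q (?N \<nu>) j)) / real b ^ ?N \<nu>)"
  define a where "a = extrap_coeff b \<alpha>"
  define A where "A = (\<Sum>\<nu>=1..\<alpha>. \<bar>a \<nu>\<bar>)"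
  have A0: "A \<ge> 0" by (simp add: A_def sum_nonneg)
  have N: "?N \<nu> \<in> {m - \<alpha> + 1..m}" "?N \<nu> \<ge> 1" if "\<nu> \<in> {1..\<alpha>}" for \<nu> using that m by auto
  define kk where "kk = (\<lambda>t \<nu> n x. \<Prod>j\<in>{1..s}. bern_kernel \<alpha> (t j) (y \<nu> n j) (x j))"
  define E where "E = (\<lambda>t x. \<Sum>\<nu>=1..\<alpha>. a \<nu> * ((\<Sum>n<b ^ ?N \<nu>. kk t \<nu> n x) / real (b ^ ?N \<nu>)))"
  define g where "g = (\<lambda>t. G (W.mindex t))"
  have Gi: "integrable ?M (g t)" for t unfolding g_def by (rule W.integrable_G[OF W.adm_mindex])
  have Ki: "integrable ?M (\<lambda>x. g t x * kk t \<nu> n x)" for t \<nu> n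
    unfolding kk_def by (rule integrable_mult_prod_bb[OF _ _ _ Gi]) (use bb_bern_kernel \<alpha> in auto)
  have GE: "g t x * E t x = (\<Sum>\<nu>=1..\<alpha>. a \<nu> * ((\<Sum>n<b ^ ?N \<nu>. g t x * kk t \<nu> n x) / real (b ^ ?N \<nu>)))" for t x
    unfolding E_def sum_distrib_left[of "g t x" _ "{1..\<alpha>}"]
    by (intro sum.cong refl, subst sum_distrib_left[symmetric]) (simp only: times_divide_eq_right mult.left_commute)
  have Si: "integrable ?M (\<lambda>x. a \<nu> * ((\<Sum>n<b ^ ?N \<nu>. g t x * kk t \<nu> n x) / real (b ^ ?N \<nu>)))" for t \<nu>
    by (rule integrable_mult_right, rule integrable_divide, rule Bochner_Integration.integrable_sum, rule Ki)
  have GEi: "integrable ?M (\<lambda>x. g t x * E t x)" for t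
    unfolding GE by (rule Bochner_Integration.integrable_sum, rule Si)
  have IE: "(\<integral>x. g t x * E t x \<partial>?M) = (\<Sum>\<nu>=1..\<alpha>. a \<nu> * ((\<Sum>n<b ^ ?N \<nu>. \<integral>x. g t x * kk t \<nu> n x \<partial>?M) / real (b ^ ?N \<nu>)))" for t
  proof -
    have "(\<integral>x. g t x * E t x \<partial>?M) = (\<Sum>\<nu>=1..\<alpha>. \<integral>x. a \<nu> * ((\<Sum>n<b ^ ?N \<nu>. g t x * kk t \<nu> n x) / real (b ^ ?N \<nu>)) \<partial>?M)"
      unfolding GE by (rule Bochner_Integration.integral_sum, rule Si)
    also have "\<dots> = (\<Sum>\<nu>=1..\<alpha>. a \<nu> * ((\<Sum>n<b ^ ?N \<nu>. \<integral>x. g t x * kk t \<nu> n x \<partial>?M) / real (b ^ ?N \<nu>)))"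
    proof (rule sum.cong[OF refl])
      fix \<nu>
      have "(\<integral>x. (\<Sum>n<b ^ ?N \<nu>. g t x * kk t \<nu> n x) \<partial>?M) = (\<Sum>n<b ^ ?N \<nu>. \<integral>x. g t x * kk t \<nu> n x \<partial>?M)"
        by (rule Bochner_Integration.integral_sum, rule Ki)
      then show "(\<integral>x. a \<nu> * ((\<Sum>n<b ^ ?N \<nu>. g t x * kk t \<nu> n x) / real (b ^ ?N \<nu>)) \<partial>?M)
        = a \<nu> * ((\<Sum>n<b ^ ?N \<nu>. \<integral>x. g t x * kk t \<nu> n x \<partial>?M) / real (b ^ ?N \<nu>))"
        by (simp only: integral_mult_right_zero integral_divide_zero)
    qed
    finally show ?thesis .
  qed
  define T where "T = {1..s} \<rightarrow>\<^sub>E {..Suc \<alpha>}"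
  have rep: "f (poly_lattice_point s (p (?N \<nu>)) (Q (?N \<nu>)) n) = (\<Sum>t\<in>T. \<integral>x. g t x * kk t \<nu> n x \<partial>?M)" if \<nu>: "\<nu> \<in> {1..\<alpha>}" for \<nu> n
  proof -
    let ?P = "poly_lattice_point s (p (?N \<nu>)) (Q (?N \<nu>)) n"
    have pj: "?P j = y \<nu> n j" if "j \<in> {1..s}" for j
      using that p[OF N(1)[OF \<nu>]] by (simp only: poly_lattice_point_def y_def restrict_apply' grid_index(2))
    have y01: "0 \<le> y \<nu> n j \<and> y \<nu> n j < 1" for j
    proof -
      have "real (grid_index (?N \<nu>) (p (?N \<nu>)) (poly_of_nat n * Q (?N \<nu>) j)) < real b ^ ?N \<nu>"
        using grid_index(1) of_nat_less_iff[where 'a = real] by (simp only: of_nat_power[symmetric])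
      then show ?thesis by (simp add: y_def)
    qed
    have "?P \<in> cube {1..s}" unfolding cube_def
    proof (rule PiE_I)
      show "?P j \<in> {0..<1}" if "j \<in> {1..s}" for j using pj[OF that] y01 by simp
      show "?P j = undefined" if "j \<notin> {1..s}" for j using that by (simp only: poly_lattice_point_def restrict_def if_False)
    qed
    from W.representation[OF _ cf this] \<alpha>
    have "f ?P = (\<Sum>t\<in>T. \<integral>x. g t x * (\<Prod>j\<in>{1..s}. bern_kernel \<alpha> (t j) (?P j) (x j)) \<partial>?M)"
      by (simp add: T_def g_def)
    also have "(\<lambda>t x. \<Prod>j\<in>{1..s}. bern_kernel \<alpha> (t j) (?P j) (x j)) = (\<lambda>t x. kk t \<nu> n x)"
      unfolding kk_def by (intro ext prod.cong refl) (simp only: pj)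
    finally show ?thesis by metis
  qed
  have rule_eq: "extrap_rule b \<alpha> m (\<lambda>n. image_mset (poly_lattice_point s (p n) (Q n)) (mset_set {0..<b ^ n})) f
     = (\<Sum>t\<in>T. \<integral>x. g t x * E t x \<partial>?M)"
  proof -
    have "extrap_rule b \<alpha> m (\<lambda>n. image_mset (poly_lattice_point s (p n) (Q n)) (mset_set {0..<b ^ n})) f
       = (\<Sum>\<nu>=1..\<alpha>. a \<nu> * ((\<Sum>n<b ^ ?N \<nu>. f (poly_lattice_point s (p (?N \<nu>)) (Q (?N \<nu>)) n)) / real (b ^ ?N \<nu>)))"
      unfolding extrap_rule_def a_def qmc_def
      by (simp add: sum_unfold_sum_mset multiset.map_comp comp_def lessThan_atLeast0)
    also have "\<dots> = (\<Sum>\<nu>=1..\<alpha>. \<Sum>t\<in>T. a \<nu> * ((\<Sum>n<b ^ ?N \<nu>. \<integral>x. g t x * kk t \<nu> n x \<partial>?M) / real (b ^ ?N \<nu>)))"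
    proof (rule sum.cong[OF refl])
      fix \<nu> assume \<nu>: "\<nu> \<in> {1..\<alpha>}"
      have "(\<Sum>n<b ^ ?N \<nu>. f (poly_lattice_point s (p (?N \<nu>)) (Q (?N \<nu>)) n)) = (\<Sum>t\<in>T. \<Sum>n<b ^ ?N \<nu>. \<integral>x. g t x * kk t \<nu> n x \<partial>?M)"
        unfolding rep[OF \<nu>] by (rule sum.swap)
      then show "a \<nu> * ((\<Sum>n<b ^ ?N \<nu>. f (poly_lattice_point s (p (?N \<nu>)) (Q (?N \<nu>)) n)) / real (b ^ ?N \<nu>))
        = (\<Sum>t\<in>T. a \<nu> * ((\<Sum>n<b ^ ?N \<nu>. \<integral>x. g t x * kk t \<nu> n x \<partial>?M) / real (b ^ ?N \<nu>)))"
        by (simp only: sum_divide_distrib[of _ T] sum_distrib_left[of _ _ T])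
    qed
    also have "\<dots> = (\<Sum>t\<in>T. \<integral>x. g t x * E t x \<partial>?M)" unfolding IE by (rule sum.swap)
    finally show ?thesis .
  qed
  define tt where "tt = (\<lambda>u (\<sigma> :: nat \<Rightarrow> nat). \<lambda>j\<in>{1..s}. if j \<in> u then \<sigma> j else 0)"
  define U where "U = Pow {1..s} - {{}}"
  have zero: "(\<Sum>\<sigma>\<in>{} \<rightarrow>\<^sub>E {1..Suc \<alpha>}. \<integral>x. g (tt {} \<sigma>) x * E (tt {} \<sigma>) x \<partial>?M) = (\<integral>x. f x \<partial>?M)"
  proof -
    have z: "tt {} \<sigma> j = 0" if "j \<in> {1..s}" for \<sigma> j using that by (simp add: tt_def)
    have "W.mindex (tt {} \<sigma>) = (\<lambda>_. 0)" for \<sigma> using z by (simp add: W.mindex_def fun_eq_iff)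
    then have "g (tt {} \<sigma>) = f" for \<sigma> by (simp add: g_def G_def)
    moreover have "kk (tt {} \<sigma>) \<nu> n x = 1" for \<sigma> \<nu> n x
      unfolding kk_def using z by (intro prod.neutral ballI) (simp add: bern_kernel_def)
    then have "E (tt {} \<sigma>) x = 1" for \<sigma> x
      using extrap_coeff_moments[OF b2, of 0 \<alpha>] \<alpha> by (simp add: E_def a_def)
    ultimately show ?thesis by simp
  qed
  have "(\<Sum>t\<in>T. \<integral>x. g t x * E t x \<partial>?M) = (\<Sum>u\<in>Pow {1..s}. \<Sum>\<sigma>\<in>u \<rightarrow>\<^sub>E {1..Suc \<alpha>}. \<integral>x. g (tt u \<sigma>) x * E (tt u \<sigma>) x \<partial>?M)"
    unfolding T_def tt_def by (rule sum_PiE_support) simp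
  also have "\<dots> = (\<integral>x. f x \<partial>?M) + (\<Sum>u\<in>U. \<Sum>\<sigma>\<in>u \<rightarrow>\<^sub>E {1..Suc \<alpha>}. \<integral>x. g (tt u \<sigma>) x * E (tt u \<sigma>) x \<partial>?M)"
    unfolding U_def by (subst sum.remove[of "Pow {1..s}" "{}"]) (simp, blast, simp only: zero)
  finally have err: "extrap_rule b \<alpha> m (\<lambda>n. image_mset (poly_lattice_point s (p n) (Q n)) (mset_set {0..<b ^ n})) f - (\<integral>x. f x \<partial>?M)
     = (\<Sum>u\<in>U. \<Sum>\<sigma>\<in>u \<rightarrow>\<^sub>E {1..Suc \<alpha>}. \<integral>x. g (tt u \<sigma>) x * E (tt u \<sigma>) x \<partial>?M)"
    unfolding rule_eq by simp
  define R where "R = (\<lambda>u :: nat set. A * ((1 / real b) ^ (\<alpha> * (m - \<alpha> + 1)) * D_const \<alpha> ^ card u))"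
  define S where "S = (\<lambda>u \<sigma>. \<Sum>\<nu>=1..\<alpha>. \<bar>a \<nu>\<bar> * (\<Sum>k\<in>dual_net (?N \<nu>) (p (?N \<nu>)) (Q (?N \<nu>)) u. \<Prod>j\<in>u. ker_bound (?N \<nu>) \<alpha> (\<sigma> j) (k j)))"
  have R0: "R u \<ge> 0" for u unfolding R_def using A0 D_const_nonneg[OF \<alpha>] by simp
  have S0: "S u \<sigma> \<ge> 0" for u \<sigma> unfolding S_def
  proof (intro sum_nonneg mult_nonneg_nonneg prod_nonneg ballI)
    fix \<nu> k j assume "\<nu> \<in> {1..\<alpha>}" "k \<in> dual_net (?N \<nu>) (p (?N \<nu>)) (Q (?N \<nu>)) u" "j \<in> u"
    then show "0 \<le> ker_bound (?N \<nu>) \<alpha> (\<sigma> j) (k j)"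
      by (intro ker_bound_nonneg[OF \<alpha> N(2)]) (auto simp: dual_net_def PiE_iff)
  qed simp
  have trm: "\<bar>\<integral>x. g (tt u \<sigma>) x * E (tt u \<sigma>) x \<partial>?M\<bar> \<le> (S u \<sigma> + R u) * mean_abs s \<alpha> u f \<sigma>"
    and dm: "integrable (cube_measure (top_set \<alpha> u \<sigma>)) (deriv_mean s \<alpha> u (top_set \<alpha> u \<sigma>) (restrict \<sigma> (u - top_set \<alpha> u \<sigma>)) f)"
    if u: "u \<in> U" and \<sigma>: "\<sigma> \<in> u \<rightarrow>\<^sub>E {1..Suc \<alpha>}" for u \<sigma>
  proof -
    let ?v = "top_set \<alpha> u \<sigma>"
    have us: "u \<subseteq> {1..s}" "u \<noteq> {}" and fu: "finite u" using u finite_subset by (auto simp: U_def)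
    have vs: "?v \<subseteq> {1..s}" using us by (auto simp: top_set_def)
    have s1: "1 \<le> \<sigma> j" "\<sigma> j \<le> Suc \<alpha>" if "j \<in> u" for j using PiE_mem[OF \<sigma> that] by auto
    have tu: "tt u \<sigma> j = \<sigma> j" if "j \<in> u" for j using that us by (auto simp: tt_def)
    have tn: "tt u \<sigma> j = 0" if "j \<in> {1..s}" "j \<notin> u" for j using that by (simp add: tt_def)
    have kku: "kk (tt u \<sigma>) \<nu> n x = (\<Prod>j\<in>u. bern_kernel \<alpha> (\<sigma> j) (y \<nu> n j) (x j))" for \<nu> n x
      unfolding kk_def using us tn tu by (intro prod.mono_neutral_cong_right) (auto simp: bern_kernel_def)
    have bound: "\<bar>E (tt u \<sigma>) x\<bar> \<le> S u \<sigma> + R u" for x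
    proof -
      define X where "X = (\<lambda>\<nu>. (\<Sum>n<b ^ ?N \<nu>. \<Prod>j\<in>u. bern_kernel \<alpha> (\<sigma> j) (y \<nu> n j) (x j)) / real (b ^ ?N \<nu>))"
      define Y where "Y = (\<lambda>\<nu>. (1 / real b) ^ (?N \<nu> * (\<Sum>j\<in>u. min (\<sigma> j) \<alpha>)) * (\<Prod>j\<in>u. ker_const (?N \<nu>) \<alpha> (\<sigma> j) (x j)))"
      define Z where "Z = (\<lambda>\<nu>. \<Sum>k\<in>dual_net (?N \<nu>) (p (?N \<nu>)) (Q (?N \<nu>)) u. \<Prod>j\<in>u. ker_bound (?N \<nu>) \<alpha> (\<sigma> j) (k j))"
      have XY: "\<bar>X \<nu> - Y \<nu>\<bar> \<le> Z \<nu>" if "\<nu> \<in> {1..\<alpha>}" for \<nu>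
        unfolding X_def Y_def Z_def y_def
        by (rule lattice_kernel_error[OF \<alpha> N(2)[OF that] fu]) (use s1 p[OF N(1)[OF that]] in auto)
      have "E (tt u \<sigma>) x = (\<Sum>\<nu>=1..\<alpha>. a \<nu> * X \<nu>)" by (simp only: E_def kku X_def)
      also have "\<dots> = (\<Sum>\<nu>=1..\<alpha>. a \<nu> * (X \<nu> - Y \<nu>)) + (\<Sum>\<nu>=1..\<alpha>. a \<nu> * Y \<nu>)"
        by (simp only: sum.distrib[symmetric] distrib_left[symmetric] diff_add_cancel)
      finally have "\<bar>E (tt u \<sigma>) x\<bar> \<le> \<bar>\<Sum>\<nu>=1..\<alpha>. a \<nu> * (X \<nu> - Y \<nu>)\<bar> + \<bar>\<Sum>\<nu>=1..\<alpha>. a \<nu> * Y \<nu>\<bar>" by linarith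
      moreover have "\<bar>\<Sum>\<nu>=1..\<alpha>. a \<nu> * (X \<nu> - Y \<nu>)\<bar> \<le> (\<Sum>\<nu>=1..\<alpha>. \<bar>a \<nu>\<bar> * Z \<nu>)"
        by (rule order_trans[OF sum_abs sum_mono]) (simp only: abs_mult mult_left_mono[OF XY abs_ge_zero])
      moreover have "\<bar>\<Sum>\<nu>=1..\<alpha>. a \<nu> * Y \<nu>\<bar> \<le> R u"
        unfolding Y_def R_def A_def a_def by (rule extrap_grid_part[OF \<alpha> m fu us(2)]) (rule s1)
      ultimately show ?thesis unfolding S_def Z_def by linarith
    qed
    have dep: "E (tt u \<sigma>) x = E (tt u \<sigma>) x'" if x: "\<And>j. j \<in> ?v \<Longrightarrow> x j = x' j" for x x'
    proof -
      have "bern_kernel \<alpha> (\<sigma> j) z (x j) = bern_kernel \<alpha> (\<sigma> j) z (x' j)" if "j \<in> u" for j z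
      proof (cases "\<sigma> j \<le> \<alpha>")
        case False
        then have "j \<in> ?v" using s1[OF that] that by (simp add: top_set_def)
        then show ?thesis by (simp only: x)
      qed (rule bern_kernel_indep)
      then show ?thesis unfolding E_def kku by (simp only: cong: prod.cong)
    qed
    have mi: "W.mindex (tt u \<sigma>) = mixed_index \<alpha> u ?v (restrict \<sigma> (u - ?v))"
    proof
      fix j
      show "W.mindex (tt u \<sigma>) j = mixed_index \<alpha> u ?v (restrict \<sigma> (u - ?v)) j"
      proof (cases "j \<in> u")
        case True
        then have "j \<in> {1..s}" using us by blast
        then show ?thesis using True tu[OF True] s1[OF True]
          by (simp add: W.mindex_def mixed_index_def top_set_def min_def)
      next
        case False
        then show ?thesis using tn[of j] by (simp add: W.mindex_def mixed_index_def top_set_def)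
      qed
    qed
    obtain j0 where j0: "j0 \<in> u" using us by blast
    have "W.mindex (tt u \<sigma>) j0 \<noteq> 0" using tu[OF j0] s1[OF j0] us j0 \<alpha> by (auto simp: W.mindex_def)
    then have "W.mindex (tt u \<sigma>) \<noteq> (\<lambda>_. 0)" by metis
    then have gd: "g (tt u \<sigma>) = weak_deriv s (mixed_index \<alpha> u ?v (restrict \<sigma> (u - ?v))) f"
      unfolding g_def G_def mi by simp
    have dme: "(\<lambda>x. \<integral>z. g (tt u \<sigma>) (merge ?v ({1..s} - ?v) (x, z)) \<partial>cube_measure ({1..s} - ?v))
      = deriv_mean s \<alpha> u ?v (restrict \<sigma> (u - ?v)) f"
      by (rule ext) (simp only: gd deriv_mean_def)
    note C = cube_integral_abs_le[OF vs _ Gi GEi dep bound]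
    show "integrable (cube_measure ?v) (deriv_mean s \<alpha> u ?v (restrict \<sigma> (u - ?v)) f)"
      using C(2) by (simp only: dme finite_atLeastAtMost)
    show "\<bar>\<integral>x. g (tt u \<sigma>) x * E (tt u \<sigma>) x \<partial>?M\<bar> \<le> (S u \<sigma> + R u) * mean_abs s \<alpha> u f \<sigma>"
      using C(1) unfolding fun_cong[OF dme] mean_abs_def by (simp only: finite_atLeastAtMost)
  qed
  have nt: "norm_term s \<alpha> \<gamma> q f u \<le> 1" if "u \<subseteq> {1..s}" for u
  proof -
    have "norm_term s \<alpha> \<gamma> q f u \<le> sobolev_norm s \<alpha> \<gamma> q f"
      unfolding sobolev_norm_def by (rule Max_ge) (use that in auto)
    then show ?thesis using f(2) by (rule order_trans)
  qed
  define h where "h = (\<lambda>u :: nat set. (real \<alpha> + 1) powr real_of_ereal (ereal (real (card u)) / conj_exponent q))"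
  have per_u: "(\<Sum>\<sigma>\<in>u \<rightarrow>\<^sub>E {1..Suc \<alpha>}. \<bar>\<integral>x. g (tt u \<sigma>) x * E (tt u \<sigma>) x \<partial>?M\<bar>)
     \<le> (\<Sum>\<nu>=1..\<alpha>. \<bar>a \<nu>\<bar> * (\<gamma> u * (\<Sum>k\<in>dual_net (?N \<nu>) (p (?N \<nu>)) (Q (?N \<nu>)) u. \<Prod>j\<in>u. C_const b \<alpha> * rho \<alpha> (?N \<nu>) (k j))))
       + A * (1 / real b) ^ (\<alpha> * (m - \<alpha> + 1)) * (\<gamma> u * h u * D_const \<alpha> ^ card u)" if u: "u \<in> U" for u
  proof -
    let ?S = "u \<rightarrow>\<^sub>E {1..Suc \<alpha>}"
    have us: "u \<subseteq> {1..s}" and fu: "finite u" using u finite_subset by (auto simp: U_def)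
    note mb = mean_abs_bounds[OF us q \<gamma>[OF us] nt[OF us] dm[OF u]]
    have SS: "(\<Sum>\<sigma>\<in>?S. S u \<sigma>) \<le> (\<Sum>\<nu>=1..\<alpha>. \<bar>a \<nu>\<bar> * (\<Sum>k\<in>dual_net (?N \<nu>) (p (?N \<nu>)) (Q (?N \<nu>)) u. \<Prod>j\<in>u. C_const b \<alpha> * rho \<alpha> (?N \<nu>) (k j)))"
    proof -
      have "(\<Sum>\<sigma>\<in>?S. S u \<sigma>) = (\<Sum>\<nu>=1..\<alpha>. \<bar>a \<nu>\<bar> * (\<Sum>k\<in>dual_net (?N \<nu>) (p (?N \<nu>)) (Q (?N \<nu>)) u. \<Sum>\<sigma>\<in>?S. \<Prod>j\<in>u. ker_bound (?N \<nu>) \<alpha> (\<sigma> j) (k j)))"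
        unfolding S_def by (subst sum.swap, intro sum.cong refl, subst sum.swap) (simp only: sum_distrib_left)
      also have "\<dots> \<le> (\<Sum>\<nu>=1..\<alpha>. \<bar>a \<nu>\<bar> * (\<Sum>k\<in>dual_net (?N \<nu>) (p (?N \<nu>)) (Q (?N \<nu>)) u. \<Prod>j\<in>u. C_const b \<alpha> * rho \<alpha> (?N \<nu>) (k j)))"
      proof (rule sum_mono, rule mult_left_mono, rule sum_mono)
        fix \<nu> k assume \<nu>: "\<nu> \<in> {1..\<alpha>}" and k: "k \<in> dual_net (?N \<nu>) (p (?N \<nu>)) (Q (?N \<nu>)) u"
        have kj: "k j < b ^ ?N \<nu>" if "j \<in> u" for j using k that by (auto simp: dual_net_def PiE_iff)
        have "(\<Sum>\<sigma>\<in>?S. \<Prod>j\<in>u. ker_bound (?N \<nu>) \<alpha> (\<sigma> j) (k j)) = (\<Prod>j\<in>u. \<Sum>t=1..Suc \<alpha>. ker_bound (?N \<nu>) \<alpha> t (k j))"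
          by (rule prod_sum_PiE[symmetric]) (use fu in auto)
        also have "\<dots> \<le> (\<Prod>j\<in>u. C_const b \<alpha> * rho \<alpha> (?N \<nu>) (k j))"
          by (intro prod_mono conjI sum_nonneg sum_ker_bound[OF \<alpha> N(2)[OF \<nu>]] ker_bound_nonneg[OF \<alpha> N(2)[OF \<nu>]] kj)
        finally show "(\<Sum>\<sigma>\<in>?S. \<Prod>j\<in>u. ker_bound (?N \<nu>) \<alpha> (\<sigma> j) (k j)) \<le> (\<Prod>j\<in>u. C_const b \<alpha> * rho \<alpha> (?N \<nu>) (k j))" .
      qed simp
      finally show ?thesis .
    qed
    have "(\<Sum>\<sigma>\<in>?S. \<bar>\<integral>x. g (tt u \<sigma>) x * E (tt u \<sigma>) x \<partial>?M\<bar>) \<le> (\<Sum>\<sigma>\<in>?S. S u \<sigma> * \<gamma> u + R u * mean_abs s \<alpha> u f \<sigma>)"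
    proof (rule sum_mono)
      fix \<sigma> assume \<sigma>: "\<sigma> \<in> ?S"
      have "(S u \<sigma> + R u) * mean_abs s \<alpha> u f \<sigma> \<le> S u \<sigma> * \<gamma> u + R u * mean_abs s \<alpha> u f \<sigma>"
        using mult_left_mono[OF mb(1)[OF _ \<sigma>] S0[of u \<sigma>]] by (simp add: distrib_right)
      then show "\<bar>\<integral>x. g (tt u \<sigma>) x * E (tt u \<sigma>) x \<partial>?M\<bar> \<le> S u \<sigma> * \<gamma> u + R u * mean_abs s \<alpha> u f \<sigma>"
        using trm[OF u \<sigma>] by linarith
    qed
    also have "\<dots> = (\<Sum>\<sigma>\<in>?S. S u \<sigma>) * \<gamma> u + R u * (\<Sum>\<sigma>\<in>?S. mean_abs s \<alpha> u f \<sigma>)"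
      by (simp only: sum.distrib sum_distrib_left sum_distrib_right)
    also have "\<dots> \<le> (\<Sum>\<nu>=1..\<alpha>. \<bar>a \<nu>\<bar> * (\<Sum>k\<in>dual_net (?N \<nu>) (p (?N \<nu>)) (Q (?N \<nu>)) u. \<Prod>j\<in>u. C_const b \<alpha> * rho \<alpha> (?N \<nu>) (k j))) * \<gamma> u
        + R u * (\<gamma> u * h u)"
      unfolding h_def by (intro add_mono mult_right_mono[OF SS \<gamma>[OF us]] mult_left_mono[OF mb(2) R0])
    also have "\<dots> = (\<Sum>\<nu>=1..\<alpha>. \<bar>a \<nu>\<bar> * (\<gamma> u * (\<Sum>k\<in>dual_net (?N \<nu>) (p (?N \<nu>)) (Q (?N \<nu>)) u. \<Prod>j\<in>u. C_const b \<alpha> * rho \<alpha> (?N \<nu>) (k j))))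
       + A * (1 / real b) ^ (\<alpha> * (m - \<alpha> + 1)) * (\<gamma> u * h u * D_const \<alpha> ^ card u)"
      unfolding R_def sum_distrib_right by (intro arg_cong2[where f = "(+)"] sum.cong refl) (simp_all only: mult_ac)
    finally show ?thesis .
  qed
  have "\<bar>\<Sum>u\<in>U. \<Sum>\<sigma>\<in>u \<rightarrow>\<^sub>E {1..Suc \<alpha>}. \<integral>x. g (tt u \<sigma>) x * E (tt u \<sigma>) x \<partial>?M\<bar>
     \<le> (\<Sum>u\<in>U. \<Sum>\<sigma>\<in>u \<rightarrow>\<^sub>E {1..Suc \<alpha>}. \<bar>\<integral>x. g (tt u \<sigma>) x * E (tt u \<sigma>) x \<partial>?M\<bar>)"
    by (rule order_trans[OF sum_abs sum_mono[OF sum_abs]])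
  also have "\<dots> \<le> (\<Sum>u\<in>U. (\<Sum>\<nu>=1..\<alpha>. \<bar>a \<nu>\<bar> * (\<gamma> u * (\<Sum>k\<in>dual_net (?N \<nu>) (p (?N \<nu>)) (Q (?N \<nu>)) u. \<Prod>j\<in>u. C_const b \<alpha> * rho \<alpha> (?N \<nu>) (k j))))
       + A * (1 / real b) ^ (\<alpha> * (m - \<alpha> + 1)) * (\<gamma> u * h u * D_const \<alpha> ^ card u))"
    by (rule sum_mono[OF per_u])
  also have "\<dots> = (\<Sum>\<nu>=1..\<alpha>. \<bar>a \<nu>\<bar> * lattice_crit \<alpha> \<gamma> s (?N \<nu>) (p (?N \<nu>)) (Q (?N \<nu>)))
       + A * (1 / real b) ^ (\<alpha> * (m - \<alpha> + 1)) * (\<Sum>u\<in>U. \<gamma> u * h u * D_const \<alpha> ^ card u)"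
    unfolding lattice_crit_def U_def[symmetric] sum.distrib
    by (subst sum.swap) (simp only: sum_distrib_left)
  also have "\<dots> \<le> (\<Sum>\<nu>=1..\<alpha>. \<bar>a \<nu>\<bar> * lattice_crit \<alpha> \<gamma> s (?N \<nu>) (p (?N \<nu>)) (Q (?N \<nu>)))
       + A * (1 / real b) ^ (\<alpha> * (m - \<alpha> + 1)) * H_const s \<alpha> \<gamma> q"
  proof (intro add_left_mono mult_left_mono)
    show "(\<Sum>u\<in>U. \<gamma> u * h u * D_const \<alpha> ^ card u) \<le> H_const s \<alpha> \<gamma> q"
      unfolding H_const_def h_def U_def
      by (rule sum_mono2) (use \<gamma> D_const_nonneg[OF \<alpha>] in auto)
    show "0 \<le> A * (1 / real b) ^ (\<alpha> * (m - \<alpha> + 1))" using A0 by simp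
  qed
  finally show ?thesis unfolding err a_def[symmetric] A_def[symmetric] .
qed

end


section \<open>Dependence on the dimension\<close>

lemma num_evals_le:
  assumes b: "b \<ge> 2" and m: "m \<ge> \<alpha>" and \<alpha>: "\<alpha> \<ge> 1"
  shows "real (num_evals b \<alpha> m) \<le> real b ^ (m - \<alpha> + 1) * real b ^ \<alpha>"
proof -
  have "(\<Sum>n\<le>m. b ^ n) \<le> b ^ Suc m"
  proof (induction m)
    case (Suc m)
    have "2 * b ^ Suc m \<le> b * b ^ Suc m" using b by (intro mult_right_mono) auto
    then show ?case using Suc.IH by (simp only: sum.atMost_Suc power_Suc)
  qed (use b in simp)
  moreover have "num_evals b \<alpha> m \<le> (\<Sum>n\<le>m. b ^ n)"
    unfolding num_evals_def by (rule sum_mono2) auto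
  ultimately have "num_evals b \<alpha> m \<le> b ^ Suc m" by linarith
  also have "Suc m = (m - \<alpha> + 1) + \<alpha>" using m by simp
  finally have "real (num_evals b \<alpha> m) \<le> real (b ^ ((m - \<alpha> + 1) + \<alpha>))" by (rule of_nat_mono)
  then show ?thesis by (simp only: of_nat_power of_nat_mult power_add)
qed

lemma num_evals_pos: "b \<ge> 2 \<Longrightarrow> m \<ge> \<alpha> \<Longrightarrow> \<alpha> \<ge> 1 \<Longrightarrow> num_evals b \<alpha> m > 0"
  unfolding num_evals_def by (intro sum_pos) auto

lemma prod_one_plus_le_exp:
  fixes x :: "'a \<Rightarrow> real"
  assumes "finite A" "\<And>i. i \<in> A \<Longrightarrow> 0 \<le> x i"
  shows "(\<Prod>i\<in>A. 1 + x i) \<le> exp (\<Sum>i\<in>A. x i)"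
  unfolding exp_sum[OF assms(1)] by (intro prod_mono conjI exp_ge_add_one_self) (use assms in auto)

lemma sum_Pow_prod:
  fixes x :: "'a \<Rightarrow> real"
  assumes "finite A"
  shows "(\<Sum>u\<in>Pow A. \<Prod>i\<in>u. x i) = (\<Prod>i\<in>A. 1 + x i)"
  using prod_add[OF assms, of x "\<lambda>_. 1"] by (simp add: add.commute)

text \<open>
  This makes summability of \<open>g\<^sub>j\<^bsup>lam\<^esup>\<close> sufficient also for the constant \<open>H_const\<close>, in which the weights appear to the first power.
\<close>

lemma one_plus_le_exp_powr:
  fixes x l :: real
  assumes "x \<ge> 0" "0 < l" "l \<le> 1"
  shows "1 + x \<le> exp (x powr l / l)"
proof -
  have "(1 + x) powr l \<le> 1 + x powr l"
    using powr_sum_le[of "{True, False}" "\<lambda>i. if i then 1 else x" l] assms by simp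
  also have "\<dots> \<le> exp (x powr l)" by (rule exp_ge_add_one_self)
  finally have "((1 + x) powr l) powr (1 / l) \<le> exp (x powr l) powr (1 / l)"
    using assms by (intro powr_mono2) auto
  then show ?thesis using assms by (simp add: powr_powr exp_powr_real)
qed

lemma limsup_finite_imp_bounded:
  fixes x :: "nat \<Rightarrow> real"
  assumes "limsup (\<lambda>s. ereal (x s)) < \<infinity>"
  shows "\<exists>c\<ge>0. \<forall>s. x s \<le> c"
proof -
  obtain c where "limsup (\<lambda>s. ereal (x s)) < ereal c" using less_PInf_Ex_of_nat assms
    by (metis ereal_dense2)
  then have "eventually (\<lambda>s. ereal (x s) < ereal c) sequentially" by (rule Limsup_lessD)
  then obtain n where n: "\<And>s. s \<ge> n \<Longrightarrow> x s < c" by (auto simp: eventually_sequentially)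
  define d where "d = Max (insert 0 (insert c (x ` {..n})))"
  have "x s \<le> d" for s
  proof (cases "s \<le> n")
    case True then show ?thesis unfolding d_def by (intro Max_ge) auto
  next
    case False
    then have "x s \<le> c" using n[of s] by simp
    also have "c \<le> d" unfolding d_def by (intro Max_ge) auto
    finally show ?thesis .
  qed
  moreover have "0 \<le> d" unfolding d_def by (intro Max_ge) auto
  ultimately show ?thesis by blast
qed

context poly_lattice_base
begin

lemma E_const_nonneg: "\<alpha> \<ge> 2 \<Longrightarrow> 1 / real \<alpha> < lam \<Longrightarrow> lam \<le> 1 \<Longrightarrow> E_const b \<alpha> lam \<ge> 0"
  by (rule order_trans[OF sum_nonneg sum_rho_powr_le[where N = 1]]) auto

text \<open>
  For product weights both constants are dominated by products over the coordinates, and \<open>1 + x \<le> exp x\<close>.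
\<close>

lemma product_weight_constants:
  assumes \<alpha>: "\<alpha> \<ge> 2" and lam: "1 / real \<alpha> < lam" "lam \<le> 1"
    and \<gamma>: "\<And>u. finite u \<Longrightarrow> u \<subseteq> {1..} \<Longrightarrow> \<gamma> u \<ge> 0" and pw: "product_weights \<gamma> g"
  shows "\<exists>c\<ge>0. \<forall>s. J_const s b \<alpha> lam \<gamma> \<le> exp (c * (\<Sum>j=1..s. g j powr lam)) \<and> H_const s \<alpha> \<gamma> q \<le> exp (c * (\<Sum>j=1..s. g j powr lam))"
proof -
  have l0: "0 < lam" using lam(1) by (smt (verit) divide_nonneg_nonneg of_nat_0_le_iff)
  have g: "g j \<ge> 0" if "j \<ge> 1" for j using \<gamma>[of "{j}"] pw that by (auto simp: product_weights_def)
  have \<gamma>g: "\<gamma> u = (\<Prod>j\<in>u. g j)" if "u \<subseteq> {1..s}" for u s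
  proof -
    have "finite u \<and> u \<subseteq> {1..}" using that finite_subset by auto
    then show ?thesis using pw unfolding product_weights_def by blast
  qed
  define C where "C = C_const b \<alpha>"
  have C: "C \<ge> 2" unfolding C_def by (rule C_const_ge_2[OF \<alpha>])
  define e where "e = C powr lam * E_const b \<alpha> lam"
  have e: "e \<ge> 0" unfolding e_def using E_const_nonneg[OF \<alpha> lam] by simp
  define d where "d = D_const \<alpha> * (real \<alpha> + 1) powr real_of_ereal (inverse (conj_exponent q))"
  have d: "d \<ge> 0" unfolding d_def using D_const_nonneg[OF \<alpha>] by simp
  define c where "c = e / lam + d powr lam / lam"
  have c: "c \<ge> 0" "e / lam \<le> c" "d powr lam / lam \<le> c" unfolding c_def using e l0 by auto
  have J: "J_const s b \<alpha> lam \<gamma> \<le> exp (c * (\<Sum>j=1..s. g j powr lam))" for s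
  proof -
    let ?G = "\<Sum>j=1..s. g j powr lam"
    have G0: "?G \<ge> 0" by (intro sum_nonneg) simp
    have tm: "\<gamma> u powr lam * C_const b \<alpha> powr (lam * real (card u)) * E_const b \<alpha> lam ^ card u = (\<Prod>j\<in>u. e * g j powr lam)"
      if "u \<subseteq> {1..s}" for u
    proof -
      have "finite u" using that finite_subset by auto
      have "C_const b \<alpha> powr (lam * real (card u)) = (C powr lam) ^ card u"
        unfolding C_def[symmetric] using C by (simp add: powr_powr[symmetric] powr_realpow)
      then show ?thesis unfolding \<gamma>g[OF that] e_def
        by (simp add: prod_powr_distrib prod.distrib power_mult_distrib mult_ac)
    qed
    have "(\<Sum>u\<in>Pow {1..s} - {{}}. \<gamma> u powr lam * C_const b \<alpha> powr (lam * real (card u)) * E_const b \<alpha> lam ^ card u)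
      = (\<Sum>u\<in>Pow {1..s} - {{}}. \<Prod>j\<in>u. e * g j powr lam)"
      by (intro sum.cong refl tm) auto
    also have "\<dots> \<le> (\<Sum>u\<in>Pow {1..s}. \<Prod>j\<in>u. e * g j powr lam)"
      using e by (intro sum_mono2) (auto intro!: prod_nonneg)
    also have "\<dots> = (\<Prod>j=1..s. 1 + e * g j powr lam)" by (rule sum_Pow_prod) simp
    also have "\<dots> \<le> exp (\<Sum>j=1..s. e * g j powr lam)"
      using e by (intro prod_one_plus_le_exp) auto
    finally have le: "(\<Sum>u\<in>Pow {1..s} - {{}}. \<gamma> u powr lam * C_const b \<alpha> powr (lam * real (card u)) * E_const b \<alpha> lam ^ card u)
      \<le> exp (e * ?G)" by (simp only: sum_distrib_left)
    have "J_const s b \<alpha> lam \<gamma> \<le> exp (e * ?G) powr (1 / lam)" unfolding J_const_def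
    proof (rule powr_mono2[OF _ _ le])
      show "0 \<le> (\<Sum>u\<in>Pow {1..s} - {{}}. \<gamma> u powr lam * C_const b \<alpha> powr (lam * real (card u)) * E_const b \<alpha> lam ^ card u)"
        using E_const_nonneg[OF \<alpha> lam] by (intro sum_nonneg) simp
    qed (use l0 in simp)
    also have "\<dots> = exp ((e / lam) * ?G)" by (simp add: exp_powr_real)
    also have "\<dots> \<le> exp (c * ?G)" using mult_right_mono[OF c(2) G0] by simp
    finally show ?thesis .
  qed
  have H: "H_const s \<alpha> \<gamma> q \<le> exp (c * (\<Sum>j=1..s. g j powr lam))" for s
  proof -
    let ?G = "\<Sum>j=1..s. g j powr lam"
    have G0: "?G \<ge> 0" by (intro sum_nonneg) simp
    have tm: "\<gamma> u * (real \<alpha> + 1) powr real_of_ereal (ereal (real (card u)) / conj_exponent q) * D_const \<alpha> ^ card u = (\<Prod>j\<in>u. d * g j)"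
      if "u \<subseteq> {1..s}" for u
    proof -
      have "finite u" using that finite_subset by auto
      have ex: "real_of_ereal (ereal (real (card u)) / conj_exponent q) = real_of_ereal (inverse (conj_exponent q)) * real (card u)"
        by (simp only: divide_ereal_def real_of_ereal_mult real_of_ereal.simps mult.commute)
      have "(real \<alpha> + 1) powr real_of_ereal (ereal (real (card u)) / conj_exponent q)
        = ((real \<alpha> + 1) powr real_of_ereal (inverse (conj_exponent q))) ^ card u"
        unfolding ex powr_powr[symmetric] by (rule powr_realpow) simp
      then show ?thesis unfolding \<gamma>g[OF that] d_def
        by (simp add: prod.distrib power_mult_distrib mult_ac)
    qed
    have "H_const s \<alpha> \<gamma> q = (\<Sum>u\<in>Pow {1..s}. \<Prod>j\<in>u. d * g j)"
      unfolding H_const_def by (intro sum.cong refl tm) auto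
    also have "\<dots> = (\<Prod>j=1..s. 1 + d * g j)" by (rule sum_Pow_prod) simp
    also have "\<dots> \<le> (\<Prod>j=1..s. exp (d powr lam / lam * g j powr lam))"
    proof (intro prod_mono conjI)
      fix j assume j: "j \<in> {1..s}"
      then have gj: "g j \<ge> 0" using g by auto
      show "0 \<le> 1 + d * g j" using d gj by simp
      show "1 + d * g j \<le> exp (d powr lam / lam * g j powr lam)"
        using one_plus_le_exp_powr[of "d * g j" lam] d gj l0 lam(2) by (simp add: powr_mult)
    qed
    also have "\<dots> = exp (d powr lam / lam * ?G)" by (simp only: exp_sum[symmetric] finite_atLeastAtMost sum_distrib_left)
    also have "\<dots> \<le> exp (c * ?G)" using mult_right_mono[OF c(3) G0] by simp
    finally show ?thesis .
  qed
  show ?thesis using J H c(1) by blast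
qed

text \<open>
  One choice of a point set for each dimension and each exponent serves all rates \<open>lam\<close>. The smallest of the \<open>\<alpha>\<close> point sets of a rule
  has \<open>b\<^bsup>m - \<alpha> + 1\<^esup>\<close> points, which is the number of evaluations up to a constant factor, and \<open>1 / lam < \<alpha>\<close> makes the error of the
  extrapolated grid negligible.
\<close>

lemma good_rules_exist:
  assumes \<alpha>: "\<alpha> \<ge> 2" and q: "1 \<le> q" and \<gamma>: "\<And>u. finite u \<Longrightarrow> u \<subseteq> {1..} \<Longrightarrow> \<gamma> u \<ge> 0"
  shows "\<exists>P :: nat \<Rightarrow> nat \<Rightarrow> (nat \<Rightarrow> real) multiset.
    (\<forall>s n. n \<ge> 1 \<longrightarrow> P s n \<in> poly_lattice_point_sets TYPE('p) s n) \<and>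
    (\<forall>lam. 1 / real \<alpha> < lam \<and> lam \<le> 1 \<longrightarrow> (\<exists>K>0. \<forall>s. \<forall>m\<ge>\<alpha>.
       worst_case_error s b \<alpha> \<gamma> q m (P s) \<le> ennreal (K * (J_const s b \<alpha> lam \<gamma> + H_const s \<alpha> \<gamma> q) * real (num_evals b \<alpha> m) powr (- 1 / lam))))"
proof -
  define good where "good = (\<lambda>s n (p :: 'p mod_ring poly) q. irreducible p \<and> Polynomial.degree p = n \<and> (\<forall>j\<in>{1..s}. q j \<noteq> 0 \<and> Polynomial.degree (q j) < n) \<and>
     (\<forall>lam. 1 / real \<alpha> < lam \<and> lam \<le> 1 \<longrightarrow>
        lattice_crit \<alpha> \<gamma> s n p q \<le> J_const s b \<alpha> lam \<gamma> * (real b ^ n - 1) powr (- 1 / lam)))"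
  have "\<forall>s n. \<exists>p q. n \<ge> 1 \<longrightarrow> good s n p q"
  proof (intro allI)
    fix s n
    show "\<exists>p q. n \<ge> 1 \<longrightarrow> good s n p q"
    proof (cases "n \<ge> 1")
      case True
      have "\<exists>p q. good s n p q" unfolding good_def by (rule good_lattice_exists[OF \<alpha> True \<gamma>])
      then show ?thesis by blast
    qed simp
  qed
  then obtain pp where "\<forall>s n. \<exists>q. n \<ge> 1 \<longrightarrow> good s n (pp s n) q" by metis
  then obtain Q where "\<forall>s n. n \<ge> 1 \<longrightarrow> good s n (pp s n) (Q s n)" by metis
  then have gd: "good s n (pp s n) (Q s n)" if "n \<ge> 1" for s n using that by blast
  define P where "P = (\<lambda>s n. image_mset (poly_lattice_point s (pp s n) (Q s n)) (mset_set {0..<b ^ n}))"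
  have "P s n \<in> poly_lattice_point_sets TYPE('p) s n" if "n \<ge> 1" for s n
    using gd[OF that, of s] unfolding poly_lattice_point_sets_def P_def good_def b_card by blast
  moreover have "\<exists>K>0. \<forall>s. \<forall>m\<ge>\<alpha>. worst_case_error s b \<alpha> \<gamma> q m (P s)
      \<le> ennreal (K * (J_const s b \<alpha> lam \<gamma> + H_const s \<alpha> \<gamma> q) * real (num_evals b \<alpha> m) powr (- 1 / lam))"
    if lam: "1 / real \<alpha> < lam" "lam \<le> 1" for lam
  proof -
    have l0: "0 < lam" using lam(1) by (smt (verit) divide_nonneg_nonneg of_nat_0_le_iff)
    have la: "1 / lam \<le> real \<alpha>" using lam(1) l0 \<alpha> by (simp add: divide_simps mult.commute)
    define A where "A = (\<Sum>\<nu>=1..\<alpha>. \<bar>extrap_coeff b \<alpha> \<nu>\<bar>)"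
    have A0: "A \<ge> 0" by (simp add: A_def sum_nonneg)
    define K where "K = (A + 1) * (2 * real b ^ \<alpha>) powr (1 / lam)"
    have "K > 0" unfolding K_def using A0 by (intro mult_pos_pos) auto
    moreover have "worst_case_error s b \<alpha> \<gamma> q m (P s)
      \<le> ennreal (K * (J_const s b \<alpha> lam \<gamma> + H_const s \<alpha> \<gamma> q) * real (num_evals b \<alpha> m) powr (- 1 / lam))"
      if m: "m \<ge> \<alpha>" for s m
    proof -
      let ?J = "J_const s b \<alpha> lam \<gamma>" and ?H = "H_const s \<alpha> \<gamma> q" and ?B = "real b ^ (m - \<alpha> + 1)"
      have \<gamma>s: "\<gamma> u \<ge> 0" if "u \<subseteq> {1..s}" for u
        by (rule \<gamma>) (use that finite_subset in auto)
      have J0: "?J \<ge> 0" by (simp add: J_const_def)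
      have H0: "?H \<ge> 0" unfolding H_const_def using \<gamma>s D_const_nonneg[OF \<alpha>] by (intro sum_nonneg) auto
      define x where "x = real (num_evals b \<alpha> m) / (2 * real b ^ \<alpha>)"
      have x0: "x > 0" unfolding x_def using num_evals_pos[OF b2 m] \<alpha> by simp
      have B2: "?B \<ge> 2"
      proof -
        have "real b ^ 1 \<le> ?B" using b2 by (intro power_increasing) auto
        from order_trans[OF rb2 this[unfolded power_one_right]] show ?thesis .
      qed
      have xB: "x \<le> ?B / 2"
      proof -
        have "x \<le> (?B * real b ^ \<alpha>) / (2 * real b ^ \<alpha>)"
          unfolding x_def using num_evals_le[OF b2 m] \<alpha> by (intro divide_right_mono) auto
        then show ?thesis by simp
      qed
      define z where "z = x powr (- 1 / lam)"
      have z: "z = (2 * real b ^ \<alpha>) powr (1 / lam) * real (num_evals b \<alpha> m) powr (- 1 / lam)"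
        unfolding z_def x_def by (simp add: powr_divide powr_minus divide_simps)
      have z0: "z \<ge> 0" by (simp add: z_def)
      have grid: "(1 / real b) ^ (\<alpha> * (m - \<alpha> + 1)) \<le> z"
      proof -
        have "?B > 0" using B2 by linarith
        then have "?B powr real \<alpha> = ?B ^ \<alpha>" by (rule powr_realpow)
        also have "\<dots> = real b ^ (\<alpha> * (m - \<alpha> + 1))" by (simp only: power_mult[symmetric] mult.commute)
        finally have p: "?B powr real \<alpha> = real b ^ (\<alpha> * (m - \<alpha> + 1))" .
        have "(1 / real b) ^ (\<alpha> * (m - \<alpha> + 1)) = ?B powr (- real \<alpha>)"
          unfolding powr_minus p power_one_over inverse_eq_divide by (rule refl)
        also have "\<dots> \<le> ?B powr (- 1 / lam)"
          using la B2 by (intro powr_mono) auto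
        also have "\<dots> \<le> z" unfolding z_def using xB x0 l0 B2 by (intro powr_mono2') auto
        finally show ?thesis .
      qed
      have crit: "lattice_crit \<alpha> \<gamma> s (m - \<nu> + 1) (pp s (m - \<nu> + 1)) (Q s (m - \<nu> + 1)) \<le> ?J * z" if \<nu>: "\<nu> \<in> {1..\<alpha>}" for \<nu>
      proof -
        have "?B \<le> real b ^ (m - \<nu> + 1)" using \<nu> m b2 by (intro power_increasing) auto
        then have "x \<le> real b ^ (m - \<nu> + 1) - 1" using xB B2 by linarith
        then have "(real b ^ (m - \<nu> + 1) - 1) powr (- 1 / lam) \<le> z"
          unfolding z_def using x0 l0 by (intro powr_mono2') auto
        then have "?J * (real b ^ (m - \<nu> + 1) - 1) powr (- 1 / lam) \<le> ?J * z" using J0 by (rule mult_left_mono)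
        moreover have "lattice_crit \<alpha> \<gamma> s (m - \<nu> + 1) (pp s (m - \<nu> + 1)) (Q s (m - \<nu> + 1))
           \<le> ?J * (real b ^ (m - \<nu> + 1) - 1) powr (- 1 / lam)"
        proof -
          have "good s (m - \<nu> + 1) (pp s (m - \<nu> + 1)) (Q s (m - \<nu> + 1))" by (rule gd) simp
          then show ?thesis using lam unfolding good_def by blast
        qed
        ultimately show ?thesis by linarith
      qed
      have "\<bar>extrap_rule b \<alpha> m (P s) f - (\<integral>x. f x \<partial>cube_measure {1..s})\<bar>
          \<le> K * (?J + ?H) * real (num_evals b \<alpha> m) powr (- 1 / lam)"
        if f: "f \<in> sobolev_space s \<alpha> \<gamma> q" "sobolev_norm s \<alpha> \<gamma> q f \<le> 1" for f
      proof -
        have pg: "pp s n \<noteq> 0 \<and> Polynomial.degree (pp s n) = n" if "n \<in> {m - \<alpha> + 1..m}" for n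
          using gd[of n s] that unfolding good_def by auto
        have "\<bar>extrap_rule b \<alpha> m (P s) f - (\<integral>x. f x \<partial>cube_measure {1..s})\<bar>
          \<le> (\<Sum>\<nu>=1..\<alpha>. \<bar>extrap_coeff b \<alpha> \<nu>\<bar> * lattice_crit \<alpha> \<gamma> s (m - \<nu> + 1) (pp s (m - \<nu> + 1)) (Q s (m - \<nu> + 1)))
           + A * (1 / real b) ^ (\<alpha> * (m - \<alpha> + 1)) * ?H"
          unfolding P_def A_def by (rule extrap_error_bound[OF \<alpha> m q \<gamma>s f pg])
        also have "\<dots> \<le> (\<Sum>\<nu>=1..\<alpha>. \<bar>extrap_coeff b \<alpha> \<nu>\<bar> * (?J * z)) + A * z * ?H"
          by (intro add_mono sum_mono mult_left_mono mult_right_mono crit grid A0 H0) auto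
        also have "(\<Sum>\<nu>=1..\<alpha>. \<bar>extrap_coeff b \<alpha> \<nu>\<bar> * (?J * z)) = A * (?J * z)"
          by (simp only: A_def sum_distrib_right)
        also have "A * (?J * z) + A * z * ?H = A * (?J + ?H) * z" by (simp only: distrib_left distrib_right mult_ac)
        also have "\<dots> \<le> (A + 1) * (?J + ?H) * z" using J0 H0 z0 by (intro mult_right_mono) auto
        also have "\<dots> = K * (?J + ?H) * real (num_evals b \<alpha> m) powr (- 1 / lam)" unfolding K_def z by (simp only: mult_ac)
        finally show ?thesis .
      qed
      then show ?thesis unfolding worst_case_error_def by (intro SUP_least ennreal_leI) auto
    qed
    ultimately show ?thesis by blast
  qed
  ultimately show ?thesis by (intro exI[of _ P]) blast
qed

end

theorem corollary2:
  fixes b \<alpha> :: nat and q :: ereal and \<gamma> :: "nat set \<Rightarrow> real"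
  assumes "b = CARD('p::prime_card)"
    and "\<alpha> > 1"
    and "1 \<le> q"
    and "\<And>u. finite u \<Longrightarrow> u \<subseteq> {1..} \<Longrightarrow> \<gamma> u \<ge> 0"
  shows "\<exists>P :: nat \<Rightarrow> nat \<Rightarrow> nat \<Rightarrow> (nat \<Rightarrow> real) multiset.
    (\<forall>s\<ge>1. \<forall>m\<ge>\<alpha>. \<forall>n\<in>{m - \<alpha> + 1..m}. P s m n \<in> poly_lattice_point_sets TYPE('p) s n) \<and>
    (\<forall>lam. 1 / real \<alpha> < lam \<and> lam \<le> 1 \<and>
        convergent (\<lambda>s. J_const s b \<alpha> lam \<gamma>) \<and> convergent (\<lambda>s. H_const s \<alpha> \<gamma> q) \<longrightarrow>
      (\<exists>C>0. \<forall>s\<ge>1. \<forall>m\<ge>\<alpha>. worst_case_error s b \<alpha> \<gamma> q m (P s m)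
         \<le> ennreal (C * real (num_evals b \<alpha> m) powr (- 1 / lam)))) \<and>
    (\<forall>lam \<kappa>. 1 / real \<alpha> < lam \<and> lam \<le> 1 \<and> \<kappa> > 0 \<and>
        limsup (\<lambda>s. ereal (J_const s b \<alpha> lam \<gamma> / real s powr \<kappa>)) < \<infinity> \<and>
        limsup (\<lambda>s. ereal (H_const s \<alpha> \<gamma> q / real s powr \<kappa>)) < \<infinity> \<longrightarrow>
      (\<exists>C>0. \<exists>t>0. \<forall>s\<ge>1. \<forall>m\<ge>\<alpha>. worst_case_error s b \<alpha> \<gamma> q m (P s m)
         \<le> ennreal (C * real s powr t * real (num_evals b \<alpha> m) powr (- 1 / lam)))) \<and>
    (\<forall>g lam. product_weights \<gamma> g \<and> 1 / real \<alpha> < lam \<and> lam \<le> 1 \<and>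
        summable (\<lambda>j. g (Suc j) powr lam) \<longrightarrow>
      (\<exists>C>0. \<forall>s\<ge>1. \<forall>m\<ge>\<alpha>. worst_case_error s b \<alpha> \<gamma> q m (P s m)
         \<le> ennreal (C * real (num_evals b \<alpha> m) powr (- 1 / lam)))) \<and>
    (\<forall>g lam. product_weights \<gamma> g \<and> 1 / real \<alpha> < lam \<and> lam \<le> 1 \<and>
        limsup (\<lambda>s. ereal ((\<Sum>j=1..s. g j powr lam) / ln (real s + 1))) < \<infinity> \<longrightarrow>
      (\<exists>C>0. \<exists>t>0. \<forall>s\<ge>1. \<forall>m\<ge>\<alpha>. worst_case_error s b \<alpha> \<gamma> q m (P s m)
         \<le> ennreal (C * real s powr t * real (num_evals b \<alpha> m) powr (- 1 / lam))))"
proof -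
  have b2: "b \<ge> 2" using prime_card[where 'a = 'p] prime_ge_2_nat assms(1) by blast
  interpret poly_lattice_base b "TYPE('p)" by unfold_locales (fact b2, fact assms(1))
  have \<alpha>: "\<alpha> \<ge> 2" using assms(2) by simp
  from good_rules_exist[OF \<alpha> assms(3,4)]
  obtain P where PP: "(\<forall>s n. n \<ge> 1 \<longrightarrow> P s n \<in> poly_lattice_point_sets TYPE('p) s n) \<and>
    (\<forall>lam. 1 / real \<alpha> < lam \<and> lam \<le> 1 \<longrightarrow> (\<exists>K>0. \<forall>s. \<forall>m\<ge>\<alpha>.
       worst_case_error s b \<alpha> \<gamma> q m (P s) \<le> ennreal (K * (J_const s b \<alpha> lam \<gamma> + H_const s \<alpha> \<gamma> q) * real (num_evals b \<alpha> m) powr (- 1 / lam))))" ..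
  have W: "\<exists>K>0. \<forall>s. \<forall>m\<ge>\<alpha>.
       worst_case_error s b \<alpha> \<gamma> q m (P s) \<le> ennreal (K * (J_const s b \<alpha> lam \<gamma> + H_const s \<alpha> \<gamma> q) * real (num_evals b \<alpha> m) powr (- 1 / lam))"
    if "1 / real \<alpha> < lam" "lam \<le> 1" for lam
    by (rule mp[OF spec[OF conjunct2[OF PP]]]) (intro conjI that)
  define J where "J = (\<lambda>lam s. J_const s b \<alpha> lam \<gamma>)"
  define H where "H = (\<lambda>s. H_const s \<alpha> \<gamma> q)"
  define w where "w = (\<lambda>s m. worst_case_error s b \<alpha> \<gamma> q m (P s))"
  define N where "N = (\<lambda>lam m. real (num_evals b \<alpha> m) powr (- 1 / lam))"
  have N0: "N lam m \<ge> 0" for lam m by (simp add: N_def)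
  have main: "\<exists>C>0. \<forall>s\<ge>1. \<forall>m\<ge>\<alpha>. w s m \<le> ennreal (C * real s powr t * N lam m)"
    if lam: "1 / real \<alpha> < lam" "lam \<le> 1" and c: "c \<ge> 0" and le: "\<And>s. s \<ge> 1 \<Longrightarrow> J lam s + H s \<le> c * real s powr t" for lam c t
  proof -
    obtain K where K: "K > 0" "\<And>s m. m \<ge> \<alpha> \<Longrightarrow> w s m \<le> ennreal (K * (J lam s + H s) * N lam m)"
      using W[OF lam] unfolding w_def J_def H_def N_def by blast
    have "w s m \<le> ennreal (K * (c + 1) * real s powr t * N lam m)" if "s \<ge> 1" "m \<ge> \<alpha>" for s m
    proof (rule order_trans[OF K(2)[OF that(2)]], rule ennreal_leI, rule mult_right_mono[OF _ N0])
      have "J lam s + H s \<le> (c + 1) * real s powr t"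
        using le[OF that(1)] by (rule order_trans) (simp add: mult_right_mono)
      from mult_left_mono[OF this, of K] show "K * (J lam s + H s) \<le> K * (c + 1) * real s powr t"
        using K(1) by (simp only: mult.assoc less_imp_le)
    qed
    moreover have "K * (c + 1) > 0" using K(1) c by simp
    ultimately show ?thesis by blast
  qed
  have pos: "\<exists>C>0. \<exists>t>0. \<forall>s\<ge>1. \<forall>m\<ge>\<alpha>. w s m \<le> ennreal (C * real s powr t * N lam m)"
    if lam: "1 / real \<alpha> < lam" "lam \<le> 1" and c: "c \<ge> 0" and t: "t > 0" and le: "\<And>s. s \<ge> 1 \<Longrightarrow> J lam s + H s \<le> c * real s powr t" for lam c t
    using main[OF lam c le] t by blast
  have unif: "\<exists>C>0. \<forall>s\<ge>1. \<forall>m\<ge>\<alpha>. w s m \<le> ennreal (C * N lam m)"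
    if lam: "1 / real \<alpha> < lam" "lam \<le> 1" and c: "c \<ge> 0" and le: "\<And>s. s \<ge> 1 \<Longrightarrow> J lam s + H s \<le> c" for lam c
  proof -
    have "\<exists>C>0. \<forall>s\<ge>1. \<forall>m\<ge>\<alpha>. w s m \<le> ennreal (C * real s powr 0 * N lam m)"
    proof (rule main[OF lam c])
      fix s :: nat assume "s \<ge> 1"
      then show "J lam s + H s \<le> c * real s powr 0" using le[of s] by simp
    qed
    then obtain C where C: "C > 0" "\<forall>s\<ge>1. \<forall>m\<ge>\<alpha>. w s m \<le> ennreal (C * real s powr 0 * N lam m)" by blast
    have "w s m \<le> ennreal (C * N lam m)" if "s \<ge> 1" "m \<ge> \<alpha>" for s m
    proof -
      have "real s powr 0 = 1" using that(1) by simp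
      moreover have "w s m \<le> ennreal (C * real s powr 0 * N lam m)" using C(2) that by blast
      ultimately show ?thesis by (simp only: mult_1_right)
    qed
    then show ?thesis using C(1) by blast
  qed
  have bdd: "\<exists>c\<ge>0. \<forall>s. x s \<le> c" if cv: "convergent x" for x :: "nat \<Rightarrow> real"
  proof -
    obtain c where "\<forall>s. norm (x s) \<le> c" using convergent_imp_Bseq[OF cv] by (auto simp: Bseq_def)
    then have "\<forall>s. x s \<le> max c 0" by (auto simp: abs_le_iff le_max_iff_disj)
    then show ?thesis by (intro exI[of _ "max c 0"]) auto
  qed
  have i1: "\<exists>C>0. \<forall>s\<ge>1. \<forall>m\<ge>\<alpha>. w s m \<le> ennreal (C * N lam m)"
    if lam: "1 / real \<alpha> < lam" "lam \<le> 1" and cv: "convergent (J lam)" "convergent H" for lam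
  proof -
    obtain c1 c2 where c1: "c1 \<ge> 0" "\<forall>s. J lam s \<le> c1" and c2: "c2 \<ge> 0" "\<forall>s. H s \<le> c2"
      using bdd[OF cv(1)] bdd[OF cv(2)] by blast
    show ?thesis by (rule unif[OF lam, of "c1 + c2"]) (use c1 c2 in \<open>auto intro: add_mono\<close>)
  qed
  have i2: "\<exists>C>0. \<exists>t>0. \<forall>s\<ge>1. \<forall>m\<ge>\<alpha>. w s m \<le> ennreal (C * real s powr t * N lam m)"
    if lam: "1 / real \<alpha> < lam" "lam \<le> 1" and \<kappa>: "\<kappa> > 0"
      and ls: "limsup (\<lambda>s. ereal (J lam s / real s powr \<kappa>)) < \<infinity>" "limsup (\<lambda>s. ereal (H s / real s powr \<kappa>)) < \<infinity>" for lam \<kappa>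
  proof -
    obtain c1 c2 where c1: "c1 \<ge> 0" "\<forall>s. J lam s / real s powr \<kappa> \<le> c1" and c2: "c2 \<ge> 0" "\<forall>s. H s / real s powr \<kappa> \<le> c2"
      using limsup_finite_imp_bounded[OF ls(1)] limsup_finite_imp_bounded[OF ls(2)] by blast
    show ?thesis
    proof (rule pos[OF lam _ \<kappa>])
      show "0 \<le> c1 + c2" using c1 c2 by simp
      fix s :: nat assume s: "s \<ge> 1"
      have sp: "real s powr \<kappa> > 0" using s by simp
      have "J lam s \<le> c1 * real s powr \<kappa>"
        by (rule pos_divide_le_eq[OF sp, THEN iffD1, OF spec[OF c1(2)]])
      moreover have "H s \<le> c2 * real s powr \<kappa>"
        by (rule pos_divide_le_eq[OF sp, THEN iffD1, OF spec[OF c2(2)]])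
      ultimately show "J lam s + H s \<le> (c1 + c2) * real s powr \<kappa>" unfolding distrib_right by (rule add_mono)
    qed
  qed
  have i3: "\<exists>C>0. \<forall>s\<ge>1. \<forall>m\<ge>\<alpha>. w s m \<le> ennreal (C * N lam m)"
    if pw: "product_weights \<gamma> g" and lam: "1 / real \<alpha> < lam" "lam \<le> 1" and sm: "summable (\<lambda>j. g (Suc j) powr lam)" for g lam
  proof -
    obtain c where c: "c \<ge> 0" "\<forall>s. J lam s \<le> exp (c * (\<Sum>j=1..s. g j powr lam)) \<and> H s \<le> exp (c * (\<Sum>j=1..s. g j powr lam))"
      using product_weight_constants[OF \<alpha> lam assms(4) pw] unfolding J_def H_def by blast
    define S where "S = (\<Sum>j. g (Suc j) powr lam)"
    have S: "(\<Sum>j=1..s. g j powr lam) \<le> S" for s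
    proof -
      have "(\<Sum>j=1..s. g j powr lam) = (\<Sum>j<s. g (Suc j) powr lam)"
        by (rule sum.reindex_bij_witness[where i = Suc and j = "\<lambda>j. j - 1"]) auto
      also have "\<dots> \<le> S" unfolding S_def by (rule sum_le_suminf[OF sm]) auto
      finally show ?thesis .
    qed
    show ?thesis
    proof (rule unif[OF lam])
      show "0 \<le> 2 * exp (c * S)" by simp
      fix s :: nat
      have "exp (c * (\<Sum>j=1..s. g j powr lam)) \<le> exp (c * S)" using mult_left_mono[OF S c(1)] by (simp only: exp_le_cancel_iff)
      moreover have "J lam s \<le> exp (c * (\<Sum>j=1..s. g j powr lam))" "H s \<le> exp (c * (\<Sum>j=1..s. g j powr lam))" using c(2) by blast+
      ultimately show "J lam s + H s \<le> 2 * exp (c * S)" by linarith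
    qed
  qed
  have i4: "\<exists>C>0. \<exists>t>0. \<forall>s\<ge>1. \<forall>m\<ge>\<alpha>. w s m \<le> ennreal (C * real s powr t * N lam m)"
    if pw: "product_weights \<gamma> g" and lam: "1 / real \<alpha> < lam" "lam \<le> 1"
      and ls: "limsup (\<lambda>s. ereal ((\<Sum>j=1..s. g j powr lam) / ln (real s + 1))) < \<infinity>" for g lam
  proof -
    obtain c where c: "c \<ge> 0" "\<forall>s. J lam s \<le> exp (c * (\<Sum>j=1..s. g j powr lam)) \<and> H s \<le> exp (c * (\<Sum>j=1..s. g j powr lam))"
      using product_weight_constants[OF \<alpha> lam assms(4) pw] unfolding J_def H_def by blast
    obtain a where a: "a \<ge> 0" "\<forall>s. (\<Sum>j=1..s. g j powr lam) / ln (real s + 1) \<le> a"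
      using limsup_finite_imp_bounded[OF ls] by blast
    define t where "t = c * a + 1"
    have t: "t > 0" unfolding t_def using mult_nonneg_nonneg[OF c(1) a(1)] by linarith
    show ?thesis
    proof (rule pos[OF lam _ t])
      show "0 \<le> 2 * 2 powr t" by simp
      fix s :: nat assume s: "s \<ge> 1"
      have ln: "ln (real s + 1) > 0" using s by (intro ln_gt_zero) auto
      have "(\<Sum>j=1..s. g j powr lam) \<le> a * ln (real s + 1)" by (rule pos_divide_le_eq[OF ln, THEN iffD1, OF spec[OF a(2)]])
      from mult_left_mono[OF this c(1)] have "c * (\<Sum>j=1..s. g j powr lam) \<le> (c * a) * ln (real s + 1)" by (simp only: mult.assoc)
      also have "\<dots> \<le> t * ln (real s + 1)" unfolding t_def using ln by (intro mult_right_mono) auto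
      finally have "exp (c * (\<Sum>j=1..s. g j powr lam)) \<le> exp (t * ln (real s + 1))" by (simp only: exp_le_cancel_iff)
      also have "exp (t * ln (real s + 1)) = (real s + 1) powr t" by (simp add: powr_def)
      also have "\<dots> \<le> (2 * real s) powr t" using s t by (intro powr_mono2) auto
      also have "\<dots> = 2 powr t * real s powr t" by (simp add: powr_mult)
      finally have "exp (c * (\<Sum>j=1..s. g j powr lam)) \<le> 2 powr t * real s powr t" .
      moreover have "J lam s \<le> exp (c * (\<Sum>j=1..s. g j powr lam))" "H s \<le> exp (c * (\<Sum>j=1..s. g j powr lam))" using c(2) by blast+
      ultimately have "J lam s + H s \<le> 2 * (2 powr t * real s powr t)" by linarith
      then show "J lam s + H s \<le> 2 * 2 powr t * real s powr t" by (simp only: mult.assoc)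
    qed
  qed
  show ?thesis
  proof (rule exI[of _ "\<lambda>s m. P s"], intro conjI)
    show "\<forall>s\<ge>1. \<forall>m\<ge>\<alpha>. \<forall>n\<in>{m - \<alpha> + 1..m}. P s n \<in> poly_lattice_point_sets TYPE('p) s n"
      using conjunct1[OF PP] by (intro allI impI ballI) (simp add: Suc_le_eq)
    show "\<forall>lam. 1 / real \<alpha> < lam \<and> lam \<le> 1 \<and>
        convergent (\<lambda>s. J_const s b \<alpha> lam \<gamma>) \<and> convergent (\<lambda>s. H_const s \<alpha> \<gamma> q) \<longrightarrow>
      (\<exists>C>0. \<forall>s\<ge>1. \<forall>m\<ge>\<alpha>. worst_case_error s b \<alpha> \<gamma> q m (P s)
         \<le> ennreal (C * real (num_evals b \<alpha> m) powr (- 1 / lam)))"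
      by (intro allI impI; elim conjE) (rule i1[unfolded w_def J_def H_def N_def])
    show "\<forall>lam \<kappa>. 1 / real \<alpha> < lam \<and> lam \<le> 1 \<and> \<kappa> > 0 \<and>
        limsup (\<lambda>s. ereal (J_const s b \<alpha> lam \<gamma> / real s powr \<kappa>)) < \<infinity> \<and>
        limsup (\<lambda>s. ereal (H_const s \<alpha> \<gamma> q / real s powr \<kappa>)) < \<infinity> \<longrightarrow>
      (\<exists>C>0. \<exists>t>0. \<forall>s\<ge>1. \<forall>m\<ge>\<alpha>. worst_case_error s b \<alpha> \<gamma> q m (P s)
         \<le> ennreal (C * real s powr t * real (num_evals b \<alpha> m) powr (- 1 / lam)))"
      by (intro allI impI; elim conjE) (rule i2[unfolded w_def J_def H_def N_def])
    show "\<forall>g lam. product_weights \<gamma> g \<and> 1 / real \<alpha> < lam \<and> lam \<le> 1 \<and>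
        summable (\<lambda>j. g (Suc j) powr lam) \<longrightarrow>
      (\<exists>C>0. \<forall>s\<ge>1. \<forall>m\<ge>\<alpha>. worst_case_error s b \<alpha> \<gamma> q m (P s)
         \<le> ennreal (C * real (num_evals b \<alpha> m) powr (- 1 / lam)))"
      by (intro allI impI; elim conjE) (rule i3[unfolded w_def N_def])
    show "\<forall>g lam. product_weights \<gamma> g \<and> 1 / real \<alpha> < lam \<and> lam \<le> 1 \<and>
        limsup (\<lambda>s. ereal ((\<Sum>j=1..s. g j powr lam) / ln (real s + 1))) < \<infinity> \<longrightarrow>
      (\<exists>C>0. \<exists>t>0. \<forall>s\<ge>1. \<forall>m\<ge>\<alpha>. worst_case_error s b \<alpha> \<gamma> q m (P s)
         \<le> ennreal (C * real s powr t * real (num_evals b \<alpha> m) powr (- 1 / lam)))"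
      by (intro allI impI; elim conjE) (rule i4[unfolded w_def N_def])
  qed
qed

end
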